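(* Fix $N\ge 1$ and $n\geq 1$. A homogeneous linear map $\Phi:\mathbb{O}(A)^{\otimes n}\to\mathbb{O}(A)$ of degree zero gives rise to a well-defined $\mathrm{GL}_N$-equivariant linear map $\varphi_N:\mathcal{O}(\mathrm{Rep}_N(A))^{\otimes n}\to\mathcal{O}(\mathrm{Rep}_N(A))$ by the rule $$\varphi_N\big((\alpha_1|X_1),\ldots,(\alpha_n|X_n)\big)=\big(\Phi(\alpha_1,\ldots,\alpha_n)\,\big|\,X_1\otimes\ldots\otimes X_n\big)$$ (for all homogeneous $\alpha_i\in\mathbb{O}(A)$, $X_i\in T(\mathrm{Mat}_N^*(\Bbbk))$ with $|\alpha_i|=|X_i|$) if and only if for any homogeneous $\alpha_1,\ldots,\alpha_n\in\mathbb{O}(A)$, any permutations $w_1\in S(|\alpha_1|),\ldots,w_n\in S(|\alpha_n|)$ and any $i\in\{1,\dots,n\}$ the following hold modulo $\mathfrak{R}_N(A)$: (1) $\Phi(\alpha_1,\ldots,\alpha_{i-1},\pi(\alpha_i),\alpha_{i+1},\ldots,\alpha_n)\equiv\pi\,\mathrm{Ad}\big((12)^{|\alpha_1|+\ldots+|\alpha_{i-1}|,1}\big)\Phi(\alpha_1,\ldots,\alpha_n)$; (2) $\Phi(\alpha_1,\ldots,\alpha_{i-1},\widehat{1}(\alpha_i),\alpha_{i+1},\ldots,\alpha_n)\equiv\mathrm{Ad}\big((12)^{1,|\alpha_1|+\ldots+|\alpha_{i-1}|}\big)\widehat{1}\,\Phi(\alpha_1,\ldots,\alpha_n)$; (3)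 $\Phi(w_1\cdot\alpha_1,\ldots,w_n\cdot\alpha_n)\equiv(w_1\times\ldots\times w_n)\cdot\Phi(\alpha_1,\ldots,\alpha_n)$; (4) $\Phi(\alpha_1\cdot w_1,\ldots,\alpha_n\cdot w_n)\equiv\Phi(\alpha_1,\ldots,\alpha_n)\cdot(w_1\times\ldots\times w_n)$. Moreover, any $\mathrm{GL}_N$-equivariant linear map $\varphi_N:\mathcal{O}(\mathrm{Rep}_N(A))^{\otimes n}\to\mathcal{O}(\mathrm{Rep}_N(A))$ is of this form.
   Context: $\Bbbk$ is an algebraically closed field of characteristic zero, $A$ a finitely generated associative unital $\Bbbk$-algebra, $\otimes=\otimes_\Bbbk$. Permutations. For $\sigma\in S(n),\tau\in S(m)$, $\sigma\times\tau\in S(n+m)$ acts as $\sigma$ on the first $n$ letters and as $\tau$ on the last $m$. $S(n)$ is viewed inside $S(m)$, $m\ge n$, as the permutations fixing $n+1,\dots,m$; $\mathrm{id}_n\in S(n)$ is the identity. For $\tau\in S(n)$ and $k_1,\dots,k_n\ge 0$, $\tau^{k_1,\dots,k_n}\in S(k_1+\dots+k_n)$ cuts the letters into consecutive blocks of lengths $k_1,\dots,k_n$ and moves the $i$-th block to the $\tau(i)$-th place, keeping the order inside blocks; e.g. $(12)^{k,l}$ sends $i\mapsto i+l$ for $i\le k$ and $i\mapsto i-k$ for $k<i\le k+l$. The algebra $\mathbb{O}(A)$. Let $A_\natural=A/[A,A]$ (quotient vector space by the span of commutators), $a\mapsto\overline a$ the projection, $S(A_\natural)$ the symmetric algebra.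 $\mathbb{O}(A)=\bigoplus_{n\ge0}\mathbb{O}(A)^{(n)}$, $\mathbb{O}(A)^{(n)}=A^{\otimes n}\otimes S(A_\natural)\otimes\Bbbk[S(n)]$; $|\alpha|=n$ for $\alpha\in\mathbb{O}(A)^{(n)}$. $S(n)$ acts on $\mathbb{O}(A)^{(n)}$ on both sides: $\sigma\cdot(a_1\otimes\dots\otimes a_n\otimes f\otimes\tau)=a_{\sigma^{-1}(1)}\otimes\dots\otimes a_{\sigma^{-1}(n)}\otimes f\otimes\sigma\tau$, $(a\otimes f\otimes\tau)\cdot\sigma=a\otimes f\otimes\tau\sigma$; $\mathrm{Ad}(\sigma)\alpha=\sigma\cdot\alpha\cdot\sigma^{-1}$. Product: $(a\otimes f\otimes u)(b\otimes g\otimes v)=(a\otimes b)\otimes fg\otimes(u\times v)$. Operators. For $u\in S(n)$, $n\ge1$, $u_*\in S(n-1)$ is obtained by deleting $1$ from its cycle in $u$ (the cycle $\dots\mapsto i\mapsto1\mapsto j\mapsto\dots$ becomes $\dots\mapsto i\mapsto j\mapsto\dots$) and relabelling $i\mapsto i-1$. $\pi$ has degree $-1$: $\pi(a_1\otimes\dots\otimes a_n\otimes f\otimes u)=(a_2\otimes\dots\otimes a_n)\otimes\overline{a_1}f\otimes u_*$ if $u(1)=1$, and $=(a_2\otimes\dots\otimes a_{k-1}\otimes a_1a_k\otimes a_{k+1}\otimes\dots\otimes a_n)\otimes f\otimes u_*$ with $k=u(1)$ if $u(1)>1$; $\pi=0$ on $\mathbb{O}(A)^{(0)}$. $\widehat1$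 has degree $+1$: $\widehat1(a\otimes f\otimes u)=(1\otimes a)\otimes f\otimes(\mathrm{id}_1\times u)$. Representation spaces. $\mathcal{O}(\mathrm{Rep}_N(A))$ is the commutative unital algebra generated by symbols $a_{ij}$ ($a\in A$, $1\le i,j\le N$), linear in $a$, with relations $(ab)_{ij}=\sum_k a_{ik}b_{kj}$, $(1)_{ij}=\delta_{ij}$. $\mathrm{Mat}_N^*(\Bbbk)$ is the dual space of $\mathrm{Mat}_N(\Bbbk)$ with dual basis $E^*_{ij}$, $T(\mathrm{Mat}_N^*(\Bbbk))$ its tensor algebra, $|X|=n$ for $X\in\mathrm{Mat}_N^*(\Bbbk)^{\otimes n}$. For $\alpha=(a_1\otimes\dots\otimes a_n)\otimes f_1\cdots f_m\otimes u$ put $(\alpha|E^*_{i_1j_1}\otimes\dots\otimes E^*_{i_nj_n})=\prod_t(a_t)_{i_{u^{-1}(t)}j_t}\prod_s\mathrm{tr}(f_s)\in\mathcal{O}(\mathrm{Rep}_N(A))$ with $\mathrm{tr}(\overline a)=\sum_i a_{ii}$, extended bilinearly to $(\alpha|X)$ for homogeneous $\alpha,X$ with $|\alpha|=|X|$. $\mathrm{GL}_N=\mathrm{GL}_N(\Bbbk)$ acts on $\mathrm{Mat}_N^*(\Bbbk)$ dually to conjugation, diagonally on tensor powers, and on $\mathcal{O}(\mathrm{Rep}_N(A))$ by $g.(\alpha|X)=(\alpha|g.X)$. $\mathfrak{R}_N(A)\subset\mathbb{O}(A)$ is the graded two-sided ideal spanned by homogeneous $\alpha$ with $(\alpha|X)=0$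 for all $X\in\mathrm{Mat}_N^*(\Bbbk)^{\otimes|\alpha|}$.
   Formalization: Condition (1) is required only when |α_i| ≥ 1; for |α_i| = 0 it is undefined or can fail (e.g. A = k[x], N = 1, n = 2, Φ the product, α_1 = 1 of degree 0, α_2 = x of degree 1, i = 1: left side 0, right side the class of x). *)

theory Defs
  imports
    "HOL-Analysis.Determinants"
    "HOL-Combinatorics.Permutations"
    "HOL-Library.Multiset"
    "HOL-Library.FuncSet"
    "HOL-Library.Poly_Mapping"
    "HOL-Computational_Algebra.Polynomial"
begin

section \<open>Finitely generated algebras\<close>

text \<open>The sort \<open>{ring, monoid_mult}\<close> is that of associative unital rings; unlike \<open>ring_1\<close> it does
  not exclude the zero ring.\<close>

locale assoc_algebra = vector_space smul
  for smul :: "'k::field \<Rightarrow> 'a::{ring, monoid_mult} \<Rightarrow> 'a" +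
  assumes scale_mult_left: "smul c x * y = smul c (x * y)"
    and scale_mult_right: "x * smul c y = smul c (x * y)"

locale fg_algebra = assoc_algebra +
  assumes finitely_generated:
    "\<exists>S. finite S \<and>
       (\<forall>B. subspace B \<and> 1 \<in> B \<and> (\<forall>x\<in>B. \<forall>y\<in>B. x * y \<in> B) \<and> S \<subseteq> B \<longrightarrow> B = UNIV)"

section \<open>Vector spaces presented by generators and relations\<close>

definition pm_scale :: "'k::comm_ring_1 \<Rightarrow> ('x \<Rightarrow>\<^sub>0 'k) \<Rightarrow> ('x \<Rightarrow>\<^sub>0 'k)" where
  "pm_scale c f = Poly_Mapping.map ((*) c) f"

definition lin_ext :: "('x \<Rightarrow> 'y \<Rightarrow>\<^sub>0 'k::comm_ring_1) \<Rightarrow> ('x \<Rightarrow>\<^sub>0 'k) \<Rightarrow> ('y \<Rightarrow>\<^sub>0 'k)" where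
  "lin_ext g f = (\<Sum>x\<in>Poly_Mapping.keys f. pm_scale (Poly_Mapping.lookup f x) (g x))"

text \<open>A presentation stands for the quotient of the free vector space on \<open>gens\<close> by the span of
  \<open>rels\<close>; the elements of the quotient are the cosets of that span.\<close>

record (overloaded) ('x, 'k) presentation =
  gens :: "'x set"
  rels :: "('x \<Rightarrow>\<^sub>0 'k) set"

definition rel_span :: "('x, 'k::field) presentation \<Rightarrow> ('x \<Rightarrow>\<^sub>0 'k) set" where
  "rel_span P = module.span pm_scale (rels P)"

definition cls :: "('x, 'k::field) presentation \<Rightarrow> ('x \<Rightarrow>\<^sub>0 'k) \<Rightarrow> ('x \<Rightarrow>\<^sub>0 'k) set" where
  "cls P f = {f + r |r. r \<in> rel_span P}"

definition vspace :: "('x, 'k::field) presentation \<Rightarrow> ('x \<Rightarrow>\<^sub>0 'k) set set" where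
  "vspace P = {cls P f |f. Poly_Mapping.keys f \<subseteq> gens P}"

text \<open>The map induced on cosets by a map \<open>T\<close> of the free spaces. It is the usual one whenever \<open>T\<close> is
  additive and sends relations into the span of the relations of \<open>Q\<close>.\<close>

definition descend ::
  "('y, 'k::field) presentation \<Rightarrow> (('x \<Rightarrow>\<^sub>0 'k) \<Rightarrow> ('y \<Rightarrow>\<^sub>0 'k)) \<Rightarrow> ('x \<Rightarrow>\<^sub>0 'k) set \<Rightarrow> ('y \<Rightarrow>\<^sub>0 'k) set"
where
  "descend Q T C = (\<Union>f\<in>C. cls Q (T f))"

definition vadd :: "('x, 'k::field) presentation \<Rightarrow>
  ('x \<Rightarrow>\<^sub>0 'k) set \<Rightarrow> ('x \<Rightarrow>\<^sub>0 'k) set \<Rightarrow> ('x \<Rightarrow>\<^sub>0 'k) set" where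
  "vadd P C D = (\<Union>f\<in>C. \<Union>g\<in>D. cls P (f + g))"

definition vscale :: "('x, 'k::field) presentation \<Rightarrow>
  'k \<Rightarrow> ('x \<Rightarrow>\<^sub>0 'k) set \<Rightarrow> ('x \<Rightarrow>\<^sub>0 'k) set" where
  "vscale P c C = descend P (pm_scale c) C"

definition vsubspace :: "('x, 'k::field) presentation \<Rightarrow> ('x \<Rightarrow>\<^sub>0 'k) set set \<Rightarrow> bool" where
  "vsubspace P U \<longleftrightarrow> U \<subseteq> vspace P \<and> cls P 0 \<in> U \<and>
     (\<forall>x\<in>U. \<forall>y\<in>U. vadd P x y \<in> U) \<and> (\<forall>c. \<forall>x\<in>U. vscale P c x \<in> U)"

definition vspan :: "('x, 'k::field) presentation \<Rightarrow> ('x \<Rightarrow>\<^sub>0 'k) set set \<Rightarrow> ('x \<Rightarrow>\<^sub>0 'k) set set" where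
  "vspan P S = \<Inter>{U. vsubspace P U \<and> S \<subseteq> U}"

definition linear_maps :: "('x, 'k::field) presentation \<Rightarrow> ('y, 'k) presentation \<Rightarrow>
  (('x \<Rightarrow>\<^sub>0 'k) set \<Rightarrow> ('y \<Rightarrow>\<^sub>0 'k) set) set" where
  "linear_maps P Q = {T \<in> vspace P \<rightarrow>\<^sub>E vspace Q.
     (\<forall>x\<in>vspace P. \<forall>y\<in>vspace P. T (vadd P x y) = vadd Q (T x) (T y)) \<and>
     (\<forall>c. \<forall>x\<in>vspace P. T (vscale P c x) = vscale Q c (T x))}"

text \<open>The \<open>n\<close>-th tensor power of the space presented by \<open>P\<close>, with lists of length \<open>n\<close> as the
  symbols for pure tensors.\<close>

definition tpow :: "nat \<Rightarrow> ('x, 'k::field) presentation \<Rightarrow> (('x \<Rightarrow>\<^sub>0 'k) set list, 'k) presentation" where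
  "tpow n P =
    \<lparr>gens = {l. length l = n \<and> set l \<subseteq> vspace P},
     rels =
       {Poly_Mapping.single (l[i := vadd P x y]) 1 - Poly_Mapping.single (l[i := x]) 1
          - Poly_Mapping.single (l[i := y]) 1
          |l i x y. length l = n \<and> set l \<subseteq> vspace P \<and> i < n \<and> x \<in> vspace P \<and> y \<in> vspace P}
       \<union> {Poly_Mapping.single (l[i := vscale P c x]) 1 - Poly_Mapping.single (l[i := x]) c
          |l i c x. length l = n \<and> set l \<subseteq> vspace P \<and> i < n \<and> x \<in> vspace P}\<rparr>"

definition ptensor :: "('x, 'k::field) presentation \<Rightarrow> ('x \<Rightarrow>\<^sub>0 'k) set list \<Rightarrow>
  (('x \<Rightarrow>\<^sub>0 'k) set list \<Rightarrow>\<^sub>0 'k) set" where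
  "ptensor P l = cls (tpow (length l) P) (Poly_Mapping.single l 1)"

definition tpow_map :: "nat \<Rightarrow> ('y, 'k::field) presentation \<Rightarrow>
  (('x \<Rightarrow>\<^sub>0 'k) set \<Rightarrow> ('y \<Rightarrow>\<^sub>0 'k) set) \<Rightarrow>
  (('x \<Rightarrow>\<^sub>0 'k) set list \<Rightarrow>\<^sub>0 'k) set \<Rightarrow> (('y \<Rightarrow>\<^sub>0 'k) set list \<Rightarrow>\<^sub>0 'k) set" where
  "tpow_map n Q T = descend (tpow n Q) (lin_ext (\<lambda>l. Poly_Mapping.single (map T l) 1))"

section \<open>Permutations\<close>

text \<open>\<open>S(n)\<close> is the set of functions \<open>u\<close> with \<open>u permutes {1..n}\<close>; the embedding of \<open>S(n)\<close> into
  \<open>S(m)\<close> for \<open>n \<le> m\<close> is then an inclusion.\<close>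

definition perm_times :: "nat \<Rightarrow> (nat \<Rightarrow> nat) \<Rightarrow> (nat \<Rightarrow> nat) \<Rightarrow> nat \<Rightarrow> nat" where
  "perm_times n u v i = (if i \<le> n then u i else n + v (i - n))"

fun perm_prod :: "(nat \<times> (nat \<Rightarrow> nat)) list \<Rightarrow> nat \<Rightarrow> nat" where
  "perm_prod [] = id"
| "perm_prod ((n, u) # ps) = perm_times n u (perm_prod ps)"

text \<open>The letter \<open>i\<close> lies in the block \<open>j\<close>; the blocks that end up before this one are those whose
  new place is smaller than \<open>\<tau> j\<close>.\<close>

definition block_perm :: "(nat \<Rightarrow> nat) \<Rightarrow> nat list \<Rightarrow> nat \<Rightarrow> nat" where
  "block_perm \<tau> ks i =
    (if 1 \<le> i \<and> i \<le> sum_list ks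
     then let j = (LEAST j. i \<le> sum_list (take j ks)) in
       (\<Sum>m | m \<in> {1..length ks} \<and> \<tau> m < \<tau> j. ks ! (m - 1)) + (i - sum_list (take (j - 1) ks))
     else i)"

text \<open>Deletes \<open>1\<close> from its cycle in \<open>u\<close> and relabels \<open>i \<mapsto> i - 1\<close>.\<close>

definition perm_star :: "(nat \<Rightarrow> nat) \<Rightarrow> nat \<Rightarrow> nat" where
  "perm_star u i =
    (if i = 0 then 0 else (if u (i + 1) = 1 then u 1 else u (i + 1)) - 1)"

section \<open>The algebra \<open>\<O>(A)\<close>\<close>

text \<open>The symbol \<open>([a\<^sub>1, \<dots>, a\<^sub>n], {#f\<^sub>1, \<dots>, f\<^sub>m#}, u)\<close> stands for
  \<open>(a\<^sub>1 \<otimes> \<dots> \<otimes> a\<^sub>n) \<otimes> f\<^sub>1 \<cdots> f\<^sub>m \<otimes> u\<close>, where \<open>f\<^sub>i \<in> A\<close> represents its class in \<open>A / [A, A]\<close>. The relations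
  are multilinearity in the \<open>a\<^sub>i\<close> (which gives \<open>A\<^sup>\<otimes>\<^sup>n\<close>), multilinearity in the \<open>f\<^sub>i\<close> and vanishing of
  the commutators among them (which give \<open>S(A / [A, A])\<close>).\<close>

type_synonym 'a osym = "'a list \<times> 'a multiset \<times> (nat \<Rightarrow> nat)"

definition osyms :: "nat \<Rightarrow> 'a osym set" where
  "osyms n = {(as, fs, u). length as = n \<and> u permutes {1..n}}"

inductive_set orels :: "('k::field \<Rightarrow> 'a::{ring, monoid_mult} \<Rightarrow> 'a) \<Rightarrow> ('a osym \<Rightarrow>\<^sub>0 'k) set"
  for smul :: "'k \<Rightarrow> 'a \<Rightarrow> 'a" where
  tensor_add: "\<lbrakk>i < length as; u permutes {1..length as}\<rbrakk> \<Longrightarrow>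
    Poly_Mapping.single (as[i := x + y], fs, u) 1 - Poly_Mapping.single (as[i := x], fs, u) 1
      - Poly_Mapping.single (as[i := y], fs, u) 1 \<in> orels smul"
| tensor_scale: "\<lbrakk>i < length as; u permutes {1..length as}\<rbrakk> \<Longrightarrow>
    Poly_Mapping.single (as[i := smul c x], fs, u) 1 - Poly_Mapping.single (as[i := x], fs, u) c
      \<in> orels smul"
| sym_add: "u permutes {1..length as} \<Longrightarrow>
    Poly_Mapping.single (as, add_mset (x + y) fs, u) 1 - Poly_Mapping.single (as, add_mset x fs, u) 1
      - Poly_Mapping.single (as, add_mset y fs, u) 1 \<in> orels smul"
| sym_scale: "u permutes {1..length as} \<Longrightarrow>
    Poly_Mapping.single (as, add_mset (smul c x) fs, u) 1
      - Poly_Mapping.single (as, add_mset x fs, u) c \<in> orels smul"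
| sym_commutator: "u permutes {1..length as} \<Longrightarrow>
    Poly_Mapping.single (as, add_mset (x * y - y * x) fs, u) 1 \<in> orels smul"

definition OA :: "('k::field \<Rightarrow> 'a::{ring, monoid_mult} \<Rightarrow> 'a) \<Rightarrow> ('a osym, 'k) presentation" where
  "OA smul = \<lparr>gens = (\<Union>n. osyms n), rels = orels smul\<rparr>"

definition OA_hom :: "('k::field \<Rightarrow> 'a::{ring, monoid_mult} \<Rightarrow> 'a) \<Rightarrow> nat \<Rightarrow>
  ('a osym \<Rightarrow>\<^sub>0 'k) set set" where
  "OA_hom smul n = {cls (OA smul) f |f. Poly_Mapping.keys f \<subseteq> osyms n}"

text \<open>A permutation outside \<open>S(n)\<close> is made to act by \<open>0\<close> in degree \<open>n\<close>.\<close>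

definition left_sym :: "(nat \<Rightarrow> nat) \<Rightarrow> 'a osym \<Rightarrow> ('a osym \<Rightarrow>\<^sub>0 'k::field)" where
  "left_sym \<sigma> = (\<lambda>(as, fs, u).
     if \<sigma> permutes {1..length as}
     then Poly_Mapping.single (map (\<lambda>t. as ! (inv \<sigma> t - 1)) [1..<Suc (length as)], fs, \<sigma> \<circ> u) 1
     else 0)"

definition right_sym :: "(nat \<Rightarrow> nat) \<Rightarrow> 'a osym \<Rightarrow> ('a osym \<Rightarrow>\<^sub>0 'k::field)" where
  "right_sym \<sigma> = (\<lambda>(as, fs, u).
     if \<sigma> permutes {1..length as} then Poly_Mapping.single (as, fs, u \<circ> \<sigma>) 1 else 0)"

definition left_act :: "('k::field \<Rightarrow> 'a::{ring, monoid_mult} \<Rightarrow> 'a) \<Rightarrow> (nat \<Rightarrow> nat) \<Rightarrow>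
  ('a osym \<Rightarrow>\<^sub>0 'k) set \<Rightarrow> ('a osym \<Rightarrow>\<^sub>0 'k) set" where
  "left_act smul \<sigma> = descend (OA smul) (lin_ext (left_sym \<sigma>))"

definition right_act :: "('k::field \<Rightarrow> 'a::{ring, monoid_mult} \<Rightarrow> 'a) \<Rightarrow>
  ('a osym \<Rightarrow>\<^sub>0 'k) set \<Rightarrow> (nat \<Rightarrow> nat) \<Rightarrow> ('a osym \<Rightarrow>\<^sub>0 'k) set" where
  "right_act smul C \<sigma> = descend (OA smul) (lin_ext (right_sym \<sigma>)) C"

definition Ad :: "('k::field \<Rightarrow> 'a::{ring, monoid_mult} \<Rightarrow> 'a) \<Rightarrow> (nat \<Rightarrow> nat) \<Rightarrow>
  ('a osym \<Rightarrow>\<^sub>0 'k) set \<Rightarrow> ('a osym \<Rightarrow>\<^sub>0 'k) set" where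
  "Ad smul \<sigma> C = right_act smul (left_act smul \<sigma> C) (inv \<sigma>)"

text \<open>In the last case \<open>u 1 = k > 1\<close>, and \<open>a\<^sub>k\<close> is the entry number \<open>k - 2\<close> of \<open>[a\<^sub>2, \<dots>, a\<^sub>n]\<close>, counted
  from \<open>0\<close>.\<close>

fun pi_sym :: "'a::{ring, monoid_mult} osym \<Rightarrow> ('a osym \<Rightarrow>\<^sub>0 'k::field)" where
  "pi_sym ([], fs, u) = 0"
| "pi_sym (a # as, fs, u) =
    (if u 1 = 1 then Poly_Mapping.single (as, add_mset a fs, perm_star u) 1
     else Poly_Mapping.single (as[u 1 - 2 := a * as ! (u 1 - 2)], fs, perm_star u) 1)"

definition op_pi :: "('k::field \<Rightarrow> 'a::{ring, monoid_mult} \<Rightarrow> 'a) \<Rightarrow>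
  ('a osym \<Rightarrow>\<^sub>0 'k) set \<Rightarrow> ('a osym \<Rightarrow>\<^sub>0 'k) set" where
  "op_pi smul = descend (OA smul) (lin_ext pi_sym)"

definition one_sym :: "'a::{ring, monoid_mult} osym \<Rightarrow> ('a osym \<Rightarrow>\<^sub>0 'k::field)" where
  "one_sym = (\<lambda>(as, fs, u). Poly_Mapping.single (1 # as, fs, perm_times 1 id u) 1)"

definition op_one :: "('k::field \<Rightarrow> 'a::{ring, monoid_mult} \<Rightarrow> 'a) \<Rightarrow>
  ('a osym \<Rightarrow>\<^sub>0 'k) set \<Rightarrow> ('a osym \<Rightarrow>\<^sub>0 'k) set" where
  "op_one smul = descend (OA smul) (lin_ext one_sym)"

section \<open>Representation spaces\<close>

text \<open>Polynomials in the commuting variables \<open>a\<^sub>i\<^sub>j\<close>, with \<open>i\<close>, \<open>j\<close> in an index type of \<open>N\<close> elements.\<close>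

type_synonym ('a, 'N) rmonom = "('a \<times> 'N \<times> 'N) \<Rightarrow>\<^sub>0 nat"

definition rvar :: "'a \<Rightarrow> 'N \<Rightarrow> 'N \<Rightarrow> ('a, 'N) rmonom \<Rightarrow>\<^sub>0 'k::field" where
  "rvar a i j = Poly_Mapping.single (Poly_Mapping.single (a, i, j) 1) 1"

inductive_set rep_rels :: "('k::field \<Rightarrow> 'a::{ring, monoid_mult} \<Rightarrow> 'a) \<Rightarrow>
    (('a, 'N::finite) rmonom \<Rightarrow>\<^sub>0 'k) set"
  for smul :: "'k \<Rightarrow> 'a \<Rightarrow> 'a" where
  "rvar (a + b) i j - rvar a i j - rvar b i j \<in> rep_rels smul"
| "rvar (smul c a) i j - pm_scale c (rvar a i j) \<in> rep_rels smul"
| "rvar (a * b) i j - (\<Sum>k\<in>UNIV. rvar a i k * rvar b k j) \<in> rep_rels smul"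
| "rvar 1 i j - (if i = j then 1 else 0) \<in> rep_rels smul"

text \<open>\<open>module.span (*)\<close> is the ideal generated by a set.\<close>

definition Rep :: "('k::field \<Rightarrow> 'a::{ring, monoid_mult} \<Rightarrow> 'a) \<Rightarrow>
  (('a, 'N::finite) rmonom, 'k) presentation" where
  "Rep smul = \<lparr>gens = UNIV, rels = module.span (*) (rep_rels smul)\<rparr>"

text \<open>The word \<open>[(i\<^sub>1, j\<^sub>1), \<dots>, (i\<^sub>n, j\<^sub>n)]\<close> stands for the basis element
  \<open>E\<^sup>*\<^sub>i\<^sub>1\<^sub>j\<^sub>1 \<otimes> \<dots> \<otimes> E\<^sup>*\<^sub>i\<^sub>n\<^sub>j\<^sub>n\<close> of the tensor algebra of the dual of the matrix algebra.\<close>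

type_synonym ('N, 'k) tensors = "('N \<times> 'N) list \<Rightarrow>\<^sub>0 'k"

definition tensors_deg :: "nat \<Rightarrow> ('N, 'k::field) tensors set" where
  "tensors_deg n = {X. Poly_Mapping.keys X \<subseteq> {w. length w = n}}"

definition tmult :: "('N, 'k::field) tensors \<Rightarrow> ('N, 'k) tensors \<Rightarrow> ('N, 'k) tensors" where
  "tmult X Y = lin_ext (\<lambda>v. lin_ext (\<lambda>w. Poly_Mapping.single (v @ w) 1) Y) X"

definition tprod :: "('N, 'k::field) tensors list \<Rightarrow> ('N, 'k) tensors" where
  "tprod Xs = foldr tmult Xs (Poly_Mapping.single [] 1)"

definition pair_sym :: "'a osym \<Rightarrow> ('N::finite \<times> 'N) list \<Rightarrow> ('a, 'N) rmonom \<Rightarrow>\<^sub>0 'k::field" where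
  "pair_sym = (\<lambda>(as, fs, u) w.
     if length as = length w
     then (\<Prod>t = 1..length as. rvar (as ! (t - 1)) (fst (w ! (inv u t - 1))) (snd (w ! (t - 1))))
          * (\<Prod>a\<in>#fs. \<Sum>i\<in>UNIV. rvar a i i)
     else 0)"

definition pairing :: "('k::field \<Rightarrow> 'a::{ring, monoid_mult} \<Rightarrow> 'a) \<Rightarrow> ('a osym \<Rightarrow>\<^sub>0 'k) set \<Rightarrow>
  ('N::finite, 'k) tensors \<Rightarrow> (('a, 'N) rmonom \<Rightarrow>\<^sub>0 'k) set" where
  "pairing smul C X = descend (Rep smul) (lin_ext (\<lambda>x. lin_ext (pair_sym x) X)) C"

definition R_ideal :: "('k::field \<Rightarrow> 'a::{ring, monoid_mult} \<Rightarrow> 'a) \<Rightarrow> 'N::finite itself \<Rightarrow>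
  ('a osym \<Rightarrow>\<^sub>0 'k) set set" where
  "R_ideal smul _ = vspan (OA smul) {\<alpha>. \<exists>n. \<alpha> \<in> OA_hom smul n \<and>
     (\<forall>X \<in> tensors_deg n. pairing smul \<alpha> (X :: ('N, 'k) tensors) = cls (Rep smul) 0)}"

definition cong_R :: "('k::field \<Rightarrow> 'a::{ring, monoid_mult} \<Rightarrow> 'a) \<Rightarrow> 'N::finite itself \<Rightarrow>
  ('a osym \<Rightarrow>\<^sub>0 'k) set \<Rightarrow> ('a osym \<Rightarrow>\<^sub>0 'k) set \<Rightarrow> bool" where
  "cong_R smul N x y \<longleftrightarrow> vadd (OA smul) x (vscale (OA smul) (-1) y) \<in> R_ideal smul N"

section \<open>The action of \<open>GL\<^sub>N\<close>\<close>

definition mat_unit :: "'N \<Rightarrow> 'N \<Rightarrow> 'k::field ^ 'N ^ 'N::finite" where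
  "mat_unit p q = (\<chi> i j. if i = p \<and> j = q then 1 else 0)"

text \<open>The coefficient of \<open>E\<^sup>*\<^sub>p\<^sub>q\<close> in \<open>g.E\<^sup>*\<^sub>i\<^sub>j\<close>, that is, the value of the functional
  \<open>M \<mapsto> E\<^sup>*\<^sub>i\<^sub>j(g\<^sup>-\<^sup>1 M g)\<close> at the matrix unit \<open>E\<^sub>p\<^sub>q\<close>.\<close>

definition dual_coeff :: "'k::field ^ 'N ^ 'N::finite \<Rightarrow> 'N \<times> 'N \<Rightarrow> 'N \<times> 'N \<Rightarrow> 'k" where
  "dual_coeff g = (\<lambda>(i, j) (p, q). (matrix_inv g ** mat_unit p q ** g) $ i $ j)"

definition tensor_act :: "'k::field ^ 'N ^ 'N::finite \<Rightarrow> ('N, 'k) tensors \<Rightarrow> ('N, 'k) tensors" where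
  "tensor_act g = lin_ext (\<lambda>w. \<Sum>v | length v = length w.
     Poly_Mapping.single v (\<Prod>s<length w. dual_coeff g (w ! s) (v ! s)))"

text \<open>The algebra automorphism with \<open>g.a\<^sub>i\<^sub>j = (a | g.E\<^sup>*\<^sub>i\<^sub>j)\<close>; the identity \<open>g.(\<alpha>|X) = (\<alpha>|g.X)\<close> that
  characterizes it is \<open>rep_act_pairing\<close> below.\<close>

definition rvar_act :: "'k::field ^ 'N ^ 'N::finite \<Rightarrow> 'a \<times> 'N \<times> 'N \<Rightarrow> ('a, 'N) rmonom \<Rightarrow>\<^sub>0 'k" where
  "rvar_act g = (\<lambda>(a, i, j). \<Sum>(p, q)\<in>UNIV. pm_scale (dual_coeff g (i, j) (p, q)) (rvar a p q))"

definition rmonom_act :: "'k::field ^ 'N ^ 'N::finite \<Rightarrow> ('a, 'N) rmonom \<Rightarrow> ('a, 'N) rmonom \<Rightarrow>\<^sub>0 'k" where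
  "rmonom_act g m = (\<Prod>v\<in>Poly_Mapping.keys m. rvar_act g v ^ Poly_Mapping.lookup m v)"

definition rep_act :: "('k::field \<Rightarrow> 'a::{ring, monoid_mult} \<Rightarrow> 'a) \<Rightarrow> 'k ^ 'N ^ 'N::finite \<Rightarrow>
  (('a, 'N) rmonom \<Rightarrow>\<^sub>0 'k) set \<Rightarrow> (('a, 'N) rmonom \<Rightarrow>\<^sub>0 'k) set" where
  "rep_act smul g = descend (Rep smul) (lin_ext (rmonom_act g))"

definition GL_equivariant :: "('k::field \<Rightarrow> 'a::{ring, monoid_mult} \<Rightarrow> 'a) \<Rightarrow> nat \<Rightarrow>
  (((('a, 'N::finite) rmonom \<Rightarrow>\<^sub>0 'k) set list \<Rightarrow>\<^sub>0 'k) set \<Rightarrow> (('a, 'N) rmonom \<Rightarrow>\<^sub>0 'k) set) \<Rightarrow> bool" where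
  "GL_equivariant smul n \<phi> \<longleftrightarrow>
     (\<forall>g :: 'k ^ 'N ^ 'N. invertible g \<longrightarrow>
       (\<forall>x \<in> vspace (tpow n (Rep smul)).
          \<phi> (tpow_map n (Rep smul) (rep_act smul g) x) = rep_act smul g (\<phi> x)))"

section \<open>Maps of degree zero and the maps they induce\<close>

definition hom_list :: "('k::field \<Rightarrow> 'a::{ring, monoid_mult} \<Rightarrow> 'a) \<Rightarrow> nat list \<Rightarrow>
  ('a osym \<Rightarrow>\<^sub>0 'k) set list \<Rightarrow> bool" where
  "hom_list smul ds \<alpha>s \<longleftrightarrow> list_all2 (\<lambda>d \<alpha>. \<alpha> \<in> OA_hom smul d) ds \<alpha>s"

definition degree_zero_maps :: "('k::field \<Rightarrow> 'a::{ring, monoid_mult} \<Rightarrow> 'a) \<Rightarrow> nat \<Rightarrow>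
  ((('a osym \<Rightarrow>\<^sub>0 'k) set list \<Rightarrow>\<^sub>0 'k) set \<Rightarrow> ('a osym \<Rightarrow>\<^sub>0 'k) set) set" where
  "degree_zero_maps smul n = {\<Phi> \<in> linear_maps (tpow n (OA smul)) (OA smul).
     \<forall>ds \<alpha>s. length ds = n \<and> hom_list smul ds \<alpha>s
       \<longrightarrow> \<Phi> (ptensor (OA smul) \<alpha>s) \<in> OA_hom smul (sum_list ds)}"

definition induces :: "('k::field \<Rightarrow> 'a::{ring, monoid_mult} \<Rightarrow> 'a) \<Rightarrow> nat \<Rightarrow>
  ((('a osym \<Rightarrow>\<^sub>0 'k) set list \<Rightarrow>\<^sub>0 'k) set \<Rightarrow> ('a osym \<Rightarrow>\<^sub>0 'k) set) \<Rightarrow>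
  (((('a, 'N::finite) rmonom \<Rightarrow>\<^sub>0 'k) set list \<Rightarrow>\<^sub>0 'k) set \<Rightarrow> (('a, 'N) rmonom \<Rightarrow>\<^sub>0 'k) set) \<Rightarrow> bool" where
  "induces smul n \<Phi> \<phi> \<longleftrightarrow>
     (\<forall>ds \<alpha>s Xs. length ds = n \<and> hom_list smul ds \<alpha>s
        \<and> list_all2 (\<lambda>d X. X \<in> tensors_deg d) ds Xs
       \<longrightarrow> \<phi> (ptensor (Rep smul) (map2 (pairing smul) \<alpha>s Xs))
           = pairing smul (\<Phi> (ptensor (OA smul) \<alpha>s)) (tprod Xs))"

section \<open>The operations are well defined on cosets\<close>

lemma lookup_pm_scale [simp]: "Poly_Mapping.lookup (pm_scale c f) x = c * Poly_Mapping.lookup f x"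
  by (cases "Poly_Mapping.lookup f x = 0") (simp_all add: pm_scale_def Poly_Mapping.map.rep_eq)

interpretation pm: vector_space "pm_scale :: 'k::field \<Rightarrow> ('x \<Rightarrow>\<^sub>0 'k) \<Rightarrow> _"
  by unfold_locales (auto intro!: poly_mapping_eqI simp: lookup_add algebra_simps)

lemma lin_ext_superset:
  "finite S \<Longrightarrow> Poly_Mapping.keys f \<subseteq> S \<Longrightarrow>
    lin_ext g f = (\<Sum>x\<in>S. pm_scale (Poly_Mapping.lookup f x) (g x :: _ \<Rightarrow>\<^sub>0 'k::field))"
  unfolding lin_ext_def by (rule sum.mono_neutral_left) (auto simp: in_keys_iff)

lemma lin_ext_single [simp]: "lin_ext g (Poly_Mapping.single x c) = pm_scale c (g x :: _ \<Rightarrow>\<^sub>0 'k::field)"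
  by (subst lin_ext_superset[of "{x}"]) auto

lemma lin_ext_add: "lin_ext g (f + h) = lin_ext g f + (lin_ext g h :: _ \<Rightarrow>\<^sub>0 'k::field)"
proof -
  have 1: "Poly_Mapping.keys (f + h) \<subseteq> Poly_Mapping.keys f \<union> Poly_Mapping.keys h" by (rule keys_add)
  show ?thesis
    by (subst (1 2 3) lin_ext_superset[of "Poly_Mapping.keys f \<union> Poly_Mapping.keys h"])
       (use 1 in \<open>auto simp: lookup_add pm.scale_left_distrib sum.distrib\<close>)
qed

lemma lin_ext_scale: "lin_ext g (pm_scale c f) = pm_scale c (lin_ext g f :: _ \<Rightarrow>\<^sub>0 'k::field)"
proof -
  have 1: "Poly_Mapping.keys (pm_scale c f) \<subseteq> Poly_Mapping.keys f" by (auto simp: in_keys_iff)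
  show ?thesis
    by (subst (1 2) lin_ext_superset[of "Poly_Mapping.keys f"]) (use 1 in \<open>auto simp: pm.scale_sum_right\<close>)
qed

lemma rel_span_subspace: "pm.subspace (rel_span P)"
  by (simp add: rel_span_def)

lemma cls_eq_iff: "cls P f = cls P g \<longleftrightarrow> f - g \<in> rel_span P"
proof
  assume "cls P f = cls P g"
  moreover have "f \<in> cls P f" using pm.subspace_0[OF rel_span_subspace[of P]]
    by (auto simp: cls_def intro!: exI[of _ 0])
  ultimately show "f - g \<in> rel_span P" by (auto simp: cls_def)
next
  have *: "cls P f \<subseteq> cls P g" if "f - g \<in> rel_span P" for f g
  proof (auto simp: cls_def)
    fix r assume "r \<in> rel_span P"
    then show "\<exists>r'. f + r = g + r' \<and> r' \<in> rel_span P"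
      by (intro exI[of _ "f - g + r"]) (use that pm.subspace_add[OF rel_span_subspace] in auto)
  qed
  assume 1: "f - g \<in> rel_span P"
  then have "g - f \<in> rel_span P" using pm.subspace_neg[OF rel_span_subspace 1] by simp
  then show "cls P f = cls P g" using *[OF 1] * by blast
qed

lemma descend_cls:
  assumes "\<And>f g. T (f + g) = T f + T g" "\<And>r. r \<in> rel_span P \<Longrightarrow> T r \<in> rel_span Q"
  shows "descend Q T (cls P f) = cls Q (T f)"
proof -
  have "cls Q (T f') = cls Q (T f)" if "f' \<in> cls P f" for f'
    unfolding cls_eq_iff using that assms by (auto simp: cls_def)
  moreover have "f \<in> cls P f" using pm.subspace_0[OF rel_span_subspace[of P]]
    by (auto simp: cls_def intro!: exI[of _ 0])
  ultimately show ?thesis unfolding descend_def by blast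
qed

lemma descend_lin_ext:
  assumes "\<And>r. r \<in> rels P \<Longrightarrow> lin_ext t r \<in> rel_span Q"
  shows "descend Q (lin_ext t) (cls P f) = cls Q (lin_ext t f)"
proof (rule descend_cls[OF lin_ext_add])
  fix r assume "r \<in> rel_span P"
  then show "lin_ext t r \<in> rel_span Q"
    unfolding rel_span_def[of P]
  proof (induction rule: pm.span_induct_alt)
    case base show ?case using pm.subspace_0[OF rel_span_subspace] by (simp add: lin_ext_def)
  next
    case (step c x y)
    show ?case unfolding lin_ext_add lin_ext_scale
      by (intro pm.subspace_add[OF rel_span_subspace] pm.subspace_scale[OF rel_span_subspace] assms step)
  qed
qed

lemma vscale_cls: "vscale P c (cls P f) = cls P (pm_scale c f)"
  unfolding vscale_def
  by (rule descend_cls) (use pm.subspace_scale[OF rel_span_subspace] in \<open>auto simp: pm.scale_right_distrib\<close>)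

lemma vadd_cls: "vadd P (cls P f) (cls P g) = cls P (f + g)"
proof -
  have "cls P (f' + g') = cls P (f + g)" if "f' \<in> cls P f" "g' \<in> cls P g" for f' g'
    unfolding cls_eq_iff using that pm.subspace_add[OF rel_span_subspace, of _ P]
    by (auto simp: cls_def algebra_simps)
  moreover have "f \<in> cls P f" for f using pm.subspace_0[OF rel_span_subspace[of P]]
    by (auto simp: cls_def intro!: exI[of _ 0])
  ultimately show ?thesis unfolding vadd_def by blast
qed


lemma rel_span_base: "r \<in> rels P \<Longrightarrow> r \<in> rel_span P"
  by (simp add: rel_span_def pm.span_base)

lemma perm_star_permutes:
  assumes u: "u permutes {1..Suc n}"
  shows "perm_star u permutes {1..n}"
proof (rule bij_imp_permutes)
  have inj: "inj u" using u by (rule permutes_inj)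
  have im: "u i \<in> {1..Suc n} \<longleftrightarrow> i \<in> {1..Suc n}" for i using permutes_in_image[OF u] by blast
  have "inj_on (perm_star u) {1..n}"
  proof (rule inj_onI)
    fix i j assume ij: "i \<in> {1..n}" "j \<in> {1..n}" "perm_star u i = perm_star u j"
    have p: "u (i+1) \<ge> 1" "u (j+1) \<ge> 1" "u 1 \<ge> 1" using im[of "i+1"] im[of "j+1"] im[of 1] ij by auto
    have d: "u (i+1) = u (j+1) \<longleftrightarrow> i = j" "u (i+1) = u 1 \<longleftrightarrow> i = 0" "u (j+1) = u 1 \<longleftrightarrow> j = 0"
      using inj by (auto dest: injD)
    show "i = j" using ij p d by (auto simp: perm_star_def split: if_splits)
  qed
  moreover have "perm_star u ` {1..n} \<subseteq> {1..n}"
  proof clarify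
    fix i assume i: "i \<in> {1..n}"
    have d: "u (i+1) = u 1 \<longleftrightarrow> i = 0" using inj by (auto dest: injD)
    show "perm_star u i \<in> {1..n}" using im[of "i+1"] im[of 1] i d by (auto simp: perm_star_def)
  qed
  ultimately show "bij_betw (perm_star u) {1..n} {1..n}"
    by (simp add: bij_betw_def endo_inj_surj)
  fix i assume "i \<notin> {1..n}"
  then show "perm_star u i = i"
    using permutes_not_in[OF u, of "i+1"] by (auto simp: perm_star_def not_le)
qed

lemma block_perm_transpose:
  "block_perm (Transposition.transpose 1 2) [k, l] i =
    (if 1 \<le> i \<and> i \<le> k then i + l else if k < i \<and> i \<le> k + l then i - k else i)"
proof -
  have L1: "(LEAST j. i \<le> sum_list (take j [k, l])) = 1" if "1 \<le> i" "i \<le> k"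
  proof (rule Least_equality)
    show "i \<le> sum_list (take 1 [k, l])" using that by simp
    fix y assume y: "i \<le> sum_list (take y [k, l])"
    show "1 \<le> y" using y that by (cases y) auto
  qed
  have L2: "(LEAST j. i \<le> sum_list (take j [k, l])) = 2" if "k < i" "i \<le> k + l"
  proof (rule Least_equality)
    show "i \<le> sum_list (take 2 [k, l])" using that by (simp add: numeral_2_eq_2)
    fix y assume y: "i \<le> sum_list (take y [k, l])"
    show "2 \<le> y"
    proof (rule ccontr)
      assume "\<not> 2 \<le> y" then have "y = 0 \<or> y = 1" by auto
      with y that show False by auto
    qed
  qed
  have s1: "{m. m \<in> {1..2::nat} \<and> Transposition.transpose 1 2 m < Transposition.transpose 1 2 (1::nat)} = {2}"
    and s2: "{m. m \<in> {1..2::nat} \<and> Transposition.transpose 1 2 m < Transposition.transpose 1 2 (2::nat)} = {}"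
    by (auto simp: Transposition.transpose_def split: if_splits)
  have len: "length [k, l] = 2" by simp
  consider "1 \<le> i" "i \<le> k" | "k < i" "i \<le> k + l" | "i = 0 \<or> i > k + l" by linarith
  then show ?thesis
  proof cases
    case 1
    have "block_perm (Transposition.transpose 1 2) [k, l] i
        = (\<Sum>m\<in>{2}. [k, l] ! (m - 1)) + (i - sum_list (take (1 - 1) [k, l]))"
      unfolding block_perm_def L1[OF 1] Let_def len s1 using 1 by simp
    then show ?thesis using 1 by simp
  next
    case 2
    have "block_perm (Transposition.transpose 1 2) [k, l] i
        = (\<Sum>m\<in>{}. [k, l] ! (m - 1)) + (i - sum_list (take (2 - 1) [k, l]))"
      unfolding block_perm_def L2[OF 2] Let_def len s2 using 2 by simp
    then show ?thesis using 2 by simp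
  next
    case 3
    then show ?thesis by (auto simp: block_perm_def)
  qed
qed

lemma lin_ext_diff: "lin_ext g (f - h) = lin_ext g f - (lin_ext g h :: _ \<Rightarrow>\<^sub>0 'k::field)"
  using lin_ext_add[of g "f - h" h] by (simp add: algebra_simps)

lemma pm_scale_1 [simp]: "pm_scale 1 (f :: _ \<Rightarrow>\<^sub>0 'k::field) = f" by simp

lemma pm_scale_single [simp]: "pm_scale c (Poly_Mapping.single x d) = Poly_Mapping.single x (c * d :: 'k::field)"
  by (rule poly_mapping_eqI) (simp add: lookup_single when_def)

lemmas lin_rel = lin_ext_diff lin_ext_single

lemma op_one_cls:
  "op_one smul (cls (OA smul) f) = cls (OA smul)
(lin_ext one_sym f)"
  unfolding op_one_def
proof (rule descend_lin_ext)
  have pt: "perm_times 1 id u permutes {1..length (1 # as)}" if "u permutes {1..length as}"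
    for u and as :: "'a list"
  proof (rule bij_imp_permutes)
    have inj: "inj u" using that by (rule permutes_inj)
    have im: "u i \<in> {1..length as} \<longleftrightarrow> i \<in> {1..length as}" for i using permutes_in_image[OF that] by blast
    have "inj_on (perm_times 1 id u) {1..length (1#as)}"
    proof (rule inj_onI)
      fix x y assume "x \<in> {1..length (1#as)}" "y \<in> {1..length (1#as)}" "perm_times 1 id u x = perm_times 1 id u y"
      then show "x = y" using im[of "x-1"] im[of "y-1"] injD[OF inj, of "x-1" "y-1"]
        by (auto simp: perm_times_def split: if_splits)
    qed
    moreover have "perm_times 1 id u ` {1..length (1#as)} \<subseteq> {1..length (1#as)}"
    proof clarify
      fix x assume "x \<in> {1..length (1#as)}"
      then show "perm_times 1 id u x \<in> {1..length (1#as)}"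
        using im[of "x-1"] by (auto simp: perm_times_def)
    qed
    ultimately show "bij_betw (perm_times 1 id u) {1..length (1#as)} {1..length (1#as)}"
      by (simp add: bij_betw_def endo_inj_surj)
    fix x assume "x \<notin> {1..length (1#as)}"
    then show "perm_times 1 id u x = x" using permutes_not_in[OF that, of "x-1"]
      by (auto simp: perm_times_def not_le)
  qed
  fix r assume "r \<in> rels (OA smul)"
  then have "r \<in> orels smul" by (simp add: OA_def)
  then have "lin_ext one_sym r \<in> orels smul"
  proof cases
    case (tensor_add i as u x y fs)
    then show ?thesis using orels.tensor_add[of "Suc i" "1 # as" "perm_times 1 id u" x y fs smul] pt
      by (simp add: lin_rel one_sym_def)
  next
    case (tensor_scale i as u c x fs)
    then show ?thesis using orels.tensor_scale[of "Suc i" "1 # as" "perm_times 1 id u" smul c x fs] pt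
      by (simp add: lin_rel one_sym_def)
  next
    case (sym_add u as x y fs)
    then show ?thesis using orels.sym_add[of "perm_times 1 id u" "1 # as" x y fs smul] pt
      by (simp add: lin_rel one_sym_def)
  next
    case (sym_scale u as c x fs)
    then show ?thesis using orels.sym_scale[of "perm_times 1 id u" "1 # as" smul c x fs] pt
      by (simp add: lin_rel one_sym_def)
  next
    case (sym_commutator u as x y fs)
    then show ?thesis using orels.sym_commutator[of "perm_times 1 id u" "1 # as" x y fs smul] pt
      by (simp add: lin_rel one_sym_def)
  qed
  then show "lin_ext one_sym r \<in> rel_span (OA smul)"
    by (intro rel_span_base) (simp add: OA_def)
qed

lemma perm_list_update:
  assumes s: "\<sigma> permutes {1..length as}" and i: "i < length as"
  shows "map (\<lambda>t. as[i := x] ! (inv \<sigma> t - 1)) [1..<Suc (length as)]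
       = (map (\<lambda>t. as ! (inv \<sigma> t - 1)) [1..<Suc (length as)])[\<sigma> (Suc i) - 1 := x]"
proof (rule nth_equalityI)
  have m: "\<sigma> j \<in> {1..length as} \<longleftrightarrow> j \<in> {1..length as}" for j using permutes_in_image[OF s] by blast
  have m': "inv \<sigma> j \<in> {1..length as} \<longleftrightarrow> j \<in> {1..length as}" for j
    using permutes_in_image[OF permutes_inv[OF s]] by blast
  fix j assume "j < length (map (\<lambda>t. as[i := x] ! (inv \<sigma> t - 1)) [1..<Suc (length as)])"
  then have j: "j < length as" by (simp del: upt_Suc)
  have e: "inv \<sigma> (Suc j) - 1 = i \<longleftrightarrow> \<sigma> (Suc i) - 1 = j"
  proof -
    have "inv \<sigma> (Suc j) - 1 = i \<longleftrightarrow> inv \<sigma> (Suc j) = Suc i" using m'[of "Suc j"] j by auto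
    also have "\<dots> \<longleftrightarrow> Suc j = \<sigma> (Suc i)" using permutes_inverses[OF s] by metis
    also have "\<dots> \<longleftrightarrow> \<sigma> (Suc i) - 1 = j" using m[of "Suc i"] i by auto
    finally show ?thesis .
  qed
  have "map (\<lambda>t. as[i := x] ! (inv \<sigma> t - 1)) [1..<Suc (length as)] ! j
      = (if inv \<sigma> (Suc j) - 1 = i then x else as ! (inv \<sigma> (Suc j) - 1))"
    using j i m'[of "Suc j"] by (simp add: nth_list_update del: upt_Suc)
  also have "\<dots> = (map (\<lambda>t. as ! (inv \<sigma> t - 1)) [1..<Suc (length as)])[\<sigma> (Suc i) - 1 := x] ! j"
    unfolding e using j by (simp add: nth_list_update del: upt_Suc)
  finally show "map (\<lambda>t. as[i := x] ! (inv \<sigma> t - 1)) [1..<Suc (length as)] ! j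
      = (map (\<lambda>t. as ! (inv \<sigma> t - 1)) [1..<Suc (length as)])[\<sigma> (Suc i) - 1 := x] ! j" .
qed (simp del: upt_Suc)

lemma left_act_cls: "left_act smul \<sigma> (cls (OA smul) f) = cls (OA smul) (lin_ext (left_sym \<sigma>) f)"
  unfolding left_act_def
proof (rule descend_lin_ext)
  fix r assume "r \<in> rels (OA smul)"
  then have r: "r \<in> orels smul" by (simp add: OA_def)
  have "lin_ext (left_sym \<sigma>) r \<in> orels smul \<or> lin_ext (left_sym \<sigma>) r = 0"
    using r
  proof cases
    case (tensor_add i as u x y fs)
    show ?thesis
    proof (cases "\<sigma> permutes {1..length as}")
      case True
      have "\<sigma> (Suc i) - 1 < length as" using permutes_in_image[OF True, of "Suc i"] tensor_add by auto
      then show ?thesis using True tensor_add permutes_compose[of u _ \<sigma>]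
          orels.tensor_add[of "\<sigma> (Suc i) - 1" "map (\<lambda>t. as ! (inv \<sigma> t - 1)) [1..<Suc (length as)]" "\<sigma> \<circ> u" x y fs smul]
        by (simp add: lin_rel left_sym_def perm_list_update del: upt_Suc One_nat_def)
    qed (use tensor_add in \<open>simp add: lin_rel left_sym_def\<close>)
  next
    case (tensor_scale i as u c x fs)
    show ?thesis
    proof (cases "\<sigma> permutes {1..length as}")
      case True
      have "\<sigma> (Suc i) - 1 < length as" using permutes_in_image[OF True, of "Suc i"] tensor_scale by auto
      then show ?thesis using True tensor_scale permutes_compose[of u _ \<sigma>]
          orels.tensor_scale[of "\<sigma> (Suc i) - 1" "map (\<lambda>t. as ! (inv \<sigma> t - 1)) [1..<Suc (length as)]" "\<sigma> \<circ> u" smul c x fs]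
        by (simp add: lin_rel left_sym_def perm_list_update del: upt_Suc One_nat_def)
    qed (use tensor_scale in \<open>simp add: lin_rel left_sym_def\<close>)
  next
    case (sym_add u as x y fs)
    then show ?thesis using permutes_compose[of u _ \<sigma>]
      orels.sym_add[of "\<sigma> \<circ> u" "map (\<lambda>t. as ! (inv \<sigma> t - 1)) [1..<Suc (length as)]" x y fs smul]
      by (simp add: lin_rel left_sym_def del: upt_Suc)
  next
    case (sym_scale u as c x fs)
    then show ?thesis using permutes_compose[of u _ \<sigma>]
      orels.sym_scale[of "\<sigma> \<circ> u" "map (\<lambda>t. as ! (inv \<sigma> t - 1)) [1..<Suc (length as)]" smul c x fs]
      by (simp add: lin_rel left_sym_def del: upt_Suc)
  next
    case (sym_commutator u as x y fs)
    then show ?thesis using permutes_compose[of u _ \<sigma>]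
      orels.sym_commutator[of "\<sigma> \<circ> u" "map (\<lambda>t. as ! (inv \<sigma> t - 1)) [1..<Suc (length as)]" x y fs smul]
      by (simp add: lin_rel left_sym_def del: upt_Suc)
  qed
  then show "lin_ext (left_sym \<sigma>) r \<in> rel_span (OA smul)"
    using rel_span_base[of _ "OA smul"] pm.subspace_0[OF rel_span_subspace] by (auto simp: OA_def)
qed

lemma right_act_cls: "right_act smul (cls (OA smul) f) \<sigma> = cls (OA smul) (lin_ext (right_sym \<sigma>) f)"
  unfolding right_act_def
proof (rule descend_lin_ext)
  fix r assume "r \<in> rels (OA smul)"
  then have r: "r \<in> orels smul" by (simp add: OA_def)
  have "lin_ext (right_sym \<sigma>) r \<in> orels smul \<or> lin_ext (right_sym \<sigma>) r = 0"
    using r by cases (auto simp: lin_rel right_sym_def intro!: orels.intros permutes_compose)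
  then show "lin_ext (right_sym \<sigma>) r \<in> rel_span (OA smul)"
    using rel_span_base[of _ "OA smul"] pm.subspace_0[OF rel_span_subspace] by (auto simp: OA_def)
qed

lemma (in assoc_algebra) op_pi_cls: "op_pi smul (cls (OA smul) f) = cls (OA smul) (lin_ext pi_sym f)"
  unfolding op_pi_def
proof (rule descend_lin_ext)
  have k: "u 1 - 2 < length as" "u 1 - 2 = j \<longleftrightarrow> u 1 = j + 2"
    if "u permutes {1..Suc (length as)}" "u 1 \<noteq> 1" for u and as :: "'b list" and j
    using permutes_in_image[OF that(1), of 1] that(2) by auto
  fix r assume "r \<in> rels (OA smul)"
  then have r: "r \<in> orels smul" by (simp add: OA_def)
  have "lin_ext pi_sym r \<in> orels smul \<or> lin_ext pi_sym r = 0"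
    using r
  proof cases
    case (tensor_add i as u x y fs)
    then obtain a as' where as: "as = a # as'" by (cases as) auto
    have u: "u permutes {1..Suc (length as')}" using tensor_add as by simp
    note pu = perm_star_permutes[OF u]
    consider "u 1 = 1" "i = 0" | j where "u 1 = 1" "i = Suc j" | "u 1 \<noteq> 1" "i = 0"
      | j where "u 1 \<noteq> 1" "i = Suc j" "u 1 - 2 = j" | j where "u 1 \<noteq> 1" "i = Suc j" "u 1 - 2 \<noteq> j"
      by (cases i) auto
    then show ?thesis
    proof cases
      case 1 then show ?thesis using tensor_add as pu orels.sym_add[of "perm_star u" as' x y fs smul]
        by (simp add: lin_rel)
    next
      case (2 j) then show ?thesis using tensor_add as pu
          orels.tensor_add[of j as' "perm_star u" x y "add_mset a fs" smul]
        by (simp add: lin_rel)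
    next
      case 3 then show ?thesis using tensor_add as pu k[OF u]
          orels.tensor_add[of "u 1 - 2" as' "perm_star u" "x * as' ! (u 1 - 2)" "y * as' ! (u 1 - 2)" fs smul]
        by (simp add: lin_rel distrib_right)
    next
      case (4 j) then show ?thesis using tensor_add as pu k[OF u]
          orels.tensor_add[of "u 1 - 2" as' "perm_star u" "a * x" "a * y" fs smul]
        by (simp add: lin_rel distrib_left)
    next
      case (5 j)
      then have ne: "as'[j := z] ! (u (Suc 0) - 2) = as' ! (u (Suc 0) - 2)" for z
        by (metis One_nat_def nth_list_update_neq)
      show ?thesis using 5 tensor_add as pu k[OF u]
          orels.tensor_add[of j "as'[u 1 - 2 := a * as' ! (u 1 - 2)]" "perm_star u" x y fs smul]
        by (simp add: lin_rel list_update_swap ne)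
    qed
  next
    case (tensor_scale i as u c x fs)
    then obtain a as' where as: "as = a # as'" by (cases as) auto
    have u: "u permutes {1..Suc (length as')}" using tensor_scale as by simp
    note pu = perm_star_permutes[OF u]
    consider "u 1 = 1" "i = 0" | j where "u 1 = 1" "i = Suc j" | "u 1 \<noteq> 1" "i = 0"
      | j where "u 1 \<noteq> 1" "i = Suc j" "u 1 - 2 = j" | j where "u 1 \<noteq> 1" "i = Suc j" "u 1 - 2 \<noteq> j"
      by (cases i) auto
    then show ?thesis
    proof cases
      case 1 then show ?thesis using tensor_scale as pu orels.sym_scale[of "perm_star u" as' smul c x fs]
        by (simp add: lin_rel)
    next
      case (2 j) then show ?thesis using tensor_scale as pu
          orels.tensor_scale[of j as' "perm_star u" smul c x "add_mset a fs"]
        by (simp add: lin_rel)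
    next
      case 3 then show ?thesis using tensor_scale as pu k[OF u]
          orels.tensor_scale[of "u 1 - 2" as' "perm_star u" smul c "x * as' ! (u 1 - 2)" fs]
        by (simp add: lin_rel scale_mult_left)
    next
      case (4 j) then show ?thesis using tensor_scale as pu k[OF u]
          orels.tensor_scale[of "u 1 - 2" as' "perm_star u" smul c "a * x" fs]
        by (simp add: lin_rel scale_mult_right)
    next
      case (5 j)
      then have ne: "as'[j := z] ! (u (Suc 0) - 2) = as' ! (u (Suc 0) - 2)" for z
        by (metis One_nat_def nth_list_update_neq)
      show ?thesis using 5 tensor_scale as pu k[OF u]
          orels.tensor_scale[of j "as'[u 1 - 2 := a * as' ! (u 1 - 2)]" "perm_star u" smul c x fs]
        by (simp add: lin_rel list_update_swap ne)
    qed
  next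
    case (sym_add u as x y fs)
    show ?thesis
    proof (cases as)
      case (Cons a as')
      then have u: "u permutes {1..Suc (length as')}" using sym_add by simp
      show ?thesis using sym_add Cons perm_star_permutes[OF u]
        orels.sym_add[of "perm_star u" as' x y "add_mset a fs" smul]
        orels.sym_add[of "perm_star u" "as'[u 1 - 2 := a * as' ! (u 1 - 2)]" x y fs smul]
        by (simp add: lin_rel add_mset_commute)
    qed (use sym_add in \<open>simp add: lin_rel\<close>)
  next
    case (sym_scale u as c x fs)
    show ?thesis
    proof (cases as)
      case (Cons a as')
      then have u: "u permutes {1..Suc (length as')}" using sym_scale by simp
      show ?thesis using sym_scale Cons perm_star_permutes[OF u]
        orels.sym_scale[of "perm_star u" as' smul c x "add_mset a fs"]
        orels.sym_scale[of "perm_star u" "as'[u 1 - 2 := a * as' ! (u 1 - 2)]" smul c x fs]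
        by (simp add: lin_rel add_mset_commute)
    qed (use sym_scale in \<open>simp add: lin_rel\<close>)
  next
    case (sym_commutator u as x y fs)
    show ?thesis
    proof (cases as)
      case (Cons a as')
      then have u: "u permutes {1..Suc (length as')}" using sym_commutator by simp
      show ?thesis using sym_commutator Cons perm_star_permutes[OF u]
        orels.sym_commutator[of "perm_star u" as' x y "add_mset a fs" smul]
        orels.sym_commutator[of "perm_star u" "as'[u 1 - 2 := a * as' ! (u 1 - 2)]" x y fs smul]
        by (simp add: lin_rel add_mset_commute)
    qed (use sym_commutator in \<open>simp add: lin_rel\<close>)
  qed
  then show "lin_ext pi_sym r \<in> rel_span (OA smul)"
    using rel_span_base[of _ "OA smul"] pm.subspace_0[OF rel_span_subspace] by (auto simp: OA_def)
qed

section \<open>The pairing and the action of \<open>GL\<^sub>N\<close> are well defined\<close>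

interpretation idl: module "(*) :: 'r::comm_ring_1 \<Rightarrow> 'r \<Rightarrow> 'r"
  by unfold_locales (auto simp: algebra_simps)

declare idl.scale_scale [simp del]

lemma pm_scale_mult: "pm_scale c f = Poly_Mapping.single 0 c * (f :: ('x::comm_monoid_add) \<Rightarrow>\<^sub>0 'k::field)"
  by (simp add: pm_scale_def mult_map_scale_conv_mult)

lemma rel_span_Rep: "rel_span (Rep smul) = module.span (*) (rep_rels smul)"
proof -
  have "pm.subspace (module.span (*) (rep_rels smul))"
    by (rule pm.subspaceI) (auto simp: idl.span_zero idl.span_add idl.span_scale pm_scale_mult)
  then show ?thesis
    by (auto simp: rel_span_def Rep_def intro: pm.span_base dest: pm.span_minimal[OF subset_refl, THEN subsetD])
qed

lemma idl_lin_ext: "(\<And>w. g w \<in> rel_span (Rep smul)) \<Longrightarrow> lin_ext g X \<in> rel_span (Rep smul)"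
  unfolding lin_ext_def
  by (intro pm.subspace_sum[OF rel_span_subspace] pm.subspace_scale[OF rel_span_subspace])

lemma lin_ext_fun_diff: "lin_ext g X - lin_ext h X = lin_ext (\<lambda>w. g w - h w :: _ \<Rightarrow>\<^sub>0 'k::field) X"
  by (simp add: lin_ext_def sum_subtractf pm.scale_right_diff_distrib)

lemma lin_ext_fun_scale: "pm_scale c (lin_ext h X) = lin_ext (\<lambda>w. pm_scale c (h w :: _ \<Rightarrow>\<^sub>0 'k::field)) X"
  by (simp add: lin_ext_def pm.scale_sum_right mult.commute)

lemma idl_mult: "p \<in> rel_span (Rep smul) \<Longrightarrow> q * p \<in> rel_span (Rep smul)" 
  "p \<in> rel_span (Rep smul) \<Longrightarrow> p * q \<in> rel_span (Rep smul)"
  by (auto simp: rel_span_Rep idl.span_scale mult.commute[of p])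

lemma rep_rels_idl: "p \<in> rep_rels smul \<Longrightarrow> p \<in> rel_span (Rep smul)"
  by (simp add: rel_span_Rep idl.span_base)

lemma pair_update:
  fixes as :: "'a list" and w :: "('N::finite \<times> 'N) list"
  assumes "i < length as" "length as = length w"
  shows "\<exists>q p1 p2. \<forall>x. pair_sym (as[i := x], fs, u) w = (q * rvar x p1 p2 :: _ \<Rightarrow>\<^sub>0 'k::field)"
proof -
  define F where "F = (\<lambda>(bs :: 'a list) t. rvar (bs ! (t - 1)) (fst (w ! (inv u t - 1))) (snd (w ! (t - 1))) :: _ \<Rightarrow>\<^sub>0 'k::field)"
  have "(\<Prod>t = 1..length as. F (as[i := x]) t)
      = (\<Prod>t \<in> {1..length as} - {Suc i}. F as t) * rvar x (fst (w ! (inv u (Suc i) - 1))) (snd (w ! i))" for x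
  proof -
    have "(\<Prod>t = 1..length as. F (as[i := x]) t) = F (as[i := x]) (Suc i) * (\<Prod>t \<in> {1..length as} - {Suc i}. F (as[i := x]) t)"
      using assms by (intro prod.remove) auto
    also have "(\<Prod>t \<in> {1..length as} - {Suc i}. F (as[i := x]) t) = (\<Prod>t \<in> {1..length as} - {Suc i}. F as t)"
      by (rule prod.cong) (auto simp: F_def nth_list_update)
    finally show ?thesis using assms by (simp add: F_def mult.commute)
  qed
  then show ?thesis using assms
    by (intro exI[of _ "(\<Prod>t \<in> {1..length as} - {Suc i}. F as t) * (\<Prod>a\<in>#fs. \<Sum>i\<in>UNIV. rvar a i i)"]
       exI[of _ "fst (w ! (inv u (Suc i) - 1))"] exI[of _ "snd (w ! i)"])
      (simp add: pair_sym_def F_def mult_ac)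
qed

lemma rvar_rels:
  "rvar (a + b) i j - rvar a i j - rvar b i j \<in> rel_span (Rep smul)"
  "rvar (smul c a) i j - pm_scale c (rvar a i j) \<in> rel_span (Rep smul)"
  "rvar (a * b) i j - (\<Sum>k\<in>UNIV. rvar a i k * rvar b k j) \<in> rel_span (Rep smul)"
  by (intro rep_rels_idl rep_rels.intros)+

lemma pair_sym_split:
  "pair_sym (as, fs, u) w = pair_sym (as, {#}, u) w * (\<Prod>a\<in>#fs. \<Sum>i\<in>UNIV. rvar a i i)"
  by (simp add: pair_sym_def)

lemma pair_rel_span:
  fixes smul :: "'k::field \<Rightarrow> 'a::{ring, monoid_mult} \<Rightarrow> 'a" and X :: "('N::finite, 'k) tensors"
  assumes "r \<in> orels smul"
  shows "lin_ext (\<lambda>x. lin_ext (pair_sym x) X) r \<in> rel_span (Rep smul)"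
  using assms
proof cases
  case (tensor_add i as u x y fs)
  have "pair_sym (as[i := x + y], fs, u) w - pair_sym (as[i := x], fs, u) w - pair_sym (as[i := y], fs, u) w
      \<in> rel_span (Rep smul)" for w :: "('N \<times> 'N) list"
  proof (cases "length as = length w")
    case True
    then obtain q p1 p2 where "pair_sym (as[i := x], fs, u) w = (q * rvar x p1 p2 :: _ \<Rightarrow>\<^sub>0 'k)" for x
      using pair_update[of i as w fs u] tensor_add by metis
    then show ?thesis using idl_mult(1)[OF rvar_rels(1)[of x y p1 p2 smul], of q] by (simp add: algebra_simps)
  qed (simp add: pair_sym_def pm.subspace_0[OF rel_span_subspace])
  then show ?thesis unfolding tensor_add lin_rel by (simp add: lin_ext_fun_diff idl_lin_ext)
next
  case (tensor_scale i as u c x fs)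
  have "pair_sym (as[i := smul c x], fs, u) w - pm_scale c (pair_sym (as[i := x], fs, u) w)
      \<in> rel_span (Rep smul)" for w :: "('N \<times> 'N) list"
  proof (cases "length as = length w")
    case True
    then obtain q p1 p2 where "pair_sym (as[i := x], fs, u) w = (q * rvar x p1 p2 :: _ \<Rightarrow>\<^sub>0 'k)" for x
      using pair_update[of i as w fs u] tensor_scale by metis
    then show ?thesis using idl_mult(1)[OF rvar_rels(2)[of smul c x p1 p2], of q]
      by (simp add: algebra_simps pm_scale_mult)
  qed (simp add: pair_sym_def pm.subspace_0[OF rel_span_subspace])
  then show ?thesis unfolding tensor_scale lin_rel lin_ext_fun_scale by (simp add: lin_ext_fun_diff idl_lin_ext)
next
  case (sym_add u as x y fs)
  let ?t = "\<lambda>x. \<Sum>i\<in>(UNIV :: 'N set). rvar x i i :: ('a, 'N) rmonom \<Rightarrow>\<^sub>0 'k"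
  have *: "?t (x + y) - ?t x - ?t y \<in> rel_span (Rep smul)"
    unfolding sum_subtractf[symmetric] by (intro pm.subspace_sum[OF rel_span_subspace] rvar_rels)
  have "pair_sym (as, add_mset (x + y) fs, u) w - pair_sym (as, add_mset x fs, u) w - pair_sym (as, add_mset y fs, u) w
      \<in> rel_span (Rep smul)" for w :: "('N \<times> 'N) list"
    using idl_mult(1)[OF *, of "pair_sym (as, fs, u) w"]
    by (simp add: pair_sym_split[of as "add_mset _ _"] pair_sym_split[of as fs] algebra_simps)
  then show ?thesis unfolding sym_add lin_rel by (simp add: lin_ext_fun_diff idl_lin_ext)
next
  case (sym_scale u as c x fs)
  let ?t = "\<lambda>x. \<Sum>i\<in>(UNIV :: 'N set). rvar x i i :: ('a, 'N) rmonom \<Rightarrow>\<^sub>0 'k"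
  have *: "?t (smul c x) - pm_scale c (?t x) \<in> rel_span (Rep smul)"
    unfolding sum_subtractf[symmetric] pm.scale_sum_right
    by (intro pm.subspace_sum[OF rel_span_subspace] rvar_rels)
  have "pair_sym (as, add_mset (smul c x) fs, u) w - pm_scale c (pair_sym (as, add_mset x fs, u) w)
      \<in> rel_span (Rep smul)" for w :: "('N \<times> 'N) list"
    using idl_mult(1)[OF *, of "pair_sym (as, fs, u) w"]
    by (simp add: pair_sym_split[of as "add_mset _ _"] pair_sym_split[of as fs] algebra_simps pm_scale_mult)
  then show ?thesis unfolding sym_scale lin_rel lin_ext_fun_scale by (simp add: lin_ext_fun_diff idl_lin_ext)
next
  case (sym_commutator u as x y fs)
  let ?t = "\<lambda>x. \<Sum>i\<in>(UNIV :: 'N set). rvar x i i :: ('a, 'N) rmonom \<Rightarrow>\<^sub>0 'k"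
  let ?p = "\<lambda>x y. \<Sum>i\<in>(UNIV :: 'N set). \<Sum>k\<in>UNIV. rvar x i k * rvar y k i :: ('a, 'N) rmonom \<Rightarrow>\<^sub>0 'k"
  have 1: "?t (x * y) - ?p x y \<in> rel_span (Rep smul)" for x y
    unfolding sum_subtractf[symmetric] by (intro pm.subspace_sum[OF rel_span_subspace] rvar_rels)
  have 2: "?p x y = ?p y x" by (subst sum.swap) (simp add: mult.commute)
  have 3: "?t ((x * y - y * x) + y * x) - ?t (x * y - y * x) - ?t (y * x) \<in> rel_span (Rep smul)"
    unfolding sum_subtractf[symmetric] by (intro pm.subspace_sum[OF rel_span_subspace] rvar_rels)
  have *: "?t (x * y - y * x) \<in> rel_span (Rep smul)"
    using pm.subspace_diff[OF rel_span_subspace pm.subspace_diff[OF rel_span_subspace 1[of x y] 1[of y x]] 3]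
    by (simp add: 2)
  have "pair_sym (as, add_mset (x * y - y * x) fs, u) w \<in> rel_span (Rep smul)" for w :: "('N \<times> 'N) list"
    using idl_mult(1)[OF *, of "pair_sym (as, fs, u) w"]
    by (simp add: pair_sym_split[of as "add_mset _ _"] pair_sym_split[of as fs] algebra_simps)
  then show ?thesis unfolding sym_commutator lin_rel by (simp add: idl_lin_ext)
qed

lemma pairing_cls:
  "pairing smul (cls (OA smul) f) X = cls (Rep smul) (lin_ext (\<lambda>x. lin_ext (pair_sym x) X) f)"
  unfolding pairing_def by (rule descend_lin_ext) (simp add: OA_def pair_rel_span)

lemma rmonom_act_superset:
  "finite S \<Longrightarrow> Poly_Mapping.keys m \<subseteq> S \<Longrightarrow> rmonom_act g m = (\<Prod>v\<in>S. rvar_act g v ^ Poly_Mapping.lookup m v)"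
  unfolding rmonom_act_def by (rule prod.mono_neutral_left) (auto simp: in_keys_iff)

lemma rmonom_act_add: "rmonom_act g (m + m') = rmonom_act g m * rmonom_act g m'"
proof -
  let ?S = "Poly_Mapping.keys m \<union> Poly_Mapping.keys m'"
  show ?thesis
    by (subst (1 2 3) rmonom_act_superset[of ?S])
      (use keys_add[of m m'] in \<open>auto simp: lookup_add power_add prod.distrib\<close>)
qed

lemma poly_mapping_single_induct:
  assumes "P 0" "\<And>x c f. P f \<Longrightarrow> P (Poly_Mapping.single x c + f)"
  shows "P (f :: 'x \<Rightarrow>\<^sub>0 'k::field)"
proof (induction "card (Poly_Mapping.keys f)" arbitrary: f)
  case 0 then show ?case using assms by simp
next
  case (Suc n)
  then obtain x where x: "x \<in> Poly_Mapping.keys f" by fastforce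
  let ?g = "f - Poly_Mapping.single x (Poly_Mapping.lookup f x)"
  have "Poly_Mapping.keys ?g = Poly_Mapping.keys f - {x}"
    using x by (auto simp: in_keys_iff lookup_minus lookup_single when_def split: if_splits)
  then have "P ?g" using Suc x by simp
  then show ?case using assms(2)[of ?g x "Poly_Mapping.lookup f x"] by simp
qed

lemma lin_ext_0 [simp]: "lin_ext g 0 = 0" by (simp add: lin_ext_def)

lemma act_mult: "lin_ext (rmonom_act g) (p * q) = lin_ext (rmonom_act g) p * lin_ext (rmonom_act g) q"
proof (induction p rule: poly_mapping_single_induct)
  case (2 x c p)
  have "lin_ext (rmonom_act g) (Poly_Mapping.single x c * q)
      = pm_scale c (rmonom_act g x) * lin_ext (rmonom_act g) q"
  proof (induction q rule: poly_mapping_single_induct)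
    case (2 y d q)
    have "pm_scale (c * d) (rmonom_act g x * rmonom_act g y)
        = pm_scale c (rmonom_act g x) * pm_scale d (rmonom_act g y)"
      unfolding pm.scale_scale[symmetric] by (simp only: pm_scale_mult mult_ac)
    then show ?case unfolding distrib_left lin_ext_add mult_single lin_ext_single rmonom_act_add 2 by simp
  qed simp
  then show ?case using 2 by (simp add: distrib_right lin_ext_add)
qed simp

lemma act_one: "lin_ext (rmonom_act g) 1 = 1"
proof -
  have "lin_ext (rmonom_act g) (Poly_Mapping.single 0 1) = 1"
    by (simp add: rmonom_act_def del: single_one)
  then show ?thesis by (simp only: single_one)
qed

lemma act_rvar: "lin_ext (rmonom_act g) (rvar a i j) = rvar_act g (a, i, j)"
  by (simp add: rvar_def rmonom_act_def)

lemma act_sum: "lin_ext h (sum f S) = (\<Sum>x\<in>S. lin_ext h (f x) :: _ \<Rightarrow>\<^sub>0 'k::field)"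
  by (induction S rule: infinite_finite_induct) (auto simp: lin_ext_add)

lemma act_prod: "lin_ext (rmonom_act g) (prod f S) = (\<Prod>x\<in>S. lin_ext (rmonom_act g) (f x))"
  by (induction S rule: infinite_finite_induct) (auto simp: act_mult act_one)

lemma dual_coeff_eq: "dual_coeff g (i, j) (p, q) = matrix_inv g $ i $ p * g $ q $ j"
proof -
  have "(matrix_inv g ** mat_unit p q) $ i $ s = (if s = q then matrix_inv g $ i $ p else 0)" for s
    by (simp add: matrix_matrix_mult_def mat_unit_def if_distrib[of "\<lambda>x. _ * x"] cong: if_cong)
  then show ?thesis unfolding dual_coeff_def
    by (simp add: matrix_matrix_mult_def[of "matrix_inv g ** mat_unit p q"] if_distrib[of "\<lambda>x. x * _"] cong: if_cong)
qed

lemma inv_sum: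
  fixes g :: "'k::field ^ 'N ^ 'N::finite"
  assumes "invertible g"
  shows "(\<Sum>k\<in>UNIV. g $ i $ k * matrix_inv g $ k $ j) = (if i = j then 1 else 0)"
    "(\<Sum>k\<in>UNIV. matrix_inv g $ i $ k * g $ k $ j) = (if i = j then 1 else 0)"
proof -
  have "g ** matrix_inv g = mat 1" "matrix_inv g ** g = mat 1"
    using someI_ex[OF assms[unfolded invertible_def]] by (auto simp: matrix_inv_def)
  then have "(g ** matrix_inv g) $ i $ j = mat 1 $ i $ j" "(matrix_inv g ** g) $ i $ j = mat 1 $ i $ j" by simp_all
  then show "(\<Sum>k\<in>UNIV. g $ i $ k * matrix_inv g $ k $ j) = (if i = j then 1 else 0)"
    "(\<Sum>k\<in>UNIV. matrix_inv g $ i $ k * g $ k $ j) = (if i = j then 1 else 0)"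
    by (auto simp: matrix_matrix_mult_def mat_def)
qed

abbreviation "Cst c \<equiv> Poly_Mapping.single 0 (c :: 'k::field)"

lemma Cst_simps: "Cst (a * b) = Cst a * Cst b" "Cst (sum f S) = (\<Sum>x\<in>S. Cst (f x))" "Cst 1 = (1 :: (_::comm_monoid_add) \<Rightarrow>\<^sub>0 _)"
  "Cst 0 = 0"
  by (simp_all add: mult_single) (induction S rule: infinite_finite_induct; simp add: single_add)

lemma rvar_act_eq: "rvar_act g (a, i, j) = (\<Sum>p\<in>UNIV. \<Sum>q\<in>UNIV. Cst (matrix_inv g $ i $ p * g $ q $ j) * rvar a p q)"
  by (simp add: rvar_act_def dual_coeff_eq pm_scale_mult UNIV_Times_UNIV[symmetric] sum.cartesian_product
     del: UNIV_Times_UNIV)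

lemma rvar_rel_one: "rvar 1 i j - (if i = j then 1 else 0) \<in> rel_span (Rep smul)"
  by (intro rep_rels_idl rep_rels.intros)

lemma act_rep_rels:
  fixes smul :: "'k::field \<Rightarrow> 'a::{ring, monoid_mult} \<Rightarrow> 'a" and g :: "'k ^ 'N ^ 'N::finite"
  assumes g: "invertible g" and r: "r \<in> rep_rels smul"
  shows "lin_ext (rmonom_act g) r \<in> rel_span (Rep smul)"
  using r
proof cases
  case (1 a b i j)
  then have "lin_ext (rmonom_act g) r = (\<Sum>p\<in>UNIV. \<Sum>q\<in>UNIV. Cst (matrix_inv g $ i $ p * g $ q $ j) *
      (rvar (a + b) p q - rvar a p q - rvar b p q))"
    by (simp add: lin_ext_diff act_rvar rvar_act_eq right_diff_distrib sum_subtractf)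
  then show ?thesis
    by (simp only:) (intro pm.subspace_sum[OF rel_span_subspace] idl_mult rvar_rels)
next
  case (2 c a i j)
  then have "lin_ext (rmonom_act g) r = (\<Sum>p\<in>UNIV. \<Sum>q\<in>UNIV. Cst (matrix_inv g $ i $ p * g $ q $ j) *
      (rvar (smul c a) p q - pm_scale c (rvar a p q)))"
    by (simp add: lin_ext_diff lin_ext_scale act_rvar rvar_act_eq right_diff_distrib sum_subtractf)
      (simp add: pm_scale_mult sum_distrib_left mult_ac)
  then show ?thesis
    by (simp only:) (intro pm.subspace_sum[OF rel_span_subspace] idl_mult rvar_rels)
next
  case (3 a b i j)
  let ?h = "matrix_inv g"
  have "(\<Sum>k\<in>UNIV. rvar_act g (a, i, k) * rvar_act g (b, k, j))
     = (\<Sum>k\<in>UNIV. \<Sum>p\<in>UNIV. \<Sum>q\<in>UNIV. \<Sum>r\<in>UNIV. \<Sum>s\<in>UNIV.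
          Cst (?h $ i $ p * g $ s $ j) * Cst (g $ q $ k * ?h $ k $ r) * (rvar a p q * rvar b r s))"
    unfolding rvar_act_eq sum_distrib_right unfolding sum_distrib_left
    by (simp only: Cst_simps(1) mult_ac)
  also have "\<dots> = (\<Sum>p\<in>UNIV. \<Sum>q\<in>UNIV. \<Sum>r\<in>UNIV. \<Sum>s\<in>UNIV. \<Sum>k\<in>UNIV.
          Cst (?h $ i $ p * g $ s $ j) * Cst (g $ q $ k * ?h $ k $ r) * (rvar a p q * rvar b r s))"
    by (rule trans[OF sum.swap], rule sum.cong[OF refl])+ (rule refl)
  also have "\<dots> = (\<Sum>p\<in>UNIV. \<Sum>q\<in>UNIV. \<Sum>r\<in>UNIV. \<Sum>s\<in>UNIV.
          Cst (?h $ i $ p * g $ s $ j) * Cst (\<Sum>k\<in>UNIV. g $ q $ k * ?h $ k $ r) * (rvar a p q * rvar b r s))"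
    by (simp add: Cst_simps(2) sum_distrib_left sum_distrib_right)
  also have "\<dots> = (\<Sum>p\<in>UNIV. \<Sum>q\<in>UNIV. \<Sum>r\<in>UNIV. if q = r then \<Sum>s\<in>UNIV.
          Cst (?h $ i $ p * g $ s $ j) * (rvar a p q * rvar b r s) else 0)"
    unfolding inv_sum[OF g] by (intro sum.cong refl) (auto simp: Cst_simps(3,4))
  also have "\<dots> = (\<Sum>p\<in>UNIV. \<Sum>q\<in>UNIV. \<Sum>s\<in>UNIV.
          Cst (?h $ i $ p * g $ s $ j) * (rvar a p q * rvar b q s))"
    by simp
  also have "\<dots> = (\<Sum>p\<in>UNIV. \<Sum>s\<in>UNIV. Cst (?h $ i $ p * g $ s $ j) * (\<Sum>q\<in>UNIV. rvar a p q * rvar b q s))"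
    unfolding sum_distrib_left by (rule sum.cong[OF refl], rule sum.swap)
  finally have "lin_ext (rmonom_act g) r = (\<Sum>p\<in>UNIV. \<Sum>s\<in>UNIV. Cst (?h $ i $ p * g $ s $ j) *
      (rvar (a * b) p s - (\<Sum>q\<in>UNIV. rvar a p q * rvar b q s)))"
    unfolding 3 lin_ext_diff act_sum act_mult act_rvar
    by (simp add: rvar_act_eq[of _ "a * b"] right_diff_distrib sum_subtractf)
  then show ?thesis
    by (simp only:) (intro pm.subspace_sum[OF rel_span_subspace] idl_mult rvar_rels)
next
  case (4 i j)
  let ?h = "matrix_inv g"
  have "lin_ext (rmonom_act g) (if i = j then 1 else 0) = Cst (\<Sum>p\<in>UNIV. ?h $ i $ p * g $ p $ j)"
    unfolding inv_sum[OF g] by (simp add: act_one Cst_simps)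
  also have "\<dots> = (\<Sum>p\<in>UNIV. \<Sum>q\<in>UNIV. Cst (?h $ i $ p * g $ q $ j) * (if p = q then 1 else 0))"
    by (simp add: Cst_simps(2) if_distrib[of "\<lambda>x. _ * x"] cong: if_cong)
  finally have "lin_ext (rmonom_act g) r = (\<Sum>p\<in>UNIV. \<Sum>q\<in>UNIV. Cst (?h $ i $ p * g $ q $ j) *
      (rvar 1 p q - (if p = q then 1 else 0)))"
    unfolding 4 lin_ext_diff act_rvar
    by (simp add: rvar_act_eq right_diff_distrib sum_subtractf)
  then show ?thesis
    by (simp only:) (intro pm.subspace_sum[OF rel_span_subspace] idl_mult rvar_rel_one)
qed

lemma rep_act_cls:
  fixes g :: "'k::field ^ 'N ^ 'N::finite" and smul :: "'k \<Rightarrow> 'a::{ring, monoid_mult} \<Rightarrow> 'a"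
  assumes "invertible g"
  shows "rep_act smul g (cls (Rep smul) p) = cls (Rep smul) (lin_ext (rmonom_act g) p)"
  unfolding rep_act_def
proof (rule descend_lin_ext)
  fix r :: "('a, 'N) rmonom \<Rightarrow>\<^sub>0 'k" assume "r \<in> rels (Rep smul)"
  then have "r \<in> module.span (*) (rep_rels smul)" by (simp add: Rep_def)
  then show "lin_ext (rmonom_act g) r \<in> rel_span (Rep smul)"
  proof (induction rule: idl.span_induct_alt)
    case base show ?case using pm.subspace_0[OF rel_span_subspace] by simp
  next
    case (step c x y)
    show ?case unfolding lin_ext_add act_mult
      by (intro pm.subspace_add[OF rel_span_subspace] idl_mult(1) act_rep_rels[OF assms step(1)] step(2))
  qed
qed

lemma act_trace:
  assumes g: "invertible (g :: 'k::field ^ 'N ^ 'N::finite)"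
  shows "lin_ext (rmonom_act g) (\<Sum>i\<in>UNIV. rvar a i i) = (\<Sum>i\<in>UNIV. rvar a i i)"
proof -
  have "lin_ext (rmonom_act g) (\<Sum>i\<in>UNIV. rvar a i i)
    = (\<Sum>i\<in>UNIV. \<Sum>p\<in>UNIV. \<Sum>q\<in>UNIV. Cst (g $ q $ i * matrix_inv g $ i $ p) * rvar a p q)"
    by (simp add: act_sum act_rvar rvar_act_eq mult.commute)
  also have "\<dots> = (\<Sum>p\<in>UNIV. \<Sum>q\<in>UNIV. \<Sum>i\<in>UNIV. Cst (g $ q $ i * matrix_inv g $ i $ p) * rvar a p q)"
    by (subst sum.swap, rule sum.cong[OF refl], rule sum.swap)
  also have "\<dots> = (\<Sum>p\<in>UNIV. \<Sum>q\<in>UNIV. Cst (\<Sum>i\<in>UNIV. g $ q $ i * matrix_inv g $ i $ p) * rvar a p q)"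
    by (simp add: Cst_simps(2) sum_distrib_right)
  also have "\<dots> = (\<Sum>p\<in>UNIV. \<Sum>q\<in>UNIV. if q = p then rvar a p q else 0)"
    unfolding inv_sum[OF g] by (intro sum.cong refl) (auto simp: Cst_simps(3,4))
  finally show ?thesis by simp
qed

lemma act_prod_mset: "lin_ext (rmonom_act g) (\<Prod>a\<in>#fs. h a) = (\<Prod>a\<in>#fs. lin_ext (rmonom_act g) (h a))"
  by (induction fs) (auto simp: act_one act_mult)

lemma act_pair_sym:
  fixes g :: "'k::field ^ 'N ^ 'N::finite"
  assumes g: "invertible g" and u: "u permutes {1..length as}"
  shows "lin_ext (rmonom_act g) (pair_sym (as, fs, u) w)
    = (\<Sum>v | length v = length w. Cst (\<Prod>s<length w. dual_coeff g (w ! s) (v ! s)) * pair_sym (as, fs, u) v)"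
proof (cases "length as = length w")
  case True
  let ?n = "length w" let ?h = "matrix_inv g" let ?I = "{1..length w}"
  have m: "u j \<in> ?I \<longleftrightarrow> j \<in> ?I" "inv u j \<in> ?I \<longleftrightarrow> j \<in> ?I" for j
    using permutes_in_image[OF u] permutes_in_image[OF permutes_inv[OF u]] True by auto
  have bij: "bij_betw (inv u) ?I ?I" using permutes_imp_bij[OF permutes_inv[OF u]] True by simp
  define F where "F = (\<lambda>t pq. Cst (?h $ (fst (w ! (inv u t - 1))) $ fst pq * g $ snd pq $ (snd (w ! (t - 1)))) * rvar (as ! (t - 1)) (fst pq) (snd pq))"
  have "lin_ext (rmonom_act g) (\<Prod>t\<in>?I. rvar (as ! (t - 1)) (fst (w ! (inv u t - 1))) (snd (w ! (t - 1))))
      = (\<Prod>t\<in>?I. \<Sum>pq\<in>UNIV. F t pq)"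
    unfolding act_prod act_rvar rvar_act_eq F_def
    by (simp add: sum.cartesian_product split_beta)
  also have "\<dots> = (\<Sum>f\<in>?I \<rightarrow>\<^sub>E UNIV. \<Prod>t\<in>?I. F t (f t))"
    by (rule prod_sum_PiE) auto
  also have "\<dots> = (\<Sum>v | length v = ?n. \<Prod>t\<in>?I. F t (fst (v ! (inv u t - 1)), snd (v ! (t - 1))))"
  proof (rule sum.reindex_bij_witness)
    let ?i = "\<lambda>v. restrict (\<lambda>t. (fst (v ! (inv u t - 1)), snd (v ! (t - 1)))) ?I"
    let ?j = "\<lambda>f. map (\<lambda>s. (fst (f (u (Suc s))), snd (f (Suc s)))) [0..<?n]"
    show ij: "?i (?j f) = f" if "f \<in> ?I \<rightarrow>\<^sub>E UNIV" for f
    proof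
      fix t show "?i (?j f) t = f t"
      proof (cases "t \<in> ?I")
        case t: True
        then have "Suc (inv u t - 1) = inv u t" "inv u t - 1 < ?n" "Suc (t - 1) = t" "t - 1 < ?n" using m(2)[of t] by auto
        then show ?thesis using t permutes_inverses(1)[OF u] by simp
      qed (use that in \<open>auto simp: PiE_def extensional_def\<close>)
    qed
    show "?j (?i v) = v" if "v \<in> {v. length v = ?n}" for v
    proof (rule nth_equalityI)
      fix s assume "s < length (?j (?i v))"
      then have s: "s < ?n" by simp
      then have "u (Suc s) \<in> ?I" "Suc s \<in> ?I" using m(1)[of "Suc s"] by auto
      then show "?j (?i v) ! s = v ! s" using s permutes_inverses(2)[OF u] by simp
    qed (use that in simp)
    show "(\<Prod>t\<in>?I. F t (fst (?j f ! (inv u t - 1)), snd (?j f ! (t - 1)))) = (\<Prod>t\<in>?I. F t (f t))"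
      if "f \<in> ?I \<rightarrow>\<^sub>E UNIV" for f
    proof (rule prod.cong[OF refl])
      fix t assume t: "t \<in> ?I"
      show "F t (fst (?j f ! (inv u t - 1)), snd (?j f ! (t - 1))) = F t (f t)"
        using fun_cong[OF ij[OF that], of t] t by (simp only: restrict_apply')
    qed
  qed auto
  also have "\<dots> = (\<Sum>v | length v = ?n. Cst (\<Prod>s<?n. dual_coeff g (w ! s) (v ! s)) *
      (\<Prod>t\<in>?I. rvar (as ! (t - 1)) (fst (v ! (inv u t - 1))) (snd (v ! (t - 1)))))"
  proof (rule sum.cong[OF refl])
    fix v :: "('N \<times> 'N) list" assume "v \<in> {v. length v = ?n}"
    have "(\<Prod>s<?n. dual_coeff g (w ! s) (v ! s)) = (\<Prod>t\<in>?I. dual_coeff g (w ! (t - 1)) (v ! (t - 1)))"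
      by (rule prod.reindex_bij_witness[of _ "\<lambda>t. t - 1" Suc]) auto
    also have "\<dots> = (\<Prod>t\<in>?I. ?h $ (fst (w ! (t - 1))) $ (fst (v ! (t - 1)))) * (\<Prod>t\<in>?I. g $ (snd (v ! (t - 1))) $ (snd (w ! (t - 1))))"
      unfolding prod.distrib[symmetric] by (rule prod.cong[OF refl]) (metis dual_coeff_eq prod.collapse)
    also have "(\<Prod>t\<in>?I. ?h $ (fst (w ! (t - 1))) $ (fst (v ! (t - 1)))) = (\<Prod>t\<in>?I. ?h $ (fst (w ! (inv u t - 1))) $ (fst (v ! (inv u t - 1))))"
      by (rule prod.reindex_bij_betw[OF bij, symmetric])
    finally have e: "(\<Prod>s<?n. dual_coeff g (w ! s) (v ! s)) =
       (\<Prod>t\<in>?I. ?h $ (fst (w ! (inv u t - 1))) $ (fst (v ! (inv u t - 1))) * g $ (snd (v ! (t - 1))) $ (snd (w ! (t - 1))))"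
      by (simp add: prod.distrib)
    have C: "Cst (prod f S) = (\<Prod>x\<in>S. Cst (f x) :: ('a, 'N) rmonom \<Rightarrow>\<^sub>0 'k)" for f and S :: "nat set"
      by (induction S rule: infinite_finite_induct) (auto simp: Cst_simps)
    show "(\<Prod>t\<in>?I. F t (fst (v ! (inv u t - 1)), snd (v ! (t - 1)))) = Cst (\<Prod>s<?n. dual_coeff g (w ! s) (v ! s)) *
      (\<Prod>t\<in>?I. rvar (as ! (t - 1)) (fst (v ! (inv u t - 1))) (snd (v ! (t - 1))))"
      unfolding e C prod.distrib[symmetric] F_def by simp
  qed
  finally show ?thesis using True
    by (simp add: pair_sym_def act_mult act_prod_mset act_trace[OF g] sum_distrib_right mult.assoc)
qed (simp add: pair_sym_def)

lemma lin_ext_comp: "lin_ext h (lin_ext g f) = lin_ext (\<lambda>x. lin_ext h (g x) :: _ \<Rightarrow>\<^sub>0 'k::field) f"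
  by (simp add: lin_ext_def[of g] lin_ext_def[of "\<lambda>x. lin_ext h (g x)"] act_sum lin_ext_scale)

lemma rep_act_pairing:
  fixes g :: "'k::field ^ 'N ^ 'N::finite"
  assumes g: "invertible g" and \<alpha>: "\<alpha> \<in> vspace (OA smul)"
  shows "rep_act smul g (pairing smul \<alpha> X) = pairing smul \<alpha> (tensor_act g X)"
proof -
  obtain f where f: "\<alpha> = cls (OA smul) f" "Poly_Mapping.keys f \<subseteq> gens (OA smul)"
    using \<alpha> by (auto simp: vspace_def)
  have "lin_ext (\<lambda>x. lin_ext (\<lambda>w. lin_ext (rmonom_act g) (pair_sym x w)) X) f
    = lin_ext (\<lambda>x. lin_ext (\<lambda>w. lin_ext (pair_sym x) (\<Sum>v | length v = length w.
         Poly_Mapping.single v (\<Prod>s<length w. dual_coeff g (w ! s) (v ! s)))) X) f"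
    unfolding lin_ext_def[of _ f]
  proof (rule sum.cong[OF refl])
    fix x assume "x \<in> Poly_Mapping.keys f"
    then obtain as fs u where x: "x = (as, fs, u)" and u: "u permutes {1..length as}"
      using f(2) by (auto simp: OA_def osyms_def)
    show "pm_scale (Poly_Mapping.lookup f x) (lin_ext (\<lambda>w. lin_ext (rmonom_act g) (pair_sym x w)) X) =
       pm_scale (Poly_Mapping.lookup f x) (lin_ext (\<lambda>w. lin_ext (pair_sym x) (\<Sum>v | length v = length w.
         Poly_Mapping.single v (\<Prod>s<length w. dual_coeff g (w ! s) (v ! s)))) X)"
      unfolding x act_pair_sym[OF g u] act_sum lin_ext_single pm_scale_mult ..
  qed
  then show ?thesis
    unfolding f pairing_cls rep_act_cls[OF g] tensor_act_def lin_ext_comp by simp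
qed

end

theory Submission
  imports Defs
begin

text \<open>
  Write \<open>(\<alpha>|w)\<close> for the pairing of \<open>\<alpha> \<in> \<O>(A)\<close> with a word \<open>w\<close>, a basis element of the tensor algebra. The
  operations of \<open>\<O>(A)\<close> act on pairings through simple operations on words: \<open>\<pi>\<close> puts a letter \<open>(k, k)\<close>
  in front of the word and sums over \<open>k\<close>, adjoining the unit strips a first letter \<open>(p, q)\<close> at the cost
  of the factor \<open>\<delta>\<^sub>p\<^sub>q\<close>, and multiplication by a permutation on the left or on the right permutes the
  second or the first indices of the word (\<open>pval_op_pi\<close>, \<open>pval_op_one\<close>, \<open>pval_left_act\<close>,
  \<open>pval_right_act\<close>). Congruence modulo the ideal \<open>R\<^sub>N\<close> is equality of all pairings with words
  (\<open>cong_R_iff\<close>).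

  An induced map \<open>\<phi>\<close> sends the pairings \<open>(\<alpha>\<^sub>i|w\<^sub>i)\<close> to \<open>(\<Phi>(\<alpha>\<^sub>1, \<dots>, \<alpha>\<^sub>n)|w\<^sub>1 \<cdots> w\<^sub>n)\<close>. If one \<open>\<alpha>\<^sub>i\<close> is changed by
  one of the four operations, then \<open>w\<^sub>i\<close> may be changed instead, and reading the change inside the long
  word \<open>w\<^sub>1 \<cdots> w\<^sub>n\<close> gives the four congruences; the block permutations only carry the affected letter to
  the front of the long word and back (\<open>induces_imp_compatible\<close>).

  Conversely, the same four rules suffice to derive all relations between pairings. The pairings of
  pure tensors with the identity permutation are the monomials in the variables \<open>a\<^sub>i\<^sub>j\<close>. Simultaneous
  left and right multiplication makes the order of the variables irrelevant, \<open>\<pi>\<close> applied to a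
  transposition gives \<open>(ab)\<^sub>i\<^sub>j = \<Sum>\<^sub>k a\<^sub>i\<^sub>k b\<^sub>k\<^sub>j\<close>, and the unit gives \<open>1\<^sub>i\<^sub>j = \<delta>\<^sub>i\<^sub>j\<close>. A function of a symbol and a word
  that obeys the rules therefore descends to \<open>\<O>(Rep\<^sub>N(A))\<close> (the locale \<open>slot_functional\<close>), and doing this
  in each of the \<open>n\<close> arguments constructs \<open>\<phi>\<close> (\<open>compatible_imp_induces\<close>). It is unique because pairings span,
  and equivariant because \<open>GL\<^sub>N\<close> acts on pairings through the words alone.

  For the last claim let \<open>\<phi>\<close> be equivariant. Fixing symbols \<open>x\<^sub>1, \<dots>, x\<^sub>n\<close> turns \<open>\<phi>\<close> into an equivariant
  map \<open>\<psi>\<close> from words of length \<open>D\<close> to \<open>\<O>(Rep\<^sub>N(A))\<close>, and \<open>\<psi>\<close> has to be a pairing with some \<open>\<beta> \<in> \<O>(A)\<close> of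
  degree \<open>D\<close> (\<open>equivariant_word_map_is_pairing\<close>). After padding with \<open>1\<^sub>k\<^sub>k\<close>, all monomials that occur have
  the same length \<open>M\<close>, so \<open>\<psi>\<close> is given by tensors of order \<open>M + D\<close>. Averaging makes these
  tensors invariant without changing \<open>\<psi>\<close> (\<open>reynolds_operator\<close>); invariant tensors are combinations of
  permutations (\<open>invariant_tensors_spanned_by_permutations\<close>); and the contribution of a permutation is
  the pairing with \<open>\<pi>\<^sup>M\<close> of a single symbol (\<open>contract_permutation_tensor\<close>). Choosing such \<open>\<beta>\<close> for each
  list of symbols, and extending it multilinearly along normal forms that respect the degree, defines
  \<open>\<Phi>\<close> (\<open>equivariant_imp_induced\<close>).

  The two facts of invariant theory are proved by orthogonal projection over the rational numbers, where
  sums of squares vanish only trivially; the rational points of \<open>GL\<^sub>N\<close> are enough to detect invariance.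
\<close>

type_synonym ('a, 'N, 'k) rep_map =
  "((('a, 'N) rmonom \<Rightarrow>\<^sub>0 'k) set list \<Rightarrow>\<^sub>0 'k) set \<Rightarrow> (('a, 'N) rmonom \<Rightarrow>\<^sub>0 'k) set"

section \<open>Orthogonal projection and finite spanning families\<close>

text \<open>Some combination of the vectors \<open>r x\<close> differs from \<open>b\<close> by a vector orthogonal to all of them. Over an ordered
field Gram-Schmidt produces it: if the part \<open>ea\<close> of a new vector that is orthogonal to the old ones has
square length \<open>0\<close>, then it vanishes on \<open>T\<close> and nothing has to be corrected.\<close>

lemma normal_equations:
  fixes r :: "'x \<Rightarrow> 't \<Rightarrow> 'f::linordered_field"
  assumes "finite X" "finite T"
  shows "\<exists>Z. \<forall>y\<in>X. (\<Sum>t\<in>T. (b t - (\<Sum>x\<in>X. Z x * r x t)) * r y t) = 0"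
  using assms(1)
proof (induction X arbitrary: b)
  case empty
  show ?case by simp
next
  case (insert a X)
  obtain Zb where Zb: "\<And>y. y \<in> X \<Longrightarrow> (\<Sum>t\<in>T. (b t - (\<Sum>x\<in>X. Zb x * r x t)) * r y t) = 0"
    using insert.IH[of b] by blast
  obtain Za where Za: "\<And>y. y \<in> X \<Longrightarrow> (\<Sum>t\<in>T. (r a t - (\<Sum>x\<in>X. Za x * r x t)) * r y t) = 0"
    using insert.IH[of "r a"] by blast
  define eb where "eb t = b t - (\<Sum>x\<in>X. Zb x * r x t)" for t
  define ea where "ea t = r a t - (\<Sum>x\<in>X. Za x * r x t)" for t
  \<comment> \<open>The division by zero in the degenerate case gives \<open>l = 0\<close>, which is the right value there.\<close>
  define l where "l = (\<Sum>t\<in>T. eb t * ea t) / (\<Sum>t\<in>T. ea t * ea t)"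
  define Z where "Z x = (if x = a then l else Zb x - l * Za x)" for x
  have sumZ: "(\<Sum>x\<in>insert a X. Z x * r x t) = b t - (eb t - l * ea t)" for t
  proof -
    have "(\<Sum>x\<in>insert a X. Z x * r x t) = l * r a t + (\<Sum>x\<in>X. (Zb x - l * Za x) * r x t)"
      using insert.hyps by (simp add: Z_def) (auto intro!: sum.cong)
    then show ?thesis
      by (simp add: eb_def ea_def algebra_simps sum_subtractf sum_distrib_left)
  qed
  have orthX: "(\<Sum>t\<in>T. (eb t - l * ea t) * r y t) = 0" if "y \<in> X" for y
  proof -
    have "(\<Sum>t\<in>T. (eb t - l * ea t) * r y t) = (\<Sum>t\<in>T. eb t * r y t) - l * (\<Sum>t\<in>T. ea t * r y t)"
      by (simp add: algebra_simps sum_subtractf sum_distrib_left)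
    then show ?thesis using Zb[OF that] Za[OF that] by (simp add: eb_def ea_def)
  qed
  have "(\<Sum>t\<in>T. (eb t - l * ea t) * ea t) = 0"
  proof (cases "(\<Sum>t\<in>T. ea t * ea t) = 0")
    case True
    then have "ea t = 0" if "t \<in> T" for t
      using that assms(2) by (simp add: sum_nonneg_eq_0_iff)
    then show ?thesis by simp
  next
    case False
    have "(\<Sum>t\<in>T. (eb t - l * ea t) * ea t) = (\<Sum>t\<in>T. eb t * ea t) - l * (\<Sum>t\<in>T. ea t * ea t)"
      by (simp add: algebra_simps sum_subtractf sum_distrib_left)
    then show ?thesis using False by (simp add: l_def)
  qed
  moreover have "(\<Sum>t\<in>T. (eb t - l * ea t) * r a t)
      = (\<Sum>t\<in>T. (eb t - l * ea t) * ea t) + (\<Sum>x\<in>X. Za x * (\<Sum>t\<in>T. (eb t - l * ea t) * r x t))"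
  proof -
    have "(\<Sum>x\<in>X. Za x * (\<Sum>t\<in>T. (eb t - l * ea t) * r x t))
        = (\<Sum>t\<in>T. (eb t - l * ea t) * (\<Sum>x\<in>X. Za x * r x t))"
      by (simp add: sum_distrib_left mult_ac) (rule sum.swap)
    then show ?thesis
      by (simp add: ea_def algebra_simps sum.distrib[symmetric])
  qed
  ultimately have "(\<Sum>t\<in>T. (eb t - l * ea t) * r a t) = 0" using orthX by simp
  then show ?case using orthX by (intro exI[of _ Z]) (auto simp: sumZ)
qed

text \<open>The functions \<open>f g\<close> restricted to \<open>T\<close> live in a space of dimension \<open>card T\<close>, so finitely many of them
span all of them.\<close>

lemma finite_spanning_family:
  fixes f :: "'g \<Rightarrow> 't \<Rightarrow> 'f::field"
  assumes "finite T"
  shows "\<exists>F. finite F \<and> F \<subseteq> G \<and> (\<forall>g\<in>G. \<exists>c. \<forall>t\<in>T. f g t = (\<Sum>x\<in>F. c x * f x t))"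
proof -
  define \<phi> where "\<phi> g = (\<Sum>t\<in>T. Poly_Mapping.single t (f g t))" for g
  have look: "Poly_Mapping.lookup (\<phi> g) t = (if t \<in> T then f g t else 0)" for g t
    using assms by (simp add: \<phi>_def lookup_sum lookup_single when_def)
  have in_span: "\<phi> g \<in> pm.span ((\<lambda>t. Poly_Mapping.single t 1) ` T)" for g
    unfolding \<phi>_def
  proof (rule pm.span_sum)
    fix t assume "t \<in> T"
    then have "pm_scale (f g t) (Poly_Mapping.single t 1) \<in> pm.span ((\<lambda>t. Poly_Mapping.single t 1) ` T)"
      by (intro pm.span_scale pm.span_base) auto
    then show "Poly_Mapping.single t (f g t) \<in> pm.span ((\<lambda>t. Poly_Mapping.single t 1) ` T)" by simp
  qed
  obtain B where B: "B \<subseteq> \<phi> ` G" "pm.independent B" "\<phi> ` G \<subseteq> pm.span B"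
    using pm.maximal_independent_subset[of "\<phi> ` G"] by blast
  have "B \<subseteq> pm.span ((\<lambda>t. Poly_Mapping.single t 1) ` T)"
    using B(1) in_span by blast
  then have finB: "finite B"
    using pm.independent_span_bound[OF finite_imageI[OF assms] B(2)] by blast
  obtain F where F: "F \<subseteq> G" "inj_on \<phi> F" "B = \<phi> ` F"
    using B(1) unfolding subset_image_inj by blast
  have "finite F" using finB unfolding F(3) by (rule finite_imageD) (rule F(2))
  moreover have "\<exists>c. \<forall>t\<in>T. f g t = (\<Sum>x\<in>F. c x * f x t)" if "g \<in> G" for g
  proof -
    have "\<phi> g \<in> pm.span B" using B that by blast
    then obtain u where u: "\<phi> g = (\<Sum>v\<in>B. pm_scale (u v) v)"
      unfolding pm.span_finite[OF finB] by blast
    have e: "\<phi> g = (\<Sum>x\<in>F. pm_scale (u (\<phi> x)) (\<phi> x))"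
      unfolding u F(3) by (subst sum.reindex[OF F(2)]) simp
    have "f g t = (\<Sum>x\<in>F. u (\<phi> x) * f x t)" if "t \<in> T" for t
      using arg_cong[OF e, of "\<lambda>p. Poly_Mapping.lookup p t"] that by (simp add: lookup_sum look)
    then show ?thesis by (intro exI[of _ "\<lambda>x. u (\<phi> x)"] ballI)
  qed
  ultimately show ?thesis using F(1) by (intro exI[of _ F] conjI ballI)
qed

section \<open>A Reynolds operator for the general linear group\<close>

lemma words_Suc: "{v. length v = Suc M} = (\<lambda>(x, v). x # v) ` (UNIV \<times> {v. length v = M})"
  by (auto simp: length_Suc_conv)

lemma finite_words [simp]: "finite {v :: 'b::finite list. length v = M}"
  using finite_lists_length_eq[of "UNIV :: 'b set" M] by simp

lemma sum_words_Suc: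
  "(\<Sum>v | length v = Suc M. F v) = (\<Sum>x\<in>(UNIV :: 'b::finite set). \<Sum>v | length v = M. F (x # v))"
  unfolding words_Suc by (subst sum.reindex) (auto simp: inj_on_def sum.cartesian_product split_beta)

lemma sum_words_prod:
  fixes f :: "nat \<Rightarrow> 'b::finite \<Rightarrow> 'c::comm_semiring_1"
  shows "(\<Sum>v | length v = M. \<Prod>s<M. f s (v ! s)) = (\<Prod>s<M. \<Sum>x\<in>UNIV. f s x)"
proof (induction M arbitrary: f)
  case (Suc M)
  show ?case
    unfolding sum_words_Suc prod.lessThan_Suc_shift
    by (simp add: Suc[of "\<lambda>s. f (Suc s)"] sum_distrib_left[symmetric] sum_distrib_right)
qed simp

lemma sum_words_append:
  "(\<Sum>v | length v = M + L. F v)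
    = (\<Sum>v1 | length v1 = M. \<Sum>v2 | length (v2 :: 'b::finite list) = L. F (v1 @ v2))"
  by (induction M arbitrary: F) (simp_all add: sum_words_Suc)

lemma matrix_inv_unique:
  fixes g h :: "'k::field ^ 'N ^ 'N::finite"
  assumes "g ** h = mat 1"
  shows "matrix_inv g = h"
proof -
  have hg: "h ** g = mat 1" using assms matrix_left_right_inverse by blast
  have 1: "g ** matrix_inv g = mat 1 \<and> matrix_inv g ** g = mat 1"
    unfolding matrix_inv_def by (rule someI[of _ h]) (use assms hg in auto)
  have "h ** (g ** matrix_inv g) = h ** g ** matrix_inv g" by (rule matrix_mul_assoc)
  then show ?thesis using 1 hg by simp
qed

lemma matrix_inv_invertible:
  fixes g :: "'k::field ^ 'N ^ 'N::finite"
  assumes "invertible g"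
  shows "g ** matrix_inv g = mat 1" "matrix_inv g ** g = mat 1" "invertible (matrix_inv g)"
    "matrix_inv (matrix_inv g) = g"
proof -
  show 1: "g ** matrix_inv g = mat 1" "matrix_inv g ** g = mat 1"
    using someI_ex[OF assms[unfolded invertible_def]] by (auto simp: matrix_inv_def)
  then show "invertible (matrix_inv g)" by (auto simp: invertible_def)
  show "matrix_inv (matrix_inv g) = g" by (rule matrix_inv_unique) (rule 1)
qed

text \<open>The coefficient of the word \<open>v\<close> in \<open>g.w\<close>.\<close>

definition wcoeff :: "'k::field ^ 'N ^ 'N::finite \<Rightarrow> ('N \<times> 'N) list \<Rightarrow> ('N \<times> 'N) list \<Rightarrow> 'k" where
  "wcoeff g w v = (\<Prod>s<length w. dual_coeff g (w ! s) (v ! s))"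

text \<open>The factors change places because the image of a basis vector is a row of the matrix \<open>dual_coeff g\<close>.\<close>

lemma dual_coeff_mult:
  fixes g h :: "'k::field ^ 'N ^ 'N::finite"
  assumes g: "invertible g" and h: "invertible h"
  shows "(\<Sum>y\<in>UNIV. dual_coeff g x y * dual_coeff h y z) = dual_coeff (h ** g) x z"
proof -
  have inv: "matrix_inv (h ** g) = matrix_inv g ** matrix_inv h"
  proof (rule matrix_inv_unique)
    have "h ** g ** (matrix_inv g ** matrix_inv h) = h ** (g ** matrix_inv g) ** matrix_inv h"
      by (simp only: matrix_mul_assoc)
    then show "h ** g ** (matrix_inv g ** matrix_inv h) = mat 1"
      by (simp add: matrix_inv_invertible g h)
  qed
  obtain i j r s where x: "x = (i, j)" and z: "z = (r, s)" by (cases x, cases z)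
  have "(\<Sum>y\<in>UNIV. dual_coeff g x y * dual_coeff h y z)
      = (\<Sum>p\<in>UNIV. \<Sum>q\<in>UNIV. dual_coeff g x (p, q) * dual_coeff h (p, q) z)"
    by (simp add: UNIV_Times_UNIV[symmetric] sum.cartesian_product split_beta del: UNIV_Times_UNIV)
  also have "\<dots> = (\<Sum>p\<in>UNIV. matrix_inv g $ i $ p * matrix_inv h $ p $ r) * (\<Sum>q\<in>UNIV. h $ s $ q * g $ q $ j)"
    by (simp add: x z dual_coeff_eq sum_product mult_ac) (rule sum.swap)
  finally show ?thesis
    by (simp only: x z dual_coeff_eq inv) (simp add: matrix_matrix_mult_def)
qed

lemma wcoeff_mult:
  fixes g h :: "'k::field ^ 'N ^ 'N::finite"
  assumes "invertible g" "invertible h" "length w = M"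
  shows "(\<Sum>u | length u = M. wcoeff g w u * wcoeff h u v) = wcoeff (h ** g) w v"
proof -
  have "(\<Sum>u | length u = M. wcoeff g w u * wcoeff h u v)
      = (\<Sum>u | length u = M. \<Prod>s<M. dual_coeff g (w ! s) (u ! s) * dual_coeff h (u ! s) (v ! s))"
    by (rule sum.cong) (auto simp: wcoeff_def assms prod.distrib)
  also have "\<dots> = wcoeff (h ** g) w v"
    by (subst sum_words_prod) (simp add: dual_coeff_mult assms wcoeff_def)
  finally show ?thesis .
qed

lemma wcoeff_one:
  assumes "length w = length v"
  shows "wcoeff (mat 1 :: 'k::field ^ 'N ^ 'N::finite) w v = (if w = v then 1 else 0)"
proof -
  have inv1: "matrix_inv (mat 1 :: 'k ^ 'N ^ 'N) = mat 1" by (rule matrix_inv_unique) simp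
  have "dual_coeff (mat 1 :: 'k ^ 'N ^ 'N) x y = (if x = y then 1 else 0)" for x y
    by (cases x, cases y) (simp only: dual_coeff_eq inv1, auto simp: mat_def)
  then show ?thesis using assms
    by (auto simp: wcoeff_def list_eq_iff_nth_eq intro!: prod_zero)
qed

lemma wcoeff_Cons: "wcoeff g (a # w) (b # v) = dual_coeff g a b * wcoeff g w v"
  unfolding wcoeff_def length_Cons prod.lessThan_Suc_shift by simp

lemma wcoeff_append: "length w1 = length v1 \<Longrightarrow> wcoeff g (w1 @ w2) (v1 @ v2) = wcoeff g w1 v1 * wcoeff g w2 v2"
  by (induction w1 v1 rule: list_induct2) (simp_all add: wcoeff_Cons, simp add: wcoeff_def)

text \<open>Transposes of the matrices by which the group acts on words come from the group again. In
\<open>reynolds_operator\<close> this plays the part of unitarity.\<close>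

lemma wcoeff_transpose:
  assumes "invertible g" "length w = length v"
  shows "wcoeff (transpose g) w v = wcoeff (g :: 'k::field ^ 'N ^ 'N::finite) v w"
proof -
  have "matrix_inv (transpose g) = transpose (matrix_inv g)"
    by (rule matrix_inv_unique)
      (simp add: matrix_transpose_mul[symmetric] matrix_inv_invertible[OF assms(1)])
  then have "dual_coeff (transpose g) x y = dual_coeff g y x" for x y
    by (cases x, cases y) (auto simp: dual_coeff_eq transpose_def)
  then show ?thesis using assms by (simp add: wcoeff_def)
qed

text \<open>A finite rational combination, with coefficient sum \<open>1\<close>, of the matrices \<open>R\<^sub>g = wcoeff g\<close> whose value \<open>e\<close>
satisfies \<open>R\<^sub>h e = e\<close> for all \<open>h\<close>. Let \<open>J\<close> be the span of all \<open>R\<^sub>g - 1\<close> and let \<open>e\<close> be the component of \<open>1\<close>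
orthogonal to \<open>J\<close>. Since \<open>e\<close> is a combination of matrices \<open>R\<^sub>g\<close> with coefficient sum \<open>1\<close>, both \<open>x = R\<^sub>h e - e\<close>
and \<open>R\<^sub>h\<^sup>T x - x\<close> lie in \<open>J\<close>. Hence the square length of \<open>x\<close>, which is the product of \<open>e\<close> with
\<open>R\<^sub>h\<^sup>T x - x\<close>, is zero.\<close>

lemma reynolds_operator:
  "\<exists>F c. finite F \<and> (\<forall>g\<in>F. invertible (g :: rat ^ 'N ^ 'N::finite)) \<and> (\<Sum>g\<in>F. c g) = (1::rat) \<and>
     (\<forall>h w v. invertible h \<longrightarrow> length w = M \<longrightarrow> length v = M \<longrightarrow>
        (\<Sum>u | length u = M. wcoeff h w u * (\<Sum>g\<in>F. c g * wcoeff g u v)) = (\<Sum>g\<in>F. c g * wcoeff g w v))"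
proof -
  define W where "W = {w :: ('N \<times> 'N) list. length w = M}"
  define T where "T = W \<times> W"
  define G where "G = {g :: rat ^ 'N ^ 'N. invertible g}"
  define f where "f g = (\<lambda>(w, v). wcoeff g w v - wcoeff (mat 1 :: rat ^ 'N ^ 'N) w v)" for g
  have fin: "finite W" "finite T" by (auto simp: W_def T_def)
  have inv1: "invertible (mat 1 :: rat ^ 'N ^ 'N)" by (auto simp: invertible_def)
  obtain F0 where F0: "finite F0" "F0 \<subseteq> G"
    and span: "\<And>g. g \<in> G \<Longrightarrow> \<exists>c. \<forall>t\<in>T. f g t = (\<Sum>x\<in>F0. c x * f x t)"
    using finite_spanning_family[OF fin(2), of G f] by blast
  obtain Z where Z: "\<And>y. y \<in> F0 \<Longrightarrow>
      (\<Sum>t\<in>T. ((case t of (w, v) \<Rightarrow> wcoeff (mat 1 :: rat ^ 'N ^ 'N) w v) - (\<Sum>x\<in>F0. Z x * f x t)) * f y t) = 0"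
    using normal_equations[OF F0(1) fin(2), of "\<lambda>(w, v). wcoeff (mat 1 :: rat ^ 'N ^ 'N) w v" f] by blast
  define e where "e w v = wcoeff (mat 1 :: rat ^ 'N ^ 'N) w v - (\<Sum>x\<in>F0. Z x * f x (w, v))" for w v
  define F where "F = insert (mat 1) F0"
  \<comment> \<open>The coefficients of \<open>R\<^sub>1 - \<Sum>\<^sub>x Z\<^sub>x (R\<^sub>x - R\<^sub>1)\<close>; the unit may or may not belong to \<open>F0\<close>.\<close>
  define c where "c g = (if g \<in> F0 then - Z g else 0) + (if g = mat 1 then 1 + (\<Sum>x\<in>F0. Z x) else 0)" for g
  have finF: "finite F" using F0 by (simp add: F_def)
  have FG: "g \<in> F \<Longrightarrow> invertible g" for g using F0 inv1 by (auto simp: F_def G_def)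
  have sum_c: "(\<Sum>g\<in>F. c g * k g) = (1 + (\<Sum>x\<in>F0. Z x)) * k (mat 1) - (\<Sum>x\<in>F0. Z x * k x)" for k
  proof -
    have "(\<Sum>g\<in>F. (if g \<in> F0 then - Z g else 0) * k g) = (\<Sum>g\<in>F0. - Z g * k g)"
      by (rule sum.mono_neutral_cong_right) (use finF in \<open>auto simp: F_def\<close>)
    moreover have "(\<Sum>g\<in>F. (if g = mat 1 then 1 + (\<Sum>x\<in>F0. Z x) else 0) * k g)
        = (\<Sum>g\<in>F. if g = mat 1 then (1 + (\<Sum>x\<in>F0. Z x)) * k g else 0)"
      by (rule sum.cong) auto
    then have "(\<Sum>g\<in>F. (if g = mat 1 then 1 + (\<Sum>x\<in>F0. Z x) else 0) * k g) = (1 + (\<Sum>x\<in>F0. Z x)) * k (mat 1)"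
      using finF by (simp add: F_def)
    ultimately show ?thesis
      by (simp add: c_def distrib_right sum.distrib sum_negf)
  qed
  have e_eq: "e w v = (\<Sum>g\<in>F. c g * wcoeff g w v)" for w v
    unfolding sum_c by (simp add: e_def f_def right_diff_distrib sum_subtractf sum_distrib_right algebra_simps)
  have c1: "(\<Sum>g\<in>F. c g) = 1" using sum_c[of "\<lambda>_. 1"] by simp
  define ip where "ip k = (\<Sum>(w,v)\<in>T. e w v * k w v)" for k
  have ip_f: "ip (\<lambda>w v. f g (w, v)) = 0" if gG: "g \<in> G" for g
  proof -
    obtain d where d: "\<And>t. t \<in> T \<Longrightarrow> f g t = (\<Sum>x\<in>F0. d x * f x t)" using span[OF gG] by blast
    have "ip (\<lambda>w v. f g (w, v)) = (\<Sum>t\<in>T. e (fst t) (snd t) * (\<Sum>x\<in>F0. d x * f x t))"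
      unfolding ip_def by (rule sum.cong) (auto simp: d split_beta)
    also have "\<dots> = (\<Sum>x\<in>F0. d x * (\<Sum>t\<in>T. e (fst t) (snd t) * f x t))"
      by (simp add: sum_distrib_left mult_ac) (rule sum.swap)
    also have "\<dots> = 0"
    proof (rule sum.neutral, rule ballI)
      fix x assume "x \<in> F0"
      from Z[OF this] show "d x * (\<Sum>t\<in>T. e (fst t) (snd t) * f x t) = 0"
        by (simp add: e_def split_beta)
    qed
    finally show ?thesis .
  qed
  \<comment> \<open>By orthogonality the scalar product of \<open>e\<close> with \<open>R\<^sub>g\<close> does not depend on \<open>g\<close>.\<close>
  have ip_diff: "ip (\<lambda>w v. wcoeff g w v) = ip (\<lambda>w v. wcoeff (mat 1 :: rat ^ 'N ^ 'N) w v)" if "invertible g" for g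
    using ip_f[of g] that by (simp add: ip_def f_def G_def right_diff_distrib sum_subtractf split_beta)
  have key: "(\<Sum>u\<in>W. wcoeff h w u * e u v) = e w v" if h: "invertible h" and "w \<in> W" "v \<in> W" for h w v
  proof -
    define xe where "xe a b = (\<Sum>u\<in>W. wcoeff h a u * e u b) - e a b" for a b
    have th: "invertible (transpose h)" using h
      by (metis matrix_inv_invertible(1) invertible_def matrix_left_right_inverse matrix_transpose_mul transpose_mat)
    have xe_eq: "xe a b = (\<Sum>g\<in>F. c g * (wcoeff (g ** h) a b - wcoeff g a b))" if "a \<in> W" for a b
    proof -
      have "(\<Sum>u\<in>W. wcoeff h a u * e u b) = (\<Sum>g\<in>F. c g * (\<Sum>u\<in>W. wcoeff h a u * wcoeff g u b))"
        unfolding e_eq by (simp add: sum_distrib_left mult_ac) (rule sum.swap)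
      also have "\<dots> = (\<Sum>g\<in>F. c g * wcoeff (g ** h) a b)"
        by (intro sum.cong refl) (use wcoeff_mult[OF h FG] that in \<open>simp add: W_def\<close>)
      finally show ?thesis by (simp add: xe_def e_eq right_diff_distrib sum_subtractf)
    qed
    \<comment> \<open>\<open>R\<^sub>h\<^sup>T x - x\<close> written out as a combination of differences of matrices \<open>R\<^sub>g\<close>.\<close>
    have txe: "(\<Sum>a\<in>W. wcoeff h a u * xe a b) - xe u b
       = (\<Sum>g\<in>F. c g * ((wcoeff (g ** h ** transpose h) u b - wcoeff (g ** transpose h) u b) - (wcoeff (g ** h) u b - wcoeff g u b)))"
      if u: "u \<in> W" for u b
    proof -
      have "(\<Sum>a\<in>W. wcoeff h a u * xe a b) = (\<Sum>a\<in>W. wcoeff (transpose h) u a * xe a b)"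
        by (rule sum.cong) (use u wcoeff_transpose[OF h] in \<open>auto simp: W_def\<close>)
      also have "\<dots> = (\<Sum>g\<in>F. c g * ((\<Sum>a\<in>W. wcoeff (transpose h) u a * wcoeff (g ** h) a b) - (\<Sum>a\<in>W. wcoeff (transpose h) u a * wcoeff g a b)))"
        by (simp add: xe_eq sum_distrib_left right_diff_distrib sum_subtractf mult_ac) (simp add: sum.swap[of _ F W])
      also have "\<dots> = (\<Sum>g\<in>F. c g * (wcoeff (g ** h ** transpose h) u b - wcoeff (g ** transpose h) u b))"
        by (intro sum.cong refl) (use wcoeff_mult[OF th] wcoeff_mult[OF th FG] FG h u in \<open>simp add: W_def invertible_mult\<close>)
      finally show ?thesis by (simp add: xe_eq[OF u] right_diff_distrib sum_subtractf)
    qed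
    have "(\<Sum>(a,b)\<in>T. xe a b * xe a b) = (\<Sum>a\<in>W. \<Sum>b\<in>W. \<Sum>u\<in>W. wcoeff h a u * e u b * xe a b) - (\<Sum>a\<in>W. \<Sum>b\<in>W. e a b * xe a b)"
    proof -
      have "(\<Sum>(a,b)\<in>T. xe a b * xe a b) = (\<Sum>a\<in>W. \<Sum>b\<in>W. ((\<Sum>u\<in>W. wcoeff h a u * e u b) - e a b) * xe a b)"
        by (simp add: T_def sum.cartesian_product xe_def)
      then show ?thesis by (simp add: left_diff_distrib sum_subtractf sum_distrib_right)
    qed
    also have "(\<Sum>a\<in>W. \<Sum>b\<in>W. \<Sum>u\<in>W. wcoeff h a u * e u b * xe a b) = (\<Sum>u\<in>W. \<Sum>b\<in>W. \<Sum>a\<in>W. wcoeff h a u * e u b * xe a b)"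
      by (subst sum.swap, subst (2) sum.swap, subst sum.swap) (rule refl)
    also have "\<dots> - (\<Sum>a\<in>W. \<Sum>b\<in>W. e a b * xe a b) = (\<Sum>u\<in>W. \<Sum>b\<in>W. e u b * ((\<Sum>a\<in>W. wcoeff h a u * xe a b) - xe u b))"
      by (simp add: sum_subtractf[symmetric] right_diff_distrib sum_distrib_left mult_ac)
    also have "\<dots> = ip (\<lambda>u b. (\<Sum>g\<in>F. c g * ((wcoeff (g ** h ** transpose h) u b - wcoeff (g ** transpose h) u b) - (wcoeff (g ** h) u b - wcoeff g u b))))"
      by (simp add: ip_def T_def sum.cartesian_product[symmetric] txe)
    also have "\<dots> = (\<Sum>g\<in>F. c g * ((ip (wcoeff (g ** h ** transpose h)) - ip (wcoeff (g ** transpose h))) - (ip (wcoeff (g ** h)) - ip (wcoeff g))))"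
      unfolding ip_def sum_subtractf[symmetric] split_beta sum_distrib_left
      by (subst sum.swap) (simp add: algebra_simps)
    also have "\<dots> = 0"
      by (rule sum.neutral) (use ip_diff FG h th in \<open>simp add: invertible_mult\<close>)
    finally have "(\<Sum>(a,b)\<in>T. xe a b * xe a b) = 0" .
    then have "xe w v = 0" using that fin(2)
      by (subst (asm) sum_nonneg_eq_0_iff) (auto simp: T_def)
    then show ?thesis by (simp add: xe_def)
  qed
  show ?thesis
    by (rule exI[of _ F], rule exI[of _ c]) (use finF FG c1 key in \<open>auto simp: e_eq W_def\<close>)
qed

section \<open>Invariant tensors are combinations of permutations\<close>

text \<open>For \<open>x \<in> A - B\<close> the terms of \<open>S\<close> and \<open>S \<union> {x}\<close> cancel.\<close>

lemma alternating_sum_supersets: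
  assumes "finite A" "B \<subseteq> A" "B \<noteq> A"
  shows "(\<Sum>S | B \<subseteq> S \<and> S \<subseteq> A. (-1) ^ card S) = (0 :: 'c::comm_ring_1)"
proof -
  obtain x where x: "x \<in> A" "x \<notin> B" using assms by auto
  let ?U = "{S. B \<subseteq> S \<and> S \<subseteq> A - {x}}"
  have fin: "finite ?U" using assms by (auto intro: finite_subset[of _ "Pow A"])
  have eq: "{S. B \<subseteq> S \<and> S \<subseteq> A} = ?U \<union> insert x ` ?U"
  proof (intro set_eqI iffI)
    fix S assume S: "S \<in> {S. B \<subseteq> S \<and> S \<subseteq> A}"
    show "S \<in> ?U \<union> insert x ` ?U"
    proof (cases "x \<in> S")
      case True
      then have "S = insert x (S - {x})" by auto
      then show ?thesis using S x by (auto intro!: image_eqI[of _ _ "S - {x}"])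
    qed (use S in auto)
  qed (use x in auto)
  have "(\<Sum>S\<in>insert x ` ?U. (-1) ^ card S) = (\<Sum>S\<in>?U. - ((-1) ^ card S :: 'c))"
  proof (subst sum.reindex)
    show "inj_on (insert x) ?U" by (intro inj_onI) (metis (no_types, lifting) Diff_insert_absorb mem_Collect_eq subset_Diff_insert)
    show "sum ((\<lambda>S. (-1) ^ card S) \<circ> insert x) ?U = (\<Sum>S\<in>?U. - ((-1) ^ card S :: 'c))"
    proof (rule sum.cong[OF refl])
      fix S assume S: "S \<in> ?U"
      then have "finite S" "x \<notin> S" using assms(1) by (auto dest: finite_subset)
      then show "((\<lambda>S. (-1) ^ card S) \<circ> insert x) S = - ((-1) ^ card S :: 'c)" by simp
    qed
  qed
  then show ?thesis unfolding eq using fin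
    by (subst sum.union_disjoint) (auto simp: sum_negf)
qed

text \<open>Ryser's formula for the permanent: expanding the product over all functions \<open>f\<close>, the alternating sum over
\<open>S\<close> keeps only the functions whose image is all of \<open>{..<M}\<close>.\<close>

lemma polarization:
  fixes a :: "nat \<Rightarrow> nat \<Rightarrow> 'c::comm_ring_1"
  shows "(\<Sum>S\<in>Pow {..<M}. (-1) ^ (M + card S) * (\<Prod>t<M. \<Sum>s\<in>S. a t s))
    = (\<Sum>\<sigma> | \<sigma> permutes {..<M}. \<Prod>t<M. a t (\<sigma> t))"
proof -
  let ?A = "{..<M}"
  let ?E = "?A \<rightarrow>\<^sub>E ?A"
  have finE: "finite ?E" by (intro finite_PiE) auto
  have "(\<Prod>t<M. \<Sum>s\<in>S. a t s) = (\<Sum>f\<in>?E. if f ` ?A \<subseteq> S then \<Prod>t<M. a t (f t) else 0)" if "S \<subseteq> ?A" for S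
  proof -
    have "(\<Prod>t<M. \<Sum>s\<in>S. a t s) = (\<Sum>f\<in>?A \<rightarrow>\<^sub>E S. \<Prod>t<M. a t (f t))"
      by (rule prod_sum_PiE) (use that in \<open>auto intro: finite_subset\<close>)
    also have "\<dots> = (\<Sum>f\<in>?E. if f ` ?A \<subseteq> S then \<Prod>t<M. a t (f t) else 0)"
      by (rule sum.mono_neutral_cong_left) (use finE that in \<open>auto simp: PiE_def Pi_def\<close>)
    finally show ?thesis .
  qed
  then have "(\<Sum>S\<in>Pow ?A. (-1) ^ (M + card S) * (\<Prod>t<M. \<Sum>s\<in>S. a t s))
      = (\<Sum>S\<in>Pow ?A. \<Sum>f\<in>?E. (-1) ^ (M + card S) * (if f ` ?A \<subseteq> S then \<Prod>t<M. a t (f t) else 0))"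
    by (intro sum.cong) (auto simp: sum_distrib_left)
  also have "\<dots> = (\<Sum>f\<in>?E. \<Sum>S\<in>Pow ?A. (-1) ^ (M + card S) * (if f ` ?A \<subseteq> S then \<Prod>t<M. a t (f t) else 0))"
    by (rule sum.swap)
  also have "\<dots> = (\<Sum>f\<in>?E. if f ` ?A = ?A then \<Prod>t<M. a t (f t) else 0)"
  proof (rule sum.cong[OF refl])
    fix f assume f: "f \<in> ?E"
    then have sub: "f ` ?A \<subseteq> ?A" by auto
    have "(\<Sum>S\<in>Pow ?A. (-1) ^ (M + card S) * (if f ` ?A \<subseteq> S then \<Prod>t<M. a t (f t) else 0))
        = (\<Sum>S | f ` ?A \<subseteq> S \<and> S \<subseteq> ?A. (-1) ^ (M + card S) * (\<Prod>t<M. a t (f t)))"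
      by (rule sum.mono_neutral_cong_right) auto
    also have "\<dots> = (-1) ^ M * (\<Sum>S | f ` ?A \<subseteq> S \<and> S \<subseteq> ?A. (-1) ^ card S) * (\<Prod>t<M. a t (f t))"
      by (simp add: power_add sum_distrib_left sum_distrib_right mult_ac)
    also have "\<dots> = (if f ` ?A = ?A then \<Prod>t<M. a t (f t) else 0)"
    proof (cases "f ` ?A = ?A")
      case True
      then have "{S. f ` ?A \<subseteq> S \<and> S \<subseteq> ?A} = {?A}" by auto
      then show ?thesis using True by (simp add: power_add[symmetric] mult_2[symmetric])
    next
      case False
      then show ?thesis using alternating_sum_supersets[OF _ sub, where 'c = 'c] by simp
    qed
    finally show "(\<Sum>S\<in>Pow ?A. (-1) ^ (M + card S) * (if f ` ?A \<subseteq> S then \<Prod>t<M. a t (f t) else 0))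
       = (if f ` ?A = ?A then \<Prod>t<M. a t (f t) else 0)" .
  qed
  also have "\<dots> = (\<Sum>f\<in>{f\<in>?E. f ` ?A = ?A}. \<Prod>t<M. a t (f t))"
    by (simp add: sum.inter_filter finE)
  also have "\<dots> = (\<Sum>\<sigma> | \<sigma> permutes ?A. \<Prod>t<M. a t (\<sigma> t))"
  proof (rule sum.reindex_bij_witness[of _ "\<lambda>\<sigma>. restrict \<sigma> ?A" "\<lambda>f t. if t \<in> ?A then f t else t"])
    fix f assume f: "f \<in> {f\<in>?E. f ` ?A = ?A}"
    then have inj: "inj_on f ?A" by (intro eq_card_imp_inj_on) auto
    have "bij_betw (\<lambda>t. if t \<in> ?A then f t else t) ?A ?A"
      using inj f by (subst bij_betw_cong[of _ _ f]) (auto simp: bij_betw_def)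
    then show "(\<lambda>t. if t \<in> ?A then f t else t) \<in> {\<sigma>. \<sigma> permutes ?A}"
      by (auto intro!: bij_imp_permutes split: if_splits)
    show "restrict (\<lambda>t. if t \<in> ?A then f t else t) ?A = f"
      using f by (auto simp: PiE_def extensional_def restrict_def)
  next
    fix \<sigma> assume s: "\<sigma> \<in> {\<sigma>. \<sigma> permutes ?A}"
    then have "\<sigma> ` ?A = ?A" by (simp add: permutes_image)
    then show "restrict \<sigma> ?A \<in> {f\<in>?E. f ` ?A = ?A}" by auto
    show "(\<lambda>t. if t \<in> ?A then restrict \<sigma> ?A t else t) = \<sigma>"
      using s by (auto simp: permutes_def restrict_def)
  qed auto
  finally show ?thesis .
qed

text \<open>A vector in the kernel vanishes, as is seen at a coordinate of largest absolute value: there the diagonal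
term outweighs all the others.\<close>

lemma invertible_diag_dominant:
  fixes a :: "'N::finite \<Rightarrow> 'N \<Rightarrow> nat" and t :: nat
  assumes t: "t > (\<Sum>i\<in>UNIV. \<Sum>j\<in>UNIV. a i j)"
  shows "invertible (\<chi> i j. of_nat (a i j) + (if i = j then of_nat t else 0) :: rat ^ 'N ^ 'N)"
    (is "invertible ?g")
proof -
  have "x = 0" if x: "?g *v x = 0" for x :: "rat ^ 'N"
  proof (rule ccontr)
    assume "x \<noteq> 0"
    obtain i where i: "\<And>j. \<bar>x $ j\<bar> \<le> \<bar>x $ i\<bar>"
    proof -
      have "Max (range (\<lambda>j. \<bar>x $ j\<bar>)) \<in> range (\<lambda>j. \<bar>x $ j\<bar>)" by (rule Max_in) auto
      then obtain i where "Max (range (\<lambda>j. \<bar>x $ j\<bar>)) = \<bar>x $ i\<bar>" by (rule rangeE)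
      then have "\<bar>x $ j\<bar> \<le> \<bar>x $ i\<bar>" for j by (metis Max_ge finite finite_imageI rangeI)
      then show thesis by (rule that)
    qed
    obtain j where "x $ j \<noteq> 0" using \<open>x \<noteq> 0\<close> by (auto simp: vec_eq_iff)
    then have pos: "\<bar>x $ i\<bar> > 0" using i[of j] by linarith
    have "(?g *v x) $ i = 0" using x by simp
    then have "(\<Sum>j\<in>UNIV. of_nat (a i j) * x $ j) + of_nat t * x $ i = 0"
      by (simp add: matrix_vector_mult_def distrib_right sum.distrib if_distrib[of "\<lambda>y. y * _"] cong: if_cong)
    then have "of_nat t * \<bar>x $ i\<bar> = \<bar>\<Sum>j\<in>UNIV. of_nat (a i j) * x $ j\<bar>"
      by (metis abs_minus_cancel abs_mult abs_of_nat add_eq_0_iff)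
    also have "\<dots> \<le> (\<Sum>j\<in>UNIV. of_nat (a i j) * \<bar>x $ j\<bar>)"
      by (rule order_trans[OF sum_abs]) (simp add: abs_mult)
    also have "\<dots> \<le> (\<Sum>j\<in>UNIV. of_nat (a i j) * \<bar>x $ i\<bar>)"
      by (intro sum_mono mult_left_mono i) auto
    also have "\<dots> = of_nat (\<Sum>j\<in>UNIV. a i j) * \<bar>x $ i\<bar>" by (simp add: sum_distrib_right)
    also have "\<dots> < of_nat t * \<bar>x $ i\<bar>"
    proof -
      have "(\<Sum>j\<in>UNIV. a i j) \<le> (\<Sum>i\<in>UNIV. \<Sum>j\<in>UNIV. a i j)" by (rule member_le_sum) auto
      then have "(\<Sum>j\<in>UNIV. a i j) < t" using t by linarith
      then show ?thesis using pos by (simp del: of_nat_sum)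
    qed
    finally show False by simp
  qed
  then show ?thesis by (simp add: invertible_left_inverse matrix_left_invertible_ker)
qed

text \<open>The matrix of the \<open>M\<close>-th tensor power of \<open>A\<close>.\<close>

definition mat_tpow :: "nat \<Rightarrow> ('N \<Rightarrow> 'N \<Rightarrow> 'k::comm_ring_1) \<Rightarrow> 'N list \<Rightarrow> 'N list \<Rightarrow> 'k" where
  "mat_tpow M A I J = (\<Prod>t<M. A (I ! t) (J ! t))"

definition commutes_tpow :: "nat \<Rightarrow> ('N::finite list \<Rightarrow> 'N list \<Rightarrow> 'k::comm_ring_1) \<Rightarrow> ('N \<Rightarrow> 'N \<Rightarrow> 'k) \<Rightarrow> bool" where
  "commutes_tpow M B A \<longleftrightarrow> (\<forall>I L. length I = M \<longrightarrow> length L = M \<longrightarrow>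
     (\<Sum>J | length J = M. B I J * mat_tpow M A J L) = (\<Sum>J | length J = M. mat_tpow M A I J * B J L))"

text \<open>Commuting with the tensor power of \<open>a + t\<close> is a polynomial condition on \<open>t\<close>. It holds for all large
integers \<open>t\<close>, where \<open>a + t\<close> is invertible, hence also for \<open>t = 0\<close>. Entries in \<open>nat\<close> are all that the
polarization below asks for.\<close>

lemma commutes_tpow_singular:
  fixes B :: "'N::finite list \<Rightarrow> 'N list \<Rightarrow> 'k::field_char_0"
  assumes B: "\<And>g :: rat ^ 'N ^ 'N. invertible g \<Longrightarrow> commutes_tpow M B (\<lambda>i j. of_rat (g $ i $ j))"
  shows "commutes_tpow M B (\<lambda>i j. of_nat (a i j))"
  unfolding commutes_tpow_def
proof (intro allI impI)
  fix I L :: "'N list" assume len: "length I = M" "length L = M"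
  \<comment> \<open>The entries of the tensor power of \<open>a + t\<close> as polynomials in \<open>t\<close>.\<close>
  define P where "P I J = (\<Prod>t<M. [:of_nat (a (I ! t) (J ! t)), if I ! t = J ! t then 1 else 0:] :: 'k poly)" for I J
  define p where "p = (\<Sum>J | length J = M. smult (B I J) (P J L)) - (\<Sum>J | length J = M. smult (B J L) (P I J))"
  have P: "poly (P I J) x = mat_tpow M (\<lambda>i j. of_nat (a i j) + (if i = j then x else 0)) I J" for I J x
    unfolding P_def mat_tpow_def poly_prod by (rule prod.cong) auto
  have root: "poly p (of_nat t) = 0" if "t > (\<Sum>i\<in>UNIV. \<Sum>j\<in>UNIV. a i j)" for t
  proof -
    let ?A = "\<lambda>i j. of_nat (a i j) + (if i = j then of_nat t else 0) :: 'k"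
    have "(\<lambda>i j. of_rat ((\<chi> i j. of_nat (a i j) + (if i = j then of_nat t else 0) :: rat ^ 'N ^ 'N) $ i $ j)) = ?A"
      by (auto simp: fun_eq_iff of_rat_add)
    with B[OF invertible_diag_dominant[OF that]] have "commutes_tpow M B ?A" by simp
    then show ?thesis using len
      by (simp add: p_def poly_sum P commutes_tpow_def mult.commute)
  qed
  have "p = 0"
  proof (rule ccontr)
    assume "p \<noteq> 0"
    then have "finite {x. poly p x = 0}" by (rule poly_roots_finite)
    moreover have "of_nat ` {(\<Sum>i\<in>UNIV. \<Sum>j\<in>UNIV. a i j)<..} \<subseteq> {x. poly p x = 0}" using root by auto
    ultimately have "finite (of_nat ` {(\<Sum>i\<in>UNIV. \<Sum>j\<in>UNIV. a i j)<..} :: 'k set)" by (rule rev_finite_subset)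
    then have "finite {(\<Sum>i\<in>UNIV. \<Sum>j\<in>UNIV. a i j)<..}"
      by (rule finite_imageD) (simp add: inj_on_def)
    then show False using infinite_Ioi by blast
  qed
  then have "poly p 0 = 0" by simp
  then show "(\<Sum>J | length J = M. B I J * mat_tpow M (\<lambda>i j. of_nat (a i j)) J L)
      = (\<Sum>J | length J = M. mat_tpow M (\<lambda>i j. of_nat (a i j)) I J * B J L)"
    by (simp add: p_def poly_sum P mult.commute cong: if_cong)
qed

text \<open>By \<open>polarization\<close> the sum over \<open>\<sigma>\<close> of the matrix units at \<open>(permute_list \<sigma> X, permute_list \<sigma> Y)\<close> is a
combination of tensor powers of the matrices \<open>\<Sum>\<^sub>s\<^sub>\<in>\<^sub>S E\<^bsub>X s, Y s\<^esub>\<close>. So \<open>B\<close> commutes with it, and the equation compares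
entries at \<open>(I, L)\<close> of the two products.\<close>

lemma commutes_symmetrized_units:
  fixes B :: "'N::finite list \<Rightarrow> 'N list \<Rightarrow> 'k::field_char_0"
  assumes B: "\<And>g :: rat ^ 'N ^ 'N. invertible g \<Longrightarrow> commutes_tpow M B (\<lambda>i j. of_rat (g $ i $ j))"
    and len: "length I = M" "length L = M" "length X = M" "length Y = M"
  shows "(\<Sum>\<sigma> | \<sigma> permutes {..<M} \<and> L = permute_list \<sigma> Y. B I (permute_list \<sigma> X))
    = (\<Sum>\<sigma> | \<sigma> permutes {..<M} \<and> I = permute_list \<sigma> X. B (permute_list \<sigma> Y) L)"
proof -
  define a :: "nat set \<Rightarrow> 'N \<Rightarrow> 'N \<Rightarrow> nat"
    where "a S i j = (\<Sum>s\<in>S. if i = X ! s \<and> j = Y ! s then 1 else 0)" for S i j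
  have fin: "finite {\<sigma>. \<sigma> permutes {..<M}}" by (simp add: finite_permutations)
  have pol: "(\<Sum>S\<in>Pow {..<M}. (-1) ^ (M + card S) * mat_tpow M (\<lambda>i j. of_nat (a S i j)) J K)
      = (\<Sum>\<sigma> | \<sigma> permutes {..<M}. if J = permute_list \<sigma> X \<and> K = permute_list \<sigma> Y then 1 else 0 :: 'k)"
    if "length J = M" "length K = M" for J K
  proof -
    have "mat_tpow M (\<lambda>i j. of_nat (a S i j)) J K
        = (\<Prod>t<M. \<Sum>s\<in>S. if J ! t = X ! s \<and> K ! t = Y ! s then 1 else 0 :: 'k)" for S
      unfolding mat_tpow_def a_def by (rule prod.cong) (auto intro!: sum.cong)
    then have "(\<Sum>S\<in>Pow {..<M}. (-1) ^ (M + card S) * mat_tpow M (\<lambda>i j. of_nat (a S i j)) J K)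
      = (\<Sum>\<sigma> | \<sigma> permutes {..<M}. \<Prod>t<M. if J ! t = X ! \<sigma> t \<and> K ! t = Y ! \<sigma> t then 1 else 0 :: 'k)"
      by (simp add: polarization)
    also have "\<dots> = (\<Sum>\<sigma> | \<sigma> permutes {..<M}. if J = permute_list \<sigma> X \<and> K = permute_list \<sigma> Y then 1 else 0)"
    proof (rule sum.cong[OF refl])
      fix \<sigma> assume "\<sigma> \<in> {\<sigma>. \<sigma> permutes {..<M}}"
      then have "J = permute_list \<sigma> X \<and> K = permute_list \<sigma> Y \<longleftrightarrow> (\<forall>t<M. J ! t = X ! \<sigma> t \<and> K ! t = Y ! \<sigma> t)"
        using that len by (auto simp: list_eq_iff_nth_eq permute_list_nth)
      then show "(\<Prod>t<M. if J ! t = X ! \<sigma> t \<and> K ! t = Y ! \<sigma> t then 1 else 0 :: 'k)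
         = (if J = permute_list \<sigma> X \<and> K = permute_list \<sigma> Y then 1 else 0)"
        by (auto intro!: prod_zero)
    qed
    finally show ?thesis .
  qed
  have 1: "(\<Sum>S\<in>Pow {..<M}. (-1) ^ (M + card S) * (\<Sum>J | length J = M. B I J * mat_tpow M (\<lambda>i j. of_nat (a S i j)) J L))
      = (\<Sum>J | length J = M. B I J * (\<Sum>S\<in>Pow {..<M}. (-1) ^ (M + card S) * mat_tpow M (\<lambda>i j. of_nat (a S i j)) J L))"
    by (simp add: sum_distrib_left mult_ac) (rule sum.swap)
  have 2: "(\<Sum>S\<in>Pow {..<M}. (-1) ^ (M + card S) * (\<Sum>J | length J = M. mat_tpow M (\<lambda>i j. of_nat (a S i j)) I J * B J L))
      = (\<Sum>J | length J = M. (\<Sum>S\<in>Pow {..<M}. (-1) ^ (M + card S) * mat_tpow M (\<lambda>i j. of_nat (a S i j)) I J) * B J L)"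
    by (simp add: sum_distrib_left sum_distrib_right mult_ac) (rule sum.swap)
  have 3: "(\<Sum>S\<in>Pow {..<M}. (-1) ^ (M + card S) * (\<Sum>J | length J = M. B I J * mat_tpow M (\<lambda>i j. of_nat (a S i j)) J L))
      = (\<Sum>S\<in>Pow {..<M}. (-1) ^ (M + card S) * (\<Sum>J | length J = M. mat_tpow M (\<lambda>i j. of_nat (a S i j)) I J * B J L))"
    by (rule sum.cong[OF refl]) (use commutes_tpow_singular[OF B, of "a _"] len in \<open>simp add: commutes_tpow_def\<close>)
  have "(\<Sum>J | length J = M. B I J * (\<Sum>\<sigma> | \<sigma> permutes {..<M}. if J = permute_list \<sigma> X \<and> L = permute_list \<sigma> Y then 1 else 0))
     = (\<Sum>J | length J = M. B I J * (\<Sum>S\<in>Pow {..<M}. (-1) ^ (M + card S) * mat_tpow M (\<lambda>i j. of_nat (a S i j)) J L))"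
    by (rule sum.cong[OF refl]) (simp only: pol len mem_Collect_eq)
  also have "\<dots> = (\<Sum>J | length J = M. (\<Sum>S\<in>Pow {..<M}. (-1) ^ (M + card S) * mat_tpow M (\<lambda>i j. of_nat (a S i j)) I J) * B J L)"
    using 1 2 3 by (simp only:)
  also have "\<dots> = (\<Sum>J | length J = M. (\<Sum>\<sigma> | \<sigma> permutes {..<M}. if I = permute_list \<sigma> X \<and> J = permute_list \<sigma> Y then 1 else 0) * B J L)"
    by (rule sum.cong[OF refl]) (simp only: pol len mem_Collect_eq)
  finally have "(\<Sum>J | length J = M. B I J * (\<Sum>\<sigma> | \<sigma> permutes {..<M}. if J = permute_list \<sigma> X \<and> L = permute_list \<sigma> Y then 1 else 0))
     = (\<Sum>J | length J = M. (\<Sum>\<sigma> | \<sigma> permutes {..<M}. if I = permute_list \<sigma> X \<and> J = permute_list \<sigma> Y then 1 else 0) * B J L)" .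
  moreover have "(\<Sum>J | length J = M. B I J * (\<Sum>\<sigma> | \<sigma> permutes {..<M}. if J = permute_list \<sigma> X \<and> L = permute_list \<sigma> Y then 1 else 0))
     = (\<Sum>\<sigma> | \<sigma> permutes {..<M}. \<Sum>J | length J = M. if J = permute_list \<sigma> X then (if L = permute_list \<sigma> Y then B I (permute_list \<sigma> X) else 0) else 0)"
    unfolding sum_distrib_left by (subst sum.swap) (auto intro!: sum.cong)
  moreover have "\<dots> = (\<Sum>\<sigma> | \<sigma> permutes {..<M} \<and> L = permute_list \<sigma> Y. B I (permute_list \<sigma> X))"
    using len fin by (simp add: sum.inter_filter[symmetric])
  moreover have "(\<Sum>J | length J = M. (\<Sum>\<sigma> | \<sigma> permutes {..<M}. if I = permute_list \<sigma> X \<and> J = permute_list \<sigma> Y then 1 else 0) * B J L)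
     = (\<Sum>\<sigma> | \<sigma> permutes {..<M}. \<Sum>J | length J = M. if J = permute_list \<sigma> Y then (if I = permute_list \<sigma> X then B (permute_list \<sigma> Y) L else 0) else 0)"
    unfolding sum_distrib_right by (subst sum.swap) (auto intro!: sum.cong)
  moreover have "\<dots> = (\<Sum>\<sigma> | \<sigma> permutes {..<M} \<and> I = permute_list \<sigma> X. B (permute_list \<sigma> Y) L)"
    using len fin by (simp add: sum.inter_filter[symmetric])
  ultimately show ?thesis by simp
qed

lemma permute_list_inverse:
  assumes "\<sigma> permutes {..<length xs}"
  shows "permute_list \<sigma> (permute_list (inv \<sigma>) xs) = xs" "permute_list (inv \<sigma>) (permute_list \<sigma> xs) = xs"
  using assms permutes_inv[OF assms]
  by (simp_all add: permute_list_compose[symmetric] permutes_inv_o)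

text \<open>Let \<open>P\<^sub>\<tau>\<close> be the matrix of the permutation operator of \<open>\<tau>\<close>, so that \<open>v \<tau>\<close> is its list of entries. The
normal equations give a rational matrix \<open>Z\<close> such that the numbers \<open>c\<^sub>\<tau> = \<langle>Z, P\<^sub>\<tau>\<rangle>\<close> satisfy
\<open>\<Sum>\<^sub>\<tau> c\<^sub>\<tau> P\<^sub>\<tau> = 1\<close>. Expanding \<open>c\<^sub>\<tau>\<close> in \<open>B = \<Sum>\<^sub>\<tau> c\<^sub>\<tau> B P\<^sub>\<tau>\<close> shows that \<open>B\<close> is a combination, with coefficients from
\<open>Z\<close>, of products of \<open>B\<close> with symmetrized matrix units. Moving \<open>B\<close> to the other side of these by
\<open>commutes_symmetrized_units\<close> leaves an expression in which the indices \<open>I\<close> and \<open>K\<close> of the entry occur only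
in the condition that one is a given permutation of the other.\<close>

lemma commutant_spanned_by_permutations:
  fixes B :: "'N::finite list \<Rightarrow> 'N list \<Rightarrow> 'k::field_char_0"
  assumes B: "\<And>g :: rat ^ 'N ^ 'N. invertible g \<Longrightarrow> commutes_tpow M B (\<lambda>i j. of_rat (g $ i $ j))"
  shows "\<exists>z. \<forall>I K. length I = M \<longrightarrow> length K = M \<longrightarrow>
    B I K = (\<Sum>\<sigma> | \<sigma> permutes {..<M}. if K = permute_list \<sigma> I then z \<sigma> else 0)"
proof -
  let ?P = "{\<sigma>. \<sigma> permutes {..<M}}"
  let ?L = "{I :: 'N list. length I = M}"
  define v :: "(nat \<Rightarrow> nat) \<Rightarrow> 'N list \<times> 'N list \<Rightarrow> rat"
    where "v \<tau> = (\<lambda>(I, K). if K = permute_list \<tau> I then 1 else 0)" for \<tau>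
  have finP: "finite ?P" by (simp add: finite_permutations)
  have idP: "id \<in> ?P" by (simp add: permutes_id)
  have "\<exists>Z. \<forall>y\<in>?L \<times> ?L. (\<Sum>\<tau>\<in>?P. ((if \<tau> = id then 1 else 0) - (\<Sum>x\<in>?L \<times> ?L. Z x * v \<tau> x)) * v \<tau> y) = 0"
    by (rule normal_equations) (use finP in simp_all)
  then obtain Z where Z: "\<forall>y\<in>?L \<times> ?L. (\<Sum>\<tau>\<in>?P. ((if \<tau> = id then 1 else 0) - (\<Sum>x\<in>?L \<times> ?L. Z x * v \<tau> x)) * v \<tau> y) = 0"
    by (rule exE)
  define z' where "z' x = (of_rat (Z x) :: 'k)" for x
  define c where "c \<tau> = (\<Sum>I\<in>?L. z' (I, permute_list \<tau> I))" for \<tau>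
  have c_rat: "c \<tau> = of_rat (\<Sum>x\<in>?L \<times> ?L. Z x * v \<tau> x)" for \<tau>
  proof -
    have "(\<Sum>x\<in>?L \<times> ?L. Z x * v \<tau> x) = (\<Sum>I\<in>?L. \<Sum>K\<in>?L. if K = permute_list \<tau> I then Z (I, K) else 0)"
      unfolding sum.cartesian_product by (rule sum.cong) (auto simp: v_def)
    also have "\<dots> = (\<Sum>I\<in>?L. Z (I, permute_list \<tau> I))" by (rule sum.cong) auto
    finally show ?thesis by (simp add: c_def z'_def of_rat_sum)
  qed
  have unit: "(\<Sum>\<tau>\<in>?P. if K = permute_list \<tau> I then c \<tau> else 0) = (if I = K then 1 else 0)" if "I \<in> ?L" "K \<in> ?L" for I K
  proof -
    have "(\<Sum>\<tau>\<in>?P. (\<Sum>x\<in>?L \<times> ?L. Z x * v \<tau> x) * v \<tau> (I, K)) = (\<Sum>\<tau>\<in>?P. (if \<tau> = id then 1 else 0) * v \<tau> (I, K))"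
      using Z[rule_format, of "(I, K)"] that by (simp only: left_diff_distrib sum_subtractf) simp
    also have "\<dots> = (\<Sum>\<tau>\<in>?P. if \<tau> = id then v \<tau> (I, K) else 0)" by (rule sum.cong) auto
    also have "\<dots> = (if I = K then 1 else 0)" using finP idP by (simp add: v_def)
    finally have "of_rat (\<Sum>\<tau>\<in>?P. (\<Sum>x\<in>?L \<times> ?L. Z x * v \<tau> x) * v \<tau> (I, K)) = (of_rat (if I = K then 1 else 0) :: 'k)"
      by (rule arg_cong)
    moreover have "of_rat (\<Sum>\<tau>\<in>?P. (\<Sum>x\<in>?L \<times> ?L. Z x * v \<tau> x) * v \<tau> (I, K)) = (\<Sum>\<tau>\<in>?P. if K = permute_list \<tau> I then c \<tau> else 0)"
      unfolding of_rat_sum of_rat_mult by (rule sum.cong) (auto simp: c_rat[unfolded of_rat_sum of_rat_mult] v_def)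
    ultimately show ?thesis by simp
  qed
  \<comment> \<open>What remains of the computation below once the condition on \<open>I\<close> and \<open>K\<close> is split off.\<close>
  define z where "z \<tau> = (\<Sum>L\<in>?L. \<Sum>J\<in>?L. z' (J, L) * B (permute_list (inv \<tau>) L) J)" for \<tau>
  have "B I K = (\<Sum>\<sigma>\<in>?P. if K = permute_list \<sigma> I then z \<sigma> else 0)" if IK: "I \<in> ?L" "K \<in> ?L" for I K
  proof -
    have plinv: "K = permute_list \<tau> J \<longleftrightarrow> J = permute_list (inv \<tau>) K" if "\<tau> \<in> ?P" "J \<in> ?L" "K \<in> ?L" for \<tau> and J K :: "'N list"
      using that permute_list_inverse[of \<tau> J] permute_list_inverse[of \<tau> K] by (metis mem_Collect_eq)
    have "B I K = (\<Sum>J\<in>?L. B I J * (if J = K then 1 else 0))"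
      using IK by (simp add: if_distrib[of "\<lambda>x. _ * x"] cong: if_cong)
    also have "\<dots> = (\<Sum>J\<in>?L. B I J * (\<Sum>\<tau>\<in>?P. if K = permute_list \<tau> J then c \<tau> else 0))"
      by (rule sum.cong[OF refl]) (simp only: unit IK)
    also have "\<dots> = (\<Sum>\<tau>\<in>?P. \<Sum>J\<in>?L. B I J * (if K = permute_list \<tau> J then c \<tau> else 0))"
      unfolding sum_distrib_left by (rule sum.swap)
    also have "\<dots> = (\<Sum>\<tau>\<in>?P. \<Sum>J\<in>?L. if J = permute_list (inv \<tau>) K then c \<tau> * B I J else 0)"
      by (intro sum.cong refl) (use plinv IK in auto)
    also have "\<dots> = (\<Sum>\<tau>\<in>?P. c \<tau> * B I (permute_list (inv \<tau>) K))"
      using IK by simp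
    also have "\<dots> = (\<Sum>\<sigma>\<in>?P. c (inv \<sigma>) * B I (permute_list \<sigma> K))"
      by (rule sum.reindex_bij_witness[of _ inv inv]) (auto simp: permutes_inv permutes_inv_inv)
    also have "\<dots> = (\<Sum>\<sigma>\<in>?P. \<Sum>L\<in>?L. z' (permute_list \<sigma> L, L) * B I (permute_list \<sigma> K))"
    proof (rule sum.cong[OF refl])
      fix \<sigma> assume s: "\<sigma> \<in> ?P"
      have "c (inv \<sigma>) = (\<Sum>L\<in>?L. z' (permute_list \<sigma> L, L))" unfolding c_def
        by (rule sum.reindex_bij_witness[of _ "permute_list \<sigma>" "permute_list (inv \<sigma>)"])
          (use s in \<open>auto simp: permute_list_inverse\<close>)
      then show "c (inv \<sigma>) * B I (permute_list \<sigma> K) = (\<Sum>L\<in>?L. z' (permute_list \<sigma> L, L) * B I (permute_list \<sigma> K))"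
        by (simp add: sum_distrib_right)
    qed
    also have "\<dots> = (\<Sum>\<sigma>\<in>?P. \<Sum>L\<in>?L. \<Sum>J\<in>?L. if J = permute_list \<sigma> L then z' (J, L) * B I (permute_list \<sigma> K) else 0)"
      by (intro sum.cong refl) auto
    also have "\<dots> = (\<Sum>L\<in>?L. \<Sum>J\<in>?L. \<Sum>\<sigma>\<in>?P. if J = permute_list \<sigma> L then z' (J, L) * B I (permute_list \<sigma> K) else 0)"
      by (rule trans[OF sum.swap], rule sum.cong[OF refl], rule sum.swap)
    also have "\<dots> = (\<Sum>L\<in>?L. \<Sum>J\<in>?L. z' (J, L) * (\<Sum>\<sigma> | \<sigma> permutes {..<M} \<and> J = permute_list \<sigma> L. B I (permute_list \<sigma> K)))"
      using finP by (intro sum.cong refl) (simp add: sum_distrib_left sum.inter_filter[symmetric])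
    also have "\<dots> = (\<Sum>L\<in>?L. \<Sum>J\<in>?L. z' (J, L) * (\<Sum>\<sigma> | \<sigma> permutes {..<M} \<and> I = permute_list \<sigma> K. B (permute_list \<sigma> L) J))"
    proof (intro sum.cong refl)
      fix L J :: "'N list" assume "L \<in> ?L" "J \<in> ?L"
      then show "z' (J, L) * (\<Sum>\<sigma> | \<sigma> permutes {..<M} \<and> J = permute_list \<sigma> L. B I (permute_list \<sigma> K))
          = z' (J, L) * (\<Sum>\<sigma> | \<sigma> permutes {..<M} \<and> I = permute_list \<sigma> K. B (permute_list \<sigma> L) J)"
        using commutes_symmetrized_units[OF B, of I J K L] IK by simp
    qed
    also have "\<dots> = (\<Sum>L\<in>?L. \<Sum>J\<in>?L. \<Sum>\<sigma>\<in>?P. if I = permute_list \<sigma> K then z' (J, L) * B (permute_list \<sigma> L) J else 0)"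
      using finP by (intro sum.cong refl) (simp add: sum_distrib_left sum.inter_filter[symmetric])
    also have "\<dots> = (\<Sum>\<sigma>\<in>?P. \<Sum>L\<in>?L. \<Sum>J\<in>?L. if I = permute_list \<sigma> K then z' (J, L) * B (permute_list \<sigma> L) J else 0)"
      by (rule sym, rule trans[OF sum.swap], rule sum.cong[OF refl], rule sum.swap)
    also have "\<dots> = (\<Sum>\<sigma>\<in>?P. if I = permute_list \<sigma> K then z (inv \<sigma>) else 0)"
      by (intro sum.cong refl) (auto simp: z_def permutes_inv_inv)
    also have "\<dots> = (\<Sum>\<sigma>\<in>?P. if K = permute_list \<sigma> I then z \<sigma> else 0)"
    proof (rule sum.reindex_bij_witness[of _ inv inv])
      fix \<sigma> assume s: "\<sigma> \<in> ?P"
      then have "I = permute_list \<sigma> K \<longleftrightarrow> K = permute_list (inv \<sigma>) I" using plinv[of \<sigma> K I] IK by simp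
      then show "(if K = permute_list (inv \<sigma>) I then z (inv \<sigma>) else 0) = (if I = permute_list \<sigma> K then z (inv \<sigma>) else 0)"
        by simp
    qed (auto simp: permutes_inv permutes_inv_inv)
    finally show ?thesis .
  qed
  then show ?thesis by (intro exI[of _ z] allI impI) simp
qed

lemma sum_words_zip:
  "(\<Sum>w | length w = M. F w) = (\<Sum>I | length I = M. \<Sum>J | length J = M. F (zip I J :: ('a::finite \<times> 'b::finite) list))"
proof -
  have "(\<Sum>w | length w = M. F w) = (\<Sum>(I, J) \<in> {I. length I = M} \<times> {J. length J = M}. F (zip I J))"
    by (rule sum.reindex_bij_witness[of _ "\<lambda>(I, J). zip I J" "\<lambda>w. (map fst w, map snd w)"])
      (auto simp: zip_map_fst_snd)
  then show ?thesis by (simp add: sum.cartesian_product)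
qed

text \<open>The first fundamental theorem of invariant theory for tensors on \<open>Mat\<^sup>*\<close>: with a word split into its first and
second indices, \<open>B\<close> becomes a matrix, and invariance says that it commutes with the tensor powers of all
invertible matrices.\<close>

theorem invariant_tensors_spanned_by_permutations:
  fixes B :: "('N::finite \<times> 'N) list \<Rightarrow> 'k::field_char_0"
  assumes B: "\<And>(g :: rat ^ 'N ^ 'N) w. invertible g \<Longrightarrow> length w = M \<Longrightarrow>
    (\<Sum>v | length v = M. of_rat (wcoeff g w v) * B v) = B w"
  shows "\<exists>z. \<forall>w. length w = M \<longrightarrow>
    B w = (\<Sum>\<sigma> | \<sigma> permutes {..<M}. if map snd w = permute_list \<sigma> (map fst w) then z \<sigma> else 0)"
proof -
  have "commutes_tpow M (\<lambda>I J. B (zip I J)) (\<lambda>i j. of_rat (g $ i $ j))" if g: "invertible g" for g :: "rat ^ 'N ^ 'N"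
    unfolding commutes_tpow_def
  proof (intro allI impI)
    fix I L :: "'N list" assume len: "length I = M" "length L = M"
    define G where "G = mat_tpow M (\<lambda>i j. of_rat (g $ i $ j) :: 'k)"
    define H where "H = mat_tpow M (\<lambda>i j. of_rat (matrix_inv g $ i $ j) :: 'k)"
    \<comment> \<open>First indices are acted on by the inverse matrix and second indices by \<open>g\<close>, so that invariance reads
      \<open>B = G\<^sup>-\<^sup>1 B G\<close> for the tensor power \<open>G\<close> of \<open>g\<close>.\<close>
    have wc: "of_rat (wcoeff g (zip J L) (zip I' J')) = H J I' * G J' L" if "length J = M" "length I' = M" "length J' = M" for J I' J'
      using that len by (simp add: wcoeff_def H_def G_def mat_tpow_def dual_coeff_eq of_rat_prod of_rat_mult prod.distrib)
    have GH: "(\<Sum>J | length J = M. G I J * H J I') = (if I = I' then 1 else 0)" if "length I' = M" for I'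
    proof -
      have "(\<Sum>J | length J = M. G I J * H J I') = (\<Prod>t<M. \<Sum>k\<in>UNIV. of_rat (g $ (I ! t) $ k) * of_rat (matrix_inv g $ k $ (I' ! t)))"
        by (simp add: G_def H_def mat_tpow_def prod.distrib[symmetric] sum_words_prod[symmetric])
      also have "\<dots> = (\<Prod>t<M. if I ! t = I' ! t then 1 else 0)"
        by (simp add: of_rat_mult[symmetric] of_rat_sum[symmetric] inv_sum(1)[OF g]) (rule prod.cong, auto)
      also have "\<dots> = (if I = I' then 1 else 0)"
        using len that by (auto simp: list_eq_iff_nth_eq intro!: prod_zero)
      finally show ?thesis .
    qed
    have "(\<Sum>J | length J = M. G I J * B (zip J L))
        = (\<Sum>J | length J = M. G I J * (\<Sum>I' | length I' = M. \<Sum>J' | length J' = M. H J I' * G J' L * B (zip I' J')))"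
    proof (rule sum.cong[OF refl])
      fix J :: "'N list" assume J: "J \<in> {J. length J = M}"
      have "B (zip J L) = (\<Sum>I' | length I' = M. \<Sum>J' | length J' = M. of_rat (wcoeff g (zip J L) (zip I' J')) * B (zip I' J'))"
        using B[OF g, of "zip J L"] J len by (simp add: sum_words_zip)
      also have "\<dots> = (\<Sum>I' | length I' = M. \<Sum>J' | length J' = M. H J I' * G J' L * B (zip I' J'))"
        by (intro sum.cong refl) (use J wc in auto)
      finally show "G I J * B (zip J L) = G I J * (\<Sum>I' | length I' = M. \<Sum>J' | length J' = M. H J I' * G J' L * B (zip I' J'))"
        by simp
    qed
    also have "\<dots> = (\<Sum>J | length J = M. \<Sum>I' | length I' = M. \<Sum>J' | length J' = M. (G I J * H J I') * (G J' L * B (zip I' J')))"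
      by (simp add: sum_distrib_left mult_ac)
    also have "\<dots> = (\<Sum>I' | length I' = M. \<Sum>J' | length J' = M. \<Sum>J | length J = M. (G I J * H J I') * (G J' L * B (zip I' J')))"
      by (rule trans[OF sum.swap], rule sum.cong[OF refl], rule sum.swap)
    also have "\<dots> = (\<Sum>I' | length I' = M. \<Sum>J' | length J' = M. (if I = I' then 1 else 0) * (G J' L * B (zip I' J')))"
      by (intro sum.cong refl) (use GH in \<open>simp add: sum_distrib_right[symmetric]\<close>)
    also have "\<dots> = (\<Sum>I' | length I' = M. if I = I' then \<Sum>J' | length J' = M. G J' L * B (zip I' J') else 0)"
      by (intro sum.cong refl) auto
    also have "\<dots> = (\<Sum>J' | length J' = M. B (zip I J') * G J' L)"
      using len by (simp add: mult.commute)
    finally show "(\<Sum>J | length J = M. B (zip I J) * mat_tpow M (\<lambda>i j. of_rat (g $ i $ j)) J L)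
       = (\<Sum>J | length J = M. mat_tpow M (\<lambda>i j. of_rat (g $ i $ j)) I J * B (zip J L))"
      by (simp add: G_def)
  qed
  then have "\<exists>z. \<forall>I K. length I = M \<longrightarrow> length K = M \<longrightarrow>
      B (zip I K) = (\<Sum>\<sigma> | \<sigma> permutes {..<M}. if K = permute_list \<sigma> I then z \<sigma> else 0)"
    by (rule commutant_spanned_by_permutations)
  then obtain z where z: "\<forall>I K. length I = M \<longrightarrow> length K = M \<longrightarrow>
      B (zip I K) = (\<Sum>\<sigma> | \<sigma> permutes {..<M}. if K = permute_list \<sigma> I then z \<sigma> else 0)"
    by (rule exE)
  have "B w = (\<Sum>\<sigma> | \<sigma> permutes {..<M}. if map snd w = permute_list \<sigma> (map fst w) then z \<sigma> else 0)" if "length w = M" for w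
    using z[rule_format, of "map fst w" "map snd w"] that by (simp add: zip_map_fst_snd)
  then show ?thesis by (intro exI[of _ z] allI impI)
qed

section \<open>Normal forms in presented vector spaces\<close>

text \<open>Extend a basis of \<open>S\<close> to a basis of the whole space and send the vectors of the former to \<open>0\<close>.\<close>

lemma exists_projection_along:
  assumes S: "pm.subspace (S :: ('x \<Rightarrow>\<^sub>0 'k::field) set)"
  shows "\<exists>q. (\<forall>f g. q (f + g) = q f + q g) \<and> (\<forall>c f. q (pm_scale c f) = pm_scale c (q f))
    \<and> (\<forall>f. q f = 0 \<longleftrightarrow> f \<in> S) \<and> (\<forall>f. q f - f \<in> S)"
proof -
  interpret pp: vector_space_pair "pm_scale :: 'k \<Rightarrow> ('x \<Rightarrow>\<^sub>0 'k) \<Rightarrow> _" "pm_scale :: 'k \<Rightarrow> ('x \<Rightarrow>\<^sub>0 'k) \<Rightarrow> _" ..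
  obtain B where B: "B \<subseteq> S" "pm.independent B" "S \<subseteq> pm.span B"
    using pm.maximal_independent_subset[of S] by metis
  obtain C where C: "B \<subseteq> C" "pm.independent C" "UNIV \<subseteq> pm.span C"
    using pm.maximal_independent_subset_extend[OF subset_UNIV B(2)] by metis
  define q where "q = pp.construct C (\<lambda>b. if b \<in> B then 0 else b)"
  have lin: "Vector_Spaces.linear pm_scale pm_scale q"
    unfolding q_def by (rule pp.linear_construct[OF C(2)])
  then interpret q: Vector_Spaces.linear pm_scale pm_scale q .
  have qb: "q b = (if b \<in> B then 0 else b)" if "b \<in> C" for b
    unfolding q_def by (rule pp.construct_basis[OF C(2) that])
  have 1: "q f = 0" if "f \<in> S" for f
  proof -
    have fB: "f \<in> pm.span B" using B that by blast
    show ?thesis by (rule pp.linear_eq_0_on_span[OF lin _ fB]) (use qb C(1) in auto)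
  qed
  have 2: "q f - f \<in> S" for f
  proof -
    have "f \<in> pm.span C" using C by blast
    then show ?thesis
    proof (induction rule: pm.span_induct_alt)
      case base show ?case using pm.subspace_0[OF S] by (simp add: q.zero)
    next
      case (step c x y)
      have "q x - x \<in> S" using qb[OF step(1)] B pm.subspace_0[OF S] pm.subspace_neg[OF S] by auto
      then have "pm_scale c (q x - x) + (q y - y) \<in> S"
        by (intro pm.subspace_add[OF S] pm.subspace_scale[OF S] step)
      then show ?case by (simp add: q.add q.scale pm.scale_right_diff_distrib algebra_simps)
    qed
  qed
  have "f \<in> S" if "q f = 0" for f using 2[of f] that pm.subspace_neg[OF S, of "- f"] by simp
  then show ?thesis using 1 2 q.add q.scale by (intro exI[of _ q] conjI allI iffI)
qed

text \<open>A linear choice of representatives modulo the relations. It replaces computations with cosets by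
computations in free vector spaces, where finite sums and linear and multilinear extensions are at hand.\<close>

definition nform :: "('x, 'k::field) presentation \<Rightarrow> ('x \<Rightarrow>\<^sub>0 'k) \<Rightarrow> ('x \<Rightarrow>\<^sub>0 'k)" where
  "nform P = (SOME q. (\<forall>f g. q (f + g) = q f + q g) \<and> (\<forall>c f. q (pm_scale c f) = pm_scale c (q f))
    \<and> (\<forall>f. q f = 0 \<longleftrightarrow> f \<in> rel_span P) \<and> (\<forall>f. q f - f \<in> rel_span P))"

lemma nform:
  shows nform_add: "nform P (f + g) = nform P f + nform P g"
    and nform_scale: "nform P (pm_scale c f) = pm_scale c (nform P f)"
    and nform_eq_0: "nform P f = 0 \<longleftrightarrow> f \<in> rel_span P"
    and nform_diff_self: "nform P f - f \<in> rel_span P"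
proof -
  note someI_ex[OF exists_projection_along[OF rel_span_subspace[of P]], folded nform_def]
  then show "nform P (f + g) = nform P f + nform P g" "nform P (pm_scale c f) = pm_scale c (nform P f)"
    "nform P f = 0 \<longleftrightarrow> f \<in> rel_span P" "nform P f - f \<in> rel_span P"
    by simp_all
qed

lemma nform_diff: "nform P (f - g) = nform P f - nform P g"
  using nform_add[of P "f - g" g] by (simp add: algebra_simps)

lemma nform_eq_iff: "nform P f = nform P g \<longleftrightarrow> f - g \<in> rel_span P"
  using nform_eq_0[of P "f - g"] by (simp add: nform_diff)

lemma nform_nform [simp]: "nform P (nform P f) = nform P f"
  by (simp add: nform_eq_iff nform_diff_self)

lemma nform_0 [simp]: "nform P 0 = 0"
  by (simp add: nform_eq_0 pm.subspace_0[OF rel_span_subspace])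

lemma nform_sum: "nform P (sum g S) = (\<Sum>x\<in>S. nform P (g x))"
  by (induction S rule: infinite_finite_induct) (auto simp: nform_add)

lemma cls_nform [simp]: "cls P (nform P f) = cls P f"
  by (simp add: cls_eq_iff nform_diff_self)

text \<open>The choice of the representative does not matter, because \<open>nform\<close> is constant on cosets.\<close>

definition cform :: "('x, 'k::field) presentation \<Rightarrow> ('x \<Rightarrow>\<^sub>0 'k) set \<Rightarrow> ('x \<Rightarrow>\<^sub>0 'k)" where
  "cform P C = nform P (SOME f. f \<in> C)"

lemma in_cls: "f \<in> cls P f"
  using pm.subspace_0[OF rel_span_subspace[of P]] by (auto simp: cls_def intro!: exI[of _ 0])

lemma cform_cls [simp]: "cform P (cls P f) = nform P f"
proof -
  have "(SOME f'. f' \<in> cls P f) \<in> cls P f" by (rule someI[of _ f]) (rule in_cls)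
  then show ?thesis unfolding cform_def nform_eq_iff by (auto simp: cls_def)
qed

lemma cls_cform: "C \<in> vspace P \<Longrightarrow> cls P (cform P C) = C"
  by (auto simp: vspace_def)

lemma nform_cform [simp]: "nform P (cform P C) = cform P C"
  by (simp add: cform_def)

lemma cform_inj: "C \<in> vspace P \<Longrightarrow> D \<in> vspace P \<Longrightarrow> cform P C = cform P D \<Longrightarrow> C = D"
  by (metis cls_cform)

lemma cform_vadd: "C \<in> vspace P \<Longrightarrow> D \<in> vspace P \<Longrightarrow> cform P (vadd P C D) = cform P C + cform P D"
  by (auto simp: vspace_def vadd_cls nform_add)

lemma cform_vscale: "C \<in> vspace P \<Longrightarrow> cform P (vscale P c C) = pm_scale c (cform P C)"
  by (auto simp: vspace_def vscale_cls nform_scale)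

lemma keys_pm_scale: "Poly_Mapping.keys (pm_scale c f) \<subseteq> Poly_Mapping.keys f"
  by (auto simp: in_keys_iff)

lemma cls_in_vspace: "Poly_Mapping.keys f \<subseteq> gens P \<Longrightarrow> cls P f \<in> vspace P"
  by (auto simp: vspace_def)

lemma vadd_vspace: "C \<in> vspace P \<Longrightarrow> D \<in> vspace P \<Longrightarrow> vadd P C D \<in> vspace P"
  using keys_add by (fastforce simp: vspace_def vadd_cls)

lemma vscale_vspace: "C \<in> vspace P \<Longrightarrow> vscale P c C \<in> vspace P"
  using keys_pm_scale by (fastforce simp: vspace_def vscale_cls)

definition sing :: "'x \<Rightarrow> 'x \<Rightarrow>\<^sub>0 'k::field" where "sing x = Poly_Mapping.single x 1"

lemma keys_sing [simp]: "Poly_Mapping.keys (sing x :: 'x \<Rightarrow>\<^sub>0 'k::field) = {x}" by (simp add: sing_def)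

lemma lin_ext_sing [simp]: "lin_ext g (sing x) = (g x :: _ \<Rightarrow>\<^sub>0 'k::field)" by (simp add: sing_def)

lemma linear_eq_lin_ext:
  assumes add: "\<And>f g. T (f + g) = T f + T g" and scale: "\<And>c f. T (pm_scale c f) = pm_scale c (T f)"
  shows "T f = lin_ext (\<lambda>x. T (sing x)) (f :: 'x \<Rightarrow>\<^sub>0 'k::field)"
proof (induction f rule: poly_mapping_single_induct)
  case 1
  show ?case using scale[of 0 0] by simp
next
  case (2 x c f)
  have "T (Poly_Mapping.single x c) = pm_scale c (T (sing x))"
    using scale[of c "sing x"] by (simp add: sing_def)
  then show ?case using 2 by (simp add: add lin_ext_add)
qed

lemma lin_ext_cong: "(\<And>x. x \<in> Poly_Mapping.keys f \<Longrightarrow> g x = h x) \<Longrightarrow> lin_ext g f = lin_ext h f"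
  by (simp add: lin_ext_def)

lemma linear_lin_ext:
  assumes "\<And>f g. T (f + g) = T f + T g" "\<And>c f. T (pm_scale c f) = pm_scale c (T f)"
  shows "T (lin_ext g f) = lin_ext (\<lambda>x. T (g x)) (f :: 'x \<Rightarrow>\<^sub>0 'k::field)"
  by (subst linear_eq_lin_ext[of "\<lambda>f. T (lin_ext g f)"]) (auto simp: assms lin_ext_add lin_ext_scale)

lemma lin_ext_fun_add: "lin_ext (\<lambda>x. g x + h x) f = lin_ext g f + (lin_ext h f :: _ \<Rightarrow>\<^sub>0 'k::field)"
  by (simp add: lin_ext_def pm.scale_right_distrib sum.distrib)

lemma lin_ext_fun_0 [simp]: "lin_ext (\<lambda>x. 0) f = (0 :: _ \<Rightarrow>\<^sub>0 'k::field)"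
  by (simp add: lin_ext_def)

lemma lin_ext_fun_sum: "lin_ext (\<lambda>x. \<Sum>k\<in>S. g k x) f = (\<Sum>k\<in>S. lin_ext (g k) f :: _ \<Rightarrow>\<^sub>0 'k::field)"
  by (simp add: lin_ext_def pm.scale_sum_right sum.swap[of _ S])

lemma lin_ext_swap:
  "lin_ext (\<lambda>x. lin_ext (\<lambda>y. h x y) g) f = lin_ext (\<lambda>y. lin_ext (\<lambda>x. h x y) f) (g :: _ \<Rightarrow>\<^sub>0 'k::field)"
  unfolding lin_ext_def pm.scale_sum_right pm.scale_scale
  by (subst sum.swap) (simp add: mult.commute)

lemma lin_ext_id: "lin_ext sing f = (f :: _ \<Rightarrow>\<^sub>0 'k::field)"
  by (rule linear_eq_lin_ext[of "\<lambda>f. f", symmetric]) auto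

lemma keys_lin_ext: "Poly_Mapping.keys (lin_ext g f) \<subseteq> (\<Union>x\<in>Poly_Mapping.keys f. Poly_Mapping.keys (g x :: _ \<Rightarrow>\<^sub>0 'k::field))"
proof -
  have "Poly_Mapping.keys (sum h S) \<subseteq> (\<Union>x\<in>S. Poly_Mapping.keys (h x))" for h :: "_ \<Rightarrow> _ \<Rightarrow>\<^sub>0 'k" and S
    by (rule keys_sum)
  then show ?thesis unfolding lin_ext_def using keys_pm_scale by fastforce
qed

lemma keys_lin_ext_subset:
  assumes "Poly_Mapping.keys f \<subseteq> A" "\<And>x. x \<in> A \<Longrightarrow> Poly_Mapping.keys (g x) \<subseteq> B"
  shows "Poly_Mapping.keys (lin_ext g f :: _ \<Rightarrow>\<^sub>0 'k::field) \<subseteq> B"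
  using keys_lin_ext[of g f] assms by blast

lemma nform_lin_ext: "nform P (lin_ext g f) = lin_ext (\<lambda>x. nform P (g x)) f"
  by (rule linear_lin_ext) (simp_all add: nform_add nform_scale)

section \<open>Multilinear maps and tensor powers\<close>

text \<open>A slot is given by the two lists around it, as this is the form in which induction over argument lists meets
it.\<close>

definition multilinear :: "nat \<Rightarrow> (('x \<Rightarrow>\<^sub>0 'k::field) list \<Rightarrow> ('y \<Rightarrow>\<^sub>0 'k)) \<Rightarrow> bool" where
  "multilinear n H \<longleftrightarrow> (\<forall>xs ys. Suc (length xs + length ys) = n \<longrightarrow>
     (\<forall>f g. H (xs @ (f + g) # ys) = H (xs @ f # ys) + H (xs @ g # ys)) \<and>
     (\<forall>c f. H (xs @ pm_scale c f # ys) = pm_scale c (H (xs @ f # ys))))"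

text \<open>The multilinear extension of a function on lists of basis vectors.\<close>

fun mlin :: "('x list \<Rightarrow> 'y \<Rightarrow>\<^sub>0 'k::field) \<Rightarrow> ('x \<Rightarrow>\<^sub>0 'k) list \<Rightarrow> 'y \<Rightarrow>\<^sub>0 'k" where
  "mlin F [] = F []"
| "mlin F (f # fs) = lin_ext (\<lambda>x. mlin (\<lambda>xs. F (x # xs)) fs) f"

lemma mlin_multilinear: "multilinear n (mlin F)"
proof -
  have "mlin F (xs @ (f + g) # ys) = mlin F (xs @ f # ys) + mlin F (xs @ g # ys)
    \<and> mlin F (xs @ pm_scale c f # ys) = pm_scale c (mlin F (xs @ f # ys))" for xs f g ys c
    by (induction xs arbitrary: F) (simp_all add: lin_ext_add lin_ext_scale lin_ext_fun_add lin_ext_fun_scale)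
  then show ?thesis by (auto simp: multilinear_def)
qed

lemma mlin_cong:
  "(\<And>xs. list_all2 (\<lambda>x f. x \<in> Poly_Mapping.keys f) xs fs \<Longrightarrow> F xs = G xs) \<Longrightarrow> mlin F fs = mlin G fs"
proof (induction fs arbitrary: F G)
  case (Cons f fs)
  show ?case unfolding mlin.simps
    by (rule lin_ext_cong, rule Cons.IH) (rule Cons.prems, simp)
qed simp

lemma mlin_map_sing [simp]: "mlin F (map sing xs) = F xs"
  by (induction xs arbitrary: F) simp_all

lemma mlin_0 [simp]: "mlin (\<lambda>_. 0) fs = 0"
  by (induction fs) simp_all

lemma multilinear_slot:
  assumes "multilinear n H" "Suc (length xs + length ys) = n"
  shows "H (xs @ f # ys) = lin_ext (\<lambda>x. H (xs @ sing x # ys)) f"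
  by (rule linear_eq_lin_ext[of "\<lambda>f. H (xs @ f # ys)"]) (use assms in \<open>auto simp: multilinear_def\<close>)

lemma multilinear_eq_mlin:
  assumes "multilinear n H" "length fs = n"
  shows "H fs = mlin (\<lambda>xs. H (map sing xs)) fs"
proof -
  have "length xs + length fs = n \<Longrightarrow> H (map sing xs @ fs) = mlin (\<lambda>ys. H (map sing (xs @ ys))) fs" for xs
  proof (induction fs arbitrary: xs)
    case (Cons f fs)
    have "H (map sing xs @ f # fs) = lin_ext (\<lambda>x. H (map sing xs @ sing x # fs)) f"
      by (rule multilinear_slot[OF assms(1)]) (use Cons.prems in simp)
    also have "\<dots> = lin_ext (\<lambda>x. H (map sing (xs @ [x]) @ fs)) f" by simp
    also have "\<dots> = lin_ext (\<lambda>x. mlin (\<lambda>ys. H (map sing ((xs @ [x]) @ ys))) fs) f"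
      by (rule lin_ext_cong, rule Cons.IH) (use Cons.prems in simp)
    finally show ?case by simp
  qed simp
  from this[of "[]"] show ?thesis using assms(2) by simp
qed

lemma multilinear_agree:
  assumes "multilinear n H" "multilinear n H'" "length fs = n"
    and "\<And>xs. list_all2 (\<lambda>x f. x \<in> Poly_Mapping.keys f) xs fs \<Longrightarrow> H (map sing xs) = H' (map sing xs)"
  shows "H fs = H' fs"
  unfolding multilinear_eq_mlin[OF assms(1,3)] multilinear_eq_mlin[OF assms(2,3)]
  by (rule mlin_cong) (rule assms(4))

lemma linear_mlin:
  assumes "\<And>f g. T (f + g) = T f + T g" "\<And>c f. T (pm_scale c f) = pm_scale c (T f)"
  shows "T (mlin F fs) = mlin (\<lambda>xs. T (F xs)) fs"
  by (induction fs arbitrary: F) (simp_all add: linear_lin_ext[OF assms])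

lemma lin_ext_mlin: "lin_ext g (mlin F fs) = mlin (\<lambda>xs. lin_ext g (F xs)) fs"
  by (rule linear_mlin) (simp_all add: lin_ext_add lin_ext_scale)

lemma lin_ext_mlin_swap: "lin_ext (\<lambda>x. mlin (G x) ys) f = mlin (\<lambda>zs. lin_ext (\<lambda>x. G x zs) f) ys"
proof (induction ys arbitrary: G)
  case (Cons a ys)
  show ?case unfolding mlin.simps by (subst lin_ext_swap) (simp only: Cons)
qed simp

lemma mlin_swap: "mlin (\<lambda>ws. mlin (\<lambda>xs. A xs ws) fs) gs = mlin (\<lambda>xs. mlin (\<lambda>ws. A xs ws) gs) fs"
  by (induction fs arbitrary: A) (simp_all add: lin_ext_mlin_swap[symmetric])

text \<open>The linear extensions in different arguments commute, so any slot can be made the innermost one.\<close>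

lemma mlin_slot:
  "mlin F (xs @ f # ys) = mlin (\<lambda>zs. lin_ext (\<lambda>x. F (take (length xs) zs @ x # drop (length xs) zs)) f) (xs @ ys)"
proof (induction xs arbitrary: F)
  case Nil
  have "lin_ext (\<lambda>x. mlin (\<lambda>zs. F (x # zs)) ys) f = mlin (\<lambda>zs. lin_ext (\<lambda>x. F (x # zs)) f) ys"
    by (rule lin_ext_mlin_swap)
  then show ?case by simp
next
  case (Cons a xs)
  show ?case by (simp add: Cons)
qed

lemma keys_mlin:
  assumes "\<And>xs. list_all2 (\<lambda>x f. x \<in> Poly_Mapping.keys f) xs fs \<Longrightarrow> Poly_Mapping.keys (F xs) \<subseteq> S"
  shows "Poly_Mapping.keys (mlin F fs) \<subseteq> S"
  using assms
proof (induction fs arbitrary: F)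
  case (Cons f fs)
  show ?case unfolding mlin.simps
  proof (rule keys_lin_ext_subset[OF order_refl], rule Cons.IH)
    fix x xs assume "x \<in> Poly_Mapping.keys f" "list_all2 (\<lambda>x f. x \<in> Poly_Mapping.keys f) xs fs"
    then show "Poly_Mapping.keys (F (x # xs)) \<subseteq> S" by (intro Cons.prems) simp
  qed
qed simp

text \<open>The bilinear expressions in the arguments are those by which \<open>pairing\<close> is defined.\<close>

lemma mlin_map2_lin_ext:
  "length fs = length Xs \<Longrightarrow> mlin F (map2 (\<lambda>f X. lin_ext (\<lambda>x. lin_ext (h x) X) f) fs Xs)
    = mlin (\<lambda>xs. mlin (\<lambda>ws. mlin F (map2 h xs ws)) Xs) fs"
proof (induction fs Xs arbitrary: F rule: list_induct2)
  case (Cons f fs X Xs)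
  have "mlin F (map2 (\<lambda>f X. lin_ext (\<lambda>x. lin_ext (h x) X) f) (f # fs) (X # Xs))
    = lin_ext (\<lambda>x. lin_ext (\<lambda>w. lin_ext (\<lambda>m. mlin (\<lambda>xs. mlin (\<lambda>ws. mlin (\<lambda>ms. F (m # ms)) (map2 h xs ws)) Xs) fs) (h x w)) X) f"
    by (simp add: Cons.IH lin_ext_comp)
  also have "\<dots> = lin_ext (\<lambda>x. mlin (\<lambda>xs. lin_ext (\<lambda>w. mlin (\<lambda>ws. lin_ext (\<lambda>m. mlin (\<lambda>ms. F (m # ms)) (map2 h xs ws)) (h x w)) Xs) X) fs) f"
    by (simp only: lin_ext_mlin_swap)
  finally show ?case by simp
qed simp

text \<open>A multilinear map of pairings is determined by its values at pairings of symbols with words.\<close>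

lemma multilinear_map2:
  assumes K: "multilinear n K" and len: "length fs = n" "length Xs = n"
  shows "K (map2 (\<lambda>f X. lin_ext (\<lambda>x. lin_ext (h x) X) f) fs Xs) = mlin (\<lambda>xs. mlin (\<lambda>ws. K (map2 h xs ws)) Xs) fs"
proof -
  have "K (map2 (\<lambda>f X. lin_ext (\<lambda>x. lin_ext (h x) X) f) fs Xs)
      = mlin (\<lambda>ms. K (map sing ms)) (map2 (\<lambda>f X. lin_ext (\<lambda>x. lin_ext (h x) X) f) fs Xs)"
    by (rule multilinear_eq_mlin[OF K]) (use len in simp)
  also have "\<dots> = mlin (\<lambda>xs. mlin (\<lambda>ws. mlin (\<lambda>ms. K (map sing ms)) (map2 h xs ws)) Xs) fs"
    by (rule mlin_map2_lin_ext) (use len in simp)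
  also have "\<dots> = mlin (\<lambda>xs. mlin (\<lambda>ws. K (map2 h xs ws)) Xs) fs"
  proof (rule mlin_cong, rule mlin_cong)
    fix xs ws assume xs: "list_all2 (\<lambda>x f. x \<in> Poly_Mapping.keys f) xs fs"
      and ws: "list_all2 (\<lambda>w X. w \<in> Poly_Mapping.keys X) ws Xs"
    have "length (map2 h xs ws) = n" using list_all2_lengthD[OF xs] list_all2_lengthD[OF ws] len by simp
    then show "mlin (\<lambda>ms. K (map sing ms)) (map2 h xs ws) = K (map2 h xs ws)"
      by (rule multilinear_eq_mlin[OF K, symmetric])
  qed
  finally show ?thesis .
qed

text \<open>Drops the symbols that are not generators. Composing with it turns a map given only on \<open>vspace P\<close> into
a linear map on the whole free space.\<close>

definition restr :: "('x, 'k::field) presentation \<Rightarrow> ('x \<Rightarrow>\<^sub>0 'k) \<Rightarrow> ('x \<Rightarrow>\<^sub>0 'k)" where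
  "restr P = lin_ext (\<lambda>x. if x \<in> gens P then sing x else 0)"

lemma restr_keys: "Poly_Mapping.keys (restr P f) \<subseteq> gens P"
  unfolding restr_def by (rule order_trans[OF keys_lin_ext]) (auto split: if_splits)

lemma restr_eq: "Poly_Mapping.keys f \<subseteq> gens P \<Longrightarrow> restr P f = f"
  unfolding restr_def by (subst (2) lin_ext_id[symmetric]) (auto intro!: lin_ext_cong)

lemma restr_add: "restr P (f + g) = restr P f + restr P g"
  and restr_scale: "restr P (pm_scale c f) = pm_scale c (restr P f)"
  by (simp_all add: restr_def lin_ext_add lin_ext_scale)

lemma linear_maps_lin_ext:
  assumes T: "T \<in> linear_maps P Q" and f: "Poly_Mapping.keys f \<subseteq> gens P"
  shows "cform Q (T (cls P f)) = lin_ext (\<lambda>x. cform Q (T (cls P (sing x)))) f"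
proof -
  have v: "cls P (restr P f) \<in> vspace P" for f by (rule cls_in_vspace) (rule restr_keys)
  have Tv: "T C \<in> vspace Q" if "C \<in> vspace P" for C using T that by (auto simp: linear_maps_def)
  have "cform Q (T (cls P (restr P f))) = lin_ext (\<lambda>x. cform Q (T (cls P (restr P (sing x))))) f"
  proof (rule linear_eq_lin_ext[of "\<lambda>f. cform Q (T (cls P (restr P f)))"])
    fix f g c
    have "T (cls P (restr P (f + g))) = vadd Q (T (cls P (restr P f))) (T (cls P (restr P g)))"
      using T v by (simp add: linear_maps_def restr_add vadd_cls[symmetric])
    then show "cform Q (T (cls P (restr P (f + g)))) = cform Q (T (cls P (restr P f))) + cform Q (T (cls P (restr P g)))"
      using Tv v by (simp add: cform_vadd)
    have "T (cls P (restr P (pm_scale c f))) = vscale Q c (T (cls P (restr P f)))"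
      using T v by (simp add: linear_maps_def restr_scale vscale_cls[symmetric])
    then show "cform Q (T (cls P (restr P (pm_scale c f)))) = pm_scale c (cform Q (T (cls P (restr P f))))"
      using Tv v by (simp add: cform_vscale)
  qed
  also have "\<dots> = lin_ext (\<lambda>x. cform Q (T (cls P (sing x)))) f"
    by (rule lin_ext_cong) (use f in \<open>auto simp: restr_eq\<close>)
  finally show ?thesis using f by (simp add: restr_eq)
qed

lemma ptensor_vspace:
  "length l = n \<Longrightarrow> set l \<subseteq> vspace P \<Longrightarrow> ptensor P l \<in> vspace (tpow n P)"
  unfolding ptensor_def by (auto intro!: cls_in_vspace simp: tpow_def)

lemma ptensor_add:
  assumes "set (xs @ ys) \<subseteq> vspace P" "C \<in> vspace P" "D \<in> vspace P" "Suc (length xs + length ys) = n"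
  shows "ptensor P (xs @ vadd P C D # ys) = vadd (tpow n P) (ptensor P (xs @ C # ys)) (ptensor P (xs @ D # ys))"
proof -
  have "Poly_Mapping.single ((xs @ C # ys)[length xs := vadd P C D]) 1
      - Poly_Mapping.single ((xs @ C # ys)[length xs := C]) 1
      - Poly_Mapping.single ((xs @ C # ys)[length xs := D]) (1 :: 'b) \<in> rels (tpow n P)"
    unfolding tpow_def presentation.simps
    by (rule UnI1, intro CollectI exI[of _ "xs @ C # ys"] exI[of _ "length xs"] exI[of _ C] exI[of _ D])
      (use assms in auto)
  then show ?thesis
    using assms(4) rel_span_base[of _ "tpow n P"]
    by (simp add: ptensor_def vadd_cls cls_eq_iff diff_diff_add)
qed

lemma ptensor_scale:
  assumes "set (xs @ ys) \<subseteq> vspace P" "C \<in> vspace P" "Suc (length xs + length ys) = n"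
  shows "ptensor P (xs @ vscale P c C # ys) = vscale (tpow n P) c (ptensor P (xs @ C # ys))"
proof -
  have "Poly_Mapping.single ((xs @ C # ys)[length xs := vscale P c C]) 1
      - Poly_Mapping.single ((xs @ C # ys)[length xs := C]) c \<in> rels (tpow n P)"
    unfolding tpow_def presentation.simps
    by (rule UnI2, intro CollectI exI[of _ "xs @ C # ys"] exI[of _ "length xs"] exI[of _ c] exI[of _ C])
      (use assms in auto)
  then show ?thesis
    using assms(3) rel_span_base[of _ "tpow n P"]
    by (simp add: ptensor_def vscale_cls cls_eq_iff)
qed

text \<open>The map \<open>c\<close> parametrizes cosets linearly by vectors of a free space.\<close>

lemma linear_maps_tpow_multilinear:
  fixes P :: "('x, 'k::field) presentation" and Q :: "('y, 'k) presentation"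
    and c :: "('z \<Rightarrow>\<^sub>0 'k) \<Rightarrow> ('x \<Rightarrow>\<^sub>0 'k) set"
  assumes T: "T \<in> linear_maps (tpow n P) Q"
    and c: "\<And>f. c f \<in> vspace P" "\<And>f g. c (f + g) = vadd P (c f) (c g)" "\<And>a f. c (pm_scale a f) = vscale P a (c f)"
  shows "multilinear n (\<lambda>fs. cform Q (T (ptensor P (map c fs))))"
  unfolding multilinear_def
proof (intro allI impI conjI)
  fix xs ys :: "('z \<Rightarrow>\<^sub>0 'k) list" and f g a
  assume n: "Suc (length xs + length ys) = n"
  have v: "ptensor P (map c (xs @ f # ys)) \<in> vspace (tpow n P)" for f
    by (rule ptensor_vspace) (use n c(1) in auto)
  have Tv: "T C \<in> vspace Q" if "C \<in> vspace (tpow n P)" for C using T that by (auto simp: linear_maps_def)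
  have s: "set (map c xs @ map c ys) \<subseteq> vspace P" using c(1) by auto
  have "T (ptensor P (map c (xs @ (f + g) # ys)))
      = vadd Q (T (ptensor P (map c (xs @ f # ys)))) (T (ptensor P (map c (xs @ g # ys))))"
    using T v[of f] v[of g] n by (simp add: linear_maps_def c(2) ptensor_add[OF s c(1) c(1), of n])
  then show "cform Q (T (ptensor P (map c (xs @ (f + g) # ys))))
      = cform Q (T (ptensor P (map c (xs @ f # ys)))) + cform Q (T (ptensor P (map c (xs @ g # ys))))"
    using v Tv by (simp add: cform_vadd)
  have "T (ptensor P (map c (xs @ pm_scale a f # ys))) = vscale Q a (T (ptensor P (map c (xs @ f # ys))))"
    using T v[of f] n by (simp add: linear_maps_def c(3) ptensor_scale[OF s c(1), of n])
  then show "cform Q (T (ptensor P (map c (xs @ pm_scale a f # ys))))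
      = pm_scale a (cform Q (T (ptensor P (map c (xs @ f # ys)))))"
    using v Tv by (simp add: cform_vscale)
qed

text \<open>The universal property of the tensor power. Multilinearity is asked of a map \<open>H\<close> on free spaces, to which
the cosets are transported by a linear choice of representatives \<open>c\<close>.\<close>

lemma tpow_universal:
  fixes P :: "('x, 'k::field) presentation" and Q :: "('y, 'k) presentation"
  assumes H: "multilinear n H" and keys: "\<And>fs. Poly_Mapping.keys (H fs) \<subseteq> gens Q"
    and c: "\<And>C D. C \<in> vspace P \<Longrightarrow> D \<in> vspace P \<Longrightarrow> c (vadd P C D) = c C + c D"
      "\<And>a C. C \<in> vspace P \<Longrightarrow> c (vscale P a C) = pm_scale a (c C)"
  shows "\<exists>T\<in>linear_maps (tpow n P) Q. \<forall>l. length l = n \<longrightarrow> set l \<subseteq> vspace P \<longrightarrow>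
    T (ptensor P l) = cls Q (H (map c l))"
proof -
  define t where "t l = H (map c l)" for l
  have slot: "l[i := x] = take i l @ x # drop (Suc i) l" if "i < length l" for i x and l :: "('x \<Rightarrow>\<^sub>0 'k) set list"
    using that by (rule upd_conv_take_nth_drop)
  have desc: "descend Q (lin_ext t) (cls (tpow n P) f) = cls Q (lin_ext t f)" for f
  proof (rule descend_lin_ext)
    fix r assume "r \<in> rels (tpow n P)"
    then consider (add) l i x y where "length l = n" "set l \<subseteq> vspace P" "i < n" "x \<in> vspace P" "y \<in> vspace P"
        "r = Poly_Mapping.single (l[i := vadd P x y]) 1 - Poly_Mapping.single (l[i := x]) 1 - Poly_Mapping.single (l[i := y]) 1"
      | (scale) l i a x where "length l = n" "set l \<subseteq> vspace P" "i < n" "x \<in> vspace P"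
        "r = Poly_Mapping.single (l[i := vscale P a x]) 1 - Poly_Mapping.single (l[i := x]) a"
      unfolding tpow_def by auto
    then have "lin_ext t r = 0"
    proof cases
      case add
      have "t (l[i := vadd P x y]) = t (l[i := x]) + t (l[i := y])"
        using H add c(1)[of x y] by (simp add: t_def slot multilinear_def)
      then show ?thesis using add by (simp add: lin_rel)
    next
      case scale
      have "t (l[i := vscale P a x]) = pm_scale a (t (l[i := x]))"
        using H scale c(2)[of x a] by (simp add: t_def slot multilinear_def)
      then show ?thesis using scale by (simp add: lin_rel)
    qed
    then show "lin_ext t r \<in> rel_span Q" using pm.subspace_0[OF rel_span_subspace] by simp
  qed
  define T where "T = restrict (descend Q (lin_ext t)) (vspace (tpow n P))"
  have T: "T (cls (tpow n P) f) = cls Q (lin_ext t f)" if "cls (tpow n P) f \<in> vspace (tpow n P)" for f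
    using that by (simp add: T_def desc)
  have inv: "cls Q (lin_ext t f) \<in> vspace Q" for f
    by (rule cls_in_vspace, rule order_trans[OF keys_lin_ext]) (use keys in \<open>auto simp: t_def\<close>)
  have "T \<in> linear_maps (tpow n P) Q"
    unfolding linear_maps_def
  proof (intro CollectI conjI ballI allI)
    show "T \<in> vspace (tpow n P) \<rightarrow>\<^sub>E vspace Q"
      using inv desc by (auto simp: T_def vspace_def)
    fix x y a assume x: "x \<in> vspace (tpow n P)"
    from x obtain f where f: "x = cls (tpow n P) f" by (auto simp: vspace_def)
    show "T (vscale (tpow n P) a x) = vscale Q a (T x)"
      using vscale_vspace[OF x, of a] x unfolding f vscale_cls by (simp add: T vscale_cls lin_ext_scale)
    assume y: "y \<in> vspace (tpow n P)"
    from y obtain g where g: "y = cls (tpow n P) g" by (auto simp: vspace_def)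
    show "T (vadd (tpow n P) x y) = vadd Q (T x) (T y)"
      using vadd_vspace[OF x y] x y unfolding f g vadd_cls by (simp add: T vadd_cls lin_ext_add)
  qed
  moreover have "T (ptensor P l) = cls Q (H (map c l))" if "length l = n" "set l \<subseteq> vspace P" for l
    using T[of "Poly_Mapping.single l 1"] ptensor_vspace[OF that] that by (simp add: ptensor_def t_def)
  ultimately show ?thesis by (intro bexI[of _ T]) auto
qed

lemma linear_maps_eq_on_ptensor:
  assumes T: "T \<in> linear_maps (tpow n P) Q" "T' \<in> linear_maps (tpow n P) Q"
    and eq: "\<And>l. length l = n \<Longrightarrow> set l \<subseteq> vspace P \<Longrightarrow> T (ptensor P l) = T' (ptensor P l)"
    and C: "C \<in> vspace (tpow n P)"
  shows "T C = T' C"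
proof -
  obtain f where f: "C = cls (tpow n P) f" "Poly_Mapping.keys f \<subseteq> gens (tpow n P)"
    using C by (auto simp: vspace_def)
  have "cform Q (T C) = cform Q (T' C)"
    unfolding f(1) linear_maps_lin_ext[OF T(1) f(2)] linear_maps_lin_ext[OF T(2) f(2)]
  proof (rule lin_ext_cong)
    fix l assume "l \<in> Poly_Mapping.keys f"
    then have l: "length l = n" "set l \<subseteq> vspace P" using f(2) by (auto simp: tpow_def)
    then show "cform Q (T (cls (tpow n P) (sing l))) = cform Q (T' (cls (tpow n P) (sing l)))"
      using eq[OF l] by (simp add: ptensor_def sing_def)
  qed
  moreover have "T C \<in> vspace Q" "T' C \<in> vspace Q" using T C by (auto simp: linear_maps_def)
  ultimately show ?thesis by (rule cform_inj[rotated 2])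
qed

lemma linear_maps_ext:
  assumes T: "T \<in> linear_maps P Q" "T' \<in> linear_maps P Q" and eq: "\<And>C. C \<in> vspace P \<Longrightarrow> T C = T' C"
  shows "T = T'"
  by (rule PiE_ext[of T "vspace P" "\<lambda>_. vspace Q"]) (use T eq in \<open>auto simp: linear_maps_def\<close>)

section \<open>The operations of \<O>(A) seen by the pairing\<close>

text \<open>With normal forms, equations between elements of the representation algebra become equations between
polynomials, which can be summed and extended linearly.\<close>

definition pw :: "('k::field \<Rightarrow> 'a::{ring, monoid_mult} \<Rightarrow> 'a) \<Rightarrow> 'a osym \<Rightarrow> ('N::finite \<times> 'N) list \<Rightarrow> ('a, 'N) rmonom \<Rightarrow>\<^sub>0 'k" where
  "pw smul x w = nform (Rep smul) (pair_sym x w)"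

definition pval :: "('k::field \<Rightarrow> 'a::{ring, monoid_mult} \<Rightarrow> 'a) \<Rightarrow> ('a osym \<Rightarrow>\<^sub>0 'k) set \<Rightarrow> ('N::finite \<times> 'N) list \<Rightarrow> ('a, 'N) rmonom \<Rightarrow>\<^sub>0 'k" where
  "pval smul \<alpha> w = cform (Rep smul) (pairing smul \<alpha> (sing w))"

lemma cform_pairing_cls:
  fixes f :: "'a::{ring, monoid_mult} osym \<Rightarrow>\<^sub>0 'k::field"
  shows "cform (Rep smul) (pairing smul (cls (OA smul) f) X) = lin_ext (\<lambda>x. lin_ext (pw smul x) X) f"
proof -
  have 1: "nform (Rep smul) (lin_ext g f) = lin_ext (\<lambda>x. nform (Rep smul) (g x)) f" for g and f :: "'x \<Rightarrow>\<^sub>0 'k"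
    by (rule linear_lin_ext) (simp_all add: nform_add nform_scale)
  show ?thesis by (simp add: pairing_cls 1 pw_def[abs_def])
qed

lemma pval_cls: "pval smul (cls (OA smul) f) w = lin_ext (\<lambda>x. pw smul x w) f"
  by (simp add: pval_def cform_pairing_cls)

lemma pairing_in_vspace: "\<alpha> \<in> vspace (OA smul) \<Longrightarrow> pairing smul \<alpha> X \<in> vspace (Rep smul)"
  by (auto simp: vspace_def pairing_cls Rep_def)

lemma cform_pairing:
  assumes "\<alpha> \<in> vspace (OA smul)"
  shows "cform (Rep smul) (pairing smul \<alpha> X) = lin_ext (pval smul \<alpha>) X"
proof -
  obtain f where f: "\<alpha> = cls (OA smul) f" using assms by (auto simp: vspace_def)
  show ?thesis unfolding f cform_pairing_cls pval_cls[abs_def] by (rule lin_ext_swap)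
qed

lemma OA_hom_vspace: "\<alpha> \<in> OA_hom smul d \<Longrightarrow> \<alpha> \<in> vspace (OA smul)"
  by (auto simp: OA_hom_def vspace_def OA_def)

text \<open>Pairings see only one degree at a time.\<close>

lemma pw_length:
  fixes smul :: "'k::field \<Rightarrow> 'a::{ring, monoid_mult} \<Rightarrow> 'a"
  shows "x \<in> osyms d \<Longrightarrow> length w \<noteq> d \<Longrightarrow> pw smul x w = 0"
proof -
  assume "x \<in> osyms d" "length w \<noteq> d"
  then have "pair_sym x w = (0 :: _ \<Rightarrow>\<^sub>0 'k)" by (auto simp: pair_sym_def osyms_def split: prod.split)
  then show ?thesis by (simp add: pw_def nform_eq_0 pm.subspace_0[OF rel_span_subspace])
qed

lemma pval_length: "\<alpha> \<in> OA_hom smul d \<Longrightarrow> length w \<noteq> d \<Longrightarrow> pval smul \<alpha> w = 0"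
proof -
  assume \<alpha>: "\<alpha> \<in> OA_hom smul d" and w: "length w \<noteq> d"
  obtain f where f: "\<alpha> = cls (OA smul) f" "Poly_Mapping.keys f \<subseteq> osyms d" using \<alpha> by (auto simp: OA_hom_def)
  have "lin_ext (\<lambda>x. pw smul x w) f = lin_ext (\<lambda>x. 0) f"
    by (rule lin_ext_cong) (use f w pw_length in blast)
  then show ?thesis by (simp add: f pval_cls)
qed

text \<open>The factors are indexed by the place \<open>s\<close> of the first index instead of the place \<open>u s\<close> of the second one.\<close>

lemma pair_sym_alt:
  assumes u: "u permutes {1..length as}" and len: "length w = length as"
  shows "pair_sym (as, fs, u) w =
    ((\<Prod>s = 1..length as. rvar (as ! (u s - 1)) (fst (w ! (s - 1))) (snd (w ! (u s - 1))))
     * (\<Prod>a\<in>#fs. \<Sum>i\<in>UNIV. rvar a i i) :: _ \<Rightarrow>\<^sub>0 'k::field)"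
proof -
  have "(\<Prod>t = 1..length as. rvar (as ! (t - 1)) (fst (w ! (inv u t - 1))) (snd (w ! (t - 1))))
     = (\<Prod>s = 1..length as. rvar (as ! (u s - 1)) (fst (w ! (s - 1))) (snd (w ! (u s - 1))) :: _ \<Rightarrow>\<^sub>0 'k)"
    by (rule prod.reindex_bij_witness[of _ u "inv u"])
      (use permutes_inverses[OF u] permutes_in_image[OF u] permutes_in_image[OF permutes_inv[OF u]] in auto)
  then show ?thesis using len by (simp add: pair_sym_def)
qed

lemma prod_atLeast1_shift: "(\<Prod>s = 1..Suc n. F s) = F 1 * (\<Prod>s = 1..n. F (Suc s) :: 'c::comm_monoid_mult)"
proof -
  have e: "{1..Suc n} = insert 1 (Suc ` {1..n})" by (auto simp: image_Suc_atLeastAtMost)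
  have "prod F {1..Suc n} = F 1 * prod F (Suc ` {1..n})" unfolding e by (rule prod.insert) auto
  also have "prod F (Suc ` {1..n}) = prod (F \<circ> Suc) {1..n}" by (rule prod.reindex) simp
  finally show ?thesis by (simp only: o_def)
qed

text \<open>If \<open>u 1 = 1\<close>, then summing over \<open>k\<close> turns the factor of the first letter into a trace. Otherwise \<open>k\<close>
occurs in exactly two factors \<open>a\<^sub>i\<^sub>k\<close> and \<open>b\<^sub>k\<^sub>j\<close>, with \<open>b\<close> the letter at place \<open>u 1\<close>, and the sum over \<open>k\<close> is
\<open>(ab)\<^sub>i\<^sub>j\<close> by the relation for products.\<close>

lemma pair_sym_pi:
  assumes x: "x \<in> osyms (Suc d)" and w: "length (w :: ('N::finite \<times> 'N) list) = d"
  shows "lin_ext (\<lambda>y. pair_sym y w) (pi_sym x) - (\<Sum>k\<in>UNIV. pair_sym x ((k, k) # w))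
    \<in> rel_span (Rep smul :: (('a::{ring,monoid_mult}, 'N) rmonom, 'k::field) presentation)"
proof -
  obtain as fs u a where x_eq: "x = (a # as, fs, u)" and len: "length as = d" and u: "u permutes {1..Suc d}"
    using x by (cases x) (auto simp: osyms_def length_Suc_conv)
  let ?v = "perm_star u"
  have v: "?v permutes {1..d}" using u by (rule perm_star_permutes)
  have im: "u i \<in> {1..Suc d} \<longleftrightarrow> i \<in> {1..Suc d}" for i using permutes_in_image[OF u] by blast
  have inj: "u i = u j \<longleftrightarrow> i = j" for i j using permutes_inj[OF u] by (auto dest: injD)
  let ?tr = "\<Prod>a\<in>#fs. \<Sum>i\<in>UNIV. rvar a i i :: ('a, 'N) rmonom \<Rightarrow>\<^sub>0 'k"
  have rhs: "pair_sym x ((k, k) # w) =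
     rvar ((a # as) ! (u 1 - 1)) k (snd (((k, k) # w) ! (u 1 - 1))) *
     (\<Prod>s = 1..d. rvar ((a # as) ! (u (Suc s) - 1)) (fst (w ! (s - 1))) (snd (((k, k) # w) ! (u (Suc s) - 1)))) * ?tr" for k
    unfolding x_eq using u len w
    by (subst pair_sym_alt; simp only: length_Cons prod_atLeast1_shift)
      (intro arg_cong2[of _ _ _ _ "(*)"] prod.cong refl; auto simp: nth_Cons')
  show ?thesis
  proof (cases "u 1 = 1")
    case True
    have "(\<Sum>k\<in>UNIV. pair_sym x ((k, k) # w)) = (\<Sum>k\<in>UNIV. rvar a k k * (\<Prod>s = 1..d. rvar ((a # as) ! (u (Suc s) - 1)) (fst (w ! (s - 1))) (snd (((k, k) # w) ! (u (Suc s) - 1)))) * ?tr)"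
      unfolding rhs using True by simp
    also have "\<dots> = (\<Sum>k\<in>UNIV. rvar a k k * (\<Prod>s = 1..d. rvar (as ! (?v s - 1)) (fst (w ! (s - 1))) (snd (w ! (?v s - 1)))) * ?tr)"
    proof (intro sum.cong refl arg_cong2[of _ _ _ _ "(*)"] prod.cong)
      fix k s assume s: "s \<in> {1..d}"
      then have "u (Suc s) \<noteq> 1" "u (Suc s) \<ge> 1" using inj[of "Suc s" 1] True im[of "Suc s"] by auto
      then have "\<exists>r. u (Suc s) = Suc (Suc r)" by (intro exI[of _ "u (Suc s) - 2"]) linarith
      then obtain r where "u (Suc s) = Suc (Suc r)" ..
      then show "rvar ((a # as) ! (u (Suc s) - 1)) (fst (w ! (s - 1))) (snd (((k, k) # w) ! (u (Suc s) - 1)))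
         = rvar (as ! (?v s - 1)) (fst (w ! (s - 1))) (snd (w ! (?v s - 1)))"
        using s by (simp add: perm_star_def)
    qed
    also have "\<dots> = pair_sym (as, add_mset a fs, ?v) w"
      using v len w by (subst pair_sym_alt) (auto simp: sum_distrib_right sum_distrib_left mult_ac)
    finally show ?thesis using True by (simp add: x_eq pm.subspace_0[OF rel_span_subspace])
  next
    case False
    then have "u 1 = Suc (Suc (u 1 - 2)) \<and> u 1 - 2 < d" using im[of 1] by auto
    then obtain K where K: "u 1 = Suc (Suc K)" "K < d" by blast
    \<comment> \<open>The place in the word whose first index goes with the first letter of the symbol.\<close>
    obtain p where p: "u (Suc p) = 1" "p \<in> {1..d}"
    proof -
      have "u (inv u 1) = 1" using permutes_inverses(1)[OF u] .
      moreover have "inv u 1 \<in> {1..Suc d}" using permutes_in_image[OF permutes_inv[OF u], of 1] by auto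
      moreover have "inv u 1 \<noteq> 1" using False calculation(1) by auto
      ultimately have "Suc (inv u 1 - 1) = inv u 1" "inv u 1 - 1 \<in> {1..d}" by auto
      then show thesis using that[of "inv u 1 - 1"] permutes_inverses(1)[OF u, of 1] by simp
    qed
    let ?as = "as[K := a * as ! K]"
    define Rest where "Rest = (\<Prod>s\<in>{1..d} - {p}. rvar (as ! (?v s - 1)) (fst (w ! (s - 1))) (snd (w ! (?v s - 1)))) * ?tr"
    have vp: "?v p = Suc K" using p K by (auto simp: perm_star_def)
    have vs: "u (Suc s) = Suc (?v s)" "?v s \<noteq> Suc K" "?v s \<ge> 1" if "s \<in> {1..d} - {p}" for s
    proof -
      have "u (Suc s) \<noteq> 1" using inj[of "Suc s" "Suc p"] p that by auto
      moreover have "u (Suc s) \<ge> 1" using im[of "Suc s"] that by auto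
      ultimately show 1: "u (Suc s) = Suc (?v s)" using that by (auto simp: perm_star_def)
      show "?v s \<noteq> Suc K"
      proof
        assume "?v s = Suc K"
        then have "?v s = ?v p" using vp by simp
        then have "s = p" by (rule injD[OF permutes_inj[OF v]])
        then show False using that by simp
      qed
      show "?v s \<ge> 1" using permutes_in_image[OF v, of s] that by auto
    qed
    have "pair_sym (?as, fs, ?v) w = (\<Prod>s = 1..d. rvar (?as ! (?v s - 1)) (fst (w ! (s - 1))) (snd (w ! (?v s - 1))) :: ('a, 'N) rmonom \<Rightarrow>\<^sub>0 'k) * ?tr"
      using v len w by (subst pair_sym_alt) auto
    also have "(\<Prod>s = 1..d. rvar (?as ! (?v s - 1)) (fst (w ! (s - 1))) (snd (w ! (?v s - 1))))
        = (rvar (?as ! (?v p - 1)) (fst (w ! (p - 1))) (snd (w ! (?v p - 1))) :: ('a, 'N) rmonom \<Rightarrow>\<^sub>0 'k) * (\<Prod>s\<in>{1..d} - {p}. rvar (?as ! (?v s - 1)) (fst (w ! (s - 1))) (snd (w ! (?v s - 1))))"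
      by (rule prod.remove) (use p in auto)
    also have "(\<Prod>s\<in>{1..d} - {p}. rvar (?as ! (?v s - 1)) (fst (w ! (s - 1))) (snd (w ! (?v s - 1)))) = (\<Prod>s\<in>{1..d} - {p}. rvar (as ! (?v s - 1)) (fst (w ! (s - 1))) (snd (w ! (?v s - 1))) :: ('a, 'N) rmonom \<Rightarrow>\<^sub>0 'k)"
    proof (rule prod.cong[OF refl])
      fix s assume "s \<in> {1..d} - {p}"
      from vs(2,3)[OF this] have "?v s - 1 \<noteq> K" by linarith
      then show "rvar (?as ! (?v s - 1)) (fst (w ! (s - 1))) (snd (w ! (?v s - 1)))
          = (rvar (as ! (?v s - 1)) (fst (w ! (s - 1))) (snd (w ! (?v s - 1))) :: ('a, 'N) rmonom \<Rightarrow>\<^sub>0 'k)" by simp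
    qed
    finally have lhs: "pair_sym (?as, fs, ?v) w = rvar (a * as ! K) (fst (w ! (p - 1))) (snd (w ! K)) * Rest"
      using K len by (simp add: vp Rest_def mult.assoc)
    have rhs': "pair_sym x ((k, k) # w) = rvar a (fst (w ! (p - 1))) k * rvar (as ! K) k (snd (w ! K)) * Rest" for k
    proof -
      have "(\<Prod>s = 1..d. rvar ((a # as) ! (u (Suc s) - 1)) (fst (w ! (s - 1))) (snd (((k, k) # w) ! (u (Suc s) - 1))))
          = rvar ((a # as) ! (u (Suc p) - 1)) (fst (w ! (p - 1))) (snd (((k, k) # w) ! (u (Suc p) - 1))) *
            (\<Prod>s\<in>{1..d} - {p}. rvar ((a # as) ! (u (Suc s) - 1)) (fst (w ! (s - 1))) (snd (((k, k) # w) ! (u (Suc s) - 1))) :: ('a, 'N) rmonom \<Rightarrow>\<^sub>0 'k)"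
        by (rule prod.remove) (use p in auto)
      also have "(\<Prod>s\<in>{1..d} - {p}. rvar ((a # as) ! (u (Suc s) - 1)) (fst (w ! (s - 1))) (snd (((k, k) # w) ! (u (Suc s) - 1))))
         = (\<Prod>s\<in>{1..d} - {p}. rvar (as ! (?v s - 1)) (fst (w ! (s - 1))) (snd (w ! (?v s - 1))) :: ('a, 'N) rmonom \<Rightarrow>\<^sub>0 'k)"
      proof (rule prod.cong[OF refl])
        fix s assume "s \<in> {1..d} - {p}"
        note vs[OF this]
        moreover then obtain r where "?v s = Suc r" by (cases "?v s") auto
        ultimately show "rvar ((a # as) ! (u (Suc s) - 1)) (fst (w ! (s - 1))) (snd (((k, k) # w) ! (u (Suc s) - 1)))
          = (rvar (as ! (?v s - 1)) (fst (w ! (s - 1))) (snd (w ! (?v s - 1))) :: ('a, 'N) rmonom \<Rightarrow>\<^sub>0 'k)" by simp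
      qed
      finally show ?thesis unfolding rhs using p K by (simp add: Rest_def mult_ac)
    qed
    have "rvar (a * as ! K) (fst (w ! (p - 1))) (snd (w ! K)) * Rest
        - (\<Sum>k\<in>UNIV. rvar a (fst (w ! (p - 1))) k * rvar (as ! K) k (snd (w ! K)) * Rest) \<in> rel_span (Rep smul)"
      using idl_mult(2)[OF rvar_rels(3)[of a "as ! K" "fst (w ! (p - 1))" "snd (w ! K)" smul], of Rest]
      by (simp add: left_diff_distrib sum_distrib_right)
    then show ?thesis using False K by (simp add: x_eq lhs rhs'[unfolded x_eq])
  qed
qed

lemma permutes_atMost_iff:
  assumes "u permutes {1..n::nat}"
  shows "u i \<le> n \<longleftrightarrow> i \<le> n" "u i = 0 \<longleftrightarrow> i = 0"
proof -
  have "u i \<in> {1..n} \<longleftrightarrow> i \<in> {1..n}" using permutes_in_image[OF assms] by blast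
  moreover have "i \<notin> {1..n} \<Longrightarrow> u i = i" using permutes_not_in[OF assms] by blast
  ultimately show "u i \<le> n \<longleftrightarrow> i \<le> n" "u i = 0 \<longleftrightarrow> i = 0" by (cases "i \<in> {1..n}"; force)+
qed

lemma perm_times_comp:
  assumes "u' permutes {1..n}" "v' permutes {1..m}"
  shows "perm_times n u v (perm_times n u' v' i) = perm_times n (u \<circ> u') (v \<circ> v') i"
  using permutes_atMost_iff[OF assms(1), of i] permutes_atMost_iff(2)[OF assms(2), of "i - n"]
  by (auto simp: perm_times_def)

lemma perm_times_permutes:
  assumes u: "u permutes {1..n}" and v: "v permutes {1..m}"
  shows "perm_times n u v permutes {1..n + m}"
proof -
  have id: "perm_times n id id i = i" for i by (simp add: perm_times_def)
  have "bij (perm_times n u v)"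
  proof (rule o_bij[of "perm_times n (inv u) (inv v)"])
    show "perm_times n (inv u) (inv v) \<circ> perm_times n u v = id"
      using id by (simp add: fun_eq_iff perm_times_comp[OF u v] permutes_inv_o[OF u] permutes_inv_o[OF v])
    show "perm_times n u v \<circ> perm_times n (inv u) (inv v) = id"
      using id by (simp add: fun_eq_iff perm_times_comp[OF permutes_inv[OF u] permutes_inv[OF v]] permutes_inv_o[OF u] permutes_inv_o[OF v])
  qed
  moreover have "perm_times n u v i = i" if "i \<notin> {1..n + m}" for i
  proof -
    have "i - n \<notin> {1..m}" "i \<notin> {1..n}" using that by auto
    then have "v (i - n) = i - n" "u i = i" using permutes_not_in[OF u] permutes_not_in[OF v] by blast+
    then show ?thesis by (simp add: perm_times_def)
  qed
  ultimately show ?thesis by (simp add: permutes_def bij_iff)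
qed

text \<open>The new letter contributes the factor \<open>1\<^sub>p\<^sub>q\<close>.\<close>

lemma pair_sym_one:
  assumes x: "x \<in> osyms d" and w: "length (w :: ('N::finite \<times> 'N) list) = d"
  shows "lin_ext (\<lambda>y. pair_sym y ((p, q) # w)) (one_sym x) - (if p = q then pair_sym x w else 0)
    \<in> rel_span (Rep smul :: (('a::{ring,monoid_mult}, 'N) rmonom, 'k::field) presentation)"
proof -
  obtain as fs u where x_eq: "x = (as, fs, u)" and len: "length as = d" and u: "u permutes {1..d}"
    using x by (cases x) (auto simp: osyms_def)
  have pt: "perm_times 1 id u permutes {1..Suc d}"
    using perm_times_permutes[of id 1 u d] u by (simp add: permutes_id)
  have us: "u s = Suc (u s - 1)" if "s \<in> {1..d}" for s using permutes_in_image[OF u, of s] that by auto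
  have "pair_sym (1 # as, fs, perm_times 1 id u) ((p, q) # w) = rvar 1 p q * (pair_sym x w :: ('a, 'N) rmonom \<Rightarrow>\<^sub>0 'k)"
  proof -
    have "pair_sym (1 # as, fs, perm_times 1 id u) ((p, q) # w) = (\<Prod>s = 1..Suc d. rvar ((1 # as) ! (perm_times 1 id u s - 1)) (fst (((p, q) # w) ! (s - 1))) (snd (((p, q) # w) ! (perm_times 1 id u s - 1)))) * (\<Prod>a\<in>#fs. \<Sum>i\<in>UNIV. rvar a i i :: ('a, 'N) rmonom \<Rightarrow>\<^sub>0 'k)"
      using pt len w by (subst pair_sym_alt) auto
    also have "(\<Prod>s = 1..Suc d. rvar ((1 # as) ! (perm_times 1 id u s - 1)) (fst (((p, q) # w) ! (s - 1))) (snd (((p, q) # w) ! (perm_times 1 id u s - 1))))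
       = rvar 1 p q * (\<Prod>s = 1..d. rvar (as ! (u s - 1)) (fst (w ! (s - 1))) (snd (w ! (u s - 1))) :: ('a, 'N) rmonom \<Rightarrow>\<^sub>0 'k)"
      unfolding prod_atLeast1_shift
    proof (rule arg_cong2[of _ _ _ _ "(*)"], goal_cases)
      case 2
      show ?case
      proof (rule prod.cong[OF refl])
        fix s assume s: "s \<in> {1..d}"
        then obtain r where "u s = Suc r" using us by blast
        moreover obtain s' where "s = Suc s'" using s by (cases s) auto
        ultimately show "rvar ((1 # as) ! (perm_times 1 id u (Suc s) - 1)) (fst (((p, q) # w) ! (Suc s - 1))) (snd (((p, q) # w) ! (perm_times 1 id u (Suc s) - 1)))
          = (rvar (as ! (u s - 1)) (fst (w ! (s - 1))) (snd (w ! (u s - 1))) :: ('a, 'N) rmonom \<Rightarrow>\<^sub>0 'k)"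
          by (simp add: perm_times_def)
      qed
    qed (simp add: perm_times_def)
    moreover have "pair_sym x w = (\<Prod>s = 1..d. rvar (as ! (u s - 1)) (fst (w ! (s - 1))) (snd (w ! (u s - 1)))) * (\<Prod>a\<in>#fs. \<Sum>i\<in>UNIV. rvar a i i :: ('a, 'N) rmonom \<Rightarrow>\<^sub>0 'k)"
      using u len w by (simp add: x_eq pair_sym_alt)
    ultimately show ?thesis by (simp only: mult.assoc)
  qed
  then have "lin_ext (\<lambda>y. pair_sym y ((p, q) # w)) (one_sym x) = rvar 1 p q * (pair_sym x w :: ('a, 'N) rmonom \<Rightarrow>\<^sub>0 'k)"
    by (simp add: one_sym_def x_eq)
  moreover have "(rvar 1 p q - (if p = q then 1 else 0)) * pair_sym x w \<in> rel_span (Rep smul)"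
    by (rule idl_mult(2)) (rule rvar_rel_one)
  ultimately show ?thesis by (simp add: left_diff_distrib split: if_splits)
qed

text \<open>What left multiplication of a symbol by \<open>\<sigma>\<close> does to the word it is paired with; \<open>permute_fst\<close> describes right
multiplication by \<open>inv \<sigma>\<close>.\<close>

definition permute_snd :: "(nat \<Rightarrow> nat) \<Rightarrow> ('N \<times> 'N) list \<Rightarrow> ('N \<times> 'N) list" where
  "permute_snd \<sigma> w = map (\<lambda>s. (fst (w ! (s - 1)), snd (w ! (\<sigma> s - 1)))) [1..<Suc (length w)]"

definition permute_fst :: "(nat \<Rightarrow> nat) \<Rightarrow> ('N \<times> 'N) list \<Rightarrow> ('N \<times> 'N) list" where
  "permute_fst \<sigma> w = map (\<lambda>s. (fst (w ! (\<sigma> s - 1)), snd (w ! (s - 1)))) [1..<Suc (length w)]"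

lemma length_permute_snd_fst [simp]: "length (permute_snd \<sigma> w) = length w" "length (permute_fst \<sigma> w) = length w"
  by (simp_all add: permute_snd_def permute_fst_def del: upt_Suc)

lemma nth_permute_snd: "j < length w \<Longrightarrow> permute_snd \<sigma> w ! j = (fst (w ! j), snd (w ! (\<sigma> (Suc j) - 1)))"
  by (simp add: permute_snd_def del: upt_Suc)

lemma nth_permute_fst: "j < length w \<Longrightarrow> permute_fst \<sigma> w ! j = (fst (w ! (\<sigma> (Suc j) - 1)), snd (w ! j))"
  by (simp add: permute_fst_def del: upt_Suc)

lemma pair_sym_left:
  assumes x: "x \<in> osyms d" and w: "length (w :: ('N::finite \<times> 'N) list) = d" and s: "\<sigma> permutes {1..d}"
  shows "lin_ext (\<lambda>y. pair_sym y w) (left_sym \<sigma> x) = (pair_sym x (permute_snd \<sigma> w) :: _ \<Rightarrow>\<^sub>0 'k::field)"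
proof -
  obtain as fs u where x_eq: "x = (as, fs, u)" and len: "length as = d" and u: "u permutes {1..d}"
    using x by (cases x) (auto simp: osyms_def)
  define as' where "as' = map (\<lambda>t. as ! (inv \<sigma> t - 1)) [1..<Suc (length as)]"
  have len': "length as' = d" by (simp add: as'_def len del: upt_Suc)
  have "lin_ext (\<lambda>y. pair_sym y w) (left_sym \<sigma> x) = (pair_sym (as', fs, \<sigma> \<circ> u) w :: _ \<Rightarrow>\<^sub>0 'k)"
    using s len by (simp add: left_sym_def x_eq as'_def del: upt_Suc)
  also have "\<dots> = pair_sym (as, fs, u) (permute_snd \<sigma> w)"
  proof -
    have su: "\<sigma> \<circ> u permutes {1..length as'}" using u s len' by (simp add: permutes_compose)
    have "(\<Prod>t = 1..d. rvar (as' ! ((\<sigma> \<circ> u) t - 1)) (fst (w ! (t - 1))) (snd (w ! ((\<sigma> \<circ> u) t - 1))))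
       = (\<Prod>t = 1..d. rvar (as ! (u t - 1)) (fst (permute_snd \<sigma> w ! (t - 1))) (snd (permute_snd \<sigma> w ! (u t - 1))) :: _ \<Rightarrow>\<^sub>0 'k)"
    proof (rule prod.cong[OF refl])
      fix t assume t: "t \<in> {1..d}"
      have ut: "u t \<in> {1..d}" using permutes_in_image[OF u] t by blast
      have sut: "\<sigma> (u t) \<in> {1..d}" using permutes_in_image[OF s] ut by blast
      have nth: "as' ! j = as ! (inv \<sigma> (Suc j) - 1)" if "j < d" for j
        using that len by (simp add: as'_def del: upt_Suc)
      have "Suc (\<sigma> (u t) - 1) = \<sigma> (u t)" "\<sigma> (u t) - 1 < d" using sut by auto
      with nth[of "\<sigma> (u t) - 1"] have "as' ! (\<sigma> (u t) - 1) = as ! (inv \<sigma> (\<sigma> (u t)) - 1)" by simp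
      also have "inv \<sigma> (\<sigma> (u t)) = u t" by (rule permutes_inverses(2)[OF s])
      finally show "rvar (as' ! ((\<sigma> \<circ> u) t - 1)) (fst (w ! (t - 1))) (snd (w ! ((\<sigma> \<circ> u) t - 1)))
        = rvar (as ! (u t - 1)) (fst (permute_snd \<sigma> w ! (t - 1))) (snd (permute_snd \<sigma> w ! (u t - 1)))"
        using t ut w by (auto simp: nth_permute_snd)
    qed
    then show ?thesis using su u len len' w by (simp add: pair_sym_alt)
  qed
  finally show ?thesis by (simp add: x_eq)
qed

lemma pair_sym_right:
  assumes x: "x \<in> osyms d" and w: "length (w :: ('N::finite \<times> 'N) list) = d" and s: "\<sigma> permutes {1..d}"
  shows "lin_ext (\<lambda>y. pair_sym y w) (right_sym \<sigma> x) = (pair_sym x (permute_fst (inv \<sigma>) w) :: _ \<Rightarrow>\<^sub>0 'k::field)"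
proof -
  obtain as fs u where x_eq: "x = (as, fs, u)" and len: "length as = d" and u: "u permutes {1..d}"
    using x by (cases x) (auto simp: osyms_def)
  have "lin_ext (\<lambda>y. pair_sym y w) (right_sym \<sigma> x) = (pair_sym (as, fs, u \<circ> \<sigma>) w :: _ \<Rightarrow>\<^sub>0 'k)"
    using s len by (simp add: right_sym_def x_eq)
  also have "\<dots> = pair_sym (as, fs, u) (permute_fst (inv \<sigma>) w)"
  proof -
    have us: "u \<circ> \<sigma> permutes {1..length as}" using u s len by (simp add: permutes_compose)
    have "(\<Prod>t = 1..d. rvar (as ! ((u \<circ> \<sigma>) t - 1)) (fst (w ! (t - 1))) (snd (w ! ((u \<circ> \<sigma>) t - 1))))
       = (\<Prod>t = 1..d. rvar (as ! (u t - 1)) (fst (permute_fst (inv \<sigma>) w ! (t - 1))) (snd (permute_fst (inv \<sigma>) w ! (u t - 1))) :: _ \<Rightarrow>\<^sub>0 'k)"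
    proof (rule prod.reindex_bij_witness[of _ "inv \<sigma>" \<sigma>])
      fix t assume t: "t \<in> {1..d}"
      show "\<sigma> t \<in> {1..d}" "inv \<sigma> t \<in> {1..d}" "inv \<sigma> (\<sigma> t) = t" "\<sigma> (inv \<sigma> t) = t"
        using permutes_in_image[OF s] permutes_in_image[OF permutes_inv[OF s]] t permutes_inverses[OF s] by blast+
      have "u (\<sigma> t) \<in> {1..d}" "\<sigma> t \<in> {1..d}" using permutes_in_image[OF u] permutes_in_image[OF s] t by blast+
      then show "rvar (as ! (u (\<sigma> t) - 1)) (fst (permute_fst (inv \<sigma>) w ! (\<sigma> t - 1))) (snd (permute_fst (inv \<sigma>) w ! (u (\<sigma> t) - 1)))
         = (rvar (as ! ((u \<circ> \<sigma>) t - 1)) (fst (w ! (t - 1))) (snd (w ! ((u \<circ> \<sigma>) t - 1))) :: _ \<Rightarrow>\<^sub>0 'k)"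
        using w t permutes_inverses(2)[OF s] by (auto simp: nth_permute_fst)
    qed
    then show ?thesis using us u len w by (simp add: pair_sym_alt)
  qed
  finally show ?thesis by (simp add: x_eq)
qed

lemma OA_hom_cases:
  assumes "\<alpha> \<in> OA_hom smul d"
  obtains f where "\<alpha> = cls (OA smul) f" "Poly_Mapping.keys f \<subseteq> osyms d"
  using assms by (auto simp: OA_hom_def)

lemma OA_hom_cls: "Poly_Mapping.keys f \<subseteq> osyms d \<Longrightarrow> cls (OA smul) f \<in> OA_hom smul d"
  by (auto simp: OA_hom_def)

lemma pval_lin_ext:
  assumes f: "Poly_Mapping.keys f \<subseteq> osyms d"
    and T: "\<And>x. x \<in> osyms d \<Longrightarrow> nform (Rep smul) (lin_ext (\<lambda>y. pair_sym y w) (T x)) = F x"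
  shows "pval smul (cls (OA smul) (lin_ext T f)) w = lin_ext F f"
  unfolding pval_cls lin_ext_comp
proof (rule lin_ext_cong)
  fix x assume "x \<in> Poly_Mapping.keys f"
  then have "x \<in> osyms d" using f by auto
  from T[OF this] show "lin_ext (\<lambda>x. pw smul x w) (T x) = F x"
    by (simp add: nform_lin_ext pw_def)
qed

lemma pval_op_pi:
  fixes smul :: "'k::field \<Rightarrow> 'b::{ring, monoid_mult} \<Rightarrow> 'b"
  assumes A: "assoc_algebra smul" and \<alpha>: "\<alpha> \<in> OA_hom smul (Suc d)" and w: "length w = d"
  shows "pval smul (op_pi smul \<alpha>) w = (\<Sum>k\<in>UNIV. pval smul \<alpha> ((k, k) # w))"
proof -
  obtain f where f: "\<alpha> = cls (OA smul) f" "Poly_Mapping.keys f \<subseteq> osyms (Suc d)"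
    using \<alpha> by (rule OA_hom_cases)
  have "pval smul (cls (OA smul) (lin_ext pi_sym f)) w = lin_ext (\<lambda>x. \<Sum>k\<in>UNIV. pw smul x ((k, k) # w)) f"
  proof (rule pval_lin_ext[OF f(2)])
    fix x :: "'b osym" assume "x \<in> osyms (Suc d)"
    from pair_sym_pi[OF this w, of smul]
    show "nform (Rep smul) (lin_ext (\<lambda>y. pair_sym y w) (pi_sym x)) = (\<Sum>k\<in>UNIV. pw smul x ((k, k) # w))"
      by (simp only: nform_eq_iff[symmetric] nform_sum pw_def)
  qed
  then show ?thesis
    by (simp add: f(1) assoc_algebra.op_pi_cls[OF A] lin_ext_fun_sum pval_cls)
qed

lemma op_pi_hom:
  fixes smul :: "'k::field \<Rightarrow> 'b::{ring, monoid_mult} \<Rightarrow> 'b"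
  assumes A: "assoc_algebra smul" and \<alpha>: "\<alpha> \<in> OA_hom smul (Suc d)"
  shows "op_pi smul \<alpha> \<in> OA_hom smul d"
proof -
  obtain f where f: "\<alpha> = cls (OA smul) f" "Poly_Mapping.keys f \<subseteq> osyms (Suc d)"
    using \<alpha> by (rule OA_hom_cases)
  have "Poly_Mapping.keys (pi_sym x :: 'b osym \<Rightarrow>\<^sub>0 'k) \<subseteq> osyms d" if "x \<in> osyms (Suc d)" for x :: "'b osym"
    using that perm_star_permutes[of "snd (snd x)" d]
    by (cases x; cases "fst x") (auto simp: osyms_def)
  then show ?thesis unfolding f(1) assoc_algebra.op_pi_cls[OF A]
    by (intro OA_hom_cls keys_lin_ext_subset[OF f(2)])
qed

lemma pval_op_one:
  fixes smul :: "'k::field \<Rightarrow> 'b::{ring, monoid_mult} \<Rightarrow> 'b"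
  assumes \<alpha>: "\<alpha> \<in> OA_hom smul d" and w: "length w = d"
  shows "pval smul (op_one smul \<alpha>) ((p, q) # w) = (if p = q then pval smul \<alpha> w else 0)"
proof -
  obtain f where f: "\<alpha> = cls (OA smul) f" "Poly_Mapping.keys f \<subseteq> osyms d"
    using \<alpha> by (rule OA_hom_cases)
  have "pval smul (cls (OA smul) (lin_ext one_sym f)) ((p, q) # w) = lin_ext (\<lambda>x. if p = q then pw smul x w else 0) f"
  proof (rule pval_lin_ext[OF f(2)])
    fix x :: "'b osym" assume "x \<in> osyms d"
    from pair_sym_one[OF this w, of p q smul]
    show "nform (Rep smul) (lin_ext (\<lambda>y. pair_sym y ((p, q) # w)) (one_sym x)) = (if p = q then pw smul x w else 0)"
      by (simp add: nform_eq_iff[symmetric] pw_def split: if_splits)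
  qed
  then show ?thesis by (simp add: f(1) op_one_cls pval_cls)
qed

lemma op_one_hom:
  fixes smul :: "'k::field \<Rightarrow> 'b::{ring, monoid_mult} \<Rightarrow> 'b"
  assumes \<alpha>: "\<alpha> \<in> OA_hom smul d"
  shows "op_one smul \<alpha> \<in> OA_hom smul (Suc d)"
proof -
  obtain f where f: "\<alpha> = cls (OA smul) f" "Poly_Mapping.keys f \<subseteq> osyms d"
    using \<alpha> by (rule OA_hom_cases)
  have "Poly_Mapping.keys (one_sym x :: 'b osym \<Rightarrow>\<^sub>0 'k) \<subseteq> osyms (Suc d)" if "x \<in> osyms d" for x :: "'b osym"
    using that perm_times_permutes[of id 1 "snd (snd x)" d]
    by (cases x) (auto simp: osyms_def one_sym_def permutes_id)
  then show ?thesis unfolding f(1) op_one_cls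
    by (intro OA_hom_cls keys_lin_ext_subset[OF f(2)])
qed

lemma pval_left_act:
  fixes smul :: "'k::field \<Rightarrow> 'b::{ring, monoid_mult} \<Rightarrow> 'b"
  assumes \<alpha>: "\<alpha> \<in> OA_hom smul d" and w: "length w = d" and s: "\<sigma> permutes {1..d}"
  shows "pval smul (left_act smul \<sigma> \<alpha>) w = pval smul \<alpha> (permute_snd \<sigma> w)"
proof -
  obtain f where f: "\<alpha> = cls (OA smul) f" "Poly_Mapping.keys f \<subseteq> osyms d"
    using \<alpha> by (rule OA_hom_cases)
  have "pval smul (cls (OA smul) (lin_ext (left_sym \<sigma>) f)) w = lin_ext (\<lambda>x. pw smul x (permute_snd \<sigma> w)) f"
    by (rule pval_lin_ext[OF f(2)]) (simp only: pair_sym_left[OF _ w s] pw_def)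
  then show ?thesis by (simp add: f(1) left_act_cls pval_cls)
qed

lemma left_act_hom:
  fixes smul :: "'k::field \<Rightarrow> 'b::{ring, monoid_mult} \<Rightarrow> 'b"
  assumes \<alpha>: "\<alpha> \<in> OA_hom smul d"
  shows "left_act smul \<sigma> \<alpha> \<in> OA_hom smul d"
proof -
  obtain f where f: "\<alpha> = cls (OA smul) f" "Poly_Mapping.keys f \<subseteq> osyms d"
    using \<alpha> by (rule OA_hom_cases)
  have "Poly_Mapping.keys (left_sym \<sigma> x :: 'b osym \<Rightarrow>\<^sub>0 'k) \<subseteq> osyms d" if "x \<in> osyms d" for x :: "'b osym"
    using that by (cases x) (auto simp: osyms_def left_sym_def permutes_compose simp del: upt_Suc)
  then show ?thesis unfolding f(1) left_act_cls
    by (intro OA_hom_cls keys_lin_ext_subset[OF f(2)])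
qed

lemma pval_right_act:
  fixes smul :: "'k::field \<Rightarrow> 'b::{ring, monoid_mult} \<Rightarrow> 'b"
  assumes \<alpha>: "\<alpha> \<in> OA_hom smul d" and w: "length w = d" and s: "\<sigma> permutes {1..d}"
  shows "pval smul (right_act smul \<alpha> \<sigma>) w = pval smul \<alpha> (permute_fst (inv \<sigma>) w)"
proof -
  obtain f where f: "\<alpha> = cls (OA smul) f" "Poly_Mapping.keys f \<subseteq> osyms d"
    using \<alpha> by (rule OA_hom_cases)
  have "pval smul (cls (OA smul) (lin_ext (right_sym \<sigma>) f)) w = lin_ext (\<lambda>x. pw smul x (permute_fst (inv \<sigma>) w)) f"
    by (rule pval_lin_ext[OF f(2)]) (simp only: pair_sym_right[OF _ w s] pw_def)
  then show ?thesis by (simp add: f(1) right_act_cls pval_cls)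
qed

lemma right_act_hom:
  fixes smul :: "'k::field \<Rightarrow> 'b::{ring, monoid_mult} \<Rightarrow> 'b"
  assumes \<alpha>: "\<alpha> \<in> OA_hom smul d"
  shows "right_act smul \<alpha> \<sigma> \<in> OA_hom smul d"
proof -
  obtain f where f: "\<alpha> = cls (OA smul) f" "Poly_Mapping.keys f \<subseteq> osyms d"
    using \<alpha> by (rule OA_hom_cases)
  have "Poly_Mapping.keys (right_sym \<sigma> x :: 'b osym \<Rightarrow>\<^sub>0 'k) \<subseteq> osyms d" if "x \<in> osyms d" for x :: "'b osym"
    using that by (cases x) (auto simp: osyms_def right_sym_def permutes_compose)
  then show ?thesis unfolding f(1) right_act_cls
    by (intro OA_hom_cls keys_lin_ext_subset[OF f(2)])
qed

text \<open>What \<open>Ad \<sigma>\<close> does to the word.\<close>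

definition permute_word :: "(nat \<Rightarrow> nat) \<Rightarrow> 'b list \<Rightarrow> 'b list" where
  "permute_word \<sigma> w = map (\<lambda>s. w ! (\<sigma> s - 1)) [1..<Suc (length w)]"

lemma length_permute_word [simp]: "length (permute_word \<sigma> w) = length w"
  by (simp add: permute_word_def del: upt_Suc)

lemma nth_permute_word: "j < length w \<Longrightarrow> permute_word \<sigma> w ! j = w ! (\<sigma> (Suc j) - 1)"
  by (simp add: permute_word_def del: upt_Suc)

lemma permute_snd_fst:
  assumes s: "\<sigma> permutes {1..length w}"
  shows "permute_snd \<sigma> (permute_fst \<sigma> w) = permute_word \<sigma> w"
proof (rule nth_equalityI)
  fix j assume "j < length (permute_snd \<sigma> (permute_fst \<sigma> w))"
  then have j: "j < length w" by simp
  then have "\<sigma> (Suc j) \<in> {1..length w}" using permutes_in_image[OF s, of "Suc j"] by auto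
  then have "\<sigma> (Suc j) - 1 < length w" by auto
  then show "permute_snd \<sigma> (permute_fst \<sigma> w) ! j = permute_word \<sigma> w ! j"
    using j by (simp add: nth_permute_snd nth_permute_fst nth_permute_word)
qed simp

lemma Ad_hom: "\<alpha> \<in> OA_hom smul d \<Longrightarrow> Ad smul \<sigma> \<alpha> \<in> OA_hom smul d"
  unfolding Ad_def by (intro right_act_hom left_act_hom)

lemma pval_Ad:
  assumes \<alpha>: "\<alpha> \<in> OA_hom smul d" and w: "length w = d" and s: "\<sigma> permutes {1..d}"
  shows "pval smul (Ad smul \<sigma> \<alpha>) w = pval smul \<alpha> (permute_word \<sigma> w)"
proof -
  have "pval smul (Ad smul \<sigma> \<alpha>) w = pval smul (left_act smul \<sigma> \<alpha>) (permute_fst \<sigma> w)"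
    unfolding Ad_def using pval_right_act[OF left_act_hom[OF \<alpha>] w permutes_inv[OF s], of \<sigma>]
    by (simp add: permutes_inv_inv[OF s])
  also have "\<dots> = pval smul \<alpha> (permute_snd \<sigma> (permute_fst \<sigma> w))"
    by (rule pval_left_act[OF \<alpha> _ s]) (simp add: w)
  finally show ?thesis using permute_snd_fst[of \<sigma> w] s w by simp
qed

lemma pval_vadd:
  "\<alpha> \<in> vspace (OA smul) \<Longrightarrow> \<beta> \<in> vspace (OA smul) \<Longrightarrow>
    pval smul (vadd (OA smul) \<alpha> \<beta>) w = pval smul \<alpha> w + pval smul \<beta> w"
  by (auto simp: vspace_def vadd_cls pval_cls lin_ext_add)

lemma pval_vscale:
  "\<alpha> \<in> vspace (OA smul) \<Longrightarrow> pval smul (vscale (OA smul) c \<alpha>) w = pm_scale c (pval smul \<alpha> w)"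
  by (auto simp: vspace_def vscale_cls pval_cls lin_ext_scale)

lemma OA_hom_vadd:
  assumes "\<alpha> \<in> OA_hom smul d" "\<beta> \<in> OA_hom smul d"
  shows "vadd (OA smul) \<alpha> \<beta> \<in> OA_hom smul d"
proof -
  obtain f g where f: "\<alpha> = cls (OA smul) f" "Poly_Mapping.keys f \<subseteq> osyms d"
    and g: "\<beta> = cls (OA smul) g" "Poly_Mapping.keys g \<subseteq> osyms d"
    using assms by (auto simp: OA_hom_def)
  then show ?thesis unfolding f g vadd_cls
    by (intro OA_hom_cls) (use keys_add[of f g] in blast)
qed

lemma OA_hom_vscale:
  assumes "\<alpha> \<in> OA_hom smul d"
  shows "vscale (OA smul) c \<alpha> \<in> OA_hom smul d"
proof -
  obtain f where f: "\<alpha> = cls (OA smul) f" "Poly_Mapping.keys f \<subseteq> osyms d"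
    using assms by (auto simp: OA_hom_def)
  then show ?thesis unfolding f vscale_cls
    by (intro OA_hom_cls) (use keys_pm_scale[of c f] in blast)
qed

text \<open>Each generator of the ideal pairs to zero with all words of length \<open>d\<close>: in degree \<open>d\<close> by definition, in the
other degrees for reasons of length. So do their combinations, and conversely an element of degree \<open>d\<close>
that pairs to zero with all words is itself a generator.\<close>

lemma cong_R_iff:
  fixes smul :: "'k::field \<Rightarrow> 'a::{ring, monoid_mult} \<Rightarrow> 'a"
  assumes x: "x \<in> OA_hom smul d" and y: "y \<in> OA_hom smul d"
  shows "cong_R smul TYPE('N::finite) x y \<longleftrightarrow>
    (\<forall>w :: ('N \<times> 'N) list. length w = d \<longrightarrow> pval smul x w = pval smul y w)"
proof -
  define S where "S = {\<alpha>. \<exists>n. \<alpha> \<in> OA_hom smul n \<and>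
     (\<forall>X \<in> tensors_deg n. pairing smul \<alpha> (X :: ('N, 'k) tensors) = cls (Rep smul) 0)}"
  have sv: "S \<subseteq> vspace (OA smul)" using OA_hom_vspace by (auto simp: S_def)
  define z where "z = vadd (OA smul) x (vscale (OA smul) (-1) y)"
  have zh: "z \<in> OA_hom smul d" unfolding z_def by (intro OA_hom_vadd OA_hom_vscale x y)
  have zv: "pval smul z w = pval smul x w - pval smul y w" for w :: "('N \<times> 'N) list"
    using OA_hom_vspace[OF x] OA_hom_vspace[OF y]
    by (simp add: z_def pval_vadd pval_vscale vscale_vspace)
  have cong: "cong_R smul TYPE('N) x y \<longleftrightarrow> z \<in> vspan (OA smul) S"
    by (simp add: cong_R_def R_ideal_def z_def S_def)
  show ?thesis unfolding cong
  proof
    assume z: "z \<in> vspan (OA smul) S"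
    \<comment> \<open>A subspace that contains the generators of the ideal.\<close>
    define U where "U = {\<alpha> \<in> vspace (OA smul). \<forall>w :: ('N \<times> 'N) list. length w = d \<longrightarrow> pval smul \<alpha> w = 0}"
    have "vsubspace (OA smul) U"
      unfolding vsubspace_def U_def
      by (auto simp: pval_vadd pval_vscale vadd_vspace vscale_vspace pval_cls intro: cls_in_vspace)
    moreover have "S \<subseteq> U"
    proof
      fix \<alpha> assume \<alpha>S: "\<alpha> \<in> S"
      then obtain n where n: "\<alpha> \<in> OA_hom smul n"
        "\<And>X :: ('N, 'k) tensors. X \<in> tensors_deg n \<Longrightarrow> pairing smul \<alpha> X = cls (Rep smul) 0" by (auto simp: S_def)
      have "pval smul \<alpha> w = 0" if "length w = d" for w :: "('N \<times> 'N) list"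
      proof (cases "n = d")
        case True
        then have "pairing smul \<alpha> (sing w :: ('N, 'k) tensors) = cls (Rep smul) 0"
          using that by (intro n) (simp add: tensors_deg_def)
        then show ?thesis by (simp add: pval_def)
      qed (rule pval_length[OF n(1)], use that in auto)
      then show "\<alpha> \<in> U" using \<alpha>S sv by (auto simp: U_def)
    qed
    ultimately have "z \<in> U" using z by (auto simp: vspan_def)
    then show "\<forall>w :: ('N \<times> 'N) list. length w = d \<longrightarrow> pval smul x w = pval smul y w"
      using zv by (auto simp: U_def)
  next
    assume eq: "\<forall>w :: ('N \<times> 'N) list. length w = d \<longrightarrow> pval smul x w = pval smul y w"
    have "pairing smul z X = cls (Rep smul) 0" if X: "X \<in> tensors_deg d" for X :: "('N, 'k) tensors"
    proof -
      have "cform (Rep smul) (pairing smul z X) = lin_ext (pval smul z) X"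
        by (rule cform_pairing) (rule OA_hom_vspace[OF zh])
      also have "\<dots> = lin_ext (\<lambda>w. 0) X"
        by (rule lin_ext_cong) (use X eq zv in \<open>auto simp: tensors_deg_def\<close>)
      finally have "cform (Rep smul) (pairing smul z X) = cform (Rep smul) (cls (Rep smul) 0)" by simp
      then show ?thesis
        by (rule cform_inj[rotated 2])
          (auto intro: pairing_in_vspace OA_hom_vspace[OF zh] cls_in_vspace)
    qed
    then have "z \<in> S" using zh by (auto simp: S_def)
    then show "z \<in> vspan (OA smul) S" by (auto simp: vspan_def)
  qed
qed

section \<open>Induced maps satisfy the four congruences\<close>

lemma tprod_eq_mlin: "tprod Xs = mlin (\<lambda>ws. sing (concat ws)) Xs"
proof (induction Xs)
  case Nil
  show ?case by (simp add: tprod_def sing_def)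
next
  case (Cons X Xs)
  have "tprod (X # Xs) = lin_ext (\<lambda>v. lin_ext (\<lambda>w. sing (v @ w)) (tprod Xs)) X"
    by (simp add: tprod_def tmult_def sing_def)
  also have "\<dots> = lin_ext (\<lambda>v. mlin (\<lambda>ws. sing (v @ concat ws)) Xs) X"
    unfolding Cons by (simp add: lin_ext_mlin)
  finally show ?case by simp
qed

lemma tprod_sing [simp]: "tprod (map sing ws) = sing (concat ws)"
  by (simp add: tprod_eq_mlin)

lemma tprod_slot:
  "tprod (map sing vs @ X # map sing vs') = lin_ext (\<lambda>x. sing (concat vs @ x @ concat vs')) X"
proof -
  have "tprod (map sing vs @ X # map sing vs')
      = lin_ext (\<lambda>x. mlin (\<lambda>ws. sing (concat ws)) (map sing vs @ sing x # map sing vs')) X"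
    unfolding tprod_eq_mlin by (rule multilinear_slot[OF mlin_multilinear refl])
  also have "\<dots> = lin_ext (\<lambda>x. mlin (\<lambda>ws. sing (concat ws)) (map sing (vs @ x # vs'))) X"
    by simp
  finally show ?thesis by (simp only: mlin_map_sing) simp
qed

lemma pairing_eqI:
  fixes smul :: "'k::field \<Rightarrow> 'a::{ring, monoid_mult} \<Rightarrow> 'a" and X Y :: "('N::finite, 'k) tensors"
  assumes "\<alpha> \<in> vspace (OA smul)" "\<beta> \<in> vspace (OA smul)"
    and "lin_ext (pval smul \<alpha>) X = lin_ext (pval smul \<beta>) Y"
  shows "pairing smul \<alpha> X = pairing smul \<beta> Y"
  using assms by (intro cform_inj[OF pairing_in_vspace pairing_in_vspace]) (simp_all add: cform_pairing)

lemma hom_list_append: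
  "hom_list smul (ds @ d # ds') (\<alpha>s @ \<alpha> # \<alpha>s') \<longleftrightarrow> hom_list smul ds \<alpha>s \<and> \<alpha> \<in> OA_hom smul d \<and> hom_list smul ds' \<alpha>s'"
  if "length ds = length \<alpha>s"
  using that by (simp add: hom_list_def list_all2_append)

lemma hom_list_length: "hom_list smul ds \<alpha>s \<Longrightarrow> length \<alpha>s = length ds"
  by (auto simp: hom_list_def dest: list_all2_lengthD)

lemma degree_zero_hom:
  assumes "\<Phi> \<in> degree_zero_maps smul n" "length ds = n" "hom_list smul ds \<alpha>s"
  shows "\<Phi> (ptensor (OA smul) \<alpha>s) \<in> OA_hom smul (sum_list ds)"
  using assms by (auto simp: degree_zero_maps_def)

lemma list_all2_tensors_deg:
  "list_all2 (\<lambda>d w. length w = d) ds ws \<Longrightarrow> list_all2 (\<lambda>d X. X \<in> tensors_deg d) ds (map sing ws)"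
  by (simp add: list_all2_map2 tensors_deg_def)

lemma induces_words:
  fixes \<phi> :: "('a::{ring, monoid_mult}, 'N::finite, 'k::field) rep_map"
  assumes ind: "induces smul n \<Phi> \<phi>" and n: "length ds = n" and \<alpha>s: "hom_list smul ds \<alpha>s"
    and ws: "list_all2 (\<lambda>d w. length w = d) ds ws"
  shows "cform (Rep smul) (\<phi> (ptensor (Rep smul) (map2 (pairing smul) \<alpha>s (map sing ws))))
    = pval smul (\<Phi> (ptensor (OA smul) \<alpha>s)) (concat ws)"
proof -
  have "\<phi> (ptensor (Rep smul) (map2 (pairing smul) \<alpha>s (map sing ws))) = pairing smul (\<Phi> (ptensor (OA smul) \<alpha>s)) (tprod (map sing ws))"
    using ind n \<alpha>s list_all2_tensors_deg[OF ws] unfolding induces_def by blast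
  then show ?thesis by (simp add: pval_def)
qed

text \<open>If \<open>(\<beta>|v) = (\<alpha>|X)\<close>, then \<open>\<beta>\<close> and \<open>v\<close> may be replaced by \<open>\<alpha>\<close> and \<open>X\<close> in one argument of an induced map, whose value
depends on the pairing alone. Each of the four congruences is an instance.\<close>

lemma induces_slot:
  fixes \<phi> :: "('a::{ring, monoid_mult}, 'N::finite, 'k::field) rep_map"
  assumes ind: "induces smul n \<Phi> \<phi>" and \<Phi>: "\<Phi> \<in> degree_zero_maps smul n" and n: "length (ds @ d # ds') = n"
    and \<alpha>s: "hom_list smul ds \<alpha>s" "hom_list smul ds' \<alpha>s'" and \<alpha>: "\<alpha> \<in> OA_hom smul d" and \<beta>: "\<beta> \<in> OA_hom smul e"
    and vs: "list_all2 (\<lambda>d w. length w = d) ds vs" "list_all2 (\<lambda>d w. length w = d) ds' vs'" and v: "length v = e"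
    and X: "X \<in> tensors_deg d"
    and eq: "pval smul \<beta> v = lin_ext (pval smul \<alpha>) (X :: ('N, 'k) tensors)"
  shows "pval smul (\<Phi> (ptensor (OA smul) (\<alpha>s @ \<beta> # \<alpha>s'))) (concat vs @ v @ concat vs')
    = lin_ext (\<lambda>x. pval smul (\<Phi> (ptensor (OA smul) (\<alpha>s @ \<alpha> # \<alpha>s'))) (concat vs @ x @ concat vs')) X"
proof -
  have len: "length \<alpha>s = length vs" "length ds = length \<alpha>s" "length ds = length vs"
    using hom_list_length[OF \<alpha>s(1)] list_all2_lengthD[OF vs(1)] by simp_all
  have hl: "hom_list smul (ds @ d # ds') (\<alpha>s @ \<alpha> # \<alpha>s')" "hom_list smul (ds @ e # ds') (\<alpha>s @ \<beta> # \<alpha>s')"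
    using \<alpha>s \<alpha> \<beta> len by (simp_all add: hom_list_append)
  have pe: "pairing smul \<beta> (sing v) = pairing smul \<alpha> X"
    by (rule pairing_eqI) (use \<alpha> \<beta> OA_hom_vspace eq in auto)
  have "pval smul (\<Phi> (ptensor (OA smul) (\<alpha>s @ \<beta> # \<alpha>s'))) (concat (vs @ v # vs'))
    = cform (Rep smul) (\<phi> (ptensor (Rep smul) (map2 (pairing smul) (\<alpha>s @ \<beta> # \<alpha>s') (map sing (vs @ v # vs')))))"
    by (rule induces_words[OF ind _ hl(2), symmetric]) (use n vs v len in \<open>simp_all add: list_all2_append\<close>)
  also have "map2 (pairing smul) (\<alpha>s @ \<beta> # \<alpha>s') (map sing (vs @ v # vs')) = map2 (pairing smul) (\<alpha>s @ \<alpha> # \<alpha>s') (map sing vs @ X # map sing vs')"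
    using len pe by simp
  also have "\<phi> (ptensor (Rep smul) \<dots>) = pairing smul (\<Phi> (ptensor (OA smul) (\<alpha>s @ \<alpha> # \<alpha>s'))) (tprod (map sing vs @ X # map sing vs'))"
  proof -
    have "list_all2 (\<lambda>d X. X \<in> tensors_deg d) (ds @ d # ds') (map sing vs @ X # map sing vs')"
      using list_all2_tensors_deg[OF vs(1)] list_all2_tensors_deg[OF vs(2)] X len by (simp add: list_all2_append)
    then show ?thesis using ind n hl(1) unfolding induces_def by blast
  qed
  also have "cform (Rep smul) \<dots> = lin_ext (pval smul (\<Phi> (ptensor (OA smul) (\<alpha>s @ \<alpha> # \<alpha>s')))) (tprod (map sing vs @ X # map sing vs'))"
    by (rule cform_pairing, rule OA_hom_vspace, rule degree_zero_hom[OF \<Phi> n hl(1)])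
  finally show ?thesis by (simp add: tprod_slot lin_ext_comp)
qed

lemma block_perm_permutes:
  assumes "k + l \<le> n"
  shows "block_perm (Transposition.transpose 1 2) [k, l] permutes {1..n}"
proof -
  have "block_perm (Transposition.transpose 1 2) [k, l] (block_perm (Transposition.transpose 1 2) [l, k] i) = i" for k l i
    unfolding block_perm_transpose by auto
  then have "bij (block_perm (Transposition.transpose 1 2) [k, l])"
    by (intro o_bij[of "block_perm (Transposition.transpose 1 2) [l, k]"]) (auto simp: fun_eq_iff)
  moreover have "block_perm (Transposition.transpose 1 2) [k, l] i = i" if "i \<notin> {1..n}" for i
    using that assms unfolding block_perm_transpose by auto
  ultimately show ?thesis by (simp add: permutes_def bij_iff)
qed

text \<open>This is why the block permutations occur: they move one letter past the block \<open>u\<close>.\<close>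

lemma permute_word_block_in:
  "permute_word (block_perm (Transposition.transpose 1 2) [length u, 1]) (x # u @ v) = u @ x # v"
proof (rule nth_equalityI)
  fix j assume "j < length (permute_word (block_perm (Transposition.transpose 1 2) [length u, 1]) (x # u @ v))"
  then have j: "j < Suc (length u + length v)" by simp
  then have "permute_word (block_perm (Transposition.transpose 1 2) [length u, 1]) (x # u @ v) ! j
      = (x # u @ v) ! (block_perm (Transposition.transpose 1 2) [length u, 1] (Suc j) - 1)"
    by (intro nth_permute_word) simp
  also have "\<dots> = (u @ x # v) ! j"
    unfolding block_perm_transpose
    by (cases "j < length u"; cases "j = length u") (auto simp: nth_append nth_Cons')
  finally show "permute_word (block_perm (Transposition.transpose 1 2) [length u, 1]) (x # u @ v) ! j = (u @ x # v) ! j" .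
qed simp

lemma permute_word_block_out:
  "permute_word (block_perm (Transposition.transpose 1 2) [1, length u]) (u @ x # v) = x # u @ v"
proof (rule nth_equalityI)
  fix j assume "j < length (permute_word (block_perm (Transposition.transpose 1 2) [1, length u]) (u @ x # v))"
  then have j: "j < Suc (length u + length v)" by simp
  then have "permute_word (block_perm (Transposition.transpose 1 2) [1, length u]) (u @ x # v) ! j
      = (u @ x # v) ! (block_perm (Transposition.transpose 1 2) [1, length u] (Suc j) - 1)"
    by (intro nth_permute_word) simp
  also have "\<dots> = (x # u @ v) ! j"
    unfolding block_perm_transpose by (cases u) (auto simp: nth_append nth_Cons')
  finally show "permute_word (block_perm (Transposition.transpose 1 2) [1, length u]) (u @ x # v) ! j = (x # u @ v) ! j" .
qed simp

lemma split_word: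
  assumes "length w = sum_list ds"
  shows "\<exists>ws. list_all2 (\<lambda>d w. length w = d) ds ws \<and> w = concat ws"
  using assms
proof (induction ds arbitrary: w)
  case (Cons d ds)
  obtain ws where "list_all2 (\<lambda>d w. length w = d) ds ws" "drop d w = concat ws"
    using Cons.IH[of "drop d w"] Cons.prems by auto
  then show ?case using Cons.prems
    by (intro exI[of _ "take d w # ws"]) (simp, metis append_take_drop_id)
qed simp

lemma split_word3:
  assumes "length w = sum_list ds + d + sum_list ds'"
  obtains vs v vs' where "list_all2 (\<lambda>d w. length w = d) ds vs" "length v = d"
    "list_all2 (\<lambda>d w. length w = d) ds' vs'" "w = concat vs @ v @ concat vs'"
proof -
  obtain vs where vs: "list_all2 (\<lambda>d w. length w = d) ds vs" "take (sum_list ds) w = concat vs"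
    using split_word[of "take (sum_list ds) w" ds] assms by auto
  obtain vs' where vs': "list_all2 (\<lambda>d w. length w = d) ds' vs'" "drop (sum_list ds + d) w = concat vs'"
    using split_word[of "drop (sum_list ds + d) w" ds'] assms by auto
  have "w = take (sum_list ds) w @ take d (drop (sum_list ds) w) @ drop (sum_list ds + d) w"
    by (metis add.commute append_take_drop_id drop_drop)
  then show thesis using that[OF vs(1) _ vs'(1), of "take d (drop (sum_list ds) w)"] assms vs(2) vs'(2) by simp
qed

lemma length_concat_words: "list_all2 (\<lambda>d w. length w = d) ds ws \<Longrightarrow> length (concat ws) = sum_list ds"
  by (induction rule: list_all2_induct) auto

text \<open>Conjugation moves the contraction by \<open>\<pi>\<close> from the front of the word to the place after \<open>u\<close>.\<close>

lemma pval_pi_Ad: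
  fixes smul :: "'k::field \<Rightarrow> 'a::{ring, monoid_mult} \<Rightarrow> 'a" and u w :: "('N::finite \<times> 'N) list"
  assumes A: "assoc_algebra smul" and \<beta>: "\<beta> \<in> OA_hom smul (Suc (length u + length w))"
  shows "pval smul (op_pi smul (Ad smul (block_perm (Transposition.transpose 1 2) [length u, 1]) \<beta>)) (u @ w)
    = (\<Sum>k\<in>UNIV. pval smul \<beta> (u @ (k, k) # w))"
proof -
  let ?\<sigma> = "block_perm (Transposition.transpose 1 2) [length u, 1]"
  have \<sigma>: "?\<sigma> permutes {1..Suc (length u + length w)}" by (rule block_perm_permutes) simp
  have "pval smul (op_pi smul (Ad smul ?\<sigma> \<beta>)) (u @ w) = (\<Sum>k\<in>UNIV. pval smul (Ad smul ?\<sigma> \<beta>) ((k, k) # u @ w))"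
    by (rule pval_op_pi[OF A Ad_hom[OF \<beta>]]) simp
  also have "\<dots> = (\<Sum>k\<in>UNIV. pval smul \<beta> (permute_word ?\<sigma> ((k, k) # u @ w)))"
    by (rule sum.cong[OF refl], rule pval_Ad[OF \<beta> _ \<sigma>]) simp
  finally show ?thesis by (simp only: permute_word_block_in)
qed

lemma pval_Ad_one:
  fixes smul :: "'k::field \<Rightarrow> 'a::{ring, monoid_mult} \<Rightarrow> 'a" and u w :: "('N::finite \<times> 'N) list"
  assumes \<beta>: "\<beta> \<in> OA_hom smul (length u + length w)"
  shows "pval smul (Ad smul (block_perm (Transposition.transpose 1 2) [1, length u]) (op_one smul \<beta>)) (u @ (p, q) # w)
    = (if p = q then pval smul \<beta> (u @ w) else 0)"
proof -
  let ?\<sigma> = "block_perm (Transposition.transpose 1 2) [1, length u]"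
  have \<sigma>: "?\<sigma> permutes {1..Suc (length u + length w)}" by (rule block_perm_permutes) simp
  have "pval smul (Ad smul ?\<sigma> (op_one smul \<beta>)) (u @ (p, q) # w) = pval smul (op_one smul \<beta>) (permute_word ?\<sigma> (u @ (p, q) # w))"
    by (rule pval_Ad[OF op_one_hom[OF \<beta>] _ \<sigma>]) simp
  also have "\<dots> = pval smul (op_one smul \<beta>) ((p, q) # u @ w)" by (simp only: permute_word_block_out)
  also have "\<dots> = (if p = q then pval smul \<beta> (u @ w) else 0)" by (rule pval_op_one[OF \<beta>]) simp
  finally show ?thesis .
qed

lemma induces_imp_cong_pi:
  fixes \<phi> :: "('a::{ring, monoid_mult}, 'N::finite, 'k::field) rep_map"
  assumes A: "assoc_algebra smul" and ind: "induces smul n \<Phi> \<phi>" and \<Phi>: "\<Phi> \<in> degree_zero_maps smul n"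
    and n: "length (ds @ Suc d # ds') = n"
    and \<alpha>s: "hom_list smul ds \<alpha>s" "hom_list smul ds' \<alpha>s'" and \<alpha>: "\<alpha> \<in> OA_hom smul (Suc d)"
  shows "cong_R smul TYPE('N) (\<Phi> (ptensor (OA smul) (\<alpha>s @ op_pi smul \<alpha> # \<alpha>s')))
     (op_pi smul (Ad smul (block_perm (Transposition.transpose 1 2) [sum_list ds, 1]) (\<Phi> (ptensor (OA smul) (\<alpha>s @ \<alpha> # \<alpha>s')))))"
proof -
  let ?\<sigma> = "block_perm (Transposition.transpose 1 2) [sum_list ds, 1]"
  let ?\<beta> = "\<Phi> (ptensor (OA smul) (\<alpha>s @ \<alpha> # \<alpha>s'))"
  let ?D = "sum_list ds + d + sum_list ds'"
  have len: "length ds = length \<alpha>s" using \<alpha>s by (simp add: hom_list_length)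
  have p: "op_pi smul \<alpha> \<in> OA_hom smul d" by (rule op_pi_hom[OF A \<alpha>])
  have h: "?\<beta> \<in> OA_hom smul (Suc ?D)"
    using degree_zero_hom[OF \<Phi> n, of "\<alpha>s @ \<alpha> # \<alpha>s'"] \<alpha>s \<alpha> len by (simp add: hom_list_append add.assoc)
  have h': "\<Phi> (ptensor (OA smul) (\<alpha>s @ op_pi smul \<alpha> # \<alpha>s')) \<in> OA_hom smul ?D"
    using degree_zero_hom[OF \<Phi>, of "ds @ d # ds'" "\<alpha>s @ op_pi smul \<alpha> # \<alpha>s'"] n \<alpha>s p len by (simp add: hom_list_append add.assoc)
  have "pval smul (\<Phi> (ptensor (OA smul) (\<alpha>s @ op_pi smul \<alpha> # \<alpha>s'))) w = pval smul (op_pi smul (Ad smul ?\<sigma> ?\<beta>)) w"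
    if w: "length w = ?D" for w :: "('N \<times> 'N) list"
  proof -
    obtain vs v vs' where v: "list_all2 (\<lambda>d w. length w = d) ds vs" "length v = d"
      "list_all2 (\<lambda>d w. length w = d) ds' vs'" "w = concat vs @ v @ concat vs'"
      using split_word3[OF w] .
    have "pval smul (\<Phi> (ptensor (OA smul) (\<alpha>s @ op_pi smul \<alpha> # \<alpha>s'))) w
      = lin_ext (\<lambda>x. pval smul ?\<beta> (concat vs @ x @ concat vs')) (\<Sum>k\<in>UNIV. sing ((k, k) # v))"
      unfolding v(4)
    proof (rule induces_slot[OF ind \<Phi> n \<alpha>s \<alpha> p v(1,3,2)])
      show "(\<Sum>k\<in>UNIV. sing ((k, k) # v)) \<in> tensors_deg (Suc d)"
        unfolding tensors_deg_def using keys_sum[of "\<lambda>k. sing ((k, k) # v)" UNIV] v(2) by fastforce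
      show "pval smul (op_pi smul \<alpha>) v = lin_ext (pval smul \<alpha>) (\<Sum>k\<in>UNIV. sing ((k, k) # v))"
        by (simp add: pval_op_pi[OF A \<alpha> v(2)] act_sum)
    qed
    also have "\<dots> = (\<Sum>k\<in>UNIV. pval smul ?\<beta> (concat vs @ (k, k) # v @ concat vs'))"
      by (simp add: act_sum)
    also have "\<dots> = pval smul (op_pi smul (Ad smul ?\<sigma> ?\<beta>)) w"
      using pval_pi_Ad[OF A, of ?\<beta> "concat vs" "v @ concat vs'"] h length_concat_words[OF v(1)]
        length_concat_words[OF v(3)] v(2,4) by (simp add: add.assoc)
    finally show ?thesis .
  qed
  then show ?thesis by (subst cong_R_iff[OF h' op_pi_hom[OF A Ad_hom[OF h]]]) blast
qed

lemma induces_imp_cong_one: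
  fixes \<phi> :: "('a::{ring, monoid_mult}, 'N::finite, 'k::field) rep_map"
  assumes ind: "induces smul n \<Phi> \<phi>" and \<Phi>: "\<Phi> \<in> degree_zero_maps smul n"
    and n: "length (ds @ d # ds') = n"
    and \<alpha>s: "hom_list smul ds \<alpha>s" "hom_list smul ds' \<alpha>s'" and \<alpha>: "\<alpha> \<in> OA_hom smul d"
  shows "cong_R smul TYPE('N) (\<Phi> (ptensor (OA smul) (\<alpha>s @ op_one smul \<alpha> # \<alpha>s')))
     (Ad smul (block_perm (Transposition.transpose 1 2) [1, sum_list ds]) (op_one smul (\<Phi> (ptensor (OA smul) (\<alpha>s @ \<alpha> # \<alpha>s')))))"
proof -
  let ?\<sigma> = "block_perm (Transposition.transpose 1 2) [1, sum_list ds]"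
  let ?\<beta> = "\<Phi> (ptensor (OA smul) (\<alpha>s @ \<alpha> # \<alpha>s'))"
  let ?D = "sum_list ds + d + sum_list ds'"
  have len: "length ds = length \<alpha>s" using \<alpha>s by (simp add: hom_list_length)
  have p: "op_one smul \<alpha> \<in> OA_hom smul (Suc d)" by (rule op_one_hom[OF \<alpha>])
  have h: "?\<beta> \<in> OA_hom smul ?D"
    using degree_zero_hom[OF \<Phi> n, of "\<alpha>s @ \<alpha> # \<alpha>s'"] \<alpha>s \<alpha> len by (simp add: hom_list_append add.assoc)
  have h1: "op_one smul ?\<beta> \<in> OA_hom smul (Suc ?D)" by (rule op_one_hom[OF h])
  have h': "\<Phi> (ptensor (OA smul) (\<alpha>s @ op_one smul \<alpha> # \<alpha>s')) \<in> OA_hom smul (Suc ?D)"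
    using degree_zero_hom[OF \<Phi>, of "ds @ Suc d # ds'" "\<alpha>s @ op_one smul \<alpha> # \<alpha>s'"] n \<alpha>s p len by (simp add: hom_list_append add.assoc)
  have "pval smul (\<Phi> (ptensor (OA smul) (\<alpha>s @ op_one smul \<alpha> # \<alpha>s'))) w = pval smul (Ad smul ?\<sigma> (op_one smul ?\<beta>)) w"
    if w: "length w = Suc ?D" for w :: "('N \<times> 'N) list"
  proof -
    have "length w = sum_list ds + Suc d + sum_list ds'" using w by simp
    from split_word3[OF this] obtain vs v0 vs' where v: "list_all2 (\<lambda>d w. length w = d) ds vs" "length v0 = Suc d"
      "list_all2 (\<lambda>d w. length w = d) ds' vs'" "w = concat vs @ v0 @ concat vs'" .
    obtain p' q v' where v0: "v0 = (p', q) # v'" and v': "length v' = d" using v(2) by (cases v0) auto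
    have "pval smul (\<Phi> (ptensor (OA smul) (\<alpha>s @ op_one smul \<alpha> # \<alpha>s'))) w
      = lin_ext (\<lambda>x. pval smul ?\<beta> (concat vs @ x @ concat vs')) (if p' = q then sing v' else 0)"
      unfolding v(4)
    proof (rule induces_slot[OF ind \<Phi> n \<alpha>s \<alpha> p v(1,3,2)])
      show "(if p' = q then sing v' else 0) \<in> tensors_deg d" using v' by (simp add: tensors_deg_def)
      show "pval smul (op_one smul \<alpha>) v0 = lin_ext (pval smul \<alpha>) (if p' = q then sing v' else 0)"
        by (simp add: v0 pval_op_one[OF \<alpha> v'])
    qed
    also have "\<dots> = (if p' = q then pval smul ?\<beta> (concat vs @ v' @ concat vs') else 0)" by simp
    also have "\<dots> = pval smul (Ad smul ?\<sigma> (op_one smul ?\<beta>)) w"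
      using pval_Ad_one[of ?\<beta> smul "concat vs" "v' @ concat vs'" p' q] h length_concat_words[OF v(1)]
        length_concat_words[OF v(3)] v(4) v0 v' by (simp add: add.assoc)
    finally show ?thesis .
  qed
  then show ?thesis by (subst cong_R_iff[OF h' Ad_hom[OF h1]]) blast
qed

lemma permute_snd_append:
  assumes "u permutes {1..n}" "v permutes {1..length w'}" "length w = n"
  shows "permute_snd (perm_times n u v) (w @ w') = permute_snd u w @ permute_snd v w'"
proof (rule nth_equalityI)
  fix j assume "j < length (permute_snd (perm_times n u v) (w @ w'))"
  then have j: "j < n + length w'" using assms by simp
  show "permute_snd (perm_times n u v) (w @ w') ! j = (permute_snd u w @ permute_snd v w') ! j"
  proof (cases "j < n")
    case True
    then have "u (Suc j) \<in> {1..n}" using permutes_in_image[OF assms(1), of "Suc j"] by auto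
    then have "u (Suc j) - 1 < n" by auto
    then show ?thesis using True assms(3) by (simp add: nth_permute_snd perm_times_def nth_append)
  next
    case False
    define i where "i = j - n"
    have i: "i < length w'" "j = n + i" using j False by (auto simp: i_def)
    then have "v (Suc i) \<in> {1..length w'}" using permutes_in_image[OF assms(2), of "Suc i"] by auto
    then obtain r where "v (Suc i) = Suc r" by (cases "v (Suc i)") auto
    then show ?thesis using i assms(3) by (simp add: nth_permute_snd perm_times_def nth_append)
  qed
qed (use assms in simp)

lemma permute_fst_append:
  assumes "u permutes {1..n}" "v permutes {1..length w'}" "length w = n"
  shows "permute_fst (perm_times n u v) (w @ w') = permute_fst u w @ permute_fst v w'"
proof (rule nth_equalityI)
  fix j assume "j < length (permute_fst (perm_times n u v) (w @ w'))"
  then have j: "j < n + length w'" using assms by simp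
  show "permute_fst (perm_times n u v) (w @ w') ! j = (permute_fst u w @ permute_fst v w') ! j"
  proof (cases "j < n")
    case True
    then have "u (Suc j) \<in> {1..n}" using permutes_in_image[OF assms(1), of "Suc j"] by auto
    then have "u (Suc j) - 1 < n" by auto
    then show ?thesis using True assms(3) by (simp add: nth_permute_fst perm_times_def nth_append)
  next
    case False
    define i where "i = j - n"
    have i: "i < length w'" "j = n + i" using j False by (auto simp: i_def)
    then have "v (Suc i) \<in> {1..length w'}" using permutes_in_image[OF assms(2), of "Suc i"] by auto
    then obtain r where "v (Suc i) = Suc r" by (cases "v (Suc i)") auto
    then show ?thesis using i assms(3) by (simp add: nth_permute_fst perm_times_def nth_append)
  qed
qed (use assms in simp)

lemma perm_prod_permutes:
  "list_all2 (\<lambda>d w. w permutes {1..d}) ds ws \<Longrightarrow> perm_prod (zip ds ws) permutes {1..sum_list ds}"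
proof (induction rule: list_all2_induct)
  case Nil
  show ?case by (simp add: fun_eq_iff)
next
  case (Cons d ds w ws)
  then show ?case using perm_times_permutes by simp
qed

lemma inv_perm_times:
  assumes u: "u permutes {1..n}" and v: "v permutes {1..m}"
  shows "inv (perm_times n u v) = perm_times n (inv u) (inv v)"
proof (rule inv_unique_comp)
  have id: "perm_times n id id i = i" for i by (simp add: perm_times_def)
  show "perm_times n u v \<circ> perm_times n (inv u) (inv v) = id"
    using id by (simp add: fun_eq_iff perm_times_comp[OF permutes_inv[OF u] permutes_inv[OF v]] permutes_inv_o[OF u] permutes_inv_o[OF v])
  show "perm_times n (inv u) (inv v) \<circ> perm_times n u v = id"
    using id by (simp add: fun_eq_iff perm_times_comp[OF u v] permutes_inv_o[OF u] permutes_inv_o[OF v])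
qed

lemma permute_snd_concat:
  assumes "list_all2 (\<lambda>d w. w permutes {1..d}) ds ws" "list_all2 (\<lambda>d w. length w = d) ds vs"
  shows "permute_snd (perm_prod (zip ds ws)) (concat vs) = concat (map2 permute_snd ws vs)"
  using assms
proof (induction ds arbitrary: ws vs)
  case Nil
  then show ?case by (simp add: permute_snd_def)
next
  case (Cons d ds)
  then obtain w ws' v vs' where e: "ws = w # ws'" "vs = v # vs'" and 1: "w permutes {1..d}" "length v = d"
    "list_all2 (\<lambda>d w. w permutes {1..d}) ds ws'" "list_all2 (\<lambda>d w. length w = d) ds vs'"
    by (auto simp: list_all2_Cons1)
  show ?case using Cons.IH[OF 1(3,4)] permute_snd_append[OF 1(1) _ 1(2), of "perm_prod (zip ds ws')" "concat vs'"]
      perm_prod_permutes[OF 1(3)] length_concat_words[OF 1(4)] by (simp add: e)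
qed

lemma permute_fst_concat:
  assumes "list_all2 (\<lambda>d w. w permutes {1..d}) ds ws" "list_all2 (\<lambda>d w. length w = d) ds vs"
  shows "permute_fst (inv (perm_prod (zip ds ws))) (concat vs) = concat (map2 (\<lambda>w. permute_fst (inv w)) ws vs)"
  using assms
proof (induction ds arbitrary: ws vs)
  case Nil
  then show ?case by (simp add: permute_fst_def)
next
  case (Cons d ds)
  then obtain w ws' v vs' where e: "ws = w # ws'" "vs = v # vs'" and 1: "w permutes {1..d}" "length v = d"
    "list_all2 (\<lambda>d w. w permutes {1..d}) ds ws'" "list_all2 (\<lambda>d w. length w = d) ds vs'"
    by (auto simp: list_all2_Cons1)
  show ?case using Cons.IH[OF 1(3,4)]
      permute_fst_append[OF permutes_inv[OF 1(1)] _ 1(2), of "inv (perm_prod (zip ds ws'))" "concat vs'"]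
      permutes_inv[OF perm_prod_permutes[OF 1(3)]] length_concat_words[OF 1(4)]
      inv_perm_times[OF 1(1) perm_prod_permutes[OF 1(3)]] by (simp add: e)
qed

lemma list_all2_map2I:
  assumes "list_all2 P ds xs" "list_all2 Q ds ys" "\<And>d x y. P d x \<Longrightarrow> Q d y \<Longrightarrow> R d (f x y)"
  shows "list_all2 R ds (map2 f xs ys)"
  using assms by (auto simp: list_all2_conv_all_nth)

lemma induces_imp_cong_left:
  fixes \<phi> :: "('a::{ring, monoid_mult}, 'N::finite, 'k::field) rep_map"
  assumes ind: "induces smul n \<Phi> \<phi>" and \<Phi>: "\<Phi> \<in> degree_zero_maps smul n" and n: "length ds = n"
    and \<alpha>s: "hom_list smul ds \<alpha>s" and ws: "list_all2 (\<lambda>d w. w permutes {1..d}) ds ws"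
  shows "cong_R smul TYPE('N) (\<Phi> (ptensor (OA smul) (map2 (left_act smul) ws \<alpha>s)))
     (left_act smul (perm_prod (zip ds ws)) (\<Phi> (ptensor (OA smul) \<alpha>s)))"
proof -
  have hl: "hom_list smul ds (map2 (left_act smul) ws \<alpha>s)"
    unfolding hom_list_def by (rule list_all2_map2I[OF ws \<alpha>s[unfolded hom_list_def]]) (rule left_act_hom)
  note h = degree_zero_hom[OF \<Phi> n \<alpha>s] and h' = degree_zero_hom[OF \<Phi> n hl]
  have "pval smul (\<Phi> (ptensor (OA smul) (map2 (left_act smul) ws \<alpha>s))) v = pval smul (left_act smul (perm_prod (zip ds ws)) (\<Phi> (ptensor (OA smul) \<alpha>s))) v"
    if v: "length v = sum_list ds" for v :: "('N \<times> 'N) list"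
  proof -
    obtain vs where vs: "list_all2 (\<lambda>d w. length w = d) ds vs" "v = concat vs" using split_word[OF v] by blast
    have vs': "list_all2 (\<lambda>d w. length w = d) ds (map2 permute_snd ws vs)"
      by (rule list_all2_map2I[OF ws vs(1)]) simp
    have len: "length ws = length ds" "length vs = length ds" "length \<alpha>s = length ds"
      using ws vs(1) \<alpha>s by (auto dest: list_all2_lengthD hom_list_length)
    have "map2 (pairing smul) (map2 (left_act smul) ws \<alpha>s) (map sing vs) = map2 (pairing smul) \<alpha>s (map sing (map2 permute_snd ws vs))"
    proof (rule nth_equalityI)
      fix j assume "j < length (map2 (pairing smul) (map2 (left_act smul) ws \<alpha>s) (map sing vs))"
      then have j: "j < length ds" using len by simp
      have a: "\<alpha>s ! j \<in> OA_hom smul (ds ! j)" "length (vs ! j) = ds ! j" "(ws ! j) permutes {1..ds ! j}"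
        using j \<alpha>s vs(1) ws by (auto simp: hom_list_def list_all2_conv_all_nth)
      have "pairing smul (left_act smul (ws ! j) (\<alpha>s ! j)) (sing (vs ! j)) = pairing smul (\<alpha>s ! j) (sing (permute_snd (ws ! j) (vs ! j)))"
        by (rule pairing_eqI) (use a in \<open>auto intro: OA_hom_vspace left_act_hom simp: pval_left_act[OF a]\<close>)
      then show "map2 (pairing smul) (map2 (left_act smul) ws \<alpha>s) (map sing vs) ! j = map2 (pairing smul) \<alpha>s (map sing (map2 permute_snd ws vs)) ! j"
        using j len by simp
    qed (use len in simp)
    then have "pval smul (\<Phi> (ptensor (OA smul) (map2 (left_act smul) ws \<alpha>s))) (concat vs) = pval smul (\<Phi> (ptensor (OA smul) \<alpha>s)) (concat (map2 permute_snd ws vs))"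
      unfolding induces_words[OF ind n hl vs(1), symmetric] induces_words[OF ind n \<alpha>s vs', symmetric] by simp
    then show ?thesis
      by (simp add: pval_left_act[OF h v perm_prod_permutes[OF ws]]) (simp add: vs(2) permute_snd_concat[OF ws vs(1)])
  qed
  then show ?thesis by (subst cong_R_iff[OF h' left_act_hom[OF h]]) blast
qed

lemma induces_imp_cong_right:
  fixes \<phi> :: "('a::{ring, monoid_mult}, 'N::finite, 'k::field) rep_map"
  assumes ind: "induces smul n \<Phi> \<phi>" and \<Phi>: "\<Phi> \<in> degree_zero_maps smul n" and n: "length ds = n"
    and \<alpha>s: "hom_list smul ds \<alpha>s" and ws: "list_all2 (\<lambda>d w. w permutes {1..d}) ds ws"
  shows "cong_R smul TYPE('N) (\<Phi> (ptensor (OA smul) (map2 (right_act smul) \<alpha>s ws)))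
     (right_act smul (\<Phi> (ptensor (OA smul) \<alpha>s)) (perm_prod (zip ds ws)))"
proof -
  have hl: "hom_list smul ds (map2 (right_act smul) \<alpha>s ws)"
    unfolding hom_list_def by (rule list_all2_map2I[OF \<alpha>s[unfolded hom_list_def] ws]) (rule right_act_hom)
  note h = degree_zero_hom[OF \<Phi> n \<alpha>s] and h' = degree_zero_hom[OF \<Phi> n hl]
  have "pval smul (\<Phi> (ptensor (OA smul) (map2 (right_act smul) \<alpha>s ws))) v = pval smul (right_act smul (\<Phi> (ptensor (OA smul) \<alpha>s)) (perm_prod (zip ds ws))) v"
    if v: "length v = sum_list ds" for v :: "('N \<times> 'N) list"
  proof -
    obtain vs where vs: "list_all2 (\<lambda>d w. length w = d) ds vs" "v = concat vs" using split_word[OF v] by blast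
    let ?vs' = "map2 (\<lambda>w. permute_fst (inv w)) ws vs"
    have vs': "list_all2 (\<lambda>d w. length w = d) ds ?vs'"
      by (rule list_all2_map2I[OF ws vs(1)]) simp
    have len: "length ws = length ds" "length vs = length ds" "length \<alpha>s = length ds"
      using ws vs(1) \<alpha>s by (auto dest: list_all2_lengthD hom_list_length)
    have "map2 (pairing smul) (map2 (right_act smul) \<alpha>s ws) (map sing vs) = map2 (pairing smul) \<alpha>s (map sing ?vs')"
    proof (rule nth_equalityI)
      fix j assume "j < length (map2 (pairing smul) (map2 (right_act smul) \<alpha>s ws) (map sing vs))"
      then have j: "j < length ds" using len by simp
      have a: "\<alpha>s ! j \<in> OA_hom smul (ds ! j)" "length (vs ! j) = ds ! j" "(ws ! j) permutes {1..ds ! j}"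
        using j \<alpha>s vs(1) ws by (auto simp: hom_list_def list_all2_conv_all_nth)
      have "pairing smul (right_act smul (\<alpha>s ! j) (ws ! j)) (sing (vs ! j)) = pairing smul (\<alpha>s ! j) (sing (permute_fst (inv (ws ! j)) (vs ! j)))"
        by (rule pairing_eqI) (use a in \<open>auto intro: OA_hom_vspace right_act_hom simp: pval_right_act[OF a]\<close>)
      then show "map2 (pairing smul) (map2 (right_act smul) \<alpha>s ws) (map sing vs) ! j = map2 (pairing smul) \<alpha>s (map sing ?vs') ! j"
        using j len by simp
    qed (use len in simp)
    then have "pval smul (\<Phi> (ptensor (OA smul) (map2 (right_act smul) \<alpha>s ws))) (concat vs) = pval smul (\<Phi> (ptensor (OA smul) \<alpha>s)) (concat ?vs')"
      unfolding induces_words[OF ind n hl vs(1), symmetric] induces_words[OF ind n \<alpha>s vs', symmetric] by simp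
    then show ?thesis
      by (simp add: pval_right_act[OF h v perm_prod_permutes[OF ws]]) (simp add: vs(2) permute_fst_concat[OF ws vs(1)])
  qed
  then show ?thesis by (subst cong_R_iff[OF h' right_act_hom[OF h]]) blast
qed

section \<open>Induced maps are determined by symbols and words\<close>

lemma gens_Rep [simp]: "gens (Rep smul) = UNIV" by (simp add: Rep_def)

lemma cls_Rep_vspace [simp]: "cls (Rep smul) p \<in> vspace (Rep smul)"
  by (rule cls_in_vspace) simp

lemma map_cls_cform: "set l \<subseteq> vspace P \<Longrightarrow> map (\<lambda>f. cls P f) (map (cform P) l) = l"
  by (induction l) (auto simp: cls_cform)

lemma multilinear_Rep:
  assumes "T \<in> linear_maps (tpow n (Rep smul)) Q"
  shows "multilinear n (\<lambda>ps. cform Q (T (ptensor (Rep smul) (map (cls (Rep smul)) ps))))"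
  by (rule linear_maps_tpow_multilinear[OF assms]) (simp_all add: vadd_cls vscale_cls)

lemma linear_maps_Rep_eqI:
  fixes T T' :: "((('a::{ring, monoid_mult}, 'N::finite) rmonom \<Rightarrow>\<^sub>0 'k::field) set list \<Rightarrow>\<^sub>0 'k) set \<Rightarrow> ('y \<Rightarrow>\<^sub>0 'k) set"
  assumes T: "T \<in> linear_maps (tpow n (Rep smul)) Q" "T' \<in> linear_maps (tpow n (Rep smul)) Q"
    and eq: "\<And>ms. length ms = n \<Longrightarrow>
      T (ptensor (Rep smul) (map (\<lambda>m. cls (Rep smul) (sing m)) ms)) = T' (ptensor (Rep smul) (map (\<lambda>m. cls (Rep smul) (sing m)) ms))"
  shows "T = T'"
proof (rule linear_maps_ext[OF T], rule linear_maps_eq_on_ptensor[OF T])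
  fix l :: "(('a, 'N) rmonom \<Rightarrow>\<^sub>0 'k) set list" assume l: "length l = n" "set l \<subseteq> vspace (Rep smul)"
  have v: "T (ptensor (Rep smul) l) \<in> vspace Q" "T' (ptensor (Rep smul) l) \<in> vspace Q"
    using T ptensor_vspace[OF l] by (auto simp: linear_maps_def)
  have "cform Q (T (ptensor (Rep smul) (map (cls (Rep smul)) (map (cform (Rep smul)) l))))
      = cform Q (T' (ptensor (Rep smul) (map (cls (Rep smul)) (map (cform (Rep smul)) l))))"
  proof (rule multilinear_agree[OF multilinear_Rep[OF T(1)] multilinear_Rep[OF T(2)]])
    fix ms assume "list_all2 (\<lambda>x f. x \<in> Poly_Mapping.keys f) ms (map (cform (Rep smul)) l)"
    then have "length ms = n" using l by (auto dest: list_all2_lengthD)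
    from eq[OF this] show "cform Q (T (ptensor (Rep smul) (map (cls (Rep smul)) (map sing ms))))
        = cform Q (T' (ptensor (Rep smul) (map (cls (Rep smul)) (map sing ms))))" by (simp add: o_def)
  qed (use l in simp)
  then show "T (ptensor (Rep smul) l) = T' (ptensor (Rep smul) l)"
    unfolding map_cls_cform[OF l(2)] using v by (intro cform_inj) auto
qed

lemma restr_OA_cls:
  "cls (OA smul) (restr (OA smul) (f + g)) = vadd (OA smul) (cls (OA smul) (restr (OA smul) f)) (cls (OA smul) (restr (OA smul) g))"
  "cls (OA smul) (restr (OA smul) (pm_scale c f)) = vscale (OA smul) c (cls (OA smul) (restr (OA smul) f))"
  "cls (OA smul) (restr (OA smul) f) \<in> vspace (OA smul)"
  by (simp_all add: restr_add restr_scale vadd_cls vscale_cls cls_in_vspace restr_keys)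

lemma osyms_gens: "x \<in> osyms d \<Longrightarrow> x \<in> gens (OA smul)" by (auto simp: OA_def)

lemma restr_sing: "x \<in> gens P \<Longrightarrow> restr P (sing x) = sing x"
  by (rule restr_eq) simp

lemma pval_eq_cform:
  assumes "\<beta> \<in> vspace (OA smul)"
  shows "pval smul \<beta> w = lin_ext (\<lambda>x. pw smul x w) (cform (OA smul) \<beta>)"
  using pval_cls[of smul "cform (OA smul) \<beta>" w] by (simp add: cls_cform[OF assms])

lemma degree_zero_multilinear:
  assumes \<Phi>: "\<Phi> \<in> linear_maps (tpow n (OA smul)) (OA smul)"
  shows "multilinear n (\<lambda>fs. pval smul (\<Phi> (ptensor (OA smul) (map (\<lambda>f. cls (OA smul) (restr (OA smul) f)) fs))) W)"
proof -
  have m: "multilinear n (\<lambda>fs. cform (OA smul) (\<Phi> (ptensor (OA smul) (map (\<lambda>f. cls (OA smul) (restr (OA smul) f)) fs))))"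
    by (rule linear_maps_tpow_multilinear[OF \<Phi>]) (rule restr_OA_cls)+
  have v: "\<Phi> (ptensor (OA smul) (map (\<lambda>f. cls (OA smul) (restr (OA smul) f)) fs)) \<in> vspace (OA smul)" if "length fs = n" for fs
  proof -
    have "ptensor (OA smul) (map (\<lambda>f. cls (OA smul) (restr (OA smul) f)) fs) \<in> vspace (tpow n (OA smul))"
      by (rule ptensor_vspace) (use that restr_OA_cls(3) in auto)
    then show ?thesis using \<Phi> by (auto simp: linear_maps_def)
  qed
  show ?thesis unfolding multilinear_def
  proof (intro allI impI conjI)
    fix xs ys :: "('a osym \<Rightarrow>\<^sub>0 'b) list" and f g c assume n: "Suc (length xs + length ys) = n"
    then have l: "length (xs @ f # ys) = n" for f by simp
    show "pval smul (\<Phi> (ptensor (OA smul) (map (\<lambda>f. cls (OA smul) (restr (OA smul) f)) (xs @ (f + g) # ys)))) W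
      = pval smul (\<Phi> (ptensor (OA smul) (map (\<lambda>f. cls (OA smul) (restr (OA smul) f)) (xs @ f # ys)))) W
      + pval smul (\<Phi> (ptensor (OA smul) (map (\<lambda>f. cls (OA smul) (restr (OA smul) f)) (xs @ g # ys)))) W"
      unfolding pval_eq_cform[OF v[OF l]] using m n by (simp only: multilinear_def lin_ext_add)
    show "pval smul (\<Phi> (ptensor (OA smul) (map (\<lambda>f. cls (OA smul) (restr (OA smul) f)) (xs @ pm_scale c f # ys)))) W
      = pm_scale c (pval smul (\<Phi> (ptensor (OA smul) (map (\<lambda>f. cls (OA smul) (restr (OA smul) f)) (xs @ f # ys)))) W)"
      unfolding pval_eq_cform[OF v[OF l]] using m n by (simp only: multilinear_def lin_ext_scale)
  qed
qed

lemma pval_mlin: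
  assumes \<Phi>: "\<Phi> \<in> linear_maps (tpow n (OA smul)) (OA smul)" and n: "length fs = n"
    and fs: "\<And>f. f \<in> set fs \<Longrightarrow> Poly_Mapping.keys f \<subseteq> gens (OA smul)"
  shows "pval smul (\<Phi> (ptensor (OA smul) (map (cls (OA smul)) fs))) W
    = mlin (\<lambda>xs. pval smul (\<Phi> (ptensor (OA smul) (map (\<lambda>x. cls (OA smul) (sing x)) xs))) W) fs"
proof -
  have "pval smul (\<Phi> (ptensor (OA smul) (map (cls (OA smul)) fs))) W
      = pval smul (\<Phi> (ptensor (OA smul) (map (\<lambda>f. cls (OA smul) (restr (OA smul) f)) fs))) W"
    by (intro arg_cong[of _ _ "\<lambda>l. pval smul (\<Phi> (ptensor (OA smul) l)) W"] map_cong refl) (simp add: restr_eq fs)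
  also have "\<dots> = mlin (\<lambda>xs. pval smul (\<Phi> (ptensor (OA smul) (map (\<lambda>f. cls (OA smul) (restr (OA smul) f)) (map sing xs)))) W) fs"
    by (rule multilinear_eq_mlin[OF degree_zero_multilinear[OF \<Phi>] n])
  also have "\<dots> = mlin (\<lambda>xs. pval smul (\<Phi> (ptensor (OA smul) (map (\<lambda>x. cls (OA smul) (sing x)) xs))) W) fs"
  proof (rule mlin_cong)
    fix xs assume "list_all2 (\<lambda>x f. x \<in> Poly_Mapping.keys f) xs fs"
    then have "\<forall>x\<in>set xs. x \<in> gens (OA smul)"
      using fs by (fastforce simp: list_all2_conv_all_nth in_set_conv_nth)
    then have "map (\<lambda>f. cls (OA smul) (restr (OA smul) f)) (map sing xs) = map (\<lambda>x. cls (OA smul) (sing x)) xs"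
      by (simp add: restr_sing)
    then show "pval smul (\<Phi> (ptensor (OA smul) (map (\<lambda>f. cls (OA smul) (restr (OA smul) f)) (map sing xs)))) W
      = pval smul (\<Phi> (ptensor (OA smul) (map (\<lambda>x. cls (OA smul) (sing x)) xs))) W" by (simp only:)
  qed
  finally show ?thesis .
qed

lemma hom_list_cases:
  assumes "hom_list smul ds \<alpha>s"
  obtains fs where "\<alpha>s = map (cls (OA smul)) fs" "list_all2 (\<lambda>d f. Poly_Mapping.keys f \<subseteq> osyms d) ds fs"
proof -
  have "\<exists>fs. \<alpha>s = map (cls (OA smul)) fs \<and> list_all2 (\<lambda>d f. Poly_Mapping.keys f \<subseteq> osyms d) ds fs"
    using assms unfolding hom_list_def
  proof (induction rule: list_all2_induct)
    case (Cons d ds \<alpha> \<alpha>s)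
    obtain f where "\<alpha> = cls (OA smul) f" "Poly_Mapping.keys f \<subseteq> osyms d" using Cons(1) by (rule OA_hom_cases)
    moreover obtain fs where "\<alpha>s = map (cls (OA smul)) fs" "list_all2 (\<lambda>d f. Poly_Mapping.keys f \<subseteq> osyms d) ds fs"
      using Cons(3) by blast
    ultimately show ?case by (intro exI[of _ "f # fs"]) simp
  qed simp
  then show thesis using that by blast
qed

text \<open>Both sides of the defining equation are multilinear, so it is enough to test symbols against words.\<close>

lemma inducesI_symbols:
  fixes \<phi> :: "('a::{ring, monoid_mult}, 'N::finite, 'k::field) rep_map"
  assumes \<Phi>: "\<Phi> \<in> degree_zero_maps smul n" and \<phi>: "\<phi> \<in> linear_maps (tpow n (Rep smul)) (Rep smul)"
    and eq: "\<And>xs ws. length xs = n \<Longrightarrow> list_all2 (\<lambda>x w. x \<in> osyms (length w)) xs ws \<Longrightarrow>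
      cform (Rep smul) (\<phi> (ptensor (Rep smul) (map2 (\<lambda>x w. cls (Rep smul) (pair_sym x w)) xs ws)))
      = pval smul (\<Phi> (ptensor (OA smul) (map (\<lambda>x. cls (OA smul) (sing x)) xs))) (concat ws)"
  shows "induces smul n \<Phi> \<phi>"
  unfolding induces_def
proof (intro allI impI, elim conjE)
  fix ds \<alpha>s and Xs :: "('N, 'k) tensors list"
  assume n: "length ds = n" and h: "hom_list smul ds \<alpha>s" and X: "list_all2 (\<lambda>d X. X \<in> tensors_deg d) ds Xs"
  have \<Phi>': "\<Phi> \<in> linear_maps (tpow n (OA smul)) (OA smul)" using \<Phi> by (simp add: degree_zero_maps_def)
  obtain fs where fs: "\<alpha>s = map (cls (OA smul)) fs" "list_all2 (\<lambda>d f. Poly_Mapping.keys f \<subseteq> osyms d) ds fs"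
    using h by (rule hom_list_cases)
  have len: "length fs = n" "length Xs = n" using fs(2) X n by (auto dest: list_all2_lengthD)
  have gens: "Poly_Mapping.keys f \<subseteq> gens (OA smul)" if "f \<in> set fs" for f
    using that fs(2) osyms_gens by (fastforce simp: list_all2_conv_all_nth in_set_conv_nth)
  define K where "K ps = cform (Rep smul) (\<phi> (ptensor (Rep smul) (map (cls (Rep smul)) ps)))" for ps :: "(('a, 'N) rmonom \<Rightarrow>\<^sub>0 'k) list"
  have K: "multilinear n K" unfolding K_def by (rule multilinear_Rep[OF \<phi>])
  let ?h = "pair_sym :: 'a osym \<Rightarrow> ('N \<times> 'N) list \<Rightarrow> ('a, 'N) rmonom \<Rightarrow>\<^sub>0 'k"
  have hom: "\<Phi> (ptensor (OA smul) \<alpha>s) \<in> OA_hom smul (sum_list ds)" by (rule degree_zero_hom[OF \<Phi> n h])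
  have "\<alpha> \<in> vspace (OA smul)" if "\<alpha> \<in> set \<alpha>s" for \<alpha>
    using that gens unfolding fs(1) by (auto intro: cls_in_vspace)
  then have vl: "set (map2 (pairing smul) \<alpha>s Xs) \<subseteq> vspace (Rep smul)"
    by (auto intro!: pairing_in_vspace dest: set_zip_leftD)
  have "map2 (pairing smul) \<alpha>s Xs = map (cls (Rep smul)) (map2 (\<lambda>f X. lin_ext (\<lambda>x. lin_ext (?h x) X) f) fs Xs)"
    unfolding fs(1) by (rule nth_equalityI) (simp_all add: pairing_cls)
  then have "cform (Rep smul) (\<phi> (ptensor (Rep smul) (map2 (pairing smul) \<alpha>s Xs))) = K (map2 (\<lambda>f X. lin_ext (\<lambda>x. lin_ext (?h x) X) f) fs Xs)"
    by (simp add: K_def)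
  also have "\<dots> = mlin (\<lambda>xs. mlin (\<lambda>ws. K (map2 ?h xs ws)) Xs) fs"
    by (rule multilinear_map2[OF K len])
  also have "\<dots> = mlin (\<lambda>xs. mlin (\<lambda>ws. pval smul (\<Phi> (ptensor (OA smul) (map (\<lambda>x. cls (OA smul) (sing x)) xs))) (concat ws)) Xs) fs"
  proof (rule mlin_cong, rule mlin_cong)
    fix xs ws assume xs: "list_all2 (\<lambda>x f. x \<in> Poly_Mapping.keys f) xs fs" and ws: "list_all2 (\<lambda>w X. w \<in> Poly_Mapping.keys X) ws Xs"
    have l: "length xs = n" "length ws = n" using xs ws len by (auto dest: list_all2_lengthD)
    have "xs ! j \<in> osyms (length (ws ! j))" if "j < n" for j
    proof -
      have "xs ! j \<in> Poly_Mapping.keys (fs ! j)" "ws ! j \<in> Poly_Mapping.keys (Xs ! j)"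
        "Poly_Mapping.keys (fs ! j) \<subseteq> osyms (ds ! j)" "Xs ! j \<in> tensors_deg (ds ! j)"
        using that xs ws fs(2) X len n by (auto simp: list_all2_conv_all_nth)
      moreover from this have "length (ws ! j) = ds ! j" by (auto simp: tensors_deg_def)
      ultimately show ?thesis by auto
    qed
    then have val: "list_all2 (\<lambda>x w. x \<in> osyms (length w)) xs ws" using l by (simp add: list_all2_conv_all_nth)
    have "K (map2 ?h xs ws) = cform (Rep smul) (\<phi> (ptensor (Rep smul) (map2 (\<lambda>x w. cls (Rep smul) (?h x w)) xs ws)))"
      by (simp add: K_def o_def split_def)
    then show "K (map2 ?h xs ws)
      = pval smul (\<Phi> (ptensor (OA smul) (map (\<lambda>x. cls (OA smul) (sing x)) xs))) (concat ws)"
      using eq[OF l(1) val] by simp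
  qed
  also have "\<dots> = mlin (\<lambda>ws. mlin (\<lambda>xs. pval smul (\<Phi> (ptensor (OA smul) (map (\<lambda>x. cls (OA smul) (sing x)) xs))) (concat ws)) fs) Xs"
    by (rule mlin_swap[symmetric])
  also have "\<dots> = mlin (\<lambda>ws. pval smul (\<Phi> (ptensor (OA smul) \<alpha>s)) (concat ws)) Xs"
    unfolding fs(1) by (simp only: pval_mlin[OF \<Phi>' len(1) gens])
  also have "\<dots> = cform (Rep smul) (pairing smul (\<Phi> (ptensor (OA smul) \<alpha>s)) (tprod Xs))"
    by (simp add: cform_pairing[OF OA_hom_vspace[OF hom]] tprod_eq_mlin lin_ext_mlin)
  finally show "\<phi> (ptensor (Rep smul) (map2 (pairing smul) \<alpha>s Xs)) = pairing smul (\<Phi> (ptensor (OA smul) \<alpha>s)) (tprod Xs)"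
  proof (rule cform_inj[rotated 2])
    have "ptensor (Rep smul) (map2 (pairing smul) \<alpha>s Xs) \<in> vspace (tpow n (Rep smul))"
      by (rule ptensor_vspace) (use vl len fs(1) in auto)
    then show "\<phi> (ptensor (Rep smul) (map2 (pairing smul) \<alpha>s Xs)) \<in> vspace (Rep smul)"
      using \<phi> by (auto simp: linear_maps_def)
    show "pairing smul (\<Phi> (ptensor (OA smul) \<alpha>s)) (tprod Xs) \<in> vspace (Rep smul)"
      by (rule pairing_in_vspace[OF OA_hom_vspace[OF hom]])
  qed
qed

definition mon_of :: "'x list \<Rightarrow> 'x \<Rightarrow>\<^sub>0 nat" where
  "mon_of xs = sum_list (map (\<lambda>x. Poly_Mapping.single x 1) xs)"

lemma mon_of_simps [simp]: "mon_of [] = 0" "mon_of (x # xs) = Poly_Mapping.single x 1 + mon_of xs"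
  "mon_of (xs @ ys) = mon_of xs + mon_of ys"
  by (simp_all add: mon_of_def)

lemma mon_of_surj: "\<exists>xs. mon_of xs = m"
proof -
  have 1: "\<exists>xs. mon_of xs = Poly_Mapping.single x n" for x :: 'a and n
  proof (induction n)
    case 0 show ?case by (rule exI[of _ "[]"]) simp
  next
    case (Suc n)
    then obtain xs where "mon_of xs = Poly_Mapping.single x n" ..
    then show ?case by (intro exI[of _ "x # xs"]) (simp add: single_add[symmetric])
  qed
  have 2: "\<exists>xs. mon_of xs = (\<Sum>x\<in>S. Poly_Mapping.single x (Poly_Mapping.lookup m x))" if "finite S" for S
    using that
  proof induction
    case empty show ?case by (rule exI[of _ "[]"]) simp
  next
    case (insert x S)
    then obtain xs where "mon_of xs = (\<Sum>x\<in>S. Poly_Mapping.single x (Poly_Mapping.lookup m x))" by blast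
    moreover obtain ys where "mon_of ys = Poly_Mapping.single x (Poly_Mapping.lookup m x)" using 1 by blast
    ultimately show ?case using insert.hyps by (intro exI[of _ "ys @ xs"]) simp
  qed
  have "(\<Sum>x\<in>Poly_Mapping.keys m. Poly_Mapping.single x (Poly_Mapping.lookup m x)) = m"
    by (rule poly_mapping_eqI) (auto simp: lookup_sum lookup_single when_def in_keys_iff)
  then show ?thesis using 2[of "Poly_Mapping.keys m"] by simp
qed

lemma mon_of_eq_iff: "mon_of xs = mon_of ys \<longleftrightarrow> mset xs = mset ys"
proof -
  have "Poly_Mapping.lookup (mon_of xs) x = count (mset xs) x" for xs :: "'a list" and x
    by (induction xs) (auto simp: lookup_add lookup_single when_def)
  then show ?thesis by (metis multiset_eqI poly_mapping_eqI)
qed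

text \<open>A monomial as a list of variables, in an arbitrary but fixed order.\<close>

definition mlist :: "('x \<Rightarrow>\<^sub>0 nat) \<Rightarrow> 'x list" where "mlist m = (SOME xs. mon_of xs = m)"

lemma mon_of_mlist [simp]: "mon_of (mlist m) = m"
  unfolding mlist_def by (rule someI_ex[OF mon_of_surj])

text \<open>The symbol whose pairing with \<open>map snd zs\<close> is the product of the variables \<open>zs\<close>, see \<open>pair_sym_vsym\<close>.\<close>

definition vsym :: "('a \<times> 'N \<times> 'N) list \<Rightarrow> 'a osym" where "vsym zs = (map fst zs, {#}, id)"

lemma vsym_osyms: "vsym zs \<in> osyms (length (map snd zs))"
  by (simp add: vsym_def osyms_def permutes_id)

lemma pair_sym_vsym: "pair_sym (vsym zs) (map snd zs) = (sing (mon_of zs) :: ('a, 'N::finite) rmonom \<Rightarrow>\<^sub>0 'k::field)"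
proof -
  have "(\<Prod>t = 1..length zs. rvar (map fst zs ! (t - 1)) (fst (map snd zs ! (t - 1))) (snd (map snd zs ! (t - 1))))
     = (sing (mon_of zs) :: ('a, 'N) rmonom \<Rightarrow>\<^sub>0 'k)"
  proof (induction zs)
    case Nil
    show ?case by (simp add: sing_def)
  next
    case (Cons z zs)
    have "(\<Prod>t = 1..length zs. rvar (map fst (z # zs) ! (Suc t - 1)) (fst (map snd (z # zs) ! (Suc t - 1))) (snd (map snd (z # zs) ! (Suc t - 1))))
      = (\<Prod>t = 1..length zs. rvar (map fst zs ! (t - 1)) (fst (map snd zs ! (t - 1))) (snd (map snd zs ! (t - 1))) :: ('a, 'N) rmonom \<Rightarrow>\<^sub>0 'k)"
      by (rule prod.cong) (auto simp: nth_Cons')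
    then show ?case unfolding length_Cons prod_atLeast1_shift using Cons
      by (cases z) (simp add: rvar_def sing_def mult_single)
  qed
  then show ?thesis by (simp add: vsym_def pair_sym_def inv_id)
qed

lemma pairing_sing: "pairing smul (cls (OA smul) (sing x)) (sing w) = cls (Rep smul) (pair_sym x w)"
  by (simp add: pairing_cls)

text \<open>Monomials are pairings of homogeneous elements, so an induced map is determined by its defining
equation.\<close>

lemma monomial_pairings:
  "map (\<lambda>m. cls (Rep smul) (sing m)) ms
    = map2 (pairing smul) (map (\<lambda>m. cls (OA smul) (sing (vsym (mlist m)))) ms) (map (\<lambda>m. sing (map snd (mlist m))) ms)"
  "hom_list smul (map (\<lambda>m. length (mlist m)) ms) (map (\<lambda>m. cls (OA smul) (sing (vsym (mlist m)))) ms)"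
  "list_all2 (\<lambda>d X. X \<in> tensors_deg d) (map (\<lambda>m. length (mlist m)) ms) (map (\<lambda>m. sing (map snd (mlist m))) ms)"
  using vsym_osyms
  by (induction ms) (auto simp: pairing_sing pair_sym_vsym hom_list_def tensors_deg_def intro!: OA_hom_cls)

lemma induces_unique:
  fixes \<phi> \<phi>' :: "('a::{ring, monoid_mult}, 'N::finite, 'k::field) rep_map"
  assumes \<phi>: "\<phi> \<in> linear_maps (tpow n (Rep smul)) (Rep smul)" "\<phi>' \<in> linear_maps (tpow n (Rep smul)) (Rep smul)"
    and ind: "induces smul n \<Phi> \<phi>" "induces smul n \<Phi> \<phi>'"
  shows "\<phi> = \<phi>'"
proof (rule linear_maps_Rep_eqI[OF \<phi>])
  fix ms :: "('a, 'N) rmonom list" assume "length ms = n"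
  then show "\<phi> (ptensor (Rep smul) (map (\<lambda>m. cls (Rep smul) (sing m)) ms)) = \<phi>' (ptensor (Rep smul) (map (\<lambda>m. cls (Rep smul) (sing m)) ms))"
    using ind monomial_pairings(2)[where smul = smul and ms = ms] monomial_pairings(3)[where ms = ms] unfolding monomial_pairings(1) induces_def by (metis length_map)
qed

section \<open>Induced maps are equivariant\<close>

lemma tensor_act_sing: "tensor_act g (sing w) = (\<Sum>v | length v = length w. pm_scale (wcoeff g w v) (sing v))"
  by (simp add: tensor_act_def wcoeff_def sing_def)

lemma tprod_Cons: "tprod (X # Xs) = lin_ext (\<lambda>v. lin_ext (\<lambda>w. sing (v @ w)) (tprod Xs)) X"
  by (simp add: tprod_def tmult_def sing_def)

text \<open>The action on words is diagonal.\<close>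

lemma tprod_tensor_act: "tprod (map (\<lambda>w. tensor_act g (sing w)) ws) = tensor_act g (sing (concat ws))"
proof (induction ws)
  case Nil
  show ?case by (simp add: tensor_act_sing tprod_def) (simp add: wcoeff_def sing_def)
next
  case (Cons w ws)
  let ?c = "concat ws"
  have "tprod (map (\<lambda>w. tensor_act g (sing w)) (w # ws))
    = (\<Sum>v | length v = length w. \<Sum>v' | length v' = length ?c. pm_scale (wcoeff g w v * wcoeff g ?c v') (sing (v @ v')))"
    by (simp add: tprod_Cons Cons) (simp add: tensor_act_sing act_sum lin_ext_scale pm.scale_sum_right)
  also have "\<dots> = (\<Sum>v | length v = length w. \<Sum>v' | length v' = length ?c. pm_scale (wcoeff g (w @ ?c) (v @ v')) (sing (v @ v')))"
    by (intro sum.cong refl) (simp add: wcoeff_append)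
  also have "\<dots> = (\<Sum>v | length v = length w + length ?c. pm_scale (wcoeff g (w @ ?c) v) (sing v))"
    by (rule sum_words_append[symmetric])
  finally show ?case by (simp add: tensor_act_sing)
qed

lemma tpow_map_cls:
  fixes P :: "('x, 'k::field) presentation" and Q :: "('y, 'k) presentation"
  assumes T: "\<And>C. C \<in> vspace P \<Longrightarrow> T C \<in> vspace Q"
    "\<And>C D. C \<in> vspace P \<Longrightarrow> D \<in> vspace P \<Longrightarrow> T (vadd P C D) = vadd Q (T C) (T D)"
    "\<And>c C. C \<in> vspace P \<Longrightarrow> T (vscale P c C) = vscale Q c (T C)"
  shows "tpow_map n Q T (cls (tpow n P) f) = cls (tpow n Q) (lin_ext (\<lambda>l. Poly_Mapping.single (map T l) 1) f)"
  unfolding tpow_map_def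
proof (rule descend_lin_ext)
  fix r assume "r \<in> rels (tpow n P)"
  then consider (add) l i x y where "length l = n" "set l \<subseteq> vspace P" "i < n" "x \<in> vspace P" "y \<in> vspace P"
      "r = Poly_Mapping.single (l[i := vadd P x y]) 1 - Poly_Mapping.single (l[i := x]) 1 - Poly_Mapping.single (l[i := y]) 1"
    | (scale) l i a x where "length l = n" "set l \<subseteq> vspace P" "i < n" "x \<in> vspace P"
      "r = Poly_Mapping.single (l[i := vscale P a x]) 1 - Poly_Mapping.single (l[i := x]) a"
    unfolding tpow_def by auto
  then have "lin_ext (\<lambda>l. Poly_Mapping.single (map T l) 1) r \<in> rels (tpow n Q)"
  proof cases
    case add
    show ?thesis unfolding tpow_def presentation.simps
      by (rule UnI1, intro CollectI exI[of _ "map T l"] exI[of _ i] exI[of _ "T x"] exI[of _ "T y"])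
        (use add T in \<open>auto simp: lin_rel map_update\<close>)
  next
    case scale
    show ?thesis unfolding tpow_def presentation.simps
      by (rule UnI2, intro CollectI exI[of _ "map T l"] exI[of _ i] exI[of _ a] exI[of _ "T x"])
        (use scale T in \<open>auto simp: lin_rel map_update\<close>)
  qed
  then show "lin_ext (\<lambda>l. Poly_Mapping.single (map T l) 1) r \<in> rel_span (tpow n Q)" by (rule rel_span_base)
qed

lemma rep_act_linear:
  fixes g :: "'k::field ^ 'N ^ 'N::finite" and smul :: "'k \<Rightarrow> 'a::{ring, monoid_mult} \<Rightarrow> 'a"
  assumes g: "invertible g"
  shows "C \<in> vspace (Rep smul) \<Longrightarrow> rep_act smul g C \<in> vspace (Rep smul)"
    "C \<in> vspace (Rep smul) \<Longrightarrow> D \<in> vspace (Rep smul) \<Longrightarrow> rep_act smul g (vadd (Rep smul) C D) = vadd (Rep smul) (rep_act smul g C) (rep_act smul g D)"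
    "C \<in> vspace (Rep smul) \<Longrightarrow> rep_act smul g (vscale (Rep smul) c C) = vscale (Rep smul) c (rep_act smul g C)"
  by (auto simp: vspace_def[of "Rep smul"] rep_act_cls[OF g] vadd_cls vscale_cls lin_ext_add lin_ext_scale)

text \<open>The two sides agree on tensors of monomials, which are pairings: the group element moves to the words by
\<open>g.(\<alpha>|X) = (\<alpha>|g.X)\<close>, and concatenation of words is equivariant.\<close>

lemma induces_GL_equivariant:
  fixes \<phi> :: "('a::{ring, monoid_mult}, 'N::finite, 'k::field) rep_map"
  assumes \<Phi>: "\<Phi> \<in> degree_zero_maps smul n" and \<phi>: "\<phi> \<in> linear_maps (tpow n (Rep smul)) (Rep smul)"
    and ind: "induces smul n \<Phi> \<phi>"
  shows "GL_equivariant smul n \<phi>"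
  unfolding GL_equivariant_def
proof (intro allI impI ballI)
  fix g :: "'k ^ 'N ^ 'N" and x :: "((('a, 'N) rmonom \<Rightarrow>\<^sub>0 'k) set list \<Rightarrow>\<^sub>0 'k) set"
  assume g: "invertible g" and x: "x \<in> vspace (tpow n (Rep smul))"
  let ?R = "Rep smul :: (('a, 'N) rmonom, 'k) presentation"
  let ?V = "vspace (tpow n ?R)"
  let ?t = "tpow_map n ?R (rep_act smul g)"
  note act = rep_act_linear[OF g, of _ smul]
  have t: "?t (cls (tpow n ?R) f) = cls (tpow n ?R) (lin_ext (\<lambda>l. Poly_Mapping.single (map (rep_act smul g) l) 1) f)" for f
    by (rule tpow_map_cls) (use act in auto)
  have tV: "?t C \<in> ?V" if C: "C \<in> ?V" for C
  proof -
    obtain f where f: "C = cls (tpow n ?R) f" "Poly_Mapping.keys f \<subseteq> gens (tpow n ?R)" using C by (auto simp: vspace_def)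
    show ?thesis unfolding f(1) t
      by (rule cls_in_vspace, rule keys_lin_ext_subset[OF f(2)]) (use act(1) in \<open>auto simp: tpow_def\<close>)
  qed
  have t_add: "?t (vadd (tpow n ?R) C D) = vadd (tpow n ?R) (?t C) (?t D)" if "C \<in> ?V" "D \<in> ?V" for C D
    using that by (auto simp: vspace_def t vadd_cls lin_ext_add)
  have t_scale: "?t (vscale (tpow n ?R) c C) = vscale (tpow n ?R) c (?t C)" if "C \<in> ?V" for c C
    using that by (auto simp: vspace_def t vscale_cls lin_ext_scale)
  have \<phi>V: "\<phi> C \<in> vspace ?R" if "C \<in> ?V" for C using \<phi> that by (auto simp: linear_maps_def)
  have \<phi>_add: "\<phi> (vadd (tpow n ?R) C D) = vadd ?R (\<phi> C) (\<phi> D)" if "C \<in> ?V" "D \<in> ?V" for C D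
    using \<phi> that by (simp add: linear_maps_def)
  have \<phi>_scale: "\<phi> (vscale (tpow n ?R) c C) = vscale ?R c (\<phi> C)" if "C \<in> ?V" for c C
    using \<phi> that by (simp add: linear_maps_def)
  \<comment> \<open>Elements of \<open>linear_maps\<close> are extensional, hence the restrictions.\<close>
  define T1 where "T1 = restrict (\<lambda>x. \<phi> (?t x)) ?V"
  define T2 where "T2 = restrict (\<lambda>x. rep_act smul g (\<phi> x)) ?V"
  have "T1 \<in> linear_maps (tpow n ?R) ?R"
    unfolding linear_maps_def T1_def
    by (auto simp: tV \<phi>V vadd_vspace vscale_vspace t_add t_scale \<phi>_add \<phi>_scale)
  moreover have "T2 \<in> linear_maps (tpow n ?R) ?R"
    unfolding linear_maps_def T2_def
    by (auto simp: \<phi>V vadd_vspace vscale_vspace \<phi>_add \<phi>_scale act)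
  moreover have "T1 (ptensor ?R (map (\<lambda>m. cls ?R (sing m)) ms)) = T2 (ptensor ?R (map (\<lambda>m. cls ?R (sing m)) ms))"
    if ms: "length ms = n" for ms
  proof -
    let ?ds = "map (\<lambda>m. length (mlist m)) ms"
    let ?as = "map (\<lambda>m. cls (OA smul) (sing (vsym (mlist m)))) ms"
    let ?ws = "map (\<lambda>m. map snd (mlist m)) ms"
    let ?l = "map (\<lambda>m. cls ?R (sing m)) ms"
    have Xs: "map (\<lambda>m. sing (map snd (mlist m))) ms = map sing ?ws" by simp
    have h: "hom_list smul ?ds ?as" by (rule monomial_pairings(2))
    have l: "?l = map2 (pairing smul) ?as (map sing ?ws)" unfolding Xs[symmetric] by (rule monomial_pairings(1))
    have lv: "set ?l \<subseteq> vspace ?R" by auto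
    have hom: "\<Phi> (ptensor (OA smul) ?as) \<in> vspace (OA smul)"
      using degree_zero_hom[OF \<Phi> _ h] ms by (intro OA_hom_vspace) simp
    have l': "map (rep_act smul g) ?l = map2 (pairing smul) ?as (map (\<lambda>w. tensor_act g (sing w)) ?ws)"
    proof (rule nth_equalityI)
      fix j assume "j < length (map (rep_act smul g) ?l)"
      then have j: "j < length ms" by simp
      have "?as ! j \<in> vspace (OA smul)" using h j by (auto simp: hom_list_def list_all2_conv_all_nth intro: OA_hom_vspace)
      from rep_act_pairing[OF g this, of "sing (?ws ! j)"]
      show "map (rep_act smul g) ?l ! j = map2 (pairing smul) ?as (map (\<lambda>w. tensor_act g (sing w)) ?ws) ! j"
        using j unfolding l by simp
    qed simp
    have ptV: "ptensor ?R ?l \<in> ?V" by (rule ptensor_vspace) (use ms lv in auto)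
    have "?t (ptensor ?R ?l) = ptensor ?R (map (rep_act smul g) ?l)"
      using t[of "Poly_Mapping.single ?l 1"] ms by (simp add: ptensor_def o_def)
    then have "T1 (ptensor ?R ?l) = \<phi> (ptensor ?R (map2 (pairing smul) ?as (map (\<lambda>w. tensor_act g (sing w)) ?ws)))"
      using ptV by (simp only: T1_def restrict_apply' l')
    also have "\<dots> = pairing smul (\<Phi> (ptensor (OA smul) ?as)) (tprod (map (\<lambda>w. tensor_act g (sing w)) ?ws))"
    proof -
      have keys_ok: "tensor_act g (sing w) \<in> tensors_deg (length w)" for w :: "('N \<times> 'N) list"
      proof -
        have "Poly_Mapping.keys (\<Sum>v | length v = length w. pm_scale (wcoeff g w v) (sing v)) \<subseteq> {v. length v = length w}"
          by (rule order_trans[OF keys_sum]) (use keys_pm_scale in fastforce)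
        then show ?thesis by (simp add: tensor_act_sing tensors_deg_def)
      qed
      have "list_all2 (\<lambda>d X. X \<in> tensors_deg d) ?ds (map (\<lambda>w. tensor_act g (sing w)) ?ws)"
      proof -
        have "tensor_act g (sing (map snd (mlist m))) \<in> tensors_deg (length (mlist m))" for m :: "('a, 'N) rmonom"
          using keys_ok[of "map snd (mlist m)"] by simp
        then show ?thesis by (simp add: list_all2_conv_all_nth)
      qed
      then show ?thesis using ind ms h unfolding induces_def by (metis length_map)
    qed
    also have "\<dots> = rep_act smul g (pairing smul (\<Phi> (ptensor (OA smul) ?as)) (tprod (map sing ?ws)))"
      by (simp only: tprod_tensor_act tprod_sing rep_act_pairing[OF g hom])
    also have "pairing smul (\<Phi> (ptensor (OA smul) ?as)) (tprod (map sing ?ws)) = \<phi> (ptensor ?R (map2 (pairing smul) ?as (map sing ?ws)))"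
      using ind ms h monomial_pairings(3)[of ms] unfolding induces_def Xs by (metis length_map)
    finally show ?thesis using ptV by (simp only: T2_def restrict_apply' l)
  qed
  ultimately have "T1 = T2" by (intro linear_maps_Rep_eqI)
  then have "T1 x = T2 x" by simp
  then show "\<phi> (?t x) = rep_act smul g (\<phi> x)" using x by (simp add: T1_def T2_def)
qed

section \<open>Functions of symbols and words that descend to the representation algebra\<close>

text \<open>Passes from permutations of the positions \<open>0, \<dots>, n - 1\<close> of a list to those of \<open>1, \<dots>, n\<close>.\<close>

lemma shift_permutes:
  assumes p: "p permutes {..<n}"
  shows "(\<lambda>i. if 1 \<le> i \<and> i \<le> n then Suc (p (i - 1)) else i) permutes {1..n}"
proof (rule bij_imp_permutes)
  have im: "p i < n \<longleftrightarrow> i < n" for i using permutes_in_image[OF p, of i] by simp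
  have "inj_on (\<lambda>i. if 1 \<le> i \<and> i \<le> n then Suc (p (i - 1)) else i) {1..n}"
  proof (rule inj_onI)
    fix i j assume ij: "i \<in> {1..n}" "j \<in> {1..n}" "(if 1 \<le> i \<and> i \<le> n then Suc (p (i - 1)) else i) = (if 1 \<le> j \<and> j \<le> n then Suc (p (j - 1)) else j)"
    then have "p (i - 1) = p (j - 1)" by simp
    then have "i - 1 = j - 1" by (rule injD[OF permutes_inj[OF p]])
    then show "i = j" using ij by auto
  qed
  moreover have "(\<lambda>i. if 1 \<le> i \<and> i \<le> n then Suc (p (i - 1)) else i) ` {1..n} \<subseteq> {1..n}"
  proof clarify
    fix i assume i: "i \<in> {1..n}"
    then have "p (i - 1) < n" using im[of "i - 1"] by auto
    then show "(if 1 \<le> i \<and> i \<le> n then Suc (p (i - 1)) else i) \<in> {1..n}" using i by auto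
  qed
  ultimately show "bij_betw (\<lambda>i. if 1 \<le> i \<and> i \<le> n then Suc (p (i - 1)) else i) {1..n} {1..n}"
    unfolding bij_betw_def by (intro conjI endo_inj_surj finite_atLeastAtMost)
qed auto

lemma permute_word_shift:
  assumes "p permutes {..<length xs}"
  shows "permute_word (\<lambda>i. if 1 \<le> i \<and> i \<le> length xs then Suc (p (i - 1)) else i) xs = permute_list p xs"
  by (rule nth_equalityI) (use assms in \<open>auto simp: nth_permute_word permute_list_nth\<close>)

lemma permute_word_map: "\<sigma> permutes {1..length xs} \<Longrightarrow> permute_word \<sigma> (map f xs) = map f (permute_word \<sigma> xs)"
proof (rule nth_equalityI)
  fix j assume s: "\<sigma> permutes {1..length xs}" and "j < length (permute_word \<sigma> (map f xs))"
  then have j: "j < length xs" by simp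
  then have "\<sigma> (Suc j) - 1 < length xs" using permutes_in_image[OF s, of "Suc j"] by auto
  then show "permute_word \<sigma> (map f xs) ! j = map f (permute_word \<sigma> xs) ! j"
    using j by (simp add: nth_permute_word)
qed simp

lemma permute_word_inv:
  assumes s: "\<sigma> permutes {1..length xs}"
  shows "permute_word (inv \<sigma>) (permute_word \<sigma> xs) = xs"
proof (rule nth_equalityI)
  fix j assume "j < length (permute_word (inv \<sigma>) (permute_word \<sigma> xs))"
  then have j: "j < length xs" by simp
  then have i: "inv \<sigma> (Suc j) \<in> {1..length xs}" using permutes_in_image[OF permutes_inv[OF s], of "Suc j"] by auto
  then have "Suc (inv \<sigma> (Suc j) - 1) = inv \<sigma> (Suc j)" "inv \<sigma> (Suc j) - 1 < length xs" by auto
  then show "permute_word (inv \<sigma>) (permute_word \<sigma> xs) ! j = xs ! j"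
    using j permutes_inverses(1)[OF s] by (simp add: nth_permute_word)
qed simp

lemma permute_fst_transpose:
  "permute_fst (inv (Transposition.transpose 1 2)) (p # q # w) = (fst q, snd p) # (fst p, snd q) # w"
proof (rule nth_equalityI)
  fix j assume "j < length (permute_fst (inv (Transposition.transpose 1 2)) (p # q # w))"
  then have j: "j < Suc (Suc (length w))" by simp
  consider "j = 0" | "j = 1" | i where "j = Suc (Suc i)" by (cases j; cases "j - 1") auto
  then show "permute_fst (inv (Transposition.transpose 1 2)) (p # q # w) ! j = ((fst q, snd p) # (fst p, snd q) # w) ! j"
    using j by cases (simp_all add: nth_permute_fst Transposition.transpose_def)
qed simp

lemma perm_star_transpose: "perm_star (Transposition.transpose 1 2) = id"
  by (auto simp: perm_star_def fun_eq_iff Transposition.transpose_def)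

lemma perm_star_id: "perm_star id = id"
  by (auto simp: perm_star_def fun_eq_iff)

lemma perm_times_id: "perm_times n id id = id"
  by (auto simp: perm_times_def fun_eq_iff)

text \<open>A function \<open>L\<close> of a symbol and a word that obeys the rules which the pairing obeys: the relations of \<open>\<O>(A)\<close>
and the effects of \<open>\<pi>\<close>, of the unit and of the two multiplications. The aim is that \<open>L x w\<close> is the value at
\<open>(x|w)\<close> of one linear map on the representation algebra.\<close>

locale slot_functional =
  fixes smul :: "'k::field \<Rightarrow> 'a::{ring, monoid_mult} \<Rightarrow> 'a" and L :: "'a osym \<Rightarrow> ('N::finite \<times> 'N) list \<Rightarrow> 'y \<Rightarrow>\<^sub>0 'k"
  assumes L_rel: "r \<in> orels smul \<Longrightarrow> lin_ext (\<lambda>x. L x w) r = 0"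
    and L_pi: "x \<in> osyms (Suc d) \<Longrightarrow> length w = d \<Longrightarrow> lin_ext (\<lambda>y. L y w) (pi_sym x) = (\<Sum>k\<in>UNIV. L x ((k, k) # w))"
    and L_one: "x \<in> osyms d \<Longrightarrow> length w = d \<Longrightarrow> lin_ext (\<lambda>y. L y ((p, q) # w)) (one_sym x) = (if p = q then L x w else 0)"
    and L_left: "x \<in> osyms d \<Longrightarrow> length w = d \<Longrightarrow> \<sigma> permutes {1..d} \<Longrightarrow>
      lin_ext (\<lambda>y. L y w) (left_sym \<sigma> x) = L x (permute_snd \<sigma> w)"
    and L_right: "x \<in> osyms d \<Longrightarrow> length w = d \<Longrightarrow> \<sigma> permutes {1..d} \<Longrightarrow>
      lin_ext (\<lambda>y. L y w) (right_sym \<sigma> x) = L x (permute_fst (inv \<sigma>) w)"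
begin

text \<open>The only candidate: a monomial is the pairing of its own variables.\<close>

definition lval :: "(('a, 'N) rmonom \<Rightarrow>\<^sub>0 'k) \<Rightarrow> ('y \<Rightarrow>\<^sub>0 'k)" where
  "lval = lin_ext (\<lambda>m. L (vsym (mlist m)) (map snd (mlist m)))"

text \<open>Reordering the variables conjugates the symbol, which amounts to a left and a right multiplication.\<close>

lemma L_permute:
  assumes s: "\<sigma> permutes {1..length zs}"
  shows "L (vsym zs) (map snd zs) = L (vsym (permute_word \<sigma> zs)) (map snd (permute_word \<sigma> zs))"
proof -
  let ?d = "length zs" and ?ys = "permute_word \<sigma> zs"
  let ?as = "map fst ?ys" and ?w = "map snd zs"
  have x: "(?as, {#}, id) \<in> osyms ?d" "(map fst zs, {#}, \<sigma>) \<in> osyms ?d"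
    using s by (auto simp: osyms_def permutes_id)
  have iv: "inv \<sigma> permutes {1..?d}" using s by (rule permutes_inv)
  have as: "permute_word (inv \<sigma>) ?as = map fst zs"
    using permute_word_map[of "inv \<sigma>" ?ys fst] iv permute_word_inv[OF s] by simp
  have "L (map fst zs, {#}, \<sigma>) (permute_fst \<sigma> ?w) = L (?as, {#}, id) (permute_snd \<sigma> (permute_fst \<sigma> ?w))"
    using L_left[OF x(1) _ s, of "permute_fst \<sigma> ?w"] s as by (simp add: left_sym_def permute_word_def del: upt_Suc)
  moreover have "L (map fst zs, {#}, id) ?w = L (map fst zs, {#}, \<sigma>) (permute_fst \<sigma> ?w)"
    using L_right[OF x(2) _ iv, of ?w] iv s by (simp add: right_sym_def permutes_inv_inv permutes_inv_o)
  moreover have "permute_snd \<sigma> (permute_fst \<sigma> ?w) = map snd ?ys"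
    using permute_snd_fst[of \<sigma> ?w] permute_word_map[OF s, of snd] s by simp
  ultimately show ?thesis by (simp add: vsym_def)
qed

lemma L_mset:
  assumes "mset xs = mset zs"
  shows "L (vsym xs) (map snd xs) = L (vsym zs) (map snd zs)"
proof -
  obtain p where p: "p permutes {..<length zs}" "permute_list p zs = xs"
    using mset_eq_permutation[OF assms] by blast
  show ?thesis using L_permute[OF shift_permutes[OF p(1)]] unfolding permute_word_shift[OF p(1)] p(2) by (rule sym)
qed

lemma lval_sing: "lval (sing (mon_of zs)) = L (vsym zs) (map snd zs)"
proof -
  have "mset (mlist (mon_of zs)) = mset zs" by (simp add: mon_of_eq_iff[symmetric])
  then show ?thesis unfolding lval_def lin_ext_sing by (rule L_mset)
qed

lemma lval_add: "lval (p + q) = lval p + lval q" and lval_diff: "lval (p - q) = lval p - lval q"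
  and lval_scale: "lval (pm_scale c p) = pm_scale c (lval p)" and lval_sum: "lval (sum f S) = (\<Sum>x\<in>S. lval (f x))"
  by (simp_all add: lval_def lin_ext_add lin_ext_diff lin_ext_scale act_sum)

lemma sing_mult: "(sing m :: ('a, 'N) rmonom \<Rightarrow>\<^sub>0 'k) * rvar a i j = sing (Poly_Mapping.single (a, i, j) 1 + m)"
  by (simp add: sing_def rvar_def mult_single add.commute)

text \<open>Each defining relation of the representation algebra, multiplied by a monomial, comes from one rule:
linearity from the relations of \<open>\<O>(A)\<close>, the product from \<open>\<pi>\<close> at a transposition, the unit from the unit.\<close>

lemma lval_rep_rels:
  assumes "r \<in> rep_rels smul"
  shows "lval (sing m * r) = 0"
proof -
  define zs where "zs = mlist m"
  have m: "m = mon_of zs" by (simp add: zs_def)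
  define as where "as = map fst zs"
  define w where "w = map snd zs"
  have len: "length as = length w" by (simp add: as_def w_def)
  have e: "lval (sing m * rvar a i j) = L (a # as, {#}, id) ((i, j) # w)" for a i j
    using lval_sing[of "(a, i, j) # zs"] by (simp only: m sing_mult mon_of_simps) (simp add: vsym_def as_def w_def)
  have e2: "lval (sing m * (rvar a i k * rvar b l j)) = L (a # b # as, {#}, id) ((i, k) # (l, j) # w)" for a b i j k l
  proof -
    have "sing m * (rvar a i k * rvar b l j) = sing m * rvar b l j * rvar a i k" by (simp add: mult_ac)
    show ?thesis unfolding \<open>sing m * (rvar a i k * rvar b l j) = _\<close>
      using lval_sing[of "(a, i, k) # (b, l, j) # zs"] by (simp only: m sing_mult mon_of_simps) (simp add: vsym_def as_def w_def)
  qed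
  show ?thesis using assms
  proof cases
    case (1 a b i j)
    have "L ((a + b) # as, {#}, id) ((i, j) # w) - L (a # as, {#}, id) ((i, j) # w) = L (b # as, {#}, id) ((i, j) # w)"
      using L_rel[OF orels.tensor_add[of 0 "a # as" id a b "{#}" smul], of "(i, j) # w"]
      by (simp add: lin_rel permutes_id)
    then show ?thesis unfolding 1 right_diff_distrib lval_diff e by simp
  next
    case (2 c a i j)
    have "L (smul c a # as, {#}, id) ((i, j) # w) = pm_scale c (L (a # as, {#}, id) ((i, j) # w))"
      using L_rel[OF orels.tensor_scale[of 0 "a # as" id smul c a "{#}"], of "(i, j) # w"]
      by (simp add: lin_rel permutes_id)
    moreover have "sing m * pm_scale c (rvar a i j) = pm_scale c (sing m * rvar a i j)"
      by (simp add: pm_scale_mult mult_ac)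
    ultimately show ?thesis unfolding 2 right_diff_distrib lval_diff by (simp only: lval_scale e) simp
  next
    case (3 a b i j)
    \<comment> \<open>\<open>\<pi>\<close> merges the letters \<open>a\<close> and \<open>b\<close> if the permutation exchanges them; right multiplication introduces the
      transposition and exchanges first indices, which turns \<open>(k, k)\<close>, \<open>(i, j)\<close> into \<open>(i, k)\<close>, \<open>(k, j)\<close>.\<close>
    let ?t = "Transposition.transpose 1 (2::nat)"
    let ?d = "Suc (Suc (length w))"
    have t: "?t permutes {1..?d}" by (rule permutes_swap_id) auto
    have x: "(a # b # as, {#}, id) \<in> osyms ?d" "(a # b # as, {#}, ?t) \<in> osyms ?d"
      using t len by (auto simp: osyms_def permutes_id)
    have t1: "?t 1 = 2" by simp
    have "(\<Sum>k\<in>UNIV. L (a # b # as, {#}, id) ((i, k) # (k, j) # w)) = (\<Sum>k\<in>UNIV. L (a # b # as, {#}, ?t) ((k, k) # (i, j) # w))"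
    proof (rule sum.cong[OF refl])
      fix k
      have "lin_ext (\<lambda>y. L y ((k, k) # (i, j) # w)) (right_sym ?t (a # b # as, {#}, id)) = L (a # b # as, {#}, id) (permute_fst (inv ?t) ((k, k) # (i, j) # w))"
        by (rule L_right[OF x(1) _ t]) simp
      then show "L (a # b # as, {#}, id) ((i, k) # (k, j) # w) = L (a # b # as, {#}, ?t) ((k, k) # (i, j) # w)"
        using t len unfolding permute_fst_transpose by (simp add: right_sym_def)
    qed
    also have "\<dots> = lin_ext (\<lambda>y. L y ((i, j) # w)) (pi_sym (a # b # as, {#}, ?t))"
      by (rule L_pi[OF x(2), symmetric]) simp
    also have "pi_sym (a # b # as, {#}, ?t) = (sing (a * b # as, {#}, id) :: _ \<Rightarrow>\<^sub>0 'k)"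
      by (simp only: pi_sym.simps perm_star_transpose t1) (simp add: sing_def)
    finally have "(\<Sum>k\<in>UNIV. L (a # b # as, {#}, id) ((i, k) # (k, j) # w)) = L (a * b # as, {#}, id) ((i, j) # w)"
      by (simp only: lin_ext_sing)
    then show ?thesis unfolding 3 right_diff_distrib lval_diff sum_distrib_left lval_sum e e2 by simp
  next
    case (4 i j)
    have "lin_ext (\<lambda>y. L y ((i, j) # w)) (one_sym (as, {#}, id)) = (if i = j then L (as, {#}, id) w else 0)"
      by (rule L_one[of _ "length w"]) (use len in \<open>auto simp: osyms_def permutes_id\<close>)
    then have "L (1 # as, {#}, id) ((i, j) # w) = (if i = j then L (as, {#}, id) w else 0)"
      by (simp only: one_sym_def prod.case perm_times_id lin_ext_single pm_scale_1)
    moreover have "lval (sing m * (if i = j then 1 else 0)) = (if i = j then L (as, {#}, id) w else 0)"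
      using lval_sing[of zs] by (simp add: m vsym_def as_def w_def) (simp add: lval_def)
    ultimately show ?thesis unfolding 4 right_diff_distrib lval_diff e by simp
  qed
qed

lemma lval_rel_span:
  assumes "r \<in> rel_span (Rep smul)"
  shows "lval r = 0"
  using assms unfolding rel_span_Rep
proof (induction rule: idl.span_induct_alt)
  case base
  show ?case by (simp add: lval_def)
next
  case (step c x y)
  have "lval (c * x) = 0"
  proof (induction c rule: poly_mapping_single_induct)
    case 1
    show ?case by (simp add: lval_def)
  next
    case (2 m d f)
    have "Poly_Mapping.single m d * x = pm_scale d (sing m * x)"
    proof -
      have "Poly_Mapping.single m d = pm_scale d (sing m)" by (simp add: sing_def)
      then show ?thesis by (simp add: pm_scale_mult mult.assoc)
    qed
    then show ?case using 2 lval_rep_rels[OF step(1), of m]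
      by (simp only: distrib_right lval_add lval_scale) simp
  qed
  then show ?case using step by (simp add: lval_add)
qed

lemma lval_cong: "p - q \<in> rel_span (Rep smul) \<Longrightarrow> lval p = lval q"
  using lval_rel_span[of "p - q"] by (simp add: lval_diff)

text \<open>A trace is produced by \<open>\<pi>\<close> from a letter that is fixed by the permutation, which permits induction on the number
of traces.\<close>

lemma lval_pair_sym_id:
  assumes "length as = length w"
  shows "lval (pair_sym (as, fs, id) w) = L (as, fs, id) w"
  using assms
proof (induction fs arbitrary: as w)
  case empty
  have "lval (pair_sym (vsym (zip as w)) (map snd (zip as w))) = L (vsym (zip as w)) (map snd (zip as w))"
    by (simp only: pair_sym_vsym lval_sing)
  then show ?case by (simp only: vsym_def map_fst_zip[OF empty] map_snd_zip[OF empty])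
next
  case (add f fs)
  have x: "(f # as, fs, id) \<in> osyms (Suc (length w))" using add.prems by (simp add: osyms_def permutes_id)
  have pi: "pi_sym (f # as, fs, id) = (sing (as, add_mset f fs, id) :: _ \<Rightarrow>\<^sub>0 'k)"
    by (simp only: pi_sym.simps perm_star_id) (simp add: sing_def)
  have "L (as, add_mset f fs, id) w = (\<Sum>k\<in>UNIV. L (f # as, fs, id) ((k, k) # w))"
    using L_pi[OF x refl] by (simp only: pi lin_ext_sing)
  also have "\<dots> = lval (\<Sum>k\<in>UNIV. pair_sym (f # as, fs, id) ((k, k) # w))"
  proof -
    have "L (f # as, fs, id) ((k, k) # w) = lval (pair_sym (f # as, fs, id) ((k, k) # w))" for k
      by (rule add.IH[symmetric]) (simp add: add.prems)
    then show ?thesis by (simp only: lval_sum)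
  qed
  also have "\<dots> = lval (pair_sym (as, add_mset f fs, id) w)"
    using lval_cong[OF pair_sym_pi[OF x refl]] by (simp only: pi lin_ext_sing)
  finally show ?case by (simp only: id_def)
qed

text \<open>Right multiplication removes the permutation of the symbol.\<close>

lemma lval_pair_sym:
  assumes x: "x \<in> osyms (length w)"
  shows "lval (pair_sym x w) = L x w"
proof -
  obtain as fs u where e: "x = (as, fs, u)" and len: "length as = length w" and u: "u permutes {1..length w}"
    using x by (cases x) (auto simp: osyms_def)
  have y: "(as, fs, id) \<in> osyms (length w)" using len by (simp add: osyms_def permutes_id)
  have r: "right_sym u (as, fs, id) = (sing x :: _ \<Rightarrow>\<^sub>0 'k)" using u len by (simp add: right_sym_def e sing_def)
  have "L x w = L (as, fs, id) (permute_fst (inv u) w)"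
    using L_right[OF y refl u] by (simp only: r lin_ext_sing)
  also have "\<dots> = lval (pair_sym (as, fs, id) (permute_fst (inv u) w))"
    using len by (simp add: lval_pair_sym_id)
  also have "\<dots> = lval (pair_sym x w)"
    using pair_sym_right[OF y refl u, where 'k = 'k] by (simp only: r lin_ext_sing)
  finally show ?thesis ..
qed

end

text \<open>A symbol and a word whose pairing is the given monomial.\<close>

definition mpair :: "('a, 'N) rmonom \<Rightarrow> 'a osym \<times> ('N \<times> 'N) list" where
  "mpair m = (vsym (mlist m), map snd (mlist m))"

context
  fixes smul :: "'k::field \<Rightarrow> 'a::{ring, monoid_mult} \<Rightarrow> 'a" and n :: nat
    and G :: "('a osym \<times> ('N::finite \<times> 'N) list) list \<Rightarrow> 'y \<Rightarrow>\<^sub>0 'k"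
  assumes slot: "\<And>zs zs'. Suc (length zs + length zs') = n \<Longrightarrow>
    \<forall>z\<in>set (zs @ zs'). fst z \<in> osyms (length (snd z)) \<Longrightarrow> slot_functional smul (\<lambda>x w. G (zs @ (x, w) # zs'))"
begin

lemma mpair_valid: "fst (mpair m) \<in> osyms (length (snd (mpair m)))"
  using vsym_osyms by (simp add: mpair_def)

text \<open>Here and in the two lemmas after it, \<open>G\<close> is a function of \<open>n\<close> symbols and \<open>n\<close> words that is a slot functional in
each argument when the others are fixed. Its multilinear extension from monomials then
respects the relations and has the prescribed values at pairings.\<close>

lemma mlin_slot_rel:
  assumes r: "r \<in> rel_span (Rep smul)" and n: "Suc (length ps + length qs) = n"
  shows "mlin (\<lambda>ms. G (map mpair ms)) (ps @ r # qs) = 0"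
proof -
  have "mlin (\<lambda>ms. G (map mpair ms)) (ps @ r # qs) = mlin (\<lambda>_. 0) (ps @ qs)"
    unfolding mlin_slot
  proof (rule mlin_cong)
    fix ms :: "('a, 'N) rmonom list" assume "list_all2 (\<lambda>x f. x \<in> Poly_Mapping.keys f) ms (ps @ qs)"
    then have len: "length ms = length ps + length qs" by (auto dest: list_all2_lengthD)
    let ?zs = "map mpair (take (length ps) ms)" and ?zs' = "map mpair (drop (length ps) ms)"
    have "slot_functional smul (\<lambda>x w. G (?zs @ (x, w) # ?zs'))"
      by (rule slot) (use len n mpair_valid in auto)
    from slot_functional.lval_rel_span[OF this r]
    show "lin_ext (\<lambda>x. G (map mpair (take (length ps) ms @ x # drop (length ps) ms))) r = 0"
      by (simp add: slot_functional.lval_def[OF \<open>slot_functional smul (\<lambda>x w. G (?zs @ (x, w) # ?zs'))\<close>] mpair_def)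
  qed
  then show ?thesis by simp
qed

lemma mlin_pair_sym:
  assumes "length zs = n" "\<forall>z\<in>set zs. fst z \<in> osyms (length (snd z))"
  shows "mlin (\<lambda>ms. G (map mpair ms)) (map (\<lambda>(x, w). pair_sym x w) zs) = G zs"
proof -
  have "mlin (\<lambda>ms. G (zs @ map mpair ms)) (map (\<lambda>(x, w). pair_sym x w) zs') = G (zs @ zs')"
    if "length (zs @ zs') = n" "\<forall>z\<in>set (zs @ zs'). fst z \<in> osyms (length (snd z))" for zs zs'
    using that
  proof (induction zs' arbitrary: zs)
    case (Cons z zs')
    obtain x w where z: "z = (x, w)" by (cases z)
    have s: "slot_functional smul (\<lambda>x w. G (zs @ (x, w) # zs'))" by (rule slot) (use Cons.prems in auto)
    have "mlin (\<lambda>ms. G (zs @ map mpair ms)) (map (\<lambda>(x, w). pair_sym x w) (z # zs'))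
      = lin_ext (\<lambda>m. mlin (\<lambda>ms. G ((zs @ [mpair m]) @ map mpair ms)) (map (\<lambda>(x, w). pair_sym x w) zs')) (pair_sym x w)"
      by (simp add: z)
    also have "\<dots> = lin_ext (\<lambda>m. G ((zs @ [mpair m]) @ zs')) (pair_sym x w)"
      by (rule lin_ext_cong, rule Cons.IH) (use Cons.prems mpair_valid in auto)
    also have "\<dots> = G (zs @ z # zs')"
      using slot_functional.lval_pair_sym[OF s, of x w] Cons.prems
      by (simp add: slot_functional.lval_def[OF s] mpair_def z)
    finally show ?case by simp
  qed simp
  from this[of "[]" zs] show ?thesis using assms by simp
qed

lemma mlin_nform:
  assumes "length ps = n"
  shows "mlin (\<lambda>ms. G (map mpair ms)) (map (nform (Rep smul)) ps) = mlin (\<lambda>ms. G (map mpair ms)) ps"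
proof -
  have "mlin (\<lambda>ms. G (map mpair ms)) (ps @ map (nform (Rep smul)) qs) = mlin (\<lambda>ms. G (map mpair ms)) (ps @ qs)"
    if "length (ps @ qs) = n" for ps qs
    using that
  proof (induction qs arbitrary: ps)
    case (Cons q qs)
    let ?F = "mlin (\<lambda>ms. G (map mpair ms))" and ?qs = "map (nform (Rep smul)) qs"
    have "?F (ps @ (q + (nform (Rep smul) q - q)) # ?qs) = ?F (ps @ q # ?qs) + ?F (ps @ (nform (Rep smul) q - q) # ?qs)"
    proof -
      have "?F (ps @ (f + g) # ?qs) = ?F (ps @ f # ?qs) + ?F (ps @ g # ?qs)" for f g
        using mlin_multilinear[of n "\<lambda>ms. G (map mpair ms)"] Cons.prems by (simp add: multilinear_def)
      then show ?thesis .
    qed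
    also have "?F (ps @ (nform (Rep smul) q - q) # ?qs) = 0"
      by (rule mlin_slot_rel[OF nform_diff_self]) (use Cons.prems in simp)
    finally have "?F (ps @ nform (Rep smul) q # ?qs) = ?F ((ps @ [q]) @ ?qs)" by simp
    also have "\<dots> = ?F ((ps @ [q]) @ qs)" by (rule Cons.IH) (use Cons.prems in simp)
    finally show ?case by simp
  qed simp
  from this[of "[]" ps] show ?thesis using assms by simp
qed

end

section \<open>The four congruences characterize induced maps\<close>

text \<open>The conjunction of the four congruences for \<open>\<pi>\<close>, the unit, left and right multiplication.\<close>

definition compatible :: "('k::field \<Rightarrow> 'a::{ring, monoid_mult} \<Rightarrow> 'a) \<Rightarrow> nat \<Rightarrow> 'N::finite itself \<Rightarrow>
  ((('a osym \<Rightarrow>\<^sub>0 'k) set list \<Rightarrow>\<^sub>0 'k) set \<Rightarrow> ('a osym \<Rightarrow>\<^sub>0 'k) set) \<Rightarrow> bool" where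
  "compatible smul n N \<Phi> \<longleftrightarrow> (\<forall>ds \<alpha>s ws i.
     length ds = n \<and> hom_list smul ds \<alpha>s \<and> list_all2 (\<lambda>d w. w permutes {1..d}) ds ws \<and> i < n \<longrightarrow>
     (ds ! i \<ge> 1 \<longrightarrow>
        cong_R smul N (\<Phi> (ptensor (OA smul) (\<alpha>s[i := op_pi smul (\<alpha>s ! i)])))
          (op_pi smul (Ad smul (block_perm (Transposition.transpose 1 2) [sum_list (take i ds), 1])
             (\<Phi> (ptensor (OA smul) \<alpha>s)))))
     \<and> cong_R smul N (\<Phi> (ptensor (OA smul) (\<alpha>s[i := op_one smul (\<alpha>s ! i)])))
          (Ad smul (block_perm (Transposition.transpose 1 2) [1, sum_list (take i ds)])
             (op_one smul (\<Phi> (ptensor (OA smul) \<alpha>s))))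
     \<and> cong_R smul N (\<Phi> (ptensor (OA smul) (map2 (left_act smul) ws \<alpha>s)))
          (left_act smul (perm_prod (zip ds ws)) (\<Phi> (ptensor (OA smul) \<alpha>s)))
     \<and> cong_R smul N (\<Phi> (ptensor (OA smul) (map2 (right_act smul) \<alpha>s ws)))
          (right_act smul (\<Phi> (ptensor (OA smul) \<alpha>s)) (perm_prod (zip ds ws))))"

lemma split_at_slot:
  assumes "length ds = n" "hom_list smul ds \<alpha>s" "i < n"
  obtains ds1 d ds2 \<alpha>s1 \<alpha> \<alpha>s2 where "ds = ds1 @ d # ds2" "\<alpha>s = \<alpha>s1 @ \<alpha> # \<alpha>s2" "length ds1 = i" "length \<alpha>s1 = i"
    "hom_list smul ds1 \<alpha>s1" "\<alpha> \<in> OA_hom smul d" "hom_list smul ds2 \<alpha>s2"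
proof -
  have l: "i < length ds" "i < length \<alpha>s" using assms hom_list_length[OF assms(2)] by auto
  have e: "ds = take i ds @ ds ! i # drop (Suc i) ds" "\<alpha>s = take i \<alpha>s @ \<alpha>s ! i # drop (Suc i) \<alpha>s"
    using l by (simp_all add: id_take_nth_drop)
  have "hom_list smul (take i ds @ ds ! i # drop (Suc i) ds) (take i \<alpha>s @ \<alpha>s ! i # drop (Suc i) \<alpha>s)"
    using assms(2) e by simp
  then show thesis using that[OF e] l hom_list_append[of "take i ds" "take i \<alpha>s"] by simp
qed

lemma induces_imp_compatible:
  fixes \<phi> :: "('a::{ring, monoid_mult}, 'N::finite, 'k::field) rep_map"
  assumes A: "assoc_algebra smul" and ind: "induces smul n \<Phi> \<phi>" and \<Phi>: "\<Phi> \<in> degree_zero_maps smul n"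
  shows "compatible smul n TYPE('N) \<Phi>"
  unfolding compatible_def
proof (intro allI impI, elim conjE, intro conjI impI)
  fix ds \<alpha>s ws i
  assume n: "length ds = n" and h: "hom_list smul ds \<alpha>s" and ws: "list_all2 (\<lambda>d w. w permutes {1..d}) ds ws" and i: "i < n"
  obtain ds1 d ds2 \<alpha>s1 \<alpha> \<alpha>s2 where s: "ds = ds1 @ d # ds2" "\<alpha>s = \<alpha>s1 @ \<alpha> # \<alpha>s2" "length ds1 = i" "length \<alpha>s1 = i"
    "hom_list smul ds1 \<alpha>s1" "\<alpha> \<in> OA_hom smul d" "hom_list smul ds2 \<alpha>s2"
    using split_at_slot[OF n h i] .
  show "cong_R smul TYPE('N) (\<Phi> (ptensor (OA smul) (\<alpha>s[i := op_pi smul (\<alpha>s ! i)])))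
      (op_pi smul (Ad smul (block_perm (Transposition.transpose 1 2) [sum_list (take i ds), 1]) (\<Phi> (ptensor (OA smul) \<alpha>s))))"
    if "1 \<le> ds ! i"
  proof -
    obtain d' where d': "d = Suc d'" using \<open>1 \<le> ds ! i\<close> s by (cases d) (auto simp: nth_append)
    show ?thesis
      using induces_imp_cong_pi[OF A ind \<Phi> n[unfolded s(1) d'] s(5,7) s(6)[unfolded d']] s(1-4) by (simp add: nth_append list_update_append)
  qed
  show "cong_R smul TYPE('N) (\<Phi> (ptensor (OA smul) (\<alpha>s[i := op_one smul (\<alpha>s ! i)])))
      (Ad smul (block_perm (Transposition.transpose 1 2) [1, sum_list (take i ds)]) (op_one smul (\<Phi> (ptensor (OA smul) \<alpha>s))))"
    using induces_imp_cong_one[OF ind \<Phi> n[unfolded s(1)] s(5,7,6)] s(1-4) by (simp add: nth_append list_update_append)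
  show "cong_R smul TYPE('N) (\<Phi> (ptensor (OA smul) (map2 (left_act smul) ws \<alpha>s)))
      (left_act smul (perm_prod (zip ds ws)) (\<Phi> (ptensor (OA smul) \<alpha>s)))"
    by (rule induces_imp_cong_left[OF ind \<Phi> n h ws])
  show "cong_R smul TYPE('N) (\<Phi> (ptensor (OA smul) (map2 (right_act smul) \<alpha>s ws)))
      (right_act smul (\<Phi> (ptensor (OA smul) \<alpha>s)) (perm_prod (zip ds ws)))"
    by (rule induces_imp_cong_right[OF ind \<Phi> n h ws])
qed

lemma list_all2_ids: "list_all2 (\<lambda>d w. w permutes {1..d}) ds (map (\<lambda>_. id) ds)"
proof (induction ds)
  case (Cons d ds)
  then show ?case unfolding list.map list_all2_Cons using permutes_id by blast
qed simp

lemma compatible_pi: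
  assumes c: "compatible smul n TYPE('N::finite) \<Phi>" and n: "length (ds @ Suc d # ds') = n"
    and h: "hom_list smul ds \<alpha>s" "hom_list smul ds' \<alpha>s'" "\<alpha> \<in> OA_hom smul (Suc d)"
  shows "cong_R smul TYPE('N) (\<Phi> (ptensor (OA smul) (\<alpha>s @ op_pi smul \<alpha> # \<alpha>s')))
     (op_pi smul (Ad smul (block_perm (Transposition.transpose 1 2) [sum_list ds, 1]) (\<Phi> (ptensor (OA smul) (\<alpha>s @ \<alpha> # \<alpha>s')))))"
proof -
  let ?ds = "ds @ Suc d # ds'" and ?as = "\<alpha>s @ \<alpha> # \<alpha>s'"
  have len: "length ds = length \<alpha>s" using h(1) by (simp add: hom_list_length)
  have "hom_list smul ?ds ?as" using h len by (simp add: hom_list_append)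
  then have "?ds ! length ds \<ge> 1 \<longrightarrow> cong_R smul TYPE('N) (\<Phi> (ptensor (OA smul) (?as[length ds := op_pi smul (?as ! length ds)])))
     (op_pi smul (Ad smul (block_perm (Transposition.transpose 1 2) [sum_list (take (length ds) ?ds), 1]) (\<Phi> (ptensor (OA smul) ?as))))"
    using c[unfolded compatible_def, rule_format, of ?ds ?as "map (\<lambda>_. id) ?ds" "length ds"] n list_all2_ids[of ?ds] by auto
  then show ?thesis by (simp add: len nth_append)
qed

lemma compatible_one:
  assumes c: "compatible smul n TYPE('N::finite) \<Phi>" and n: "length (ds @ d # ds') = n"
    and h: "hom_list smul ds \<alpha>s" "hom_list smul ds' \<alpha>s'" "\<alpha> \<in> OA_hom smul d"
  shows "cong_R smul TYPE('N) (\<Phi> (ptensor (OA smul) (\<alpha>s @ op_one smul \<alpha> # \<alpha>s')))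
     (Ad smul (block_perm (Transposition.transpose 1 2) [1, sum_list ds]) (op_one smul (\<Phi> (ptensor (OA smul) (\<alpha>s @ \<alpha> # \<alpha>s')))))"
proof -
  let ?ds = "ds @ d # ds'" and ?as = "\<alpha>s @ \<alpha> # \<alpha>s'"
  have len: "length ds = length \<alpha>s" using h(1) by (simp add: hom_list_length)
  have "hom_list smul ?ds ?as" using h len by (simp add: hom_list_append)
  then have "cong_R smul TYPE('N) (\<Phi> (ptensor (OA smul) (?as[length ds := op_one smul (?as ! length ds)])))
     (Ad smul (block_perm (Transposition.transpose 1 2) [1, sum_list (take (length ds) ?ds)]) (op_one smul (\<Phi> (ptensor (OA smul) ?as))))"
    using c[unfolded compatible_def, rule_format, of ?ds ?as "map (\<lambda>_. id) ?ds" "length ds"] n list_all2_ids[of ?ds] by auto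
  then show ?thesis by (simp add: len nth_append)
qed

lemma compatible_acts:
  assumes c: "compatible smul n TYPE('N::finite) \<Phi>" and n: "n \<ge> 1" "length ds = n"
    and h: "hom_list smul ds \<alpha>s" and ws: "list_all2 (\<lambda>d w. w permutes {1..d}) ds ws"
  shows "cong_R smul TYPE('N) (\<Phi> (ptensor (OA smul) (map2 (left_act smul) ws \<alpha>s)))
          (left_act smul (perm_prod (zip ds ws)) (\<Phi> (ptensor (OA smul) \<alpha>s)))"
    "cong_R smul TYPE('N) (\<Phi> (ptensor (OA smul) (map2 (right_act smul) \<alpha>s ws)))
          (right_act smul (\<Phi> (ptensor (OA smul) \<alpha>s)) (perm_prod (zip ds ws)))"
  using c[unfolded compatible_def, rule_format, of ds \<alpha>s ws 0] n h ws by auto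

lemma permute_id_word [simp]: "permute_snd id w = w" "permute_fst id w = w"
  by (auto intro!: nth_equalityI simp: nth_permute_snd nth_permute_fst)

lemma act_id:
  assumes "\<alpha> \<in> OA_hom smul d"
  shows "left_act smul id \<alpha> = \<alpha>" "right_act smul \<alpha> id = \<alpha>"
proof -
  obtain f where f: "\<alpha> = cls (OA smul) f" "Poly_Mapping.keys f \<subseteq> osyms d" using assms by (rule OA_hom_cases)
  have "left_sym id x = (sing x :: _ \<Rightarrow>\<^sub>0 'b)" if "x \<in> osyms d" for x :: "'a osym"
  proof (cases x)
    case (fields as fs u)
    have "map (\<lambda>t. as ! (t - 1)) [1..<Suc (length as)] = as"
      by (rule nth_equalityI) (simp_all del: upt_Suc)
    then show ?thesis using that by (simp add: fields left_sym_def osyms_def permutes_id inv_id sing_def del: upt_Suc)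
  qed
  then have "lin_ext (left_sym id) f = lin_ext sing f" by (intro lin_ext_cong) (use f in auto)
  then show "left_act smul id \<alpha> = \<alpha>" by (simp add: f(1) left_act_cls lin_ext_id)
  have "right_sym id x = (sing x :: _ \<Rightarrow>\<^sub>0 'b)" if "x \<in> osyms d" for x :: "'a osym"
    using that by (cases x) (simp add: right_sym_def osyms_def permutes_id sing_def)
  then have "lin_ext (right_sym id) f = lin_ext sing f" by (intro lin_ext_cong) (use f in auto)
  then show "right_act smul \<alpha> id = \<alpha>" by (simp add: f(1) right_act_cls lin_ext_id)
qed

lemma map2_act_ids:
  assumes "hom_list smul ds \<alpha>s"
  shows "map2 (left_act smul) (map (\<lambda>_. id) ds) \<alpha>s = \<alpha>s" "map2 (right_act smul) \<alpha>s (map (\<lambda>_. id) ds) = \<alpha>s"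
  using assms unfolding hom_list_def by (induction rule: list_all2_induct) (simp_all add: act_id)

lemma map2_permute_ids:
  assumes "length ds = length vs"
  shows "map2 permute_snd (map (\<lambda>_. id) ds) vs = vs" "map2 (\<lambda>w. permute_fst (inv w)) (map (\<lambda>_. id) ds) vs = vs"
  using assms by (induction ds vs rule: list_induct2) (simp_all add: inv_id)

lemma keys_diff_subset:
  "Poly_Mapping.keys f \<subseteq> A \<Longrightarrow> Poly_Mapping.keys g \<subseteq> A \<Longrightarrow> Poly_Mapping.keys (f - g) \<subseteq> A"
  using keys_diff[of f g] by blast

text \<open>The degree on \<open>\<O>(A)\<close> is well defined because the relations are homogeneous.\<close>

lemma orels_homogeneous:
  assumes "r \<in> orels smul"
  shows "\<exists>d. Poly_Mapping.keys r \<subseteq> osyms d"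
  using assms
proof cases
  case (tensor_add i as u x y fs)
  show ?thesis unfolding tensor_add(1)
    by (intro exI[of _ "length as"] keys_diff_subset) (use tensor_add in \<open>auto simp: osyms_def\<close>)
next
  case (tensor_scale i as u c x fs)
  show ?thesis unfolding tensor_scale(1)
    by (intro exI[of _ "length as"] keys_diff_subset) (use tensor_scale in \<open>auto simp: osyms_def\<close>)
next
  case (sym_add u as x y fs)
  show ?thesis unfolding sym_add(1)
    by (intro exI[of _ "length as"] keys_diff_subset) (use sym_add in \<open>auto simp: osyms_def\<close>)
next
  case (sym_scale u as c x fs)
  show ?thesis unfolding sym_scale(1)
    by (intro exI[of _ "length as"] keys_diff_subset) (use sym_scale in \<open>auto simp: osyms_def\<close>)
next
  case (sym_commutator u as x y fs)
  show ?thesis unfolding sym_commutator(1)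
    by (intro exI[of _ "length as"]) (use sym_commutator in \<open>auto simp: osyms_def\<close>)
qed

lemma orels_rel_span: "r \<in> orels smul \<Longrightarrow> r \<in> rel_span (OA smul)"
  by (rule rel_span_base) (simp add: OA_def)

lemma nform_pval: "\<beta> \<in> vspace (OA smul) \<Longrightarrow> nform (Rep smul) (pval smul \<beta> w) = pval smul \<beta> w"
  by (auto simp: vspace_def pval_def pairing_cls)

lemma pval_slot:
  assumes \<Phi>: "\<Phi> \<in> linear_maps (tpow n (OA smul)) (OA smul)" and n: "Suc (length xs + length xs') = n"
    and xs: "set xs \<subseteq> gens (OA smul)" "set xs' \<subseteq> gens (OA smul)" and f: "Poly_Mapping.keys f \<subseteq> gens (OA smul)"
  shows "lin_ext (\<lambda>x. pval smul (\<Phi> (ptensor (OA smul) (map (\<lambda>x. cls (OA smul) (sing x)) xs @ cls (OA smul) (sing x) # map (\<lambda>x. cls (OA smul) (sing x)) xs'))) W) f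
    = pval smul (\<Phi> (ptensor (OA smul) (map (\<lambda>x. cls (OA smul) (sing x)) xs @ cls (OA smul) f # map (\<lambda>x. cls (OA smul) (sing x)) xs'))) W"
proof -
  let ?F = "\<lambda>xs. pval smul (\<Phi> (ptensor (OA smul) (map (\<lambda>x. cls (OA smul) (sing x)) xs))) W"
  have "pval smul (\<Phi> (ptensor (OA smul) (map (cls (OA smul)) (map sing xs @ f # map sing xs')))) W = mlin ?F (map sing xs @ f # map sing xs')"
    by (rule pval_mlin[OF \<Phi>]) (use n xs f in auto)
  also have "\<dots> = lin_ext (\<lambda>x. mlin ?F (map sing xs @ sing x # map sing xs')) f"
    by (rule multilinear_slot[OF mlin_multilinear refl])
  also have "\<dots> = lin_ext (\<lambda>x. mlin ?F (map sing (xs @ x # xs'))) f" by simp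
  finally show ?thesis unfolding mlin_map_sing by (simp add: o_def)
qed

text \<open>The value \<open>(\<Phi>(\<dots>, x, \<dots>)|\<dots> w \<dots>)\<close> obeys the rules in each argument. The congruences state them for the word of
total length, and the block permutations bring them back to the letters of \<open>w\<close>; for the two multiplications
the permutations in the other arguments are taken to be identities.\<close>

lemma compatible_slot_functional:
  fixes smul :: "'k::field \<Rightarrow> 'a::{ring, monoid_mult} \<Rightarrow> 'a" and zs zs' :: "('a osym \<times> ('N::finite \<times> 'N) list) list"
  assumes A: "assoc_algebra smul" and \<Phi>: "\<Phi> \<in> degree_zero_maps smul n" and c: "compatible smul n TYPE('N) \<Phi>"
    and n: "Suc (length zs + length zs') = n" and v: "\<forall>z\<in>set (zs @ zs'). fst z \<in> osyms (length (snd z))"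
  defines "cl \<equiv> \<lambda>x. cls (OA smul) (sing x)"
  shows "slot_functional smul (\<lambda>x w. pval smul (\<Phi> (ptensor (OA smul) (map (\<lambda>z. cl (fst z)) (zs @ (x, w) # zs')))) (concat (map snd (zs @ (x, w) # zs'))))"
proof -
  have \<Phi>': "\<Phi> \<in> linear_maps (tpow n (OA smul)) (OA smul)" using \<Phi> by (simp add: degree_zero_maps_def)
  define \<alpha>s where "\<alpha>s = map (\<lambda>z. cl (fst z)) zs"
  define \<alpha>s' where "\<alpha>s' = map (\<lambda>z. cl (fst z)) zs'"
  define ds where "ds = map (\<lambda>z. length (snd z)) zs"
  define ds' where "ds' = map (\<lambda>z. length (snd z)) zs'"
  define vs where "vs = map snd zs"
  define vs' where "vs' = map snd zs'"
  define B where "B \<alpha> = \<Phi> (ptensor (OA smul) (\<alpha>s @ \<alpha> # \<alpha>s'))" for \<alpha>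
  define L where "L x w = pval smul (B (cl x)) (concat vs @ w @ concat vs')" for x w
  have L: "(\<lambda>x w. pval smul (\<Phi> (ptensor (OA smul) (map (\<lambda>z. cl (fst z)) (zs @ (x, w) # zs')))) (concat (map snd (zs @ (x, w) # zs')))) = L"
    by (simp add: L_def[abs_def] B_def \<alpha>s_def \<alpha>s'_def vs_def vs'_def)
  have clh: "cl x \<in> OA_hom smul d" if "x \<in> osyms d" for x d unfolding cl_def by (rule OA_hom_cls) (use that in simp)
  have hl: "hom_list smul ds \<alpha>s" "hom_list smul ds' \<alpha>s'"
    using v clh by (auto simp: hom_list_def ds_def \<alpha>s_def ds'_def \<alpha>s'_def list_all2_conv_all_nth)
  have vl: "list_all2 (\<lambda>d w. length w = d) ds vs" "list_all2 (\<lambda>d w. length w = d) ds' vs'"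
    by (simp_all add: ds_def vs_def ds'_def vs'_def list_all2_conv_all_nth)
  note lc = length_concat_words[OF vl(1)] length_concat_words[OF vl(2)]
  have len: "length ds = length \<alpha>s" "length ds' = length \<alpha>s'" "length ds = length vs" "length ds' = length vs'"
    by (simp_all add: ds_def \<alpha>s_def ds'_def \<alpha>s'_def vs_def vs'_def)
  have nl: "length (ds @ d # ds') = n" for d using n by (simp add: ds_def ds'_def)
  have Bh: "B \<alpha> \<in> OA_hom smul (sum_list ds + d + sum_list ds')" if "\<alpha> \<in> OA_hom smul d" for \<alpha> d
    using degree_zero_hom[OF \<Phi> nl, of d "\<alpha>s @ \<alpha> # \<alpha>s'"] hl that len by (simp add: B_def hom_list_append add.assoc)
  have lin: "lin_ext (\<lambda>x. L x w) f = pval smul (B (cls (OA smul) f)) (concat vs @ w @ concat vs')"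
    if f: "Poly_Mapping.keys f \<subseteq> osyms d" for f w d
  proof -
    have g: "Poly_Mapping.keys f \<subseteq> gens (OA smul)" using f osyms_gens by blast
    have "fst z \<in> gens (OA smul)" if "z \<in> set (zs @ zs')" for z
      using v that osyms_gens[of "fst z" _ smul] by blast
    then have "set (map fst zs) \<subseteq> gens (OA smul)" "set (map fst zs') \<subseteq> gens (OA smul)"
      unfolding set_map image_subset_iff by simp_all
    from pval_slot[OF \<Phi>' _ this g] show ?thesis using n by (simp add: L_def B_def \<alpha>s_def \<alpha>s'_def cl_def o_def)
  qed
  have pv: "pval smul \<beta> w = pval smul \<gamma> w" if "cong_R smul TYPE('N) \<beta> \<gamma>" "\<beta> \<in> OA_hom smul D" "\<gamma> \<in> OA_hom smul D" "length w = D"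
    for \<beta> \<gamma> D and w :: "('N \<times> 'N) list"
    using cong_R_iff[OF that(2,3), where 'N = 'N] that(1,4) by blast
  have "slot_functional smul L"
  proof
    fix r w assume r: "r \<in> orels smul"
    obtain d where d: "Poly_Mapping.keys r \<subseteq> osyms d" using orels_homogeneous[OF r] ..
    have "cls (OA smul) r = cls (OA smul) 0" using orels_rel_span[OF r] by (simp add: cls_eq_iff)
    then show "lin_ext (\<lambda>x. L x w) r = 0" using lin[OF d] lin[of 0 d w] by simp
  next
    fix x :: "'a osym" and d and w :: "('N \<times> 'N) list"
    assume x: "x \<in> osyms (Suc d)" and w: "length w = d"
    have op: "cls (OA smul) (pi_sym x) = op_pi smul (cl x)" by (simp add: cl_def assoc_algebra.op_pi_cls[OF A])
    have "Poly_Mapping.keys (pi_sym x :: 'a osym \<Rightarrow>\<^sub>0 'k) \<subseteq> osyms d"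
      using x perm_star_permutes[of "snd (snd x)" d] by (cases x; cases "fst x") (auto simp: osyms_def)
    from lin[OF this] have "lin_ext (\<lambda>y. L y w) (pi_sym x) = pval smul (B (op_pi smul (cl x))) (concat vs @ w @ concat vs')"
      by (simp add: op)
    also have "\<dots> = pval smul (op_pi smul (Ad smul (block_perm (Transposition.transpose 1 2) [sum_list ds, 1]) (B (cl x)))) (concat vs @ w @ concat vs')"
    proof (rule pv[of _ _ "sum_list ds + d + sum_list ds'"])
      show "cong_R smul TYPE('N) (B (op_pi smul (cl x))) (op_pi smul (Ad smul (block_perm (Transposition.transpose 1 2) [sum_list ds, 1]) (B (cl x))))"
        unfolding B_def by (rule compatible_pi[OF c nl hl clh[OF x]])
      show "B (op_pi smul (cl x)) \<in> OA_hom smul (sum_list ds + d + sum_list ds')" by (rule Bh[OF op_pi_hom[OF A clh[OF x]]])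
      show "op_pi smul (Ad smul (block_perm (Transposition.transpose 1 2) [sum_list ds, 1]) (B (cl x))) \<in> OA_hom smul (sum_list ds + d + sum_list ds')"
        by (rule op_pi_hom[OF A Ad_hom]) (use Bh[OF clh[OF x]] in simp)
    qed (use lc w in simp)
    also have "\<dots> = (\<Sum>k\<in>UNIV. pval smul (B (cl x)) (concat vs @ (k, k) # w @ concat vs'))"
      using pval_pi_Ad[OF A, of "B (cl x)" "concat vs" "w @ concat vs'"] Bh[OF clh[OF x]] lc w by (simp add: add.assoc)
    finally show "lin_ext (\<lambda>y. L y w) (pi_sym x) = (\<Sum>k\<in>UNIV. L x ((k, k) # w))" by (simp add: L_def)
  next
    fix x :: "'a osym" and d p q and w :: "('N \<times> 'N) list"
    assume x: "x \<in> osyms d" and w: "length w = d"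
    have op: "cls (OA smul) (one_sym x) = op_one smul (cl x)" by (simp add: cl_def op_one_cls)
    have "Poly_Mapping.keys (one_sym x :: 'a osym \<Rightarrow>\<^sub>0 'k) \<subseteq> osyms (Suc d)"
      using x perm_times_permutes[of id 1 "snd (snd x)" d] by (cases x) (auto simp: osyms_def one_sym_def permutes_id)
    from lin[OF this] have "lin_ext (\<lambda>y. L y ((p, q) # w)) (one_sym x) = pval smul (B (op_one smul (cl x))) (concat vs @ (p, q) # w @ concat vs')"
      by (simp add: op)
    also have "\<dots> = pval smul (Ad smul (block_perm (Transposition.transpose 1 2) [1, sum_list ds]) (op_one smul (B (cl x)))) (concat vs @ (p, q) # w @ concat vs')"
    proof (rule pv[of _ _ "Suc (sum_list ds + d + sum_list ds')"])
      show "cong_R smul TYPE('N) (B (op_one smul (cl x))) (Ad smul (block_perm (Transposition.transpose 1 2) [1, sum_list ds]) (op_one smul (B (cl x))))"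
        unfolding B_def by (rule compatible_one[OF c nl hl clh[OF x]])
      show "B (op_one smul (cl x)) \<in> OA_hom smul (Suc (sum_list ds + d + sum_list ds'))" using Bh[OF op_one_hom[OF clh[OF x]]] by simp
      show "Ad smul (block_perm (Transposition.transpose 1 2) [1, sum_list ds]) (op_one smul (B (cl x))) \<in> OA_hom smul (Suc (sum_list ds + d + sum_list ds'))"
        by (rule Ad_hom[OF op_one_hom[OF Bh[OF clh[OF x]]]])
    qed (use lc w in simp)
    also have "\<dots> = (if p = q then pval smul (B (cl x)) (concat vs @ w @ concat vs') else 0)"
      using pval_Ad_one[of "B (cl x)" smul "concat vs" "w @ concat vs'" p q] Bh[OF clh[OF x]] lc w by (simp add: add.assoc)
    finally show "lin_ext (\<lambda>y. L y ((p, q) # w)) (one_sym x) = (if p = q then L x w else 0)" by (simp add: L_def)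
  next
    fix x :: "'a osym" and d \<sigma> and w :: "('N \<times> 'N) list"
    assume x: "x \<in> osyms d" and w: "length w = d" and s: "\<sigma> permutes {1..d}"
    \<comment> \<open>\<open>\<sigma>\<close> acts in the slot of \<open>x\<close> only.\<close>
    let ?ws = "map (\<lambda>_. id) ds @ \<sigma> # map (\<lambda>_. id) ds'" and ?ds = "ds @ d # ds'" and ?as = "\<alpha>s @ cl x # \<alpha>s'"
    have ws: "list_all2 (\<lambda>d w. w permutes {1..d}) ?ds ?ws"
      using s by (intro list_all2_appendI list_all2_ids list.rel_intros)
    have wl: "list_all2 (\<lambda>d w. length w = d) ?ds (vs @ w # vs')"
      using vl w by (intro list_all2_appendI) auto
    have hl': "hom_list smul ?ds ?as" using hl clh[OF x] len by (simp add: hom_list_append)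
    have n1: "n \<ge> 1" using n by simp
    have sum: "sum_list ?ds = sum_list ds + d + sum_list ds'" by (simp add: add.assoc)
    note pp = perm_prod_permutes[OF ws]
    have W: "concat vs @ w @ concat vs' = concat (vs @ w # vs')" by simp
    have lW: "length (concat (vs @ w # vs')) = sum_list ?ds" by (rule length_concat_words[OF wl])
    have bh: "B (cl x) \<in> OA_hom smul (sum_list ?ds)" unfolding sum by (rule Bh[OF clh[OF x]])
    {
      have op: "cls (OA smul) (left_sym \<sigma> x) = left_act smul \<sigma> (cl x)" by (simp add: cl_def left_act_cls)
      have "Poly_Mapping.keys (left_sym \<sigma> x :: 'a osym \<Rightarrow>\<^sub>0 'k) \<subseteq> osyms d"
        using x by (cases x) (auto simp: osyms_def left_sym_def permutes_compose simp del: upt_Suc)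
      from lin[OF this] have "lin_ext (\<lambda>y. L y w) (left_sym \<sigma> x) = pval smul (B (left_act smul \<sigma> (cl x))) (concat vs @ w @ concat vs')"
        by (simp add: op)
      also have "\<dots> = pval smul (left_act smul (perm_prod (zip ?ds ?ws)) (B (cl x))) (concat (vs @ w # vs'))"
        unfolding W
      proof (rule pv[OF _ _ _ lW])
        have "map2 (left_act smul) ?ws ?as = \<alpha>s @ left_act smul \<sigma> (cl x) # \<alpha>s'"
          using len map2_act_ids(1)[OF hl(1)] map2_act_ids(1)[OF hl(2)] by simp
        then show "cong_R smul TYPE('N) (B (left_act smul \<sigma> (cl x))) (left_act smul (perm_prod (zip ?ds ?ws)) (B (cl x)))"
          using compatible_acts(1)[OF c n1 nl hl' ws] by (simp add: B_def)
        show "B (left_act smul \<sigma> (cl x)) \<in> OA_hom smul (sum_list ?ds)" unfolding sum by (rule Bh[OF left_act_hom[OF clh[OF x]]])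
        show "left_act smul (perm_prod (zip ?ds ?ws)) (B (cl x)) \<in> OA_hom smul (sum_list ?ds)" by (rule left_act_hom[OF bh])
      qed
      also have "\<dots> = pval smul (B (cl x)) (concat (map2 permute_snd ?ws (vs @ w # vs')))"
        unfolding pval_left_act[OF bh lW pp] permute_snd_concat[OF ws wl] ..
      also have "concat (map2 permute_snd ?ws (vs @ w # vs')) = concat vs @ permute_snd \<sigma> w @ concat vs'"
        using len map2_permute_ids(1)[of ds vs] map2_permute_ids(1)[of ds' vs'] by simp
      finally show "lin_ext (\<lambda>y. L y w) (left_sym \<sigma> x) = L x (permute_snd \<sigma> w)" by (simp add: L_def)
    }
    {
      have op: "cls (OA smul) (right_sym \<sigma> x) = right_act smul (cl x) \<sigma>" by (simp add: cl_def right_act_cls)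
      have "Poly_Mapping.keys (right_sym \<sigma> x :: 'a osym \<Rightarrow>\<^sub>0 'k) \<subseteq> osyms d"
        using x by (cases x) (auto simp: osyms_def right_sym_def permutes_compose)
      from lin[OF this] have "lin_ext (\<lambda>y. L y w) (right_sym \<sigma> x) = pval smul (B (right_act smul (cl x) \<sigma>)) (concat vs @ w @ concat vs')"
        by (simp add: op)
      also have "\<dots> = pval smul (right_act smul (B (cl x)) (perm_prod (zip ?ds ?ws))) (concat (vs @ w # vs'))"
        unfolding W
      proof (rule pv[OF _ _ _ lW])
        have "map2 (right_act smul) ?as ?ws = \<alpha>s @ right_act smul (cl x) \<sigma> # \<alpha>s'"
          using len map2_act_ids(2)[OF hl(1)] map2_act_ids(2)[OF hl(2)] by simp
        then show "cong_R smul TYPE('N) (B (right_act smul (cl x) \<sigma>)) (right_act smul (B (cl x)) (perm_prod (zip ?ds ?ws)))"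
          using compatible_acts(2)[OF c n1 nl hl' ws] by (simp add: B_def)
        show "B (right_act smul (cl x) \<sigma>) \<in> OA_hom smul (sum_list ?ds)" unfolding sum by (rule Bh[OF right_act_hom[OF clh[OF x]]])
        show "right_act smul (B (cl x)) (perm_prod (zip ?ds ?ws)) \<in> OA_hom smul (sum_list ?ds)" by (rule right_act_hom[OF bh])
      qed
      also have "\<dots> = pval smul (B (cl x)) (concat (map2 (\<lambda>w. permute_fst (inv w)) ?ws (vs @ w # vs')))"
        unfolding pval_right_act[OF bh lW pp] permute_fst_concat[OF ws wl] ..
      also have "concat (map2 (\<lambda>w. permute_fst (inv w)) ?ws (vs @ w # vs')) = concat vs @ permute_fst (inv \<sigma>) w @ concat vs'"
        using len map2_permute_ids(2)[of ds vs] map2_permute_ids(2)[of ds' vs'] by simp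
      finally show "lin_ext (\<lambda>y. L y w) (right_sym \<sigma> x) = L x (permute_fst (inv \<sigma>) w)" by (simp add: L_def)
    }
  qed
  then show ?thesis unfolding L .
qed

text \<open>The multilinear extension from monomials of \<open>(\<Phi>(x\<^sub>1, \<dots>, x\<^sub>n)|w\<^sub>1 \<cdots> w\<^sub>n)\<close> descends to the tensor power and has
the required values at pairings, by the properties of slot functionals.\<close>

lemma compatible_imp_induces:
  fixes smul :: "'k::field \<Rightarrow> 'a::{ring, monoid_mult} \<Rightarrow> 'a"
  assumes A: "assoc_algebra smul" and \<Phi>: "\<Phi> \<in> degree_zero_maps smul n" and c: "compatible smul n TYPE('N::finite) \<Phi>"
  shows "\<exists>\<phi> \<in> linear_maps (tpow n (Rep smul)) (Rep smul :: (('a, 'N) rmonom, 'k) presentation). induces smul n \<Phi> \<phi>"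
proof -
  let ?R = "Rep smul :: (('a, 'N) rmonom, 'k) presentation"
  let ?cl = "\<lambda>x. cls (OA smul) (sing x)"
  define G where "G zs = pval smul (\<Phi> (ptensor (OA smul) (map (\<lambda>z. ?cl (fst z)) zs))) (concat (map snd zs))"
    for zs :: "('a osym \<times> ('N \<times> 'N) list) list"
  have slot: "slot_functional smul (\<lambda>x w. G (zs @ (x, w) # zs'))"
    if "Suc (length zs + length zs') = n" "\<forall>z\<in>set (zs @ zs'). fst z \<in> osyms (length (snd z))" for zs zs'
    unfolding G_def by (rule compatible_slot_functional[OF A \<Phi> c that])
  let ?F = "mlin (\<lambda>ms. G (map mpair ms))"
  obtain \<phi> where \<phi>: "\<phi> \<in> linear_maps (tpow n ?R) ?R"
    and \<phi>_eq: "\<forall>l. length l = n \<longrightarrow> set l \<subseteq> vspace ?R \<longrightarrow> \<phi> (ptensor ?R l) = cls ?R (?F (map (cform ?R) l))"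
    using tpow_universal[of n ?F ?R ?R "cform ?R", OF mlin_multilinear _ cform_vadd cform_vscale] by auto
  have "induces smul n \<Phi> \<phi>"
  proof (rule inducesI_symbols[OF \<Phi> \<phi>])
    fix xs :: "'a osym list" and ws :: "('N \<times> 'N) list list"
    assume n: "length xs = n" and v: "list_all2 (\<lambda>x w. x \<in> osyms (length w)) xs ws"
    have len: "length ws = n" using v n by (auto dest: list_all2_lengthD)
    let ?l = "map2 (\<lambda>x w. cls ?R (pair_sym x w)) xs ws"
    have zv: "\<forall>z\<in>set (zip xs ws). fst z \<in> osyms (length (snd z))"
      using v by (auto simp: list_all2_iff)
    have "length ?l = n" "set ?l \<subseteq> vspace ?R" using n len by auto
    then have "\<phi> (ptensor ?R ?l) = cls ?R (?F (map (cform ?R) ?l))"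
      by (rule \<phi>_eq[rule_format])
    also have "map (cform ?R) ?l = map (nform ?R) (map (\<lambda>(x, w). pair_sym x w) (zip xs ws))"
      by (simp add: case_prod_beta)
    also have "?F \<dots> = ?F (map (\<lambda>(x, w). pair_sym x w) (zip xs ws))"
      by (rule mlin_nform[OF slot]) (use n len in auto)
    also have "\<dots> = G (zip xs ws)"
      by (rule mlin_pair_sym[OF slot]) (use n len zv in auto)
    finally have "cform ?R (\<phi> (ptensor ?R ?l)) = nform ?R (G (zip xs ws))" by simp
    also have "G (zip xs ws) = pval smul (\<Phi> (ptensor (OA smul) (map ?cl xs))) (concat ws)"
    proof -
      have "map (\<lambda>z. ?cl (fst z)) (zip xs ws) = map ?cl (map fst (zip xs ws))" by simp
      then show ?thesis unfolding G_def using n len by (simp only: map_fst_zip map_snd_zip)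
    qed
    also have "nform ?R \<dots> = \<dots>"
    proof (rule nform_pval)
      have "hom_list smul (map length ws) (map ?cl xs)"
        using v by (auto simp: hom_list_def list_all2_conv_all_nth intro!: OA_hom_cls)
      then show "\<Phi> (ptensor (OA smul) (map ?cl xs)) \<in> vspace (OA smul)"
        by (intro OA_hom_vspace[OF degree_zero_hom[OF \<Phi>]]) (use len in auto)
    qed
    finally show "cform ?R (\<phi> (ptensor ?R ?l)) = pval smul (\<Phi> (ptensor (OA smul) (map ?cl xs))) (concat ws)" .
  qed
  then show ?thesis using \<phi> by blast
qed

section \<open>Equivariant maps on words are pairings\<close>

lemma sing_add: "sing (m + m') = (sing m * sing m' :: (_::comm_monoid_add) \<Rightarrow>\<^sub>0 'k::field)"
  by (simp add: sing_def mult_single)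

text \<open>Factors \<open>1\<^sub>k\<^sub>k = 1\<close> can be adjoined, so finitely many monomials may be assumed to have the same length.\<close>

lemma pad_monomial:
  fixes smul :: "'k::field \<Rightarrow> 'a::{ring, monoid_mult} \<Rightarrow> 'a"
  shows "sing (mon_of (zs @ replicate r (1, k, k))) - sing (mon_of zs)
    \<in> rel_span (Rep smul :: (('a, 'N::finite) rmonom, 'k) presentation)"
proof (induction r)
  case 0
  show ?case by (simp add: pm.subspace_0[OF rel_span_subspace])
next
  case (Suc r)
  let ?m = "mon_of (zs @ replicate r (1, k, k))"
  have "(rvar 1 k k - (if k = k then 1 else 0)) * sing ?m \<in> rel_span (Rep smul)"
    by (rule idl_mult(2)) (rule rvar_rel_one)
  moreover have "sing (mon_of (zs @ replicate (Suc r) (1, k, k))) = rvar 1 k k * (sing ?m :: ('a, 'N) rmonom \<Rightarrow>\<^sub>0 'k)"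
    by (simp add: sing_add[symmetric] rvar_def sing_def[symmetric] add_ac)
  ultimately have "sing (mon_of (zs @ replicate (Suc r) (1, k, k))) - sing ?m \<in> rel_span (Rep smul)"
    by (simp add: left_diff_distrib)
  from pm.subspace_add[OF rel_span_subspace this Suc] show ?case by simp
qed

text \<open>The trace form identifies the representation on words with its dual; swapping the two indices of each letter
is this identification.\<close>

lemma wcoeff_swap:
  fixes g :: "'k::field ^ 'N ^ 'N::finite"
  assumes "invertible g" "length v = length v'"
  shows "wcoeff (matrix_inv g) v v' = wcoeff g (map prod.swap v') (map prod.swap v)"
proof -
  have "dual_coeff (matrix_inv g) a b = dual_coeff g (prod.swap b) (prod.swap a)" for a b :: "'N \<times> 'N"
    by (cases a; cases b) (simp add: dual_coeff_eq matrix_inv_invertible(4)[OF assms(1)] mult.commute)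
  then show ?thesis using assms(2) by (simp add: wcoeff_def)
qed

definition of_rat_mat :: "rat ^ 'N ^ 'N \<Rightarrow> 'k::field_char_0 ^ 'N ^ 'N::finite" where
  "of_rat_mat g = (\<chi> i j. of_rat (g $ i $ j))"

lemma of_rat_mat_inv:
  assumes g: "invertible g"
  shows "of_rat_mat g ** of_rat_mat (matrix_inv g) = mat 1"
  using inv_sum(1)[OF g]
  by (simp add: vec_eq_iff of_rat_mat_def matrix_matrix_mult_def mat_def of_rat_mult[symmetric] of_rat_sum[symmetric])

lemma invertible_of_rat_mat: "invertible g \<Longrightarrow> invertible (of_rat_mat g)"
  using of_rat_mat_inv[of g] matrix_left_right_inverse by (auto simp: invertible_def)

lemma wcoeff_of_rat_mat:
  assumes g: "invertible g"
  shows "wcoeff (of_rat_mat g :: 'k::field_char_0 ^ 'N ^ 'N::finite) w v = of_rat (wcoeff g w v)"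
proof -
  have "dual_coeff (of_rat_mat g :: 'k ^ 'N ^ 'N) a b = of_rat (dual_coeff g a b)" for a b
    by (cases a; cases b)
      (simp only: dual_coeff_eq matrix_inv_unique[OF of_rat_mat_inv[OF g]], simp add: of_rat_mat_def of_rat_mult)
  then show ?thesis by (simp add: wcoeff_def of_rat_prod)
qed

lemma rmonom_act_pair_sym:
  fixes g :: "'k::field ^ 'N ^ 'N::finite"
  assumes g: "invertible g" and x: "x \<in> osyms d"
  shows "lin_ext (rmonom_act g) (pair_sym x w) = (\<Sum>v | length v = length w. pm_scale (wcoeff g w v) (pair_sym x v))"
proof -
  obtain as fs u where e: "x = (as, fs, u)" and u: "u permutes {1..length as}" using x by (cases x) (auto simp: osyms_def)
  show ?thesis unfolding e act_pair_sym[OF g u] wcoeff_def pm_scale_mult ..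
qed

text \<open>The action on polynomials is well defined modulo the relations.\<close>

lemma rmonom_act_rel_span:
  fixes g :: "'k::field ^ 'N ^ 'N::finite" and smul :: "'k \<Rightarrow> 'a::{ring, monoid_mult} \<Rightarrow> 'a"
  assumes g: "invertible g" and r: "p - q \<in> rel_span (Rep smul)"
  shows "nform (Rep smul) (lin_ext (rmonom_act g) p) = nform (Rep smul) (lin_ext (rmonom_act g) q)"
proof -
  have "cls (Rep smul) p = cls (Rep smul) q" using r by (simp add: cls_eq_iff)
  then have "cls (Rep smul) (lin_ext (rmonom_act g) p) = cls (Rep smul) (lin_ext (rmonom_act g) q)"
    unfolding rep_act_cls[OF g, symmetric] by simp
  then show ?thesis by (simp add: nform_eq_iff cls_eq_iff)
qed

lemma op_pi_funpow_hom:
  assumes "assoc_algebra smul"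
  shows "\<alpha> \<in> OA_hom smul (M + D) \<Longrightarrow> (op_pi smul ^^ M) \<alpha> \<in> OA_hom smul D"
  by (induction M arbitrary: \<alpha>) (simp_all add: funpow_swap1 op_pi_hom[OF assms] del: funpow.simps(2), simp add: funpow_Suc_right op_pi_hom[OF assms] del: funpow.simps(2))

lemma pval_op_pi_funpow:
  fixes smul :: "'k::field \<Rightarrow> 'a::{ring, monoid_mult} \<Rightarrow> 'a"
  assumes A: "assoc_algebra smul" and w: "length (w :: ('N::finite \<times> 'N) list) = D"
  shows "\<alpha> \<in> OA_hom smul (M + D) \<Longrightarrow>
    pval smul ((op_pi smul ^^ M) \<alpha>) w = (\<Sum>q | length q = M. pval smul \<alpha> (map (\<lambda>k. (k, k)) q @ w))"
proof (induction M arbitrary: \<alpha>)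
  case (Suc M)
  have h: "op_pi smul \<alpha> \<in> OA_hom smul (M + D)" by (rule op_pi_hom[OF A]) (use Suc.prems in simp)
  have "pval smul ((op_pi smul ^^ Suc M) \<alpha>) w = (\<Sum>q | length q = M. pval smul (op_pi smul \<alpha>) (map (\<lambda>k. (k, k)) q @ w))"
    using Suc.IH[OF h] by (simp add: funpow_Suc_right del: funpow.simps(2))
  also have "\<dots> = (\<Sum>q | length q = M. \<Sum>k\<in>UNIV. pval smul \<alpha> ((k, k) # map (\<lambda>k. (k, k)) q @ w))"
    by (intro sum.cong refl pval_op_pi[OF A, of \<alpha> "M + D"]) (use Suc.prems w in auto)
  also have "\<dots> = (\<Sum>q | length q = Suc M. pval smul \<alpha> (map (\<lambda>k. (k, k)) q @ w))"
    unfolding sum_words_Suc by (rule trans[OF sum.swap]) simp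
  finally show ?case .
qed simp

text \<open>Letters that are \<open>1\<close> contribute Kronecker deltas.\<close>

lemma pair_sym_split_ones:
  fixes l :: "'a::{ring, monoid_mult} list" and smul :: "'k::field \<Rightarrow> 'a \<Rightarrow> 'a"
  assumes l: "length l = M" and u: "length (u :: ('N::finite \<times> 'N) list) = M + D" and \<tau>: "\<tau> permutes {1..M + D}"
  shows "pw smul (l @ replicate D 1, {#}, \<tau>) u =
    (if \<forall>t\<in>{M<..M + D}. fst (u ! (inv \<tau> t - 1)) = snd (u ! (t - 1))
     then nform (Rep smul) (\<Prod>t = 1..M. rvar (l ! (t - 1)) (fst (u ! (inv \<tau> t - 1))) (snd (u ! (t - 1)))) else 0)"
proof -
  define P where "P = (\<Prod>t = 1..M. rvar (l ! (t - 1)) (fst (u ! (inv \<tau> t - 1))) (snd (u ! (t - 1))) :: ('a, 'N) rmonom \<Rightarrow>\<^sub>0 'k)"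
  define \<delta> where "\<delta> t = (if fst (u ! (inv \<tau> t - 1)) = snd (u ! (t - 1)) then 1 else 0 :: ('a, 'N) rmonom \<Rightarrow>\<^sub>0 'k)" for t
  have split: "{1..M + D} = {1..M} \<union> {M<..M + D}" by auto
  have "pair_sym (l @ replicate D 1, {#}, \<tau>) u
      = (\<Prod>t = 1..M + D. rvar ((l @ replicate D 1) ! (t - 1)) (fst (u ! (inv \<tau> t - 1))) (snd (u ! (t - 1))) :: ('a, 'N) rmonom \<Rightarrow>\<^sub>0 'k)"
    using l u by (simp add: pair_sym_def)
  also have "\<dots> = P * (\<Prod>t\<in>{M<..M + D}. rvar 1 (fst (u ! (inv \<tau> t - 1))) (snd (u ! (t - 1))))"
    unfolding split P_def by (subst prod.union_disjoint) (auto simp: l nth_append intro!: arg_cong2[of _ _ _ _ "(*)"] prod.cong)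
  finally have e: "pair_sym (l @ replicate D 1, {#}, \<tau>) u = P * (\<Prod>t\<in>{M<..M + D}. rvar 1 (fst (u ! (inv \<tau> t - 1))) (snd (u ! (t - 1))))" .
  have "(\<Prod>t\<in>S. rvar 1 (fst (u ! (inv \<tau> t - 1))) (snd (u ! (t - 1)))) - (\<Prod>t\<in>S. \<delta> t) \<in> rel_span (Rep smul)" if "finite S" for S
    using that
  proof induction
    case empty
    show ?case by (simp add: pm.subspace_0[OF rel_span_subspace])
  next
    case (insert t S)
    let ?r = "\<lambda>t. rvar 1 (fst (u ! (inv \<tau> t - 1))) (snd (u ! (t - 1))) :: ('a, 'N) rmonom \<Rightarrow>\<^sub>0 'k"
    have 1: "?r t - \<delta> t \<in> rel_span (Rep smul)" unfolding \<delta>_def by (rule rvar_rel_one)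
    have "?r t * (prod ?r S - prod \<delta> S) + (?r t - \<delta> t) * prod \<delta> S \<in> rel_span (Rep smul)"
      by (intro pm.subspace_add[OF rel_span_subspace] idl_mult(1)[OF insert.IH] idl_mult(2)[OF 1])
    then show ?case using insert.hyps by (simp add: algebra_simps)
  qed
  from idl_mult(1)[OF this[of "{M<..M + D}"], of P]
  have "pw smul (l @ replicate D 1, {#}, \<tau>) u = nform (Rep smul) (P * (\<Prod>t\<in>{M<..M + D}. \<delta> t))"
    unfolding pw_def e nform_eq_iff by (simp add: right_diff_distrib)
  moreover have "(\<Prod>t\<in>{M<..M + D}. \<delta> t) = (if \<forall>t\<in>{M<..M + D}. fst (u ! (inv \<tau> t - 1)) = snd (u ! (t - 1)) then 1 else 0)"
    by (auto simp: \<delta>_def intro!: prod_zero)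
  ultimately show ?thesis by (simp add: P_def)
qed

text \<open>On the left, the permutation \<open>\<sigma>\<close> prescribes which indices of \<open>v\<close> and \<open>w\<close> coincide, and the remaining free ones
are summed. With \<open>v = zip p q\<close>, the condition determines \<open>p\<close> from \<open>q\<close> and \<open>w\<close> and imposes equations on \<open>w\<close> and \<open>q\<close>. On the
right the sum is over the same \<open>q\<close>, the permutation \<open>\<tau>\<close> of the symbol produces the same \<open>p\<close>, and the \<open>D\<close>
letters \<open>1\<close> produce the same equations.\<close>

lemma contract_permutation_tensor:
  fixes l :: "'a::{ring, monoid_mult} list" and smul :: "'k::field \<Rightarrow> 'a \<Rightarrow> 'a"
  assumes l: "length l = M" and w: "length (w :: ('N::finite \<times> 'N) list) = D" and s: "\<sigma> permutes {..<M + D}"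
  defines "\<tau> \<equiv> inv (\<lambda>i. if 1 \<le> i \<and> i \<le> M + D then Suc (\<sigma> (i - 1)) else i)"
  shows "(\<Sum>v | length v = M. if map snd (map prod.swap v @ w) = permute_list \<sigma> (map fst (map prod.swap v @ w))
        then pw smul (l, {#}, id) v else 0)
    = (\<Sum>q | length q = M. pw smul (l @ replicate D 1, {#}, \<tau>) (map (\<lambda>k. (k, k)) q @ w))"
proof -
  define \<rho> where "\<rho> = (\<lambda>i. if 1 \<le> i \<and> i \<le> M + D then Suc (\<sigma> (i - 1)) else i)"
  have \<rho>: "\<rho> permutes {1..M + D}" unfolding \<rho>_def by (rule shift_permutes[OF s])
  have \<tau>: "\<tau> permutes {1..M + D}" "inv \<tau> = \<rho>"
    using permutes_inv[OF \<rho>] permutes_inv_inv[OF \<rho>] by (simp_all add: \<tau>_def \<rho>_def)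
  have im: "\<sigma> t < M + D" if "t < M + D" for t using permutes_in_image[OF s, of t] that by simp
  let ?N = "nform (Rep smul) :: (('a, 'N) rmonom \<Rightarrow>\<^sub>0 'k) \<Rightarrow> _"
  define c where "c q t = (q @ map fst w) ! (\<sigma> t)" for q t
  have "(\<Sum>v | length v = M. if map snd (map prod.swap v @ w) = permute_list \<sigma> (map fst (map prod.swap v @ w))
        then pw smul (l, {#}, id) v else 0)
    = (\<Sum>p | length p = M. \<Sum>q | length q = M. if p @ map snd w = permute_list \<sigma> (q @ map fst w) then pw smul (l, {#}, id) (zip p q) else 0)"
    unfolding sum_words_zip
  proof (rule sum.cong[OF refl], rule sum.cong[OF refl])
    fix p q :: "'N list" assume "p \<in> {p. length p = M}" "q \<in> {q. length q = M}"
    then have "map snd (map prod.swap (zip p q)) = p" "map fst (map prod.swap (zip p q)) = q"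
      by (auto intro!: nth_equalityI)
    then show "(if map snd (map prod.swap (zip p q) @ w) = permute_list \<sigma> (map fst (map prod.swap (zip p q) @ w)) then pw smul (l, {#}, id) (zip p q) else 0)
        = (if p @ map snd w = permute_list \<sigma> (q @ map fst w) then pw smul (l, {#}, id) (zip p q) else 0)"
      by (simp only: map_append)
  qed
  also have "\<dots> = (\<Sum>q | length q = M. \<Sum>p | length p = M. if p @ map snd w = permute_list \<sigma> (q @ map fst w) then pw smul (l, {#}, id) (zip p q) else 0)"
    by (rule sum.swap)
  also have "\<dots> = (\<Sum>q | length q = M. pw smul (l @ replicate D 1, {#}, \<tau>) (map (\<lambda>k. (k, k)) q @ w))"
  proof (rule sum.cong[OF refl])
    fix q :: "'N list" assume "q \<in> {q. length q = M}"
    then have q: "length q = M" by simp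
    let ?u = "map (\<lambda>k. (k, k)) q @ w"
    let ?p = "map (c q) [0..<M]"
    let ?C = "\<forall>t<D. snd (w ! t) = c q (M + t)"
    have pl: "permute_list \<sigma> (q @ map fst w) = ?p @ map (\<lambda>t. c q (M + t)) [0..<D]"
      by (rule nth_equalityI) (use q w s in \<open>auto simp: permute_list_nth c_def nth_append\<close>)
    have iff: "p @ map snd w = permute_list \<sigma> (q @ map fst w) \<longleftrightarrow> p = ?p \<and> ?C" if "length p = M" for p
    proof -
      have "p @ map snd w = ?p @ map (\<lambda>t. c q (M + t)) [0..<D] \<longleftrightarrow> p = ?p \<and> map snd w = map (\<lambda>t. c q (M + t)) [0..<D]"
        using that by (intro append_eq_append_conv) simp
      moreover have "map snd w = map (\<lambda>t. c q (M + t)) [0..<D] \<longleftrightarrow> ?C"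
        using w by (simp add: list_eq_iff_nth_eq)
      ultimately show ?thesis unfolding pl by simp
    qed
    have "(\<Sum>p | length p = M. if p @ map snd w = permute_list \<sigma> (q @ map fst w) then pw smul (l, {#}, id) (zip p q) else 0)
        = (\<Sum>p | length p = M. if p = ?p then (if ?C then pw smul (l, {#}, id) (zip ?p q) else 0) else 0)"
    proof (rule sum.cong[OF refl])
      fix p :: "'N list" assume "p \<in> {p. length p = M}"
      then have p: "length p = M" by simp
      show "(if p @ map snd w = permute_list \<sigma> (q @ map fst w) then pw smul (l, {#}, id) (zip p q) else 0)
        = (if p = ?p then (if ?C then pw smul (l, {#}, id) (zip ?p q) else 0) else 0)"
        unfolding iff[OF p] by (cases "p = ?p") (simp_all only: simp_thms if_True if_False)
    qed
    also have "\<dots> = (if ?C then pw smul (l, {#}, id) (zip ?p q) else 0)" by simp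
    also have "pw smul (l, {#}, id) (zip ?p q) = ?N (\<Prod>t = 1..M. rvar (l ! (t - 1)) (fst (?u ! (inv \<tau> t - 1))) (snd (?u ! (t - 1))))"
    proof -
      have "pair_sym (l, {#}, id) (zip ?p q) = (\<Prod>t = 1..M. rvar (l ! (t - 1)) (c q (t - 1)) (q ! (t - 1)) :: ('a, 'N) rmonom \<Rightarrow>\<^sub>0 'k)"
        using l q by (simp add: pair_sym_def inv_id) (rule prod.cong, auto)
      also have "\<dots> = (\<Prod>t = 1..M. rvar (l ! (t - 1)) (fst (?u ! (inv \<tau> t - 1))) (snd (?u ! (t - 1))))"
      proof (rule prod.cong[OF refl])
        fix t assume t: "t \<in> {1..M}"
        then have "\<sigma> (t - 1) < M + D" by (intro im) auto
        then show "rvar (l ! (t - 1)) (c q (t - 1)) (q ! (t - 1)) = (rvar (l ! (t - 1)) (fst (?u ! (inv \<tau> t - 1))) (snd (?u ! (t - 1))) :: ('a, 'N) rmonom \<Rightarrow>\<^sub>0 'k)"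
          using t q w by (auto simp: \<tau>(2) \<rho>_def c_def nth_append)
      qed
      finally show ?thesis by (simp add: pw_def)
    qed
    also have "?C \<longleftrightarrow> (\<forall>t\<in>{M<..M + D}. fst (?u ! (inv \<tau> t - 1)) = snd (?u ! (t - 1)))"
    proof -
      have 1: "fst (?u ! (inv \<tau> (Suc (M + t)) - 1)) = c q (M + t)" "snd (?u ! (Suc (M + t) - 1)) = snd (w ! t)" if "t < D" for t
        using that im[of "M + t"] q w by (auto simp: \<tau>(2) \<rho>_def c_def nth_append)
      have "?C \<longleftrightarrow> (\<forall>t<D. fst (?u ! (inv \<tau> (Suc (M + t)) - 1)) = snd (?u ! (Suc (M + t) - 1)))"
      proof (intro all_cong)
        fix t assume t: "t < D"
        show "(snd (w ! t) = c q (M + t)) = (fst (?u ! (inv \<tau> (Suc (M + t)) - 1)) = snd (?u ! (Suc (M + t) - 1)))"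
          unfolding 1[OF t] by (rule eq_commute)
      qed
      also have "\<dots> \<longleftrightarrow> (\<forall>t\<in>{M<..M + D}. fst (?u ! (inv \<tau> t - 1)) = snd (?u ! (t - 1)))"
      proof (intro iffI ballI allI impI)
        fix t assume a: "\<forall>t<D. fst (?u ! (inv \<tau> (Suc (M + t)) - 1)) = snd (?u ! (Suc (M + t) - 1))" and t: "t \<in> {M<..M + D}"
        then have "Suc (M + (t - M - 1)) = t" "t - M - 1 < D" by auto
        with a[rule_format, of "t - M - 1"] show "fst (?u ! (inv \<tau> t - 1)) = snd (?u ! (t - 1))" by simp
      next
        fix t assume a: "\<forall>t\<in>{M<..M + D}. fst (?u ! (inv \<tau> t - 1)) = snd (?u ! (t - 1))" and t: "t < D"
        show "fst (?u ! (inv \<tau> (Suc (M + t)) - 1)) = snd (?u ! (Suc (M + t) - 1))"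
          by (rule a[rule_format]) (use t in simp)
      qed
      finally show ?thesis .
    qed
    finally show "(\<Sum>p | length p = M. if p @ map snd w = permute_list \<sigma> (q @ map fst w) then pw smul (l, {#}, id) (zip p q) else 0)
      = pw smul (l @ replicate D 1, {#}, \<tau>) ?u"
      using pair_sym_split_ones[OF l _ \<tau>(1), of ?u smul] q w by simp
  qed
  finally show ?thesis .
qed

lemma keys_sum_subset:
  assumes "\<And>x. x \<in> S \<Longrightarrow> Poly_Mapping.keys (h x) \<subseteq> A"
  shows "Poly_Mapping.keys (sum h S) \<subseteq> A"
  using keys_sum[of h S] assms by blast

lemma pm_scale_if: "pm_scale c (if P then x else 0) = pm_scale (if P then c else 0) (x :: _ \<Rightarrow>\<^sub>0 'k::field)"
  by simp

text \<open>Write \<open>\<psi>(w) = \<Sum>\<^sub>l \<Sum>\<^sub>v c(w, l, v) (l|v)\<close>, where \<open>l\<close> runs through finitely many lists of \<open>M\<close> elements of \<open>A\<close> and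
\<open>(l|v)\<close> is the monomial with elements \<open>l\<close> and indices \<open>v\<close>. For fixed \<open>l\<close>, the coefficients form
a tensor \<open>B l\<close> of order \<open>M + D\<close>, with the letters of \<open>v\<close> swapped because \<open>c\<close> transforms by the action in
\<open>w\<close> and by the dual action in \<open>v\<close>. Equivariance of \<open>\<psi>\<close> says that all translates of \<open>B\<close> represent the same \<open>\<psi>\<close>; hence so
does the average \<open>E\<close>. It is invariant, so it is a combination of permutation tensors, and each of these is turned
into the pairing with an iterated contraction by \<open>contract_permutation_tensor\<close>.\<close>

theorem equivariant_word_map_is_pairing:
  fixes smul :: "'k::field_char_0 \<Rightarrow> 'a::{ring, monoid_mult} \<Rightarrow> 'a" and \<psi> :: "('N::finite \<times> 'N) list \<Rightarrow> ('a, 'N) rmonom \<Rightarrow>\<^sub>0 'k"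
  assumes A: "assoc_algebra smul"
    and eqv: "\<And>(g :: 'k ^ 'N ^ 'N) w. invertible g \<Longrightarrow> length w = D \<Longrightarrow>
      nform (Rep smul) (\<Sum>w' | length w' = D. pm_scale (wcoeff g w w') (\<psi> w')) = nform (Rep smul) (lin_ext (rmonom_act g) (\<psi> w))"
  shows "\<exists>f. Poly_Mapping.keys f \<subseteq> osyms D \<and>
    (\<forall>w. length w = D \<longrightarrow> lin_ext (\<lambda>x. pw smul x w) f = nform (Rep smul) (\<psi> w))"
proof -
  let ?R = "Rep smul :: (('a, 'N) rmonom, 'k) presentation"
  let ?W = "\<lambda>n. {w :: ('N \<times> 'N) list. length w = n}"
  define T where "T = (\<Union>w\<in>?W D. Poly_Mapping.keys (\<psi> w))"
  have finT: "finite T" by (simp add: T_def)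
  define M where "M = Max (insert 0 ((\<lambda>t. length (mlist t)) ` T))"
  have M: "length (mlist t) \<le> M" if "t \<in> T" for t
    unfolding M_def by (rule Max_ge) (use finT that in auto)
  \<comment> \<open>The index of the padding is arbitrary, as \<open>1\<^sub>k\<^sub>k = 1\<close> for each \<open>k\<close>.\<close>
  define zl where "zl t = mlist t @ replicate (M - length (mlist t)) (1, undefined, undefined)" for t :: "('a, 'N) rmonom"
  have zl: "length (zl t) = M" if "t \<in> T" for t using M[OF that] by (simp add: zl_def)
  define \<LL> where "\<LL> = (\<lambda>t. map fst (zl t)) ` T"
  have fin\<LL>: "finite \<LL>" "l \<in> \<LL> \<Longrightarrow> length l = M" for l using finT zl by (auto simp: \<LL>_def)
  \<comment> \<open>\<open>\<psi> w\<close> with each monomial replaced by the pair of its elements and its indices.\<close>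
  define F where "F w = lin_ext (\<lambda>t. sing (map fst (zl t), map snd (zl t))) (\<psi> w)" for w
  define c where "c w l v = Poly_Mapping.lookup (F w) (l, v)" for w l v
  have keysF: "Poly_Mapping.keys (F w) \<subseteq> \<LL> \<times> ?W M" if "length w = D" for w
    unfolding F_def by (rule keys_lin_ext_subset[of _ T]) (use that zl in \<open>auto simp: T_def \<LL>_def\<close>)
  have F_psi: "lin_ext (\<lambda>(l, v). pair_sym (l, {#}, id) v) (F w) - \<psi> w \<in> rel_span ?R" for w
  proof -
    have "lin_ext (\<lambda>(l, v). pair_sym (l, {#}, id) v) (F w) = lin_ext (\<lambda>t. sing (mon_of (zl t))) (\<psi> w)"
    proof -
      have "pair_sym (map fst zs, {#}, id) (map snd zs) = (sing (mon_of zs) :: ('a, 'N) rmonom \<Rightarrow>\<^sub>0 'k)" for zs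
        using pair_sym_vsym[of zs] by (simp only: vsym_def)
      then show ?thesis unfolding F_def lin_ext_comp by (simp only: lin_ext_sing prod.case)
    qed
    then have "lin_ext (\<lambda>(l, v). pair_sym (l, {#}, id) v) (F w) - \<psi> w = lin_ext (\<lambda>t. sing (mon_of (zl t)) - sing t) (\<psi> w)"
      by (simp add: lin_ext_fun_diff[symmetric] lin_ext_id)
    also have "\<dots> \<in> rel_span ?R"
    proof (rule idl_lin_ext)
      fix t :: "('a, 'N) rmonom"
      show "sing (mon_of (zl t)) - sing t \<in> rel_span ?R"
        using pad_monomial[of "mlist t"] by (simp only: zl_def mon_of_mlist)
    qed
    finally show ?thesis .
  qed
  have sum_split: "(\<Sum>lv\<in>\<LL> \<times> ?W M. h lv) = (\<Sum>l\<in>\<LL>. \<Sum>v\<in>?W M. h (l, v))" for h :: "_ \<Rightarrow> ('a, 'N) rmonom \<Rightarrow>\<^sub>0 'k"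
    by (simp add: sum.cartesian_product)
  have act: "nform ?R (lin_ext (rmonom_act g) (\<psi> w)) = (\<Sum>l\<in>\<LL>. \<Sum>v\<in>?W M. \<Sum>v'\<in>?W M. pm_scale (c w l v * wcoeff g v v') (pw smul (l, {#}, id) v'))"
    if g: "invertible g" and w: "length w = D" for g :: "'k ^ 'N ^ 'N" and w
  proof -
    have "nform ?R (lin_ext (rmonom_act g) (\<psi> w)) = nform ?R (lin_ext (rmonom_act g) (lin_ext (\<lambda>(l, v). pair_sym (l, {#}, id) v) (F w)))"
      by (rule rmonom_act_rel_span[OF g F_psi, symmetric])
    also have "\<dots> = lin_ext (\<lambda>lv. nform ?R (lin_ext (rmonom_act g) (case lv of (l, v) \<Rightarrow> pair_sym (l, {#}, id) v))) (F w)"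
      unfolding lin_ext_comp nform_lin_ext ..
    also have "\<dots> = (\<Sum>lv\<in>\<LL> \<times> ?W M. pm_scale (Poly_Mapping.lookup (F w) lv) (nform ?R (lin_ext (rmonom_act g) (case lv of (l, v) \<Rightarrow> pair_sym (l, {#}, id) v))))"
      by (rule lin_ext_superset) (use fin\<LL> keysF[OF w] in auto)
    also have "\<dots> = (\<Sum>l\<in>\<LL>. \<Sum>v\<in>?W M. \<Sum>v'\<in>?W M. pm_scale (c w l v * wcoeff g v v') (pw smul (l, {#}, id) v'))"
      unfolding sum_split
    proof (intro sum.cong refl)
      fix l v assume l: "l \<in> \<LL>" and v: "v \<in> ?W M"
      have x: "(l, {#}, id) \<in> osyms M" using fin\<LL>(2)[OF l] by (simp add: osyms_def permutes_id)
      show "pm_scale (Poly_Mapping.lookup (F w) (l, v)) (nform ?R (lin_ext (rmonom_act g) (case (l, v) of (l, v) \<Rightarrow> pair_sym (l, {#}, id) v)))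
        = (\<Sum>v'\<in>?W M. pm_scale (c w l v * wcoeff g v v') (pw smul (l, {#}, id) v'))"
        using v by (simp add: rmonom_act_pair_sym[OF g x] nform_sum nform_scale pw_def pm.scale_sum_right c_def)
    qed
    finally show ?thesis .
  qed
  \<comment> \<open>The first \<open>M\<close> letters of \<open>u\<close> are the swapped indices of the monomial and the last \<open>D\<close> letters are the
    argument of \<open>\<psi>\<close>.\<close>
  define B where "B l u = c (drop M u) l (map prod.swap (take M u))" for l u
  \<comment> \<open>Replacing \<open>B\<close> by its translate under \<open>g\<close> does not change \<open>\<psi>\<close>.\<close>
  have key: "nform ?R (\<psi> w) = (\<Sum>l\<in>\<LL>. \<Sum>v\<in>?W M. pm_scale (\<Sum>u\<in>?W (M + D). wcoeff g (map prod.swap v @ w) u * B l u) (pw smul (l, {#}, id) v))"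
    if g: "invertible g" and w: "length w = D" for g :: "'k ^ 'N ^ 'N" and w
  proof -
    let ?h = "matrix_inv g"
    note gi = matrix_inv_invertible[OF g]
    have "\<psi> w = (\<Sum>w''\<in>?W D. pm_scale (wcoeff (mat 1 :: 'k ^ 'N ^ 'N) w w'') (\<psi> w''))"
    proof -
      have "(\<Sum>w''\<in>?W D. pm_scale (wcoeff (mat 1 :: 'k ^ 'N ^ 'N) w w'') (\<psi> w'')) = (\<Sum>w''\<in>?W D. if w'' = w then \<psi> w'' else 0)"
        by (rule sum.cong[OF refl]) (use w wcoeff_one[of w, where 'k = 'k] in auto)
      then show ?thesis using w by simp
    qed
    also have "\<dots> = (\<Sum>w''\<in>?W D. pm_scale (\<Sum>w'\<in>?W D. wcoeff g w w' * wcoeff ?h w' w'') (\<psi> w''))"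
      by (simp add: wcoeff_mult[OF g gi(3) w] gi(2))
    also have "\<dots> = (\<Sum>w'\<in>?W D. pm_scale (wcoeff g w w') (\<Sum>w''\<in>?W D. pm_scale (wcoeff ?h w' w'') (\<psi> w'')))"
      by (simp add: pm.scale_sum_left pm.scale_sum_right) (rule sum.swap)
    finally have "nform ?R (\<psi> w) = (\<Sum>w'\<in>?W D. pm_scale (wcoeff g w w') (nform ?R (\<Sum>w''\<in>?W D. pm_scale (wcoeff ?h w' w'') (\<psi> w''))))"
      by (simp only: nform_sum nform_scale)
    also have "\<dots> = (\<Sum>w'\<in>?W D. pm_scale (wcoeff g w w') (\<Sum>l\<in>\<LL>. \<Sum>v\<in>?W M. \<Sum>v'\<in>?W M. pm_scale (c w' l v * wcoeff ?h v v') (pw smul (l, {#}, id) v')))"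
      by (intro sum.cong refl) (simp add: eqv[OF gi(3)] act[OF gi(3)])
    also have "\<dots> = (\<Sum>w'\<in>?W D. \<Sum>l\<in>\<LL>. \<Sum>v\<in>?W M. \<Sum>v'\<in>?W M. pm_scale (wcoeff g w w' * (c w' l v * wcoeff ?h v v')) (pw smul (l, {#}, id) v'))"
      by (simp add: pm.scale_sum_right)
    also have "\<dots> = (\<Sum>l\<in>\<LL>. \<Sum>v'\<in>?W M. \<Sum>v\<in>?W M. \<Sum>w'\<in>?W D. pm_scale (wcoeff g w w' * (c w' l v * wcoeff ?h v v')) (pw smul (l, {#}, id) v'))"
    proof (rule trans[OF sum.swap], rule sum.cong[OF refl])
      fix l
      let ?t = "\<lambda>w' v v'. pm_scale (wcoeff g w w' * (c w' l v * wcoeff ?h v v')) (pw smul (l, {#}, id) v')"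
      have "(\<Sum>w'\<in>?W D. \<Sum>v\<in>?W M. \<Sum>v'\<in>?W M. ?t w' v v') = (\<Sum>w'\<in>?W D. \<Sum>v'\<in>?W M. \<Sum>v\<in>?W M. ?t w' v v')"
        by (rule sum.cong[OF refl], rule sum.swap)
      also have "\<dots> = (\<Sum>v'\<in>?W M. \<Sum>w'\<in>?W D. \<Sum>v\<in>?W M. ?t w' v v')" by (rule sum.swap)
      also have "\<dots> = (\<Sum>v'\<in>?W M. \<Sum>v\<in>?W M. \<Sum>w'\<in>?W D. ?t w' v v')" by (rule sum.cong[OF refl], rule sum.swap)
      finally show "(\<Sum>w'\<in>?W D. \<Sum>v\<in>?W M. \<Sum>v'\<in>?W M. ?t w' v v') = (\<Sum>v'\<in>?W M. \<Sum>v\<in>?W M. \<Sum>w'\<in>?W D. ?t w' v v')" .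
    qed
    also have "\<dots> = (\<Sum>l\<in>\<LL>. \<Sum>v'\<in>?W M. pm_scale (\<Sum>u\<in>?W (M + D). wcoeff g (map prod.swap v' @ w) u * B l u) (pw smul (l, {#}, id) v'))"
    proof (intro sum.cong refl)
      fix l v' assume v': "v' \<in> ?W M"
      have "(\<Sum>u\<in>?W (M + D). wcoeff g (map prod.swap v' @ w) u * B l u)
        = (\<Sum>s\<in>?W M. \<Sum>w'\<in>?W D. wcoeff g (map prod.swap v') s * wcoeff g w w' * c w' l (map prod.swap s))"
        unfolding sum_words_append by (intro sum.cong refl) (use v' in \<open>simp add: wcoeff_append B_def\<close>)
      also have "\<dots> = (\<Sum>v\<in>?W M. \<Sum>w'\<in>?W D. wcoeff g (map prod.swap v') (map prod.swap v) * wcoeff g w w' * c w' l v)"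
        by (rule sum.reindex_bij_witness[of _ "map prod.swap" "map prod.swap"]) (auto simp: o_def)
      also have "\<dots> = (\<Sum>v\<in>?W M. \<Sum>w'\<in>?W D. wcoeff g w w' * (c w' l v * wcoeff ?h v v'))"
        by (intro sum.cong refl) (use v' in \<open>simp add: wcoeff_swap[OF g] mult_ac\<close>)
      finally show "(\<Sum>v\<in>?W M. \<Sum>w'\<in>?W D. pm_scale (wcoeff g w w' * (c w' l v * wcoeff ?h v v')) (pw smul (l, {#}, id) v'))
        = pm_scale (\<Sum>u\<in>?W (M + D). wcoeff g (map prod.swap v' @ w) u * B l u) (pw smul (l, {#}, id) v')"
        by (simp only: pm.scale_sum_left)
    qed
    finally show ?thesis .
  qed
  obtain \<G> cc where \<G>: "finite \<G>" "\<forall>g\<in>\<G>. invertible (g :: rat ^ 'N ^ 'N)" "(\<Sum>g\<in>\<G>. cc g) = (1::rat)"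
    and rey: "\<forall>h w v. invertible (h :: rat ^ 'N ^ 'N) \<longrightarrow> length w = M + D \<longrightarrow> length v = M + D \<longrightarrow>
        (\<Sum>u\<in>?W (M + D). wcoeff h w u * (\<Sum>g\<in>\<G>. cc g * wcoeff g u v)) = (\<Sum>g\<in>\<G>. cc g * wcoeff g w v)"
    using reynolds_operator[where 'N = 'N, of "M + D"] by (elim exE conjE)
  define e where "e w v = (\<Sum>g\<in>\<G>. cc g * wcoeff g w v)" for w v :: "('N \<times> 'N) list"
  \<comment> \<open>The average of \<open>B\<close> over the group.\<close>
  define E where "E l u = (\<Sum>u'\<in>?W (M + D). of_rat (e u u') * B l u')" for l u
  have avg: "nform ?R (\<psi> w) = (\<Sum>l\<in>\<LL>. \<Sum>v\<in>?W M. pm_scale (E l (map prod.swap v @ w)) (pw smul (l, {#}, id) v))"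
    if w: "length w = D" for w
  proof -
    have "nform ?R (\<psi> w) = (\<Sum>g\<in>\<G>. pm_scale (of_rat (cc g)) (nform ?R (\<psi> w)))"
      by (simp only: pm.scale_sum_left[symmetric] of_rat_sum[symmetric] \<G>(3)) simp
    also have "\<dots> = (\<Sum>g\<in>\<G>. pm_scale (of_rat (cc g)) (\<Sum>l\<in>\<LL>. \<Sum>v\<in>?W M. pm_scale (\<Sum>u\<in>?W (M + D). of_rat (wcoeff g (map prod.swap v @ w) u) * B l u) (pw smul (l, {#}, id) v)))"
    proof (rule sum.cong[OF refl])
      fix g assume "g \<in> \<G>"
      then have g: "invertible g" using \<G>(2) by blast
      show "pm_scale (of_rat (cc g)) (nform ?R (\<psi> w)) = pm_scale (of_rat (cc g)) (\<Sum>l\<in>\<LL>. \<Sum>v\<in>?W M. pm_scale (\<Sum>u\<in>?W (M + D). of_rat (wcoeff g (map prod.swap v @ w) u) * B l u) (pw smul (l, {#}, id) v))"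
        by (simp only: key[OF invertible_of_rat_mat[OF g] w] wcoeff_of_rat_mat[OF g])
    qed
    also have "\<dots> = (\<Sum>l\<in>\<LL>. \<Sum>v\<in>?W M. \<Sum>g\<in>\<G>. pm_scale (of_rat (cc g) * (\<Sum>u\<in>?W (M + D). of_rat (wcoeff g (map prod.swap v @ w) u) * B l u)) (pw smul (l, {#}, id) v))"
      by (simp only: pm.scale_sum_right pm.scale_scale)
        (rule trans[OF sum.swap], rule sum.cong[OF refl], rule sum.swap)
    also have "\<dots> = (\<Sum>l\<in>\<LL>. \<Sum>v\<in>?W M. pm_scale (E l (map prod.swap v @ w)) (pw smul (l, {#}, id) v))"
    proof (intro sum.cong refl)
      fix l v
      have "E l (map prod.swap v @ w) = (\<Sum>g\<in>\<G>. of_rat (cc g) * (\<Sum>u\<in>?W (M + D). of_rat (wcoeff g (map prod.swap v @ w) u) * B l u))"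
        unfolding E_def e_def of_rat_sum of_rat_mult sum_distrib_right sum_distrib_left
        by (rule trans[OF sum.swap]) (simp only: mult_ac)
      then show "(\<Sum>g\<in>\<G>. pm_scale (of_rat (cc g) * (\<Sum>u\<in>?W (M + D). of_rat (wcoeff g (map prod.swap v @ w) u) * B l u)) (pw smul (l, {#}, id) v))
        = pm_scale (E l (map prod.swap v @ w)) (pw smul (l, {#}, id) v)"
        by (simp only: pm.scale_sum_left)
    qed
    finally show ?thesis .
  qed
  have E_inv: "(\<Sum>v\<in>?W (M + D). of_rat (wcoeff h u v) * E l v) = E l u"
    if h: "invertible (h :: rat ^ 'N ^ 'N)" and u: "length u = M + D" for h u l
  proof -
    have "(\<Sum>v\<in>?W (M + D). of_rat (wcoeff h u v) * E l v) = (\<Sum>v\<in>?W (M + D). \<Sum>u'\<in>?W (M + D). of_rat (wcoeff h u v * e v u') * B l u')"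
      by (simp only: E_def sum_distrib_left of_rat_mult mult.assoc)
    also have "\<dots> = (\<Sum>u'\<in>?W (M + D). of_rat (\<Sum>v\<in>?W (M + D). wcoeff h u v * e v u') * B l u')"
      by (rule trans[OF sum.swap]) (simp only: of_rat_sum sum_distrib_right)
    also have "\<dots> = E l u" unfolding E_def
      by (intro sum.cong refl) (use rey h u in \<open>simp add: e_def\<close>)
    finally show ?thesis .
  qed
  have "\<forall>l. \<exists>z. \<forall>u. length u = M + D \<longrightarrow>
    E l u = (\<Sum>\<sigma> | \<sigma> permutes {..<M + D}. if map snd u = permute_list \<sigma> (map fst u) then z \<sigma> else 0)"
    by (rule allI, rule invariant_tensors_spanned_by_permutations) (rule E_inv)
  from choice[OF this] obtain z where z: "\<forall>l u. length u = M + D \<longrightarrow>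
    E l u = (\<Sum>\<sigma> | \<sigma> permutes {..<M + D}. if map snd u = permute_list \<sigma> (map fst u) then z l \<sigma> else 0)"
    by (rule exE)
  define \<tau> where "\<tau> \<sigma> = inv (\<lambda>i. if 1 \<le> i \<and> i \<le> M + D then Suc (\<sigma> (i - 1)) else i)" for \<sigma> :: "nat \<Rightarrow> nat"
  let ?P = "{\<sigma>. \<sigma> permutes {..<M + D}}"
  \<comment> \<open>The element whose pairing with \<open>w\<close> is the contribution of \<open>\<sigma>\<close>.\<close>
  define \<gamma> where "\<gamma> l \<sigma> = (op_pi smul ^^ M) (cls (OA smul) (sing (l @ replicate D 1, {#}, \<tau> \<sigma>)))" for l \<sigma>
  have \<gamma>0: "cls (OA smul) (sing (l @ replicate D 1, {#}, \<tau> \<sigma>)) \<in> OA_hom smul (M + D)" if "l \<in> \<LL>" "\<sigma> \<in> ?P" for l \<sigma>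
  proof (rule OA_hom_cls)
    have "\<tau> \<sigma> permutes {1..M + D}" unfolding \<tau>_def by (rule permutes_inv[OF shift_permutes]) (use that in simp)
    then show "Poly_Mapping.keys (sing (l @ replicate D 1, {#}, \<tau> \<sigma>) :: _ \<Rightarrow>\<^sub>0 'k) \<subseteq> osyms (M + D)"
      using fin\<LL>(2)[OF that(1)] by (simp add: osyms_def)
  qed
  have "\<exists>f. \<gamma> l \<sigma> = cls (OA smul) f \<and> Poly_Mapping.keys f \<subseteq> osyms D" if "l \<in> \<LL>" "\<sigma> \<in> ?P" for l \<sigma>
    using op_pi_funpow_hom[OF A \<gamma>0[OF that]] unfolding \<gamma>_def[symmetric] by (auto simp: OA_hom_def)
  then have "\<exists>f. \<forall>l\<in>\<LL>. \<forall>\<sigma>\<in>?P. \<gamma> l \<sigma> = cls (OA smul) (f l \<sigma>) \<and> Poly_Mapping.keys (f l \<sigma>) \<subseteq> osyms D"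
    by (intro exI[of _ "\<lambda>l \<sigma>. SOME f. \<gamma> l \<sigma> = cls (OA smul) f \<and> Poly_Mapping.keys f \<subseteq> osyms D"] ballI) (rule someI_ex)
  then obtain f where f: "\<forall>l\<in>\<LL>. \<forall>\<sigma>\<in>?P. \<gamma> l \<sigma> = cls (OA smul) (f l \<sigma>) \<and> Poly_Mapping.keys (f l \<sigma>) \<subseteq> osyms D" ..
  define f' where "f' = (\<Sum>l\<in>\<LL>. \<Sum>\<sigma>\<in>?P. pm_scale (z l \<sigma>) (f l \<sigma>))"
  have "Poly_Mapping.keys f' \<subseteq> osyms D"
    unfolding f'_def
  proof (rule keys_sum_subset, rule keys_sum_subset)
    fix l \<sigma> assume "l \<in> \<LL>" "\<sigma> \<in> ?P"
    with f have "Poly_Mapping.keys (f l \<sigma>) \<subseteq> osyms D" by simp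
    then show "Poly_Mapping.keys (pm_scale (z l \<sigma>) (f l \<sigma>)) \<subseteq> osyms D"
      by (rule order_trans[OF keys_pm_scale])
  qed
  moreover have "lin_ext (\<lambda>x. pw smul x w) f' = nform ?R (\<psi> w)" if w: "length w = D" for w
  proof -
    have "lin_ext (\<lambda>x. pw smul x w) f' = (\<Sum>l\<in>\<LL>. \<Sum>\<sigma>\<in>?P. pm_scale (z l \<sigma>) (lin_ext (\<lambda>x. pw smul x w) (f l \<sigma>)))"
      by (simp add: f'_def act_sum lin_ext_scale)
    also have "\<dots> = (\<Sum>l\<in>\<LL>. \<Sum>\<sigma>\<in>?P. pm_scale (z l \<sigma>) (\<Sum>v\<in>?W M. if map snd (map prod.swap v @ w) = permute_list \<sigma> (map fst (map prod.swap v @ w)) then pw smul (l, {#}, id) v else 0))"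
    proof (intro sum.cong refl)
      fix l \<sigma> assume ls: "l \<in> \<LL>" "\<sigma> \<in> ?P"
      have "lin_ext (\<lambda>x. pw smul x w) (f l \<sigma>) = pval smul (\<gamma> l \<sigma>) w" using f ls by (simp add: pval_cls)
      also have "\<dots> = (\<Sum>q | length q = M. pw smul (l @ replicate D 1, {#}, \<tau> \<sigma>) (map (\<lambda>k. (k, k)) q @ w))"
        unfolding \<gamma>_def pval_op_pi_funpow[OF A w \<gamma>0[OF ls]] by (simp add: pval_cls)
      also have "\<dots> = (\<Sum>v\<in>?W M. if map snd (map prod.swap v @ w) = permute_list \<sigma> (map fst (map prod.swap v @ w)) then pw smul (l, {#}, id) v else 0)"
        unfolding \<tau>_def by (rule contract_permutation_tensor[symmetric]) (use fin\<LL>(2) ls w in auto)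
      finally show "pm_scale (z l \<sigma>) (lin_ext (\<lambda>x. pw smul x w) (f l \<sigma>)) = pm_scale (z l \<sigma>) (\<Sum>v\<in>?W M. if map snd (map prod.swap v @ w) = permute_list \<sigma> (map fst (map prod.swap v @ w)) then pw smul (l, {#}, id) v else 0)"
        by simp
    qed
    also have "\<dots> = (\<Sum>l\<in>\<LL>. \<Sum>v\<in>?W M. \<Sum>\<sigma>\<in>?P. pm_scale (if map snd (map prod.swap v @ w) = permute_list \<sigma> (map fst (map prod.swap v @ w)) then z l \<sigma> else 0) (pw smul (l, {#}, id) v))"
      unfolding pm.scale_sum_right by (rule sum.cong[OF refl], rule trans[OF sum.swap], intro sum.cong refl pm_scale_if)
    also have "\<dots> = (\<Sum>l\<in>\<LL>. \<Sum>v\<in>?W M. pm_scale (E l (map prod.swap v @ w)) (pw smul (l, {#}, id) v))"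
    proof (intro sum.cong refl)
      fix l v assume "v \<in> ?W M"
      then have "E l (map prod.swap v @ w) = (\<Sum>\<sigma>\<in>?P. if map snd (map prod.swap v @ w) = permute_list \<sigma> (map fst (map prod.swap v @ w)) then z l \<sigma> else 0)"
        using w by (intro z[rule_format]) simp
      then show "(\<Sum>\<sigma>\<in>?P. pm_scale (if map snd (map prod.swap v @ w) = permute_list \<sigma> (map fst (map prod.swap v @ w)) then z l \<sigma> else 0) (pw smul (l, {#}, id) v))
        = pm_scale (E l (map prod.swap v @ w)) (pw smul (l, {#}, id) v)"
        by (simp only: pm.scale_sum_left)
    qed
    finally show ?thesis using avg[OF w] by simp
  qed
  ultimately show ?thesis by (intro exI[of _ f'] conjI allI impI)
qed

section \<open>Every equivariant map is induced\<close>

text \<open>Cuts a word into pieces of prescribed lengths; the inverse of \<open>concat\<close>.\<close>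

fun split_at :: "nat list \<Rightarrow> 'b list \<Rightarrow> 'b list list" where
  "split_at [] w = []"
| "split_at (d # ds) w = take d w # split_at ds (drop d w)"

lemma split_at_concat: "list_all2 (\<lambda>d w. length w = d) ds ws \<Longrightarrow> split_at ds (concat ws) = ws"
  by (induction rule: list_all2_induct) auto

lemma tpow_map_rep_act:
  fixes g :: "'k::field ^ 'N ^ 'N::finite" and smul :: "'k \<Rightarrow> 'a::{ring, monoid_mult} \<Rightarrow> 'a"
  assumes g: "invertible g" and l: "length l = n"
  shows "tpow_map n (Rep smul) (rep_act smul g) (ptensor (Rep smul) l) = ptensor (Rep smul) (map (rep_act smul g) l)"
proof -
  have "tpow_map n (Rep smul) (rep_act smul g) (cls (tpow n (Rep smul)) f)
      = cls (tpow n (Rep smul)) (lin_ext (\<lambda>l. Poly_Mapping.single (map (rep_act smul g) l) 1) f)" for f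
    by (rule tpow_map_cls) (use rep_act_linear[OF g, of _ smul] in auto)
  from this[of "Poly_Mapping.single l 1"] show ?thesis using l by (simp add: ptensor_def)
qed

lemma keys_tensor_act_sing: "Poly_Mapping.keys (tensor_act g (sing w)) \<subseteq> {v. length v = length w}"
  unfolding tensor_act_sing by (rule keys_sum_subset) (use keys_pm_scale in fastforce)

text \<open>With the symbols fixed, the value of \<open>\<phi>\<close> is an equivariant function of the words, and so it is a pairing.\<close>

lemma equivariant_symbol_image:
  fixes \<phi> :: "('a::{ring, monoid_mult}, 'N::finite, 'k::field_char_0) rep_map"
  assumes A: "assoc_algebra smul" and \<phi>: "\<phi> \<in> linear_maps (tpow n (Rep smul)) (Rep smul)" and G: "GL_equivariant smul n \<phi>"
    and n: "length xs = n" and xs: "list_all2 (\<lambda>x d. x \<in> osyms d) xs ds"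
  shows "\<exists>f. Poly_Mapping.keys f \<subseteq> osyms (sum_list ds) \<and>
    (\<forall>ws. list_all2 (\<lambda>d w. length w = d) ds ws \<longrightarrow> lin_ext (\<lambda>x. pw smul x (concat ws)) f
       = cform (Rep smul) (\<phi> (ptensor (Rep smul) (map2 (\<lambda>x w. cls (Rep smul) (pair_sym x w)) xs ws))))"
proof -
  let ?R = "Rep smul :: (('a, 'N) rmonom, 'k) presentation"
  have ds: "length ds = n" using xs n by (auto dest: list_all2_lengthD)
  define K where "K ps = cform ?R (\<phi> (ptensor ?R (map (cls ?R) ps)))" for ps
  have K: "multilinear n K" unfolding K_def by (rule multilinear_Rep[OF \<phi>])
  define \<psi> where "\<psi> w = K (map2 pair_sym xs (split_at ds w))" for w
  have psi: "\<psi> (concat ws) = K (map2 pair_sym xs ws)" if "list_all2 (\<lambda>d w. length w = d) ds ws" for ws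
    by (simp add: \<psi>_def split_at_concat[OF that])
  have "nform ?R (\<Sum>w' | length w' = sum_list ds. pm_scale (wcoeff g w w') (\<psi> w')) = nform ?R (lin_ext (rmonom_act g) (\<psi> w))"
    if g: "invertible g" and w: "length w = sum_list ds" for g :: "'k ^ 'N ^ 'N" and w
  proof -
    obtain ws where ws: "list_all2 (\<lambda>d w. length w = d) ds ws" "w = concat ws" using split_word[OF w] by blast
    have len: "length ws = n" using ws(1) ds by (auto dest: list_all2_lengthD)
    let ?Xs = "map (\<lambda>w. tensor_act g (sing w)) ws"
    let ?ps = "map2 pair_sym xs ws :: (('a, 'N) rmonom \<Rightarrow>\<^sub>0 'k) list"
    have "(\<Sum>w' | length w' = sum_list ds. pm_scale (wcoeff g w w') (\<psi> w')) = lin_ext \<psi> (tensor_act g (sing w))"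
      by (simp add: tensor_act_sing act_sum lin_ext_scale w)
    also have "\<dots> = mlin (\<lambda>vs. \<psi> (concat vs)) ?Xs"
      unfolding ws(2) tprod_tensor_act[symmetric] tprod_eq_mlin lin_ext_mlin by simp
    also have "\<dots> = mlin (\<lambda>vs. K (map2 pair_sym xs vs)) ?Xs"
    proof (rule mlin_cong)
      fix vs assume vs: "list_all2 (\<lambda>x f. x \<in> Poly_Mapping.keys f) vs ?Xs"
      have "list_all2 (\<lambda>d w. length w = d) ds vs"
        unfolding list_all2_conv_all_nth
      proof (intro conjI allI impI)
        show "length ds = length vs" using vs len ds by (auto dest: list_all2_lengthD)
        fix i assume i: "i < length ds"
        have "vs ! i \<in> Poly_Mapping.keys (tensor_act g (sing (ws ! i)))" "length (ws ! i) = ds ! i"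
          using vs ws(1) i len ds by (auto simp: list_all2_conv_all_nth)
        then show "length (vs ! i) = ds ! i" using keys_tensor_act_sing[of g "ws ! i"] by auto
      qed
      then show "\<psi> (concat vs) = K (map2 pair_sym xs vs)" by (rule psi)
    qed
    also have "\<dots> = K (map2 (\<lambda>f X. lin_ext (\<lambda>x. lin_ext (pair_sym x) X) f) (map sing xs) ?Xs)"
      by (subst multilinear_map2[OF K]) (use n len in simp_all)
    also have "map2 (\<lambda>f X. lin_ext (\<lambda>x. lin_ext (pair_sym x) X) f) (map sing xs) ?Xs = map (lin_ext (rmonom_act g)) ?ps"
    proof (rule nth_equalityI)
      fix i assume "i < length (map2 (\<lambda>f X. lin_ext (\<lambda>x. lin_ext (pair_sym x) X) f) (map sing xs) ?Xs :: (('a, 'N) rmonom \<Rightarrow>\<^sub>0 'k) list)"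
      then have i: "i < n" using n len by simp
      then have x: "xs ! i \<in> osyms (ds ! i)" using xs n by (auto simp: list_all2_conv_all_nth)
      show "map2 (\<lambda>f X. lin_ext (\<lambda>x. lin_ext (pair_sym x) X) f) (map sing xs) ?Xs ! i = map (lin_ext (rmonom_act g)) ?ps ! i"
        using i n len by (simp add: rmonom_act_pair_sym[OF g x] tensor_act_sing act_sum lin_ext_scale)
    qed (use n len in simp)
    also have "K (map (lin_ext (rmonom_act g)) ?ps) = nform ?R (lin_ext (rmonom_act g) (\<psi> w))"
    proof -
      let ?l = "map (cls ?R) ?ps"
      have ll: "length ?l = n" using n len by simp
      have pV: "ptensor ?R ?l \<in> vspace (tpow n ?R)" by (rule ptensor_vspace[OF ll]) auto
      then have "\<phi> (ptensor ?R ?l) \<in> vspace ?R" using \<phi> by (auto simp: linear_maps_def)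
      from cls_cform[OF this] have e: "\<phi> (ptensor ?R ?l) = cls ?R (\<psi> w)" by (simp add: ws(2) psi[OF ws(1)] K_def)
      have "map (cls ?R) (map (lin_ext (rmonom_act g)) ?ps) = map (rep_act smul g) ?l"
        by (simp add: rep_act_cls[OF g])
      then have "K (map (lin_ext (rmonom_act g)) ?ps) = cform ?R (\<phi> (ptensor ?R (map (rep_act smul g) ?l)))"
        by (simp only: K_def)
      also have "\<dots> = cform ?R (rep_act smul g (\<phi> (ptensor ?R ?l)))"
        using G g pV unfolding GL_equivariant_def tpow_map_rep_act[OF g ll, symmetric] by (metis (no_types))
      finally show ?thesis unfolding e rep_act_cls[OF g] by simp
    qed
    finally show ?thesis by simp
  qed
  from equivariant_word_map_is_pairing[OF A this]
  obtain f where f: "Poly_Mapping.keys f \<subseteq> osyms (sum_list ds)"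
    "\<forall>w. length w = sum_list ds \<longrightarrow> lin_ext (\<lambda>x. pw smul x w) f = nform ?R (\<psi> w)" by blast
  show ?thesis
  proof (intro exI[of _ f] conjI allI impI)
    fix ws :: "('N \<times> 'N) list list" assume ws: "list_all2 (\<lambda>d w. length w = d) ds ws"
    have "lin_ext (\<lambda>x. pw smul x (concat ws)) f = nform ?R (K (map2 pair_sym xs ws))"
      using f(2) length_concat_words[OF ws] psi[OF ws] by simp
    also have "\<dots> = cform ?R (\<phi> (ptensor ?R (map (cls ?R) (map2 pair_sym xs ws))))" by (simp only: K_def nform_cform)
    also have "map (cls ?R) (map2 pair_sym xs ws) = map2 (\<lambda>x w. cls ?R (pair_sym x w)) xs ws"
      by (simp add: case_prod_beta)
    finally show "lin_ext (\<lambda>x. pw smul x (concat ws)) f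
       = cform ?R (\<phi> (ptensor ?R (map2 (\<lambda>x w. cls ?R (pair_sym x w)) xs ws)))" .
  qed (rule f(1))
qed

definition degree_part :: "nat \<Rightarrow> ('a osym \<Rightarrow>\<^sub>0 'k::field) \<Rightarrow> ('a osym \<Rightarrow>\<^sub>0 'k)" where
  "degree_part d = lin_ext (\<lambda>x. if x \<in> osyms d then sing x else 0)"

text \<open>Normal forms need not preserve the degree. Keeping only the part of the right degree for each symbol
gives representatives that do, which the map \<open>\<Phi>\<close> to be constructed needs in order to have degree zero.\<close>

definition hform :: "('k::field \<Rightarrow> 'a::{ring, monoid_mult} \<Rightarrow> 'a) \<Rightarrow> ('a osym \<Rightarrow>\<^sub>0 'k) \<Rightarrow> ('a osym \<Rightarrow>\<^sub>0 'k)" where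
  "hform smul = lin_ext (\<lambda>x. degree_part (length (fst x)) (nform (OA smul) (sing x)))"

lemma degree_part_linear:
  "degree_part d (f + g) = degree_part d f + degree_part d g"
  "degree_part d (pm_scale c f) = pm_scale c (degree_part d f)"
  "degree_part d (f - g) = degree_part d f - degree_part d g"
  "degree_part d 0 = 0"
  by (simp_all add: degree_part_def lin_ext_add lin_ext_scale lin_ext_diff)

lemma degree_part_keys: "Poly_Mapping.keys (degree_part d f) \<subseteq> osyms d"
  unfolding degree_part_def by (rule order_trans[OF keys_lin_ext]) (auto split: if_splits)

lemma degree_part_same: "Poly_Mapping.keys f \<subseteq> osyms d \<Longrightarrow> degree_part d f = f"
  unfolding degree_part_def by (subst (2) lin_ext_id[symmetric]) (auto intro!: lin_ext_cong)

lemma degree_part_other: "Poly_Mapping.keys f \<subseteq> osyms e \<Longrightarrow> e \<noteq> d \<Longrightarrow> degree_part d f = 0"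
proof -
  assume "Poly_Mapping.keys f \<subseteq> osyms e" "e \<noteq> d"
  then have "degree_part d f = lin_ext (\<lambda>x. 0) f"
    unfolding degree_part_def by (intro lin_ext_cong) (auto simp: osyms_def)
  then show ?thesis by simp
qed

lemma rel_span_OA: "rel_span (OA smul) = module.span pm_scale (orels smul)"
  by (simp add: rel_span_def OA_def)

text \<open>The relations are homogeneous.\<close>

lemma degree_part_rel_span:
  assumes "r \<in> rel_span (OA smul)"
  shows "degree_part d r \<in> rel_span (OA smul)"
  using assms unfolding rel_span_OA[of smul]
proof (induction rule: pm.span_induct_alt)
  case base
  show ?case by (simp add: degree_part_linear pm.span_zero)
next
  case (step c x y)
  obtain e where e: "Poly_Mapping.keys x \<subseteq> osyms e" using orels_homogeneous[OF step(1)] ..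
  have "degree_part d x \<in> pm.span (orels smul)"
    using degree_part_same[OF e] degree_part_other[OF e, of d] pm.span_base[OF step(1)] by (cases "e = d") (auto simp: pm.span_zero)
  then show ?case using step(2) by (simp add: degree_part_linear pm.span_add pm.span_scale)
qed

lemma hform_linear:
  "hform smul (f + g) = hform smul f + hform smul g"
  "hform smul (pm_scale c f) = pm_scale c (hform smul f)"
  "hform smul (f - g) = hform smul f - hform smul g"
  "hform smul 0 = 0"
  by (simp_all add: hform_def lin_ext_add lin_ext_scale lin_ext_diff)

lemma hform_homogeneous:
  assumes f: "Poly_Mapping.keys f \<subseteq> osyms d"
  shows "hform smul f = degree_part d (nform (OA smul) f)"
proof -
  have "hform smul f = lin_ext (\<lambda>x. degree_part d (nform (OA smul) (sing x))) f"
    unfolding hform_def by (rule lin_ext_cong) (use f in \<open>auto simp: osyms_def\<close>)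
  also have "\<dots> = degree_part d (nform (OA smul) f)"
    by (rule linear_eq_lin_ext[of "\<lambda>f. degree_part d (nform (OA smul) f)", symmetric])
      (simp_all add: degree_part_linear nform_add nform_scale)
  finally show ?thesis .
qed

lemma hform_keys: "Poly_Mapping.keys f \<subseteq> osyms d \<Longrightarrow> Poly_Mapping.keys (hform smul f) \<subseteq> osyms d"
  by (simp add: hform_homogeneous degree_part_keys)

lemma cls_hform:
  assumes f: "Poly_Mapping.keys f \<subseteq> osyms d"
  shows "cls (OA smul) (hform smul f) = cls (OA smul) f"
proof -
  have "hform smul f - f = degree_part d (nform (OA smul) f - f)"
    by (simp add: hform_homogeneous[OF f] degree_part_linear degree_part_same[OF f])
  then show ?thesis by (simp add: cls_eq_iff degree_part_rel_span nform_diff_self)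
qed

lemma hform_rel_span:
  assumes "r \<in> rel_span (OA smul)"
  shows "hform smul r = 0"
  using assms unfolding rel_span_OA
proof (induction rule: pm.span_induct_alt)
  case base
  show ?case by (rule hform_linear)
next
  case (step c x y)
  obtain e where e: "Poly_Mapping.keys x \<subseteq> osyms e" using orels_homogeneous[OF step(1)] ..
  have "nform (OA smul) x = 0" using orels_rel_span[OF step(1)] by (simp add: nform_eq_0)
  then have "hform smul x = 0" by (simp add: hform_homogeneous[OF e] degree_part_linear)
  then show ?case using step(2) by (simp add: hform_linear)
qed

definition hrep :: "('k::field \<Rightarrow> 'a::{ring, monoid_mult} \<Rightarrow> 'a) \<Rightarrow> ('a osym \<Rightarrow>\<^sub>0 'k) set \<Rightarrow> ('a osym \<Rightarrow>\<^sub>0 'k)" where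
  "hrep smul C = hform smul (SOME f. f \<in> C)"

lemma hrep_cls: "hrep smul (cls (OA smul) f) = hform smul f"
proof -
  have "(SOME f'. f' \<in> cls (OA smul) f) \<in> cls (OA smul) f" by (rule someI[of _ f]) (rule in_cls)
  then obtain r where "(SOME f'. f' \<in> cls (OA smul) f) = f + r" "r \<in> rel_span (OA smul)" by (auto simp: cls_def)
  then show ?thesis by (simp add: hrep_def hform_linear hform_rel_span)
qed

text \<open>The map \<open>\<Phi>\<close> is the multilinear extension of a choice of preimages \<open>\<beta> xs\<close>, one for each list of symbols, composed
with homogeneous representatives of the arguments.\<close>

theorem equivariant_imp_induced:
  fixes \<phi> :: "('a::{ring, monoid_mult}, 'N::finite, 'k::field_char_0) rep_map"
  assumes A: "assoc_algebra smul" and \<phi>: "\<phi> \<in> linear_maps (tpow n (Rep smul)) (Rep smul)" and G: "GL_equivariant smul n \<phi>"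
  shows "\<exists>\<Phi> \<in> degree_zero_maps smul n. induces smul n \<Phi> \<phi>"
proof -
  let ?R = "Rep smul :: (('a, 'N) rmonom, 'k) presentation"
  let ?O = "OA smul"
  let ?d = "\<lambda>x :: 'a osym. length (fst x)"
  define K where "K ps = cform ?R (\<phi> (ptensor ?R (map (cls ?R) ps)))" for ps
  have K: "multilinear n K" unfolding K_def by (rule multilinear_Rep[OF \<phi>])
  \<comment> \<open>\<open>f\<close> represents an admissible value of \<open>\<Phi>\<close> at the symbols \<open>xs\<close>.\<close>
  define good where "good xs f \<longleftrightarrow> Poly_Mapping.keys f \<subseteq> osyms (sum_list (map ?d xs)) \<and>
    (\<forall>ws. list_all2 (\<lambda>d w. length w = d) (map ?d xs) ws \<longrightarrow>
       lin_ext (\<lambda>x. pw smul x (concat ws)) f = K (map2 pair_sym xs ws))" for xs f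
  \<comment> \<open>The default value \<open>0\<close> makes the bound on the degree hold for all lists.\<close>
  define \<beta> where "\<beta> xs = (if length xs = n \<and> (\<forall>x\<in>set xs. x \<in> osyms (?d x)) then SOME f. good xs f else 0)" for xs
  have good: "good xs (\<beta> xs)" if "length xs = n" "\<forall>x\<in>set xs. x \<in> osyms (?d x)" for xs
  proof -
    have "list_all2 (\<lambda>x d. x \<in> osyms d) xs (map ?d xs)" using that by (simp add: list_all2_conv_all_nth)
    from equivariant_symbol_image[OF A \<phi> G that(1) this]
    obtain f where f: "Poly_Mapping.keys f \<subseteq> osyms (sum_list (map ?d xs))"
      "\<forall>ws. list_all2 (\<lambda>d w. length w = d) (map ?d xs) ws \<longrightarrow> lin_ext (\<lambda>x. pw smul x (concat ws)) f
       = cform ?R (\<phi> (ptensor ?R (map2 (\<lambda>x w. cls ?R (pair_sym x w)) xs ws)))"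
      by (elim exE conjE)
    have "map2 (\<lambda>x w. cls ?R (pair_sym x w)) xs ws = map (cls ?R) (map2 pair_sym xs ws)" for ws
      by (simp add: case_prod_beta)
    then have "good xs f" using f unfolding good_def K_def by (simp only: simp_thms)
    then have "good xs (SOME f. good xs f)" by (rule someI)
    then show ?thesis using that by (simp add: \<beta>_def)
  qed
  have keys\<beta>: "Poly_Mapping.keys (\<beta> xs) \<subseteq> osyms (sum_list (map ?d xs))" for xs
    using good[of xs] by (cases "length xs = n \<and> (\<forall>x\<in>set xs. x \<in> osyms (?d x))") (auto simp: good_def \<beta>_def)
  have degs: "map ?d xs = ds" "\<forall>x\<in>set xs. x \<in> osyms (?d x)"
    if "list_all2 (\<lambda>x f. x \<in> Poly_Mapping.keys f) xs fs" "list_all2 (\<lambda>d f. Poly_Mapping.keys f \<subseteq> osyms d) ds fs"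
    for xs ds and fs :: "('a osym \<Rightarrow>\<^sub>0 'k) list"
  proof -
    have l: "length xs = length ds" "length fs = length ds" using list_all2_lengthD[OF that(1)] list_all2_lengthD[OF that(2)] by simp_all
    have m: "xs ! i \<in> osyms (ds ! i)" if "i < length ds" for i
      using that \<open>list_all2 (\<lambda>x f. x \<in> Poly_Mapping.keys f) xs fs\<close> \<open>list_all2 _ ds fs\<close> l
      by (auto simp: list_all2_conv_all_nth)
    then have e: "?d (xs ! i) = ds ! i" if "i < length ds" for i using that by (fastforce simp: osyms_def)
    show "map ?d xs = ds" using l e by (auto intro: nth_equalityI)
    show "\<forall>x\<in>set xs. x \<in> osyms (?d x)"
    proof
      fix x assume "x \<in> set xs"
      then obtain i where "i < length ds" "x = xs ! i" using l by (auto simp: in_set_conv_nth)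
      then show "x \<in> osyms (?d x)" using m e by simp
    qed
  qed
  obtain \<Phi> where \<Phi>: "\<Phi> \<in> linear_maps (tpow n ?O) ?O"
    and \<Phi>_eq: "\<forall>l. length l = n \<longrightarrow> set l \<subseteq> vspace ?O \<longrightarrow> \<Phi> (ptensor ?O l) = cls ?O (mlin \<beta> (map (hrep smul) l))"
  proof -
    have "\<exists>T\<in>linear_maps (tpow n ?O) ?O. \<forall>l. length l = n \<longrightarrow> set l \<subseteq> vspace ?O \<longrightarrow> T (ptensor ?O l) = cls ?O (mlin \<beta> (map (hrep smul) l))"
    proof (rule tpow_universal[OF mlin_multilinear])
      show "Poly_Mapping.keys (mlin \<beta> fs) \<subseteq> gens ?O" for fs
        by (rule keys_mlin) (use keys\<beta> osyms_gens in blast)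
      show "hrep smul (vadd ?O C D) = hrep smul C + hrep smul D" if "C \<in> vspace ?O" "D \<in> vspace ?O" for C D
        using that by (auto simp: vspace_def vadd_cls hrep_cls hform_linear)
      show "hrep smul (vscale ?O a C) = pm_scale a (hrep smul C)" if "C \<in> vspace ?O" for a C
        using that by (auto simp: vspace_def vscale_cls hrep_cls hform_linear)
    qed
    then show thesis using that by blast
  qed
  have \<Phi>_cls: "\<Phi> (ptensor ?O (map (cls ?O) fs)) = cls ?O (mlin \<beta> (map (hform smul) fs))"
    if "length ds = n" "list_all2 (\<lambda>d f. Poly_Mapping.keys f \<subseteq> osyms d) ds fs" for ds fs
  proof -
    have "Poly_Mapping.keys f \<subseteq> gens ?O" if "f \<in> set fs" for f
      using that \<open>list_all2 _ ds fs\<close> osyms_gens by (fastforce simp: list_all2_conv_all_nth in_set_conv_nth)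
    then have "length (map (cls ?O) fs) = n" "set (map (cls ?O) fs) \<subseteq> vspace ?O"
      using that by (auto dest: list_all2_lengthD intro: cls_in_vspace)
    from \<Phi>_eq[rule_format, OF this] show ?thesis by (simp add: o_def hrep_cls)
  qed
  have hf: "list_all2 (\<lambda>d f. Poly_Mapping.keys f \<subseteq> osyms d) ds (map (hform smul) fs)"
    if "list_all2 (\<lambda>d f. Poly_Mapping.keys f \<subseteq> osyms d) ds fs" for ds fs
    using that by (simp add: list_all2_conv_all_nth hform_keys)
  have dz: "\<Phi> \<in> degree_zero_maps smul n"
    unfolding degree_zero_maps_def
  proof (intro CollectI conjI allI impI, rule \<Phi>, elim conjE)
    fix ds \<alpha>s assume n: "length ds = n" and h: "hom_list smul ds \<alpha>s"
    obtain fs where fs: "\<alpha>s = map (cls ?O) fs" "list_all2 (\<lambda>d f. Poly_Mapping.keys f \<subseteq> osyms d) ds fs"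
      using h by (rule hom_list_cases)
    show "\<Phi> (ptensor ?O \<alpha>s) \<in> OA_hom smul (sum_list ds)"
      unfolding fs(1) \<Phi>_cls[OF n fs(2)]
    proof (rule OA_hom_cls, rule keys_mlin)
      fix xs assume "list_all2 (\<lambda>x f. x \<in> Poly_Mapping.keys f) xs (map (hform smul) fs)"
      from degs(1)[OF this hf[OF fs(2)]] show "Poly_Mapping.keys (\<beta> xs) \<subseteq> osyms (sum_list ds)"
        using keys\<beta>[of xs] by simp
    qed
  qed
  have "induces smul n \<Phi> \<phi>"
  proof (rule inducesI_symbols[OF dz \<phi>])
    fix xs :: "'a osym list" and ws :: "('N \<times> 'N) list list"
    assume n: "length xs = n" and v: "list_all2 (\<lambda>x w. x \<in> osyms (length w)) xs ws"
    have len: "length ws = n" using v n by (auto dest: list_all2_lengthD)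
    let ?ds = "map length ws"
    let ?fs = "map (hform smul) (map sing xs)"
    have ks: "list_all2 (\<lambda>d f. Poly_Mapping.keys f \<subseteq> osyms d) ?ds (map sing xs)"
      using v by (simp add: list_all2_conv_all_nth)
    have "map (\<lambda>x. cls ?O (sing x)) xs = map (cls ?O) (map sing xs)" by simp
    then have "pval smul (\<Phi> (ptensor ?O (map (\<lambda>x. cls ?O (sing x)) xs))) (concat ws)
      = mlin (\<lambda>ys. lin_ext (\<lambda>x. pw smul x (concat ws)) (\<beta> ys)) ?fs"
      using \<Phi>_cls[OF _ ks] len by (simp only: length_map pval_cls lin_ext_mlin)
    also have "\<dots> = mlin (\<lambda>ys. K (map2 pair_sym ys ws)) ?fs"
    proof (rule mlin_cong)
      fix ys assume ys: "list_all2 (\<lambda>x f. x \<in> Poly_Mapping.keys f) ys ?fs"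
      note d = degs[OF ys hf[OF ks]]
      have "length ys = n" using ys n by (auto dest: list_all2_lengthD)
      from good[OF this d(2)] have "list_all2 (\<lambda>d w. length w = d) (map ?d ys) ws \<longrightarrow>
         lin_ext (\<lambda>x. pw smul x (concat ws)) (\<beta> ys) = K (map2 pair_sym ys ws)"
        unfolding good_def by (elim conjE) (erule spec)
      then show "lin_ext (\<lambda>x. pw smul x (concat ws)) (\<beta> ys) = K (map2 pair_sym ys ws)"
        unfolding d(1) by (simp add: list_all2_conv_all_nth)
    qed
    also have "\<dots> = K (map2 (\<lambda>f X. lin_ext (\<lambda>x. lin_ext (pair_sym x) X) f) ?fs (map sing ws))"
      by (subst multilinear_map2[OF K]) (use n len in simp_all)
    also have "\<dots> = cform ?R (\<phi> (ptensor ?R (map2 (\<lambda>x w. cls ?R (pair_sym x w)) xs ws)))"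
    proof -
      have "map (cls ?R) (map2 (\<lambda>f X. lin_ext (\<lambda>x. lin_ext (pair_sym x) X) f) ?fs (map sing ws)) = map2 (\<lambda>x w. cls ?R (pair_sym x w)) xs ws"
      proof (rule nth_equalityI)
        fix i assume "i < length (map (cls ?R) (map2 (\<lambda>f X. lin_ext (\<lambda>x. lin_ext (pair_sym x) X) f) ?fs (map sing ws)))"
        then have i: "i < n" using n len by simp
        then have x: "xs ! i \<in> osyms (length (ws ! i))" using v n by (auto simp: list_all2_conv_all_nth)
        have "cls ?R (lin_ext (\<lambda>x. lin_ext (pair_sym x) (sing (ws ! i))) (hform smul (sing (xs ! i)))) = pairing smul (cls ?O (hform smul (sing (xs ! i)))) (sing (ws ! i))"
          by (simp only: pairing_cls)
        also have "cls ?O (hform smul (sing (xs ! i))) = cls ?O (sing (xs ! i))"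
          by (rule cls_hform[of _ "length (ws ! i)"]) (use x in simp)
        finally show "map (cls ?R) (map2 (\<lambda>f X. lin_ext (\<lambda>x. lin_ext (pair_sym x) X) f) ?fs (map sing ws)) ! i = map2 (\<lambda>x w. cls ?R (pair_sym x w)) xs ws ! i"
          using i n len by (simp add: pairing_sing)
      qed (use n len in simp)
      then show ?thesis by (simp only: K_def)
    qed
    finally show "cform ?R (\<phi> (ptensor ?R (map2 (\<lambda>x w. cls ?R (pair_sym x w)) xs ws)))
      = pval smul (\<Phi> (ptensor ?O (map (\<lambda>x. cls ?O (sing x)) xs))) (concat ws)" by (rule sym)
  qed
  then show ?thesis using dz by blast
qed

theorem theorem5p1:
  fixes smul :: "'k::{alg_closed_field, field_char_0} \<Rightarrow> 'a::{ring, monoid_mult} \<Rightarrow> 'a"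
    and n :: nat
  assumes "fg_algebra smul"
    and "n \<ge> 1"
  shows
    "(\<forall>\<Phi> \<in> degree_zero_maps smul n.
        (\<exists>!\<phi>. \<phi> \<in> linear_maps (tpow n (Rep smul)) (Rep smul :: (('a, 'N::finite) rmonom, 'k) presentation)
            \<and> GL_equivariant smul n \<phi> \<and> induces smul n \<Phi> \<phi>)
        \<longleftrightarrow>
        (\<forall>ds \<alpha>s ws i.
           length ds = n \<and> hom_list smul ds \<alpha>s
           \<and> list_all2 (\<lambda>d w. w permutes {1..d}) ds ws \<and> i < n \<longrightarrow>
           (ds ! i \<ge> 1 \<longrightarrow>
              cong_R smul TYPE('N)
                (\<Phi> (ptensor (OA smul) (\<alpha>s[i := op_pi smul (\<alpha>s ! i)])))
                (op_pi smul (Ad smul (block_perm (Transposition.transpose 1 2) [sum_list (take i ds), 1])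
                   (\<Phi> (ptensor (OA smul) \<alpha>s)))))
           \<and> cong_R smul TYPE('N)
                (\<Phi> (ptensor (OA smul) (\<alpha>s[i := op_one smul (\<alpha>s ! i)])))
                (Ad smul (block_perm (Transposition.transpose 1 2) [1, sum_list (take i ds)])
                   (op_one smul (\<Phi> (ptensor (OA smul) \<alpha>s))))
           \<and> cong_R smul TYPE('N)
                (\<Phi> (ptensor (OA smul) (map2 (left_act smul) ws \<alpha>s)))
                (left_act smul (perm_prod (zip ds ws)) (\<Phi> (ptensor (OA smul) \<alpha>s)))
           \<and> cong_R smul TYPE('N)
                (\<Phi> (ptensor (OA smul) (map2 (right_act smul) \<alpha>s ws)))
                (right_act smul (\<Phi> (ptensor (OA smul) \<alpha>s)) (perm_prod (zip ds ws)))))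
     \<and> (\<forall>\<phi> \<in> linear_maps (tpow n (Rep smul)) (Rep smul :: (('a, 'N) rmonom, 'k) presentation).
          GL_equivariant smul n \<phi> \<longrightarrow> (\<exists>\<Phi> \<in> degree_zero_maps smul n. induces smul n \<Phi> \<phi>))"
  unfolding compatible_def[of smul n "TYPE('N)", symmetric]
proof (intro conjI ballI impI)
  have A: "assoc_algebra smul" using assms(1) by (rule fg_algebra.axioms(1))
  let ?R = "Rep smul :: (('a, 'N) rmonom, 'k) presentation"
  fix \<Phi> assume \<Phi>: "\<Phi> \<in> degree_zero_maps smul n"
  show "(\<exists>!\<phi>. \<phi> \<in> linear_maps (tpow n ?R) ?R \<and> GL_equivariant smul n \<phi> \<and> induces smul n \<Phi> \<phi>)
      \<longleftrightarrow> compatible smul n TYPE('N) \<Phi>"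
  proof
    assume "\<exists>!\<phi>. \<phi> \<in> linear_maps (tpow n ?R) ?R \<and> GL_equivariant smul n \<phi> \<and> induces smul n \<Phi> \<phi>"
    then obtain \<phi> where "\<phi> \<in> linear_maps (tpow n ?R) ?R" "induces smul n \<Phi> \<phi>" by (elim ex1E conjE)
    then show "compatible smul n TYPE('N) \<Phi>" using induces_imp_compatible[OF A _ \<Phi>] by blast
  next
    assume "compatible smul n TYPE('N) \<Phi>"
    then obtain \<phi> where \<phi>: "\<phi> \<in> linear_maps (tpow n ?R) ?R" "induces smul n \<Phi> \<phi>"
      using compatible_imp_induces[OF A \<Phi>] by blast
    show "\<exists>!\<phi>. \<phi> \<in> linear_maps (tpow n ?R) ?R \<and> GL_equivariant smul n \<phi> \<and> induces smul n \<Phi> \<phi>"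
    proof (rule ex1I[of _ \<phi>])
      show "\<phi> \<in> linear_maps (tpow n ?R) ?R \<and> GL_equivariant smul n \<phi> \<and> induces smul n \<Phi> \<phi>"
        using \<phi> induces_GL_equivariant[OF \<Phi> \<phi>] by blast
      show "\<phi>' = \<phi>" if "\<phi>' \<in> linear_maps (tpow n ?R) ?R \<and> GL_equivariant smul n \<phi>' \<and> induces smul n \<Phi> \<phi>'" for \<phi>'
        using induces_unique[OF _ \<phi>(1) _ \<phi>(2)] that by blast
    qed
  qed
next
  fix \<phi> assume "\<phi> \<in> linear_maps (tpow n (Rep smul)) (Rep smul :: (('a, 'N) rmonom, 'k) presentation)" "GL_equivariant smul n \<phi>"
  then show "\<exists>\<Phi> \<in> degree_zero_maps smul n. induces smul n \<Phi> \<phi>"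
    by (rule equivariant_imp_induced[OF fg_algebra.axioms(1)[OF assms(1)]])
qed

end
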